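(* Let $T$ be a bounded linear operator on a complex Hilbert space $\mathcal{H}$, and let $W=\overline{W(T)}$ be the closure of its numerical range $W(T)=\{\langle Tx,x\rangle:x\in\mathcal{H},\ \|x\|=1\}$. If $W$ has non-empty interior, then for every $f\in\mathcal{A}(W)$, $$\|f(T)\|\le\Bigl(1+\sqrt{1+a(W)}\Bigr)\sup_{z\in W}|f(z)|,$$ where $\mathcal{A}(W)$ is the space of continuous functions on $W$ which are analytic in the interior of $W$, and $a(W)$ is the analytic configuration constant of $W$.
   Context: Definition of $f(T)$: for $f\in\mathcal{A}(W)$ there are complex polynomials $p_n$ converging to $f$ uniformly on $W$, and $f(T)$ is the limit of $p_n(T)$ in operator norm; the limit exists and does not depend on the choice of $(p_n)$ because of the known (Crouzeix–Palencia) bound $\|p(T)\|\le(1+\sqrt2)\sup_W|p|$ for all polynomials $p$. The analytic configuration constant $a(\Omega)$ of a compact convex set $\Omega\subset\mathbb{C}$ with non-empty interior is defined as follows. The boundary $\partial\Omega$ is a rectifiable simple closed curve, oriented counter-clockwise; $s$ denotes arclength measure on $\partial\Omega$. At every $\zeta\in\partial\Omega$ the one-sided tangent angles $\alpha_-(\zeta)\le\alpha_+(\zeta)$ (incoming and outgoing, with branches chosen so that $0\le\alpha_+(\zeta)-\alpha_-(\zeta)<\pi$) exist; $\zeta$ is called a corner if $\alpha_-(\zeta)<\alpha_+(\zeta)$, and there are at most countably many corners. Put $\theta_\zeta:=\pi-\alpha_+(\zeta)+\alpha_-(\zeta)\in(0,\pi]$ (the interior angle at $\zeta$; it equals $\pi$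 if $\zeta$ is not a corner). At a non-corner $\sigma$ let $N(\sigma)$ be the outward unit normal. For $\zeta\in\partial\Omega$ let $\mu_\zeta$ be the Borel probability measure on $\partial\Omega$ given by $d\mu_\zeta=(1-\theta_\zeta/\pi)\,d\delta_\zeta+\rho_\zeta\,ds$, where $\delta_\zeta$ is the unit point mass at $\zeta$ and $\rho_\zeta(\sigma)=\frac1\pi\operatorname{Re}\Big(\frac{N(\sigma)}{\sigma-\zeta}\Big)$ for non-corners $\sigma\ne\zeta$. Let $C(\partial\Omega)$ be the space of complex-valued continuous functions on $\partial\Omega$. The Neumann–Poincaré operator $K_\Omega:C(\partial\Omega)\to C(\partial\Omega)$ is $K_\Omega f(\zeta):=\int_{\partial\Omega}f\,d\mu_\zeta$, $\zeta\in\partial\Omega$; it fixes the constant function $\mathbf{1}$, so it acts on $C(\partial\Omega)/\mathbb{C}\mathbf{1}$, which has the quotient norm $\|g+\mathbb{C}\mathbf{1}\|_{\partial\Omega}=\min_{\lambda\in\mathbb{C}}\max_{\zeta\in\partial\Omega}|g(\zeta)-\lambda|$. Regard $\mathcal{A}(\Omega)$ (functions continuous on $\Omega$ and analytic in its interior) as a subspace of $C(\partial\Omega)$ by restriction to $\partial\Omega$. Then $a(\Omega):=\|K_\Omega:\mathcal{A}(\Omega)/\mathbb{C}\mathbf{1}\to C(\partial\Omega)/\mathbb{C}\mathbf{1}\|$ (operator norm). *)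

theory Defs
  imports "HOL-Complex_Analysis.Complex_Analysis"
begin

subsection \<open>Complex Hilbert spaces\<close>

text \<open>
  A complex Hilbert space is given on top of its underlying real Hilbert space, whose inner
  product is the real part of the Hermitian one. Norm, metric and the operator norm of
  type \<open>'a \<Rightarrow>\<^sub>L 'a\<close> are the same over the real and the complex scalars. The Hermitian
  product is linear in its first argument.
\<close>

class complex_hilbert_space = real_inner + complete_space +
  fixes scaleC :: "complex \<Rightarrow> 'a \<Rightarrow> 'a"  (infixr \<open>*\<^sub>C\<close> 75)
    and cinner :: "'a \<Rightarrow> 'a \<Rightarrow> complex"
  assumes scaleC_of_real: "complex_of_real r *\<^sub>C x = r *\<^sub>R x"
    and scaleC_add_right: "c *\<^sub>C (x + y) = c *\<^sub>C x + c *\<^sub>C y"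
    and scaleC_add_left: "(c + d) *\<^sub>C x = c *\<^sub>C x + d *\<^sub>C x"
    and scaleC_scaleC: "c *\<^sub>C d *\<^sub>C x = (c * d) *\<^sub>C x"
    and cinner_commute: "cinner x y = cnj (cinner y x)"
    and cinner_add_left: "cinner (x + y) z = cinner x z + cinner y z"
    and cinner_scaleC_left: "cinner (c *\<^sub>C x) y = c * cinner x y"
    and Re_cinner: "Re (cinner x y) = inner x y"

instantiation complex :: complex_hilbert_space
begin
definition scaleC_complex :: "complex \<Rightarrow> complex \<Rightarrow> complex"
  where "scaleC_complex c x = c * x"
definition cinner_complex :: "complex \<Rightarrow> complex \<Rightarrow> complex"
  where "cinner_complex x y = x * cnj y"
instance
  by standard (auto simp: scaleC_complex_def cinner_complex_def scaleR_conv_of_real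
      inner_complex_def algebra_simps)
end

lemma cinner_self: "cinner x x = complex_of_real ((norm x)\<^sup>2)"
  using cinner_commute[of x x] Re_cinner[of x x]
  by (simp add: complex_eq_iff power2_norm_eq_inner)

lemma norm_scaleC: "norm (c *\<^sub>C x) = cmod c * norm x"
proof -
  have "cinner (c *\<^sub>C x) (c *\<^sub>C x) = c * cnj (c * cinner x x)"
    by (metis cinner_commute cinner_scaleC_left)
  also have "\<dots> = complex_of_real ((cmod c * norm x)\<^sup>2)"
    by (simp add: cinner_self power_mult_distrib flip: complex_norm_square)
  finally have "(norm (c *\<^sub>C x))\<^sup>2 = (cmod c * norm x)\<^sup>2"
    by (simp only: cinner_self of_real_eq_iff)
  then show ?thesis
    by (simp add: power2_eq_iff_nonneg)
qed

lemma bounded_linear_scaleC: "bounded_linear (\<lambda>x. c *\<^sub>C x)"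
proof (rule bounded_linear_intro[where K = "cmod c"])
  fix r and x :: 'a
  show "c *\<^sub>C r *\<^sub>R x = r *\<^sub>R c *\<^sub>C x"
    by (metis scaleC_of_real scaleC_scaleC mult.commute)
qed (simp_all add: scaleC_add_right norm_scaleC mult.commute)

subsection \<open>Numerical range and functional calculus\<close>

definition numerical_range :: "('a::complex_hilbert_space \<Rightarrow>\<^sub>L 'a) \<Rightarrow> complex set"
  where "numerical_range T = {cinner (T x) x |x. norm x = 1}"

lift_definition poly_op ::
  "complex poly \<Rightarrow> ('a::complex_hilbert_space \<Rightarrow>\<^sub>L 'a) \<Rightarrow> 'a \<Rightarrow>\<^sub>L 'a"
  is "\<lambda>p T x. \<Sum>i\<le>degree p. coeff p i *\<^sub>C (T ^^ i) x"
proof -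
  fix p :: "complex poly" and T :: "'a \<Rightarrow> 'a"
  assume T: "bounded_linear T"
  have "bounded_linear (T ^^ i)" for i
    by (induction i)
      (use T bounded_linear_compose[OF T] in \<open>auto simp: id_def o_def bounded_linear_ident\<close>)
  then show "bounded_linear (\<lambda>x. \<Sum>i\<le>degree p. coeff p i *\<^sub>C (T ^^ i) x)"
    by (intro bounded_linear_sum bounded_linear_compose[OF bounded_linear_scaleC])
qed

definition analytic_algebra :: "complex set \<Rightarrow> (complex \<Rightarrow> complex) set"
  where "analytic_algebra \<Omega> = {f. continuous_on \<Omega> f \<and> f analytic_on interior \<Omega>}"

definition fun_calc ::
  "(complex \<Rightarrow> complex) \<Rightarrow> ('a::complex_hilbert_space \<Rightarrow>\<^sub>L 'a) \<Rightarrow> 'a \<Rightarrow>\<^sub>L 'a"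
  where "fun_calc f T = (THE A. \<exists>p :: nat \<Rightarrow> complex poly.
     uniform_limit (closure (numerical_range T)) (\<lambda>n. poly (p n)) f sequentially \<and>
     (\<lambda>n. poly_op (p n) T) \<longlonglongrightarrow> A)"

subsection \<open>The boundary curve of a convex set\<close>

text \<open>Supremum of the lengths of inscribed polygons\<close>

definition curve_length :: "(real \<Rightarrow> complex) \<Rightarrow> real \<Rightarrow> real \<Rightarrow> ennreal"
  where "curve_length \<gamma> a b =
    (SUP (n, t) \<in> {(n :: nat, t). t 0 = a \<and> t n = b \<and> mono_on {..n} t}.
       \<Sum>i<n. ennreal (dist (\<gamma> (t i)) (\<gamma> (t (Suc i)))))"

text \<open>
  \<open>\<gamma>\<close> is the counter-clockwise arclength parametrization of the simple closed curve
  \<open>\<partial>\<Omega>\<close>, of total length \<open>L\<close>, extended \<open>L\<close>-periodically to the real line so that one-sided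
  tangents make sense at every point. For compact convex \<open>\<Omega>\<close> with non-empty interior, \<open>L\<close> is
  determined by \<open>\<Omega>\<close> and \<open>\<gamma>\<close> is determined up to a shift of the parameter, so that nothing
  defined below depends on the choices made in \<open>perimeter\<close>, \<open>boundary_curve\<close> and
  \<open>boundary_time\<close>.
\<close>

definition arclength_parametrization ::
  "complex set \<Rightarrow> real \<Rightarrow> (real \<Rightarrow> complex) \<Rightarrow> bool"
  where "arclength_parametrization \<Omega> L \<gamma> \<longleftrightarrow>
     L > 0 \<and> continuous_on UNIV \<gamma> \<and> (\<forall>t. \<gamma> (t + L) = \<gamma> t) \<and>
     inj_on \<gamma> {0..<L} \<and> range \<gamma> = frontier \<Omega> \<and>
     (\<forall>a b. a \<le> b \<longrightarrow> curve_length \<gamma> a b = ennreal (b - a)) \<and>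
     (\<forall>z\<in>interior \<Omega>. winding_number (\<lambda>u. \<gamma> (L * u)) z = 1)"

definition perimeter :: "complex set \<Rightarrow> real"
  where "perimeter \<Omega> = (SOME L. \<exists>\<gamma>. arclength_parametrization \<Omega> L \<gamma>)"

definition boundary_curve :: "complex set \<Rightarrow> real \<Rightarrow> complex"
  where "boundary_curve \<Omega> = (SOME \<gamma>. arclength_parametrization \<Omega> (perimeter \<Omega>) \<gamma>)"

definition boundary_time :: "complex set \<Rightarrow> complex \<Rightarrow> real"
  where "boundary_time \<Omega> \<zeta> = (SOME t. boundary_curve \<Omega> t = \<zeta>)"

abbreviation boundary_borel :: "complex set \<Rightarrow> complex measure"
  where "boundary_borel \<Omega> \<equiv> restrict_space borel (frontier \<Omega>)"

definition arclength_measure :: "complex set \<Rightarrow> complex measure"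
  where "arclength_measure \<Omega> =
     distr (restrict_space lborel {0..<perimeter \<Omega>}) (boundary_borel \<Omega>) (boundary_curve \<Omega>)"

definition in_tangent :: "complex set \<Rightarrow> complex \<Rightarrow> complex"
  where "in_tangent \<Omega> \<zeta> =
     vector_derivative (boundary_curve \<Omega>) (at_left (boundary_time \<Omega> \<zeta>))"

definition out_tangent :: "complex set \<Rightarrow> complex \<Rightarrow> complex"
  where "out_tangent \<Omega> \<zeta> =
     vector_derivative (boundary_curve \<Omega>) (at_right (boundary_time \<Omega> \<zeta>))"

definition in_angle :: "complex set \<Rightarrow> complex \<Rightarrow> real"
  where "in_angle \<Omega> \<zeta> = Arg (in_tangent \<Omega> \<zeta>)"

definition out_angle :: "complex set \<Rightarrow> complex \<Rightarrow> real"
  where "out_angle \<Omega> \<zeta> =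
     (THE \<beta>. in_angle \<Omega> \<zeta> \<le> \<beta> \<and> \<beta> < in_angle \<Omega> \<zeta> + pi \<and> cis \<beta> = out_tangent \<Omega> \<zeta>)"

definition is_corner :: "complex set \<Rightarrow> complex \<Rightarrow> bool"
  where "is_corner \<Omega> \<zeta> \<longleftrightarrow> in_angle \<Omega> \<zeta> < out_angle \<Omega> \<zeta>"

definition interior_angle :: "complex set \<Rightarrow> complex \<Rightarrow> real"
  where "interior_angle \<Omega> \<zeta> = pi - out_angle \<Omega> \<zeta> + in_angle \<Omega> \<zeta>"

text \<open>
  The counter-clockwise unit tangent turned by \<open>-\<pi>/2\<close>; this is the outward normal at
  points that are not corners, and is used only there.
\<close>

definition outward_normal :: "complex set \<Rightarrow> complex \<Rightarrow> complex"
  where "outward_normal \<Omega> \<sigma> = cis (out_angle \<Omega> \<sigma> - pi / 2)"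

subsection \<open>The Neumann--Poincare operator and the analytic configuration constant\<close>

text \<open>
  The density is set to 0 on the arclength-null set of corners together with \<open>\<zeta>\<close>.
\<close>

definition np_density :: "complex set \<Rightarrow> complex \<Rightarrow> complex \<Rightarrow> real"
  where "np_density \<Omega> \<zeta> \<sigma> =
     (if is_corner \<Omega> \<sigma> \<or> \<sigma> = \<zeta> then 0 else Re (outward_normal \<Omega> \<sigma> / (\<sigma> - \<zeta>)) / pi)"

definition np_measure :: "complex set \<Rightarrow> complex \<Rightarrow> complex measure"
  where "np_measure \<Omega> \<zeta> = measure_of (frontier \<Omega>) (sets (boundary_borel \<Omega>))
     (\<lambda>A. ennreal (1 - interior_angle \<Omega> \<zeta> / pi) * indicator A \<zeta> +
          emeasure (density (arclength_measure \<Omega>) (\<lambda>\<sigma>. ennreal (np_density \<Omega> \<zeta> \<sigma>))) A)"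

definition np_operator :: "complex set \<Rightarrow> (complex \<Rightarrow> complex) \<Rightarrow> complex \<Rightarrow> complex"
  where "np_operator \<Omega> f \<zeta> = (LINT \<sigma>|np_measure \<Omega> \<zeta>. f \<sigma>)"

text \<open>The norm of \<open>g + \<complex>\<one>\<close> in \<open>C(\<partial>\<Omega>)/\<complex>\<one>\<close>\<close>

definition quot_norm :: "complex set \<Rightarrow> (complex \<Rightarrow> complex) \<Rightarrow> real"
  where "quot_norm \<Omega> g = (INF c. SUP \<zeta>\<in>frontier \<Omega>. cmod (g \<zeta> - c))"

definition analytic_config_const :: "complex set \<Rightarrow> real"
  where "analytic_config_const \<Omega> =
     (SUP f \<in> {f \<in> analytic_algebra \<Omega>. quot_norm \<Omega> f \<le> 1}. quot_norm \<Omega> (np_operator \<Omega> f))"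

end

theory Submission
  imports Defs
begin

text \<open>The number 2 is a total mass: the resolvent (sigma - T)^(-1) d sigma / (2 pi i) along
  the expanded curve integrates to the identity, and with its adjoint it forms a positive
  operator-valued measure, since every tangent has the numerical range on one side. The polynomial q
  approximates the Cauchy transform of conj p; its boundary behaviour is the jump relation of the
  double layer potential, and at a corner the missing kernel mass is the atom of the
  Neumann-Poincare measure. The best K can be used only if some finite K exists, so the extremal
  argument runs for a contraction of T towards an interior point of W, where a crude Cauchy estimate
  is available; the contraction is removed at the end. That <Ax, x> is nearly 0 expresses that a
  Moebius perturbation of p cannot raise the norm. In the pairing, p (q - c) p is estimated as one
  polynomial; its factor K and the factor |Ax| cancel against the K^2 of A*Ax, so a(W) enters
  without K. Corners force all calculus along the boundary to use right derivatives only.\<close>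

text \<open>
  Let \<open>|p| \<le> 1\<close> on \<open>W\<close>. Integrating the Cauchy kernel against \<open>p\<close> over a slightly expanded boundary
  and using that the numerical range lies on one side of every tangent, one obtains a polynomial \<open>q\<close>
  with \<open>|\<langle>p(T)x, y\<rangle> + \<langle>x, q(T)y\<rangle>| \<le> (2 + \<epsilon>) |x| |y|\<close>, where \<open>q\<close> approximates on the boundary
  the conjugate of the Neumann--Poincare image of \<open>p\<close> and hence lies within about \<open>a(W)\<close> of a
  constant. If \<open>K > 1\<close> is the best constant in \<open>\<parallel>p(T)\<parallel> \<le> K sup |p|\<close>, then on a vector \<open>x\<close> at which
  \<open>A = p(T)\<close> nearly attains it one has \<open>A\<^sup>*Ax \<approx> K\<^sup>2x\<close> and \<open>\<langle>Ax, x\<rangle> \<approx> 0\<close>; the pairing at \<open>(x, Ax)\<close>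
  becomes \<open>K\<^sup>2 \<le> 2K + a(W)\<close>. Density of the polynomials in \<open>\<A>(W)\<close> finishes the proof.
\<close>

section \<open>One-sided derivatives and logarithms\<close>

instance complex_hilbert_space \<subseteq> banach ..

lemma has_vector_derivative_iff_slope:
  "(f has_vector_derivative D) (at x within S) \<longleftrightarrow>
    ((\<lambda>t. (f t - f x) /\<^sub>R (t - x)) \<longlongrightarrow> D) (at x within S)"
proof -
  have "(f has_vector_derivative D) (at x within S) \<longleftrightarrow>
      ((\<lambda>y. norm ((1 / norm (y - x)) *\<^sub>R (f y - (f x + (y - x) *\<^sub>R D)))) \<longlongrightarrow> 0) (at x within S)"
    unfolding has_vector_derivative_def has_derivative_within
    by (simp only: bounded_linear_scaleR_left tendsto_norm_zero_iff simp_thms)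
  also have "\<dots> \<longleftrightarrow> ((\<lambda>t. norm ((f t - f x) /\<^sub>R (t - x) - D)) \<longlongrightarrow> 0) (at x within S)"
  proof (rule tendsto_cong)
    have "norm ((1 / norm (y - x)) *\<^sub>R (f y - (f x + (y - x) *\<^sub>R D))) = norm ((f y - f x) /\<^sub>R (y - x) - D)"
      if "y \<noteq> x" for y
    proof -
      have "(f y - f x) /\<^sub>R (y - x) - D = (1 / (y - x)) *\<^sub>R (f y - (f x + (y - x) *\<^sub>R D))"
        using that by (simp add: scaleR_diff_right scaleR_add_right divide_inverse)
      then show ?thesis by (simp add: abs_divide)
    qed
    then show "\<forall>\<^sub>F y in at x within S. norm ((1 / norm (y - x)) *\<^sub>R (f y - (f x + (y - x) *\<^sub>R D))) = norm ((f y - f x) /\<^sub>R (y - x) - D)"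
      by (auto simp: eventually_at_filter)
  qed
  also have "\<dots> \<longleftrightarrow> ((\<lambda>t. (f t - f x) /\<^sub>R (t - x)) \<longlongrightarrow> D) (at x within S)"
    by (simp only: tendsto_norm_zero_iff flip: Lim_null)
  finally show ?thesis .
qed

text \<open>A first time \<open>m\<close> at which the weaker bound with \<open>C + e\<close> breaks
  down cannot exist: the bound holds at \<open>m\<close> by continuity from the left, and the right
  derivative at \<open>m\<close>, being smaller than \<open>C + e\<close>, carries it a little
  beyond \<open>m\<close>.\<close>

lemma norm_diff_le_of_right_derivative:
  fixes F :: "real \<Rightarrow> 'a::real_normed_vector"
  assumes "a \<le> b" and cont: "continuous_on {a..b} F"
    and deriv: "\<And>t. a \<le> t \<Longrightarrow> t < b \<Longrightarrow> (F has_vector_derivative f t) (at_right t)"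
    and bound: "\<And>t. a \<le> t \<Longrightarrow> t < b \<Longrightarrow> norm (f t) \<le> C"
  shows "norm (F b - F a) \<le> C * (b - a)"
proof (cases "a = b")
  case False
  then have "a < b" using assms by simp
  have *: "norm (F b - F a) \<le> (C + e) * (b - a)" if "e > 0" for e
  proof (rule ccontr)
    assume neg: "\<not> norm (F b - F a) \<le> (C + e) * (b - a)"
    define B where "B = {t\<in>{a..b}. norm (F t - F a) > (C + e) * (t - a)}"
    define m where "m = Inf B"
    have "b \<in> B" using neg \<open>a < b\<close> by (auto simp: B_def)
    have bdd: "bdd_below B" by (auto simp: B_def intro!: bdd_belowI[of _ a])
    have lower: "m \<le> t" if "t \<in> B" for t
      unfolding m_def using bdd that by (simp add: cInf_lower)
    have am: "a \<le> m" unfolding m_def using \<open>b \<in> B\<close>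
      by (intro cInf_greatest) (auto simp: B_def)
    have mb: "m \<le> b" using lower \<open>b \<in> B\<close> by blast
    have left: "norm (F t - F a) \<le> (C + e) * (t - a)" if "a \<le> t" "t < m" for t
      using lower[of t] that mb by (fastforce simp: B_def)
    have mle: "norm (F m - F a) \<le> (C + e) * (m - a)"
    proof (cases "m = a")
      case False
      have "continuous_on {a..b} (\<lambda>t. (C + e) * (t - a) - norm (F t - F a))"
        by (intro continuous_intros cont)
      then have "continuous (at m within {a..b}) (\<lambda>t. (C + e) * (t - a) - norm (F t - F a))"
        using am mb by (auto simp: continuous_on_eq_continuous_within)
      then have c: "((\<lambda>t. (C + e) * (t - a) - norm (F t - F a)) \<longlongrightarrow>
          (C + e) * (m - a) - norm (F m - F a)) (at m within {a..<m})"
        unfolding continuous_within by (rule tendsto_within_subset) (use mb in auto)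
      have "(at m within {a..<m}) \<noteq> bot"
        using am False by (simp add: at_within_eq_bot_iff)
      moreover have "eventually (\<lambda>t. 0 \<le> (C + e) * (t - a) - norm (F t - F a)) (at m within {a..<m})"
        using left by (auto simp: eventually_at_filter)
      ultimately have "0 \<le> (C + e) * (m - a) - norm (F m - F a)"
        using tendsto_lowerbound[OF c] by blast
      then show ?thesis by simp
    qed simp
    have "m < b" using mle neg mb by (cases "m = b") auto
    have "((\<lambda>t. (F t - F m) /\<^sub>R (t - m)) \<longlongrightarrow> f m) (at_right m)"
      using deriv[OF am \<open>m < b\<close>] by (simp add: has_vector_derivative_iff_slope)
    then have "((\<lambda>t. norm ((F t - F m) /\<^sub>R (t - m))) \<longlongrightarrow> norm (f m)) (at_right m)"
      by (rule tendsto_norm)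
    moreover have "norm (f m) < C + e" using bound[OF am \<open>m < b\<close>] \<open>e > 0\<close> by simp
    ultimately have "eventually (\<lambda>t. norm ((F t - F m) /\<^sub>R (t - m)) < C + e) (at_right m)"
      by (rule order_tendstoD(2))
    then obtain c where "c > m" and c: "\<And>t. m < t \<Longrightarrow> t < c \<Longrightarrow> norm ((F t - F m) /\<^sub>R (t - m)) < C + e"
      unfolding eventually_at_right_field by blast
    have "min b c \<le> t" if "t \<in> B" for t
    proof (rule ccontr)
      assume "\<not> min b c \<le> t"
      moreover have "m < t" using lower[OF that] mle that by (cases "m = t") (auto simp: B_def)
      ultimately have "norm ((F t - F m) /\<^sub>R (t - m)) < C + e" using c by auto
      then have "norm (F t - F m) < (C + e) * (t - m)"
        using \<open>m < t\<close> by (simp add: divide_simps mult.commute)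
      then have "norm (F t - F a) \<le> (C + e) * (t - m) + (C + e) * (m - a)"
        using mle norm_triangle_ineq[of "F t - F m" "F m - F a"] by simp
      also have "\<dots> = (C + e) * (t - a)" by (simp add: algebra_simps)
      finally show False using that by (simp add: B_def)
    qed
    then have "min b c \<le> m" unfolding m_def using \<open>b \<in> B\<close> by (intro cInf_greatest) auto
    then show False using \<open>m < b\<close> \<open>c > m\<close> by auto
  qed
  show ?thesis
  proof (rule field_le_epsilon)
    fix e :: real assume "e > 0"
    then show "norm (F b - F a) \<le> C * (b - a) + e"
      using *[of "e / (b - a)"] \<open>a < b\<close> by (simp add: distrib_right)
  qed
qed simp

text \<open>A bounded right derivative makes \<open>F\<close> Lipschitz, so the forward difference
  quotients are dominated and converge to \<open>f\<close>. Their integrals telescope into averages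
  of \<open>F\<close> over short intervals at the two ends.\<close>

lemma set_integral_right_derivative:
  fixes F :: "real \<Rightarrow> complex"
  assumes "a \<le> b" and cont: "continuous_on {a..b} F"
    and deriv: "\<And>t. a \<le> t \<Longrightarrow> t < b \<Longrightarrow> (F has_vector_derivative f t) (at_right t)"
    and bound: "\<And>t. a \<le> t \<Longrightarrow> t < b \<Longrightarrow> norm (f t) \<le> C"
    and meas: "set_borel_measurable lborel {a..<b} f"
  shows "(LINT t:{a..<b}|lborel. f t) = F b - F a"
proof (cases "a = b")
  case True then show ?thesis by (simp add: set_lebesgue_integral_def)
next
  case False
  then have ab: "a < b" using assms by simp
  then have C: "C \<ge> 0" using bound[of a] by (meson norm_ge_zero order_refl order_trans)
  \<comment> \<open>Extension by constants: the forward quotients are then defined up to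
    \<open>b\<close> and beyond, with the same Lipschitz constant.\<close>
  define G where "G t = F (max a (min b t))" for t
  have Gc: "continuous_on S G" for S
    unfolding G_def
    by (rule continuous_on_compose2[OF cont]) (use ab in \<open>auto intro!: continuous_intros\<close>)
  have lip0: "norm (F t - F s) \<le> C * (t - s)" if "a \<le> s" "s \<le> t" "t \<le> b" for s t
    by (rule norm_diff_le_of_right_derivative[where f = f])
      (use that deriv bound in \<open>auto intro: continuous_on_subset[OF cont]\<close>)
  have lip1: "norm (G t - G s) \<le> C * (t - s)" if "s \<le> t" for s t
  proof -
    have "norm (G t - G s) \<le> C * (max a (min b t) - max a (min b s))"
      unfolding G_def by (rule lip0) (use that ab in auto)
    also have "\<dots> \<le> C * (t - s)"
      by (rule mult_left_mono) (use that C in auto)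
    finally show ?thesis .
  qed
  define D where "D n t = (G (t + 1 / real (Suc n)) - G t) /\<^sub>R (1 / real (Suc n))" for n t
  have Dc: "continuous_on S (D n)" for n S
    unfolding D_def by (intro continuous_intros continuous_on_compose2[OF Gc]) auto
  have lim: "(\<lambda>n. D n t) \<longlonglongrightarrow> f t" if t: "a \<le> t" "t < b" for t
  proof -
    have ev: "eventually (\<lambda>s. s < b) (at_right t)"
      using eventually_at_right_real[OF t(2)] by eventually_elim auto
    have "((\<lambda>s. (F s - F t) /\<^sub>R (s - t)) \<longlongrightarrow> f t) (at_right t)"
      using deriv[OF t] by (simp add: has_vector_derivative_iff_slope)
    then have 1: "((\<lambda>s. (G s - G t) /\<^sub>R (s - t)) \<longlongrightarrow> f t) (at_right t)"
      by (rule Lim_transform_eventually)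
        (use ev eventually_at_right_less[of t] in \<open>eventually_elim, use t in \<open>auto simp: G_def\<close>\<close>)
    have 2: "filterlim (\<lambda>n. t + 1 / real (Suc n)) (at_right t) sequentially"
      unfolding filterlim_at
    proof
      show "eventually (\<lambda>n. t + 1 / real (Suc n) \<in> {t<..} \<and> t + 1 / real (Suc n) \<noteq> t) sequentially"
        by simp
      show "(\<lambda>n. t + 1 / real (Suc n)) \<longlonglongrightarrow> t"
        using tendsto_add[OF tendsto_const[of t] LIMSEQ_inverse_real_of_nat] by (simp add: field_simps)
    qed
    show ?thesis using filterlim_compose[OF 1 2] by (simp add: D_def)
  qed
  have Dint: "(LINT t:{a..<b}|lborel. D n t) = integral {a..b} (D n)" for n
  proof -
    have "(LINT t:{a..<b}|lborel. D n t) = (LINT t:{a..b}|lborel. D n t)"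
      unfolding set_lebesgue_integral_def
    proof (rule integral_cong_AE)
      show "AE x in lborel. indicator {a..<b} x *\<^sub>R D n x = indicator {a..b} x *\<^sub>R D n x"
        using AE_lborel_singleton[of b] by eventually_elim (auto simp: indicator_def)
    qed (auto intro!: borel_measurable_continuous_onI[OF Dc] borel_measurable_scaleR)
    also have "\<dots> = integral {a..b} (D n)"
      by (rule set_borel_integral_eq_integral(2))
        (auto intro!: borel_integrable_atLeastAtMost' Dc)
    finally show ?thesis .
  qed
  \<comment> \<open>The integral of \<open>D n\<close> is a difference of two quotients of this
    primitive, at \<open>b\<close> and at \<open>a\<close>, which tend to \<open>G b\<close> and
    \<open>G a\<close>.\<close>
  define P where "P x = integral {a..x} G" for x
  have P: "(P has_vector_derivative G x) (at x within {a..b+1})" if "x \<in> {a..b+1}" for x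
    unfolding P_def by (rule integral_has_vector_derivative[OF Gc that])
  have Ps: "(\<lambda>n. (P (x + 1 / real (Suc n)) - P x) /\<^sub>R (1 / real (Suc n))) \<longlonglongrightarrow> G x" if x: "a \<le> x" "x \<le> b" for x
  proof -
    have 1: "((\<lambda>s. (P s - P x) /\<^sub>R (s - x)) \<longlongrightarrow> G x) (at x within {a..b+1})"
      using P[of x] x by (simp add: has_vector_derivative_iff_slope)
    have 2: "filterlim (\<lambda>n. x + 1 / real (Suc n)) (at x within {a..b+1}) sequentially"
      unfolding filterlim_at
    proof
      show "eventually (\<lambda>n. x + 1 / real (Suc n) \<in> {a..b+1} \<and> x + 1 / real (Suc n) \<noteq> x) sequentially"
      proof (intro always_eventually allI)
        fix n
        have "0 < 1 / real (Suc n)" "1 / real (Suc n) \<le> 1" by simp_all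
        then show "x + 1 / real (Suc n) \<in> {a..b+1} \<and> x + 1 / real (Suc n) \<noteq> x"
          using x by (simp only: atLeastAtMost_iff) linarith
      qed
      show "(\<lambda>n. x + 1 / real (Suc n)) \<longlonglongrightarrow> x"
        using tendsto_add[OF tendsto_const[of x] LIMSEQ_inverse_real_of_nat] by (simp add: field_simps)
    qed
    show ?thesis using filterlim_compose[OF 1 2] by simp
  qed
  have Di: "integral {a..b} (D n) =
      (P (b + 1 / real (Suc n)) - P b) /\<^sub>R (1 / real (Suc n)) -
      (P (a + 1 / real (Suc n)) - P a) /\<^sub>R (1 / real (Suc n))" for n
  proof -
    define h where "h = 1 / real (Suc n)"
    have h: "h > 0" by (simp add: h_def)
    have Gi: "G integrable_on {u..v}" for u v by (rule integrable_continuous_real[OF Gc])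
    have ci: "(\<lambda>t. G (t + h)) integrable_on {u..v}" for u v
      by (intro integrable_continuous_real continuous_intros continuous_on_compose2[OF Gc]) auto
    have "integral {a..b} (D n) = (integral {a..b} (\<lambda>t. G (t + h)) - integral {a..b} G) /\<^sub>R h"
      unfolding D_def h_def[symmetric] by (simp add: integral_diff ci Gi)
    also have "integral {a..b} (\<lambda>t. G (t + h)) = integral {a+h..b+h} G"
      using integral_shift_Icc_real[of a b G h] by (simp add: o_def add.commute)
    also have "\<dots> = P (b + h) - P (a + h)"
      unfolding P_def using Henstock_Kurzweil_Integration.integral_combine[of a "a+h" "b+h" G] h ab Gi by (simp add: algebra_simps)
    also have "integral {a..b} G = P b - P a" by (simp add: P_def)
    finally show ?thesis unfolding h_def by (simp add: algebra_simps)
  qed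
  have "(\<lambda>n. LINT t:{a..<b}|lborel. D n t) \<longlonglongrightarrow> G b - G a"
    unfolding Dint Di using ab by (intro tendsto_diff Ps) auto
  moreover have "(\<lambda>n. LINT t:{a..<b}|lborel. D n t) \<longlonglongrightarrow> (LINT t:{a..<b}|lborel. f t)"
    unfolding set_lebesgue_integral_def
  proof (rule integral_dominated_convergence[where w = "\<lambda>t. C * indicator {a..<b} t"])
    show "(\<lambda>x. indicator {a..<b} x *\<^sub>R f x) \<in> borel_measurable lborel"
      using meas by (simp add: set_borel_measurable_def)
    show "(\<lambda>x. indicator {a..<b} x *\<^sub>R D i x) \<in> borel_measurable lborel" for i
      by (intro borel_measurable_scaleR borel_measurable_indicator) (auto intro!: borel_measurable_continuous_onI Dc)
    show "integrable lborel (\<lambda>t. C * indicator {a..<b} t)"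
      by (intro integrable_mult_right integrable_real_indicator) (use ab in auto)
    show "AE x in lborel. (\<lambda>i. indicator {a..<b} x *\<^sub>R D i x) \<longlonglongrightarrow> indicator {a..<b} x *\<^sub>R f x"
      by (intro AE_I2) (auto simp: indicator_def intro: lim)
    show "AE x in lborel. norm (indicator {a..<b} x *\<^sub>R D i x) \<le> C * indicator {a..<b} x" for i
    proof (intro AE_I2)
      fix t
      have "norm (D i t) \<le> C"
        using mult_left_mono[OF lip1[of t "t + 1 / real (Suc i)"], of "real (Suc i)"]
        by (simp add: D_def del: of_nat_Suc)
      then show "norm (indicator {a..<b} t *\<^sub>R D i t) \<le> C * indicator {a..<b} t"
        by (auto simp: indicator_def)
    qed
  qed
  ultimately have "(LINT t:{a..<b}|lborel. f t) = G b - G a"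
    using LIMSEQ_unique by blast
  then show ?thesis using ab by (simp add: G_def)
qed

text \<open>Near \<open>s\<close> the increment of \<open>l\<close> stays in the strip where
  \<open>Ln\<close> inverts \<open>exp\<close>, so \<open>l t\<close> is \<open>l s\<close> plus the
  principal logarithm of a quotient close to 1, and the chain rule applies.\<close>

lemma has_vector_derivative_log_right:
  fixes l :: "real \<Rightarrow> complex"
  assumes cont: "(l \<longlongrightarrow> l s) (at_right s)"
    and deriv: "((\<lambda>t. exp (l t)) has_vector_derivative D) (at_right s)"
  shows "(l has_vector_derivative D / exp (l s)) (at_right s)"
proof -
  have ev: "eventually (\<lambda>t. cmod (l t - l s) < pi) (at_right s)"
    using tendstoD[OF cont pi_gt_zero] by (simp add: dist_norm)
  have "((\<lambda>t. exp (l t) / exp (l s)) has_vector_derivative D / exp (l s)) (at_right s)"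
    using has_vector_derivative_mult_left[OF deriv, of "inverse (exp (l s))"] by (simp add: divide_inverse)
  then have "((\<lambda>t. Ln (exp (l t) / exp (l s))) has_vector_derivative D / exp (l s) * 1) (at_right s)"
    by (rule field_vector_diff_chain_within[unfolded o_def])
      (auto intro!: derivative_eq_intros)
  then have d: "((\<lambda>t. l s + Ln (exp (l t) / exp (l s))) has_vector_derivative D / exp (l s)) (at_right s)"
    using has_vector_derivative_add[OF has_vector_derivative_const[of "l s"]] by fastforce
  show ?thesis
    unfolding has_vector_derivative_iff_slope
  proof (rule Lim_transform_eventually)
    show "((\<lambda>t. (l s + Ln (exp (l t) / exp (l s)) - (l s + Ln (exp (l s) / exp (l s)))) /\<^sub>R (t - s)) \<longlongrightarrow> D / exp (l s)) (at_right s)"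
      using d unfolding has_vector_derivative_iff_slope .
    show "\<forall>\<^sub>F t in at_right s. (l s + Ln (exp (l t) / exp (l s)) - (l s + Ln (exp (l s) / exp (l s)))) /\<^sub>R (t - s) =
        (l t - l s) /\<^sub>R (t - s)"
      using ev
    proof eventually_elim
      case (elim t)
      then have "\<bar>Im (l t - l s)\<bar> < pi" using abs_Im_le_cmod order_le_less_trans by blast
      then have "Ln (exp (l t - l s)) = l t - l s" by (intro Ln_exp) auto
      then show ?case by (simp flip: exp_diff)
    qed
  qed
qed

section \<open>Arclength parametrizations of convex curves\<close>

text \<open>The values are integer multiples of 2 pi i, so different values are at least 2 pi apart;
  the cruder separation 1 is enough.\<close>

lemma exp_eq_1_imp_constant_on:
  fixes f :: "'a::topological_space \<Rightarrow> complex"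
  assumes "connected S" "continuous_on S f" "\<And>x. x \<in> S \<Longrightarrow> exp (f x) = 1"
  shows "f constant_on S"
proof (rule continuous_discrete_range_constant[OF assms(1,2)])
  fix x assume x: "x \<in> S"
  show "\<exists>e>0. \<forall>y. y \<in> S \<and> f y \<noteq> f x \<longrightarrow> e \<le> cmod (f y - f x)"
  proof (intro exI conjI allI impI)
    fix y assume y: "y \<in> S \<and> f y \<noteq> f x"
    then have "exp (f y) = exp (f x)" using assms(3) x by simp
    then obtain n :: int where n: "f y = f x + of_int (2 * n) * of_real pi * \<i>"
      by (auto simp: exp_eq)
    with y have "n \<noteq> 0" by auto
    then have "2 * pi * 1 \<le> 2 * pi * \<bar>of_int n\<bar>" by (intro mult_left_mono) auto
    then have "1 \<le> 2 * pi * \<bar>of_int n\<bar>" using pi_gt3 by linarith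
    then show "1 \<le> cmod (f y - f x)"
      using n by (simp add: norm_mult mult_ac)
  qed auto
qed

text \<open>A continuous angle starting at \<open>g x\<close> would have to pass through values of
  negative sine before leaving the interval of length pi.\<close>

lemma sin_nonneg_imp_angle_range:
  fixes g :: "real \<Rightarrow> real"
  assumes "x \<le> y" "continuous_on {x..y} g"
    and sin: "\<And>t. x \<le> t \<Longrightarrow> t \<le> y \<Longrightarrow> sin (g t - g x) \<ge> 0"
  shows "g x \<le> g y" "g y \<le> g x + pi"
proof -
  show "g x \<le> g y"
  proof (rule ccontr)
    assume neg: "\<not> g x \<le> g y"
    \<comment> \<open>Cut off at pi/4 below the start, so that the sine is negative there even if
      \<open>g y\<close> is far away.\<close>
    define m where "m = max (g y) (g x - pi / 4)"
    have "\<exists>t. x \<le> t \<and> t \<le> y \<and> g t = m"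
      by (rule IVT2') (use neg assms in \<open>auto simp: m_def\<close>)
    then have "sin (m - g x) \<ge> 0" using sin by blast
    moreover have "sin (m - g x) < 0"
      using neg pi_gt3 by (intro sin_less_zero) (auto simp: m_def)
    ultimately show False by simp
  qed
  show "g y \<le> g x + pi"
  proof (rule ccontr)
    assume neg: "\<not> g y \<le> g x + pi"
    define m where "m = min (g y) (g x + 3 * pi / 2)"
    have "\<exists>t. x \<le> t \<and> t \<le> y \<and> g t = m"
      by (rule IVT') (use neg pi_gt3 assms in \<open>auto simp: m_def\<close>)
    then have "sin (m - g x) \<ge> 0" using sin by blast
    moreover have "sin (m - g x) < 0"
      using neg pi_gt3 by (intro sin_lt_zero) (auto simp: m_def)
    ultimately show False by simp
  qed
qed

lemma Im_exp_mult_cnj: "Im (exp v * cnj (exp u)) = exp (Re u + Re v) * sin (Im v - Im u)"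
  by (simp add: Re_exp Im_exp sin_diff exp_add algebra_simps)

text \<open>The sum is twice the oriented area of the triangle with vertices
  \<open>z + exp u\<close>, \<open>z + exp v\<close>, \<open>z + exp w\<close>. Were it negative,
  the middle point would lie strictly on the side of \<open>z\<close> of the segment joining the
  other two, hence in the interior of \<open>S\<close>.\<close>

lemma Im_triangle_convex_sector:
  assumes "convex S" "z \<in> interior S"
    and "z + exp u \<in> S" "z + exp w \<in> S" "z + exp v \<notin> interior S"
    and ord: "Im u < Im v" "Im v < Im w" "Im w < Im u + pi"
  shows "Im (exp v * cnj (exp u)) + Im (exp w * cnj (exp v)) + Im (exp u * cnj (exp w)) \<ge> 0"
proof (rule ccontr)
  define X where "X a b = Im (exp b * cnj (exp a))" for a b
  assume "\<not> ?thesis"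
  moreover have X: "X w u = - X u w" by (simp add: X_def algebra_simps)
  ultimately have neg: "X u v + X v w < X u w" by (simp add: X_def algebra_simps)
  have pos: "X u v > 0" "X v w > 0" "X u w > 0"
    unfolding X_def Im_exp_mult_cnj using ord by (auto intro!: mult_pos_pos sin_gt_zero)
  \<comment> \<open>Cramer's rule gives the coordinates of \<open>exp v\<close> in the basis
    \<open>exp u\<close>, \<open>exp w\<close>; negative area means
    \<open>l + m < 1\<close>.\<close>
  define l m where "l = X v w / X u w" and "m = X u v / X u w"
  have lm: "l > 0" "m > 0" "l + m < 1"
    using pos neg by (auto simp: l_def m_def field_simps)
  have eq: "exp v = of_real l * exp u + of_real m * exp w"
  proof -
    have "of_real (X u w) * exp v = of_real (X v w) * exp u + of_real (X u v) * exp w"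
      by (simp add: complex_eq_iff X_def algebra_simps)
    then show ?thesis using pos(3) by (simp add: l_def m_def field_simps)
  qed
  define y where "y = (l / (l + m)) *\<^sub>R (z + exp u) + (m / (l + m)) *\<^sub>R (z + exp w)"
  have "y \<in> S" unfolding y_def
    by (rule convexD[OF assms(1)]) (use assms lm in \<open>auto simp flip: add_divide_distrib\<close>)
  then have "y - (1 - l - m) *\<^sub>R (y - z) \<in> interior S"
    using mem_interior_convex_shrink[OF assms(1,2), of y "1 - l - m"] lm by (auto simp: algebra_simps)
  also have "y - (1 - l - m) *\<^sub>R (y - z) = z + (l + m) *\<^sub>R (y - z)"
    by (simp add: algebra_simps)
  also have "(l + m) *\<^sub>R (y - z) = l *\<^sub>R exp u + m *\<^sub>R exp w"
  proof -
    have "y - z = (l / (l + m)) *\<^sub>R exp u + (m / (l + m)) *\<^sub>R exp w + (l / (l + m) + m / (l + m) - 1) *\<^sub>R z"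
      unfolding y_def by (simp add: algebra_simps)
    also have "l / (l + m) + m / (l + m) - 1 = 0" using lm by (simp flip: add_divide_distrib)
    finally show ?thesis using lm by (simp add: scaleR_add_right)
  qed
  finally show False using assms(5) eq by (simp add: scaleR_conv_of_real)
qed

lemma curve_length_ge_dist:
  assumes "a \<le> b" shows "ennreal (dist (\<gamma> a) (\<gamma> b)) \<le> curve_length \<gamma> a b"
proof -
  have "(1, \<lambda>i. if i = 0 then a else b) \<in> {(n :: nat, t). t 0 = a \<and> t n = b \<and> mono_on {..n} t}"
    using assms by (auto simp: mono_on_def)
  then show ?thesis
    unfolding curve_length_def by (rule SUP_upper2) simp
qed

section \<open>Orientation of points on a convex curve\<close>

locale convex_curve =
  fixes \<Omega> :: "complex set" and L :: real and \<gamma> :: "real \<Rightarrow> complex"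
  assumes compact_\<Omega>: "compact \<Omega>" and convex_\<Omega>: "convex \<Omega>" and interior_\<Omega>: "interior \<Omega> \<noteq> {}"
    and param: "arclength_parametrization \<Omega> L \<gamma>"
begin

lemma L_pos: "L > 0" and continuous_\<gamma>: "continuous_on S \<gamma>" and periodic_\<gamma>: "\<gamma> (t + L) = \<gamma> t"
  and inj_\<gamma>: "inj_on \<gamma> {0..<L}" and range_\<gamma>: "range \<gamma> = frontier \<Omega>"
  and length_\<gamma>: "a \<le> b \<Longrightarrow> curve_length \<gamma> a b = ennreal (b - a)"
  and winding_\<gamma>: "z \<in> interior \<Omega> \<Longrightarrow> winding_number (\<lambda>u. \<gamma> (L * u)) z = 1"
  using param continuous_on_subset[of UNIV \<gamma> S] by (auto simp: arclength_parametrization_def)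

lemma \<gamma>_frontier: "\<gamma> t \<in> frontier \<Omega>" using range_\<gamma> by auto
lemma \<gamma>_mem: "\<gamma> t \<in> \<Omega>"
  using \<gamma>_frontier[of t] compact_\<Omega> by (metis compact_imp_closed frontier_subset_closed subsetD)
lemma \<gamma>_not_interior: "\<gamma> t \<notin> interior \<Omega>" using \<gamma>_frontier[of t] by (simp add: frontier_def)

lemma dist_\<gamma>_le: "a \<le> b \<Longrightarrow> cmod (\<gamma> b - \<gamma> a) \<le> b - a"
  using curve_length_ge_dist[of a b \<gamma>] by (simp add: length_\<gamma> dist_norm norm_minus_commute)

lemma periodic_\<gamma>_int: "\<gamma> (t + of_int k * L) = \<gamma> t"
proof -
  have nat: "\<gamma> (t + real n * L) = \<gamma> t" for n t
  proof (induction n)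
    case (Suc n)
    have eq: "t + real (Suc n) * L = (t + real n * L) + L" by (simp add: algebra_simps)
    show ?case by (simp only: eq periodic_\<gamma> Suc.IH)
  qed simp
  show ?thesis
  proof (cases "k \<ge> 0")
    case True then show ?thesis using nat[of t "nat k"] by simp
  next
    case False then show ?thesis using nat[of "t + of_int k * L" "nat (-k)"] by simp
  qed
qed

lemma \<gamma>_eq_imp: assumes "\<gamma> s = \<gamma> t" shows "\<exists>k::int. s = t + of_int k * L"
proof -
  define r where "r x = x - of_int \<lfloor>x / L\<rfloor> * L" for x
  have "r x \<in> {0..<L}" for x
    using L_pos floor_divide_lower[of L x] floor_divide_upper[of L x] by (auto simp: r_def algebra_simps)
  moreover have "\<gamma> (r x) = \<gamma> x" for x
    using periodic_\<gamma>_int[of x "- \<lfloor>x / L\<rfloor>"] by (simp add: r_def)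
  ultimately have "r s = r t" using inj_\<gamma> assms by (metis inj_onD)
  then have "s = t + of_int (\<lfloor>s / L\<rfloor> - \<lfloor>t / L\<rfloor>) * L" by (simp add: r_def algebra_simps)
  then show ?thesis by blast
qed

lemma \<gamma>_neq: assumes "a < b" "b < a + L" shows "\<gamma> a \<noteq> \<gamma> b"
proof
  assume "\<gamma> a = \<gamma> b"
  then obtain k :: int where k: "b = a + of_int k * L" using \<gamma>_eq_imp[of b a] by auto
  then have "0 < of_int k * L" "of_int k * L < 1 * L" using assms by auto
  then have "0 < (of_int k :: real)" "(of_int k :: real) < 1"
    using L_pos by (auto simp: zero_less_mult_iff mult_less_cancel_right)
  then show False by simp
qed

text \<open>Polar coordinates about \<open>z\<close> along the whole line. The increment over a
  period is continuous with discrete values, hence constant, and the winding number 1 identifies it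
  as one positive turn.\<close>

lemma log_around_interior_point:
  assumes z: "z \<in> interior \<Omega>"
  obtains q where "continuous_on UNIV q" "\<And>t. \<gamma> t = z + exp (q t)"
    "\<And>t. q (t + L) = q t + 2 * of_real pi * \<i>"
proof -
  have ne: "\<gamma> t - z \<noteq> 0" for t using z \<gamma>_not_interior[of t] by auto
  obtain q where qc: "continuous_on UNIV q" and q: "\<And>t. \<gamma> t - z = exp (q t)"
  proof (rule continuous_logarithm_on_contractible[of UNIV "\<lambda>t. \<gamma> t - z"])
    show "continuous_on UNIV (\<lambda>t. \<gamma> t - z)" by (intro continuous_intros continuous_\<gamma>)
  qed (use ne in \<open>auto simp: contractible_UNIV\<close>)
  have "exp (q (t + L) - q t) = 1" for t
    using q[of t] q[of "t + L"] by (simp add: exp_diff periodic_\<gamma>)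
  moreover have "continuous_on UNIV (\<lambda>t. q (t + L) - q t)"
    by (intro continuous_intros continuous_on_compose2[OF qc]) auto
  ultimately have "(\<lambda>t. q (t + L) - q t) constant_on UNIV"
    by (intro exp_eq_1_imp_constant_on) auto
  then obtain c where c: "\<And>t. q (t + L) = q t + c" by (auto simp: constant_on_def algebra_simps)
  have path: "path (\<lambda>u. \<gamma> (L * u))"
    unfolding path_def by (intro continuous_on_compose2[OF continuous_\<gamma>[of UNIV]] continuous_intros) auto
  have nz: "z \<notin> path_image (\<lambda>u. \<gamma> (L * u))" using ne by (auto simp: path_image_def)
  obtain r where "path r" and r: "pathfinish r - pathstart r = 2 * of_real pi * \<i> * winding_number (\<lambda>u. \<gamma> (L * u)) z"
    and re: "\<And>t. t \<in> {0..1} \<Longrightarrow> \<gamma> (L * t) = z + exp (r t)"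
    using winding_number_as_continuous_log[OF path nz] by blast
  have "(\<lambda>u. q (L * u) - r u) constant_on {0..1}"
  proof (rule exp_eq_1_imp_constant_on)
    show "continuous_on {0..1} (\<lambda>u. q (L * u) - r u)"
      using \<open>path r\<close> unfolding path_def by (intro continuous_intros continuous_on_compose2[OF qc]) auto
    fix u :: real assume "u \<in> {0..1}"
    then have "exp (q (L * u)) = exp (r u)" using q[of "L * u"] re[of u] by (simp add: algebra_simps)
    then show "exp (q (L * u) - r u) = 1" by (simp add: exp_diff)
  qed auto
  then obtain d where "\<And>u. u \<in> {0..1} \<Longrightarrow> q (L * u) - r u = d" unfolding constant_on_def by blast
  from this[of 0] this[of 1] have "q L - q 0 = r 1 - r 0" by (simp add: algebra_simps)
  then have "c = 2 * of_real pi * \<i>" using c[of 0] r winding_\<gamma>[OF z] by (simp add: pathfinish_def pathstart_def)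
  moreover have "\<gamma> t = z + exp (q t)" for t using q[of t] by (simp add: algebra_simps)
  ultimately show ?thesis using that[of q] qc c by simp
qed

text \<open>Every ray from the interior point \<open>z\<close> meets the boundary once, so the
  argument is injective in the parameter; continuity makes it monotone, and the increment over a
  period decides the direction.\<close>

lemma Im_log_strict_mono:
  assumes z: "z \<in> interior \<Omega>"
    and qc: "continuous_on UNIV q" and q: "\<And>t. \<gamma> t = z + exp (q t)"
    and qL: "\<And>t. q (t + L) = q t + 2 * of_real pi * \<i>"
  shows "strict_mono (\<lambda>t. Im (q t))"
proof -
  have qnat: "q (t + real n * L) = q t + of_nat n * (2 * of_real pi * \<i>)" for n t
  proof (induction n)
    case (Suc n)
    have "t + real (Suc n) * L = (t + real n * L) + L" by (simp add: algebra_simps)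
    then show ?case using qL[of "t + real n * L"] Suc by (simp add: algebra_simps)
  qed auto
  have nogt: "\<not> Re (q s) < Re (q t)" if eq: "Im (q s) = Im (q t)" for s t
  proof
    assume lt: "Re (q s) < Re (q t)"
    define e where "e = exp (Re (q s) - Re (q t))"
    have e: "0 < e" "e < 1" using lt by (auto simp: e_def)
    have "exp (q s) = of_real e * exp (q t)"
      using eq by (simp add: e_def complex_eq_iff Re_exp Im_exp flip: exp_add mult.assoc)
    then have "\<gamma> s = \<gamma> t - (1 - e) *\<^sub>R (\<gamma> t - z)"
      unfolding q by (simp add: scaleR_conv_of_real algebra_simps)
    moreover have "\<gamma> t - (1 - e) *\<^sub>R (\<gamma> t - z) \<in> interior \<Omega>"
      by (rule mem_interior_convex_shrink[OF convex_\<Omega> z \<gamma>_mem]) (use e in auto)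
    ultimately show False using \<gamma>_not_interior[of s] by simp
  qed
  have inj: "s = t" if eq: "Im (q s) = Im (q t)" for s t
  proof -
    have "Re (q s) = Re (q t)" using nogt[of s t] nogt[of t s] eq by force
    with eq have qe: "q s = q t" by (simp add: complex_eq_iff)
    then have "\<gamma> s = \<gamma> t" by (simp add: q)
    then obtain k :: int where k: "s = t + of_int k * L" using \<gamma>_eq_imp by blast
    have "k = 0"
    proof (cases "k \<ge> 0")
      case True
      then show ?thesis using qnat[of t "nat k"] qe k by simp
    next
      case False
      then show ?thesis using qnat[of s "nat (-k)"] qe k by simp
    qed
    then show ?thesis using k by simp
  qed
  show ?thesis
  proof (rule strict_monoI)
    fix s t :: real assume "s < t"
    obtain n where n: "real n * L > t - s" using reals_Archimedean3[OF L_pos] by blast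
    define b where "b = s + real n * L"
    have "n > 0" using n \<open>s < t\<close> by (cases n) auto
    then have "Im (q s) < Im (q b)" by (simp add: b_def qnat)
    moreover have "(Im (q s) < Im (q t) \<and> Im (q t) < Im (q b)) \<or> (Im (q b) < Im (q t) \<and> Im (q t) < Im (q s))"
      by (rule continuous_inj_imp_mono)
        (use \<open>s < t\<close> n inj in \<open>auto simp: b_def inj_on_def intro!: continuous_intros continuous_on_subset[OF qc]\<close>)
    ultimately show "Im (q s) < Im (q t)" by auto
  qed
qed

text \<open>Seen from an interior point, at most one of the three angular gaps exceeds pi. If one
  does, the other two form a sector of less than pi and the sector lemma applies; if none does, all
  three partial areas are nonnegative. So points met in this order form a positively oriented,
  possibly degenerate, triangle.\<close>

lemma Im_triangle_nonneg:
  assumes t: "t1 < t2" "t2 < t3" "t3 < t1 + L"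
  shows "Im ((\<gamma> t3 - \<gamma> t1) * cnj (\<gamma> t2 - \<gamma> t1)) \<ge> 0"
proof -
  obtain z where z: "z \<in> interior \<Omega>" using interior_\<Omega> by auto
  obtain q where qc: "continuous_on UNIV q" and q: "\<And>t. \<gamma> t = z + exp (q t)"
    and qL: "\<And>t. q (t + L) = q t + 2 * of_real pi * \<i>"
    using log_around_interior_point[OF z] by blast
  have sm: "strict_mono (\<lambda>t. Im (q t))" by (rule Im_log_strict_mono[OF z qc q qL])
  have ord: "Im (q t1) < Im (q t2)" "Im (q t2) < Im (q t3)" "Im (q t3) < Im (q t1) + 2 * pi"
    using strict_monoD[OF sm t(1)] strict_monoD[OF sm t(2)] strict_monoD[OF sm t(3)] qL[of t1] by auto
  define X where "X u v = Im (exp v * cnj (exp u))" for u v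
  have per: "X u (v + 2 * of_real pi * \<i>) = X u v" "X (u + 2 * of_real pi * \<i>) v = X u v" for u v
    by (simp_all add: X_def exp_add)
  have eq: "Im ((\<gamma> t3 - \<gamma> t1) * cnj (\<gamma> t2 - \<gamma> t1)) =
      X (q t1) (q t2) + X (q t2) (q t3) + X (q t3) (q t1)"
    by (simp add: X_def q algebra_simps)
  have core: "X u v + X v w + X w u \<ge> 0"
    if "z + exp u \<in> \<Omega>" "z + exp w \<in> \<Omega>" "z + exp v \<notin> interior \<Omega>"
      "Im u < Im v" "Im v < Im w" "Im w < Im u + pi" for u v w
    unfolding X_def by (rule Im_triangle_convex_sector[OF convex_\<Omega> z that])
  have mem: "z + exp (q t) \<in> \<Omega>" "z + exp (q t) \<notin> interior \<Omega>" for t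
    using \<gamma>_mem[of t] \<gamma>_not_interior[of t] by (simp_all add: q)
  have mem': "z + exp (q t + 2 * of_real pi * \<i>) \<in> \<Omega>" "z + exp (q t + 2 * of_real pi * \<i>) \<notin> interior \<Omega>" for t
    using mem[of t] by (simp_all add: exp_add)
  consider "Im (q t3) < Im (q t1) + pi" | "Im (q t1) + 2 * pi < Im (q t2) + pi"
    | "Im (q t2) + 2 * pi < Im (q t3) + pi"
    | "Im (q t2) - Im (q t1) \<le> pi" "Im (q t3) - Im (q t2) \<le> pi" "Im (q t1) + 2 * pi - Im (q t3) \<le> pi"
    by linarith
  then show ?thesis
  proof cases
    case 1
    show ?thesis
      unfolding eq by (rule core[OF mem(1) mem(1) mem(2) ord(1,2) 1])
  next
    case 2
    have "X (q t2) (q t3) + X (q t3) (q t1 + 2 * of_real pi * \<i>) + X (q t1 + 2 * of_real pi * \<i>) (q t2) \<ge> 0"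
      by (rule core[OF mem(1) mem'(1) mem(2)]) (use 2 ord in simp_all)
    then show ?thesis by (simp only: eq per add_ac)
  next
    case 3
    have "X (q t3) (q t1 + 2 * of_real pi * \<i>) + X (q t1 + 2 * of_real pi * \<i>) (q t2 + 2 * of_real pi * \<i>) + X (q t2 + 2 * of_real pi * \<i>) (q t3) \<ge> 0"
      by (rule core[OF mem(1) mem'(1) mem'(2)]) (use 3 ord in simp_all)
    then show ?thesis by (simp only: eq per add_ac)
  next
    case 4
    have "X (q t1) (q t2) \<ge> 0" "X (q t2) (q t3) \<ge> 0" "X (q t3) (q t1 + 2 * of_real pi * \<i>) \<ge> 0"
      unfolding X_def Im_exp_mult_cnj using 4 ord by (auto intro!: mult_nonneg_nonneg sin_ge_zero)
    then show ?thesis by (simp only: eq per add_nonneg_nonneg)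
  qed
qed

end

section \<open>Chord angles and one-sided tangent directions\<close>

context convex_curve begin

definition chord_domain :: "(real \<times> real) set"
  where "chord_domain = {(a, b). a < b \<and> b < a + L}"

text \<open>One logarithm for all chords, continuous in both end points together, so that directions
  of different chords can be compared as real numbers and not only modulo 2 pi. It exists because
  the strip \<open>chord_domain\<close> is convex.\<close>

definition chord_log :: "real \<times> real \<Rightarrow> complex"
  where "chord_log = (SOME l. continuous_on chord_domain l \<and>
     (\<forall>(a, b) \<in> chord_domain. \<gamma> b - \<gamma> a = exp (l (a, b))))"

definition chord_angle :: "real \<Rightarrow> real \<Rightarrow> real"
  where "chord_angle a b = Im (chord_log (a, b))"

lemma contractible_chord_domain: "contractible chord_domain"
proof -
  have "chord_domain = {p. inner (1, -1) p < 0} \<inter> {p. inner (-1, 1) p < L}"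
    by (auto simp: chord_domain_def inner_Pair)
  then have "convex chord_domain"
    by (simp only: convex_Int convex_halfspace_lt)
  then show ?thesis by (rule convex_imp_contractible)
qed

lemma chord_log_exists:
  "\<exists>l. continuous_on chord_domain l \<and> (\<forall>(a, b) \<in> chord_domain. \<gamma> b - \<gamma> a = exp (l (a, b)))"
proof -
  have "continuous_on chord_domain (\<lambda>p. \<gamma> (snd p) - \<gamma> (fst p))"
    by (intro continuous_intros continuous_on_compose2[OF continuous_\<gamma>[of UNIV]]) auto
  moreover have "\<gamma> (snd p) - \<gamma> (fst p) \<noteq> 0" if "p \<in> chord_domain" for p
    using that \<gamma>_neq[of "fst p" "snd p"] by (auto simp: chord_domain_def)
  ultimately obtain l where l: "continuous_on chord_domain l"
      "\<And>p. p \<in> chord_domain \<Longrightarrow> \<gamma> (snd p) - \<gamma> (fst p) = exp (l p)"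
    using continuous_logarithm_on_contractible[OF _ contractible_chord_domain, of "\<lambda>p. \<gamma> (snd p) - \<gamma> (fst p)"]
    by blast
  have "\<forall>(a, b) \<in> chord_domain. \<gamma> b - \<gamma> a = exp (l (a, b))"
  proof (rule ballI, clarify)
    fix a b assume "(a, b) \<in> chord_domain"
    from l(2)[OF this] show "\<gamma> b - \<gamma> a = exp (l (a, b))" by (simp only: fst_conv snd_conv)
  qed
  with l(1) show ?thesis by blast
qed

lemma continuous_chord_log: "continuous_on chord_domain chord_log"
  using someI_ex[OF chord_log_exists] unfolding chord_log_def by blast

lemma exp_chord_log:
  assumes "a < b" "b < a + L" shows "exp (chord_log (a, b)) = \<gamma> b - \<gamma> a"
proof -
  have "\<forall>(a, b) \<in> chord_domain. \<gamma> b - \<gamma> a = exp (chord_log (a, b))"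
    using someI_ex[OF chord_log_exists] unfolding chord_log_def by blast
  moreover have "(a, b) \<in> chord_domain" using assms by (simp add: chord_domain_def)
  ultimately have "case (a, b) of (a, b) \<Rightarrow> \<gamma> b - \<gamma> a = exp (chord_log (a, b))" by (rule bspec)
  then show ?thesis by (simp only: prod.case)
qed

lemma continuous_chord_log_right: "continuous_on {a<..<a+L} (\<lambda>t. chord_log (a, t))"
  by (rule continuous_on_compose2[OF continuous_chord_log])
    (auto intro!: continuous_intros simp: chord_domain_def)

lemma continuous_chord_log_left: "continuous_on {b-L<..<b} (\<lambda>t. chord_log (t, b))"
  by (rule continuous_on_compose2[OF continuous_chord_log])
    (auto intro!: continuous_intros simp: chord_domain_def)

lemma continuous_chord_angle_right: "continuous_on {a<..<a+L} (\<lambda>t. chord_angle a t)"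
  unfolding chord_angle_def by (intro continuous_intros continuous_chord_log_right)

lemma continuous_chord_angle_left: "continuous_on {b-L<..<b} (\<lambda>t. chord_angle t b)"
  unfolding chord_angle_def by (intro continuous_intros continuous_chord_log_left)

lemma chord_polar: "a < b \<Longrightarrow> b < a + L \<Longrightarrow> \<gamma> b - \<gamma> a = of_real (cmod (\<gamma> b - \<gamma> a)) * cis (chord_angle a b)"
  by (metis chord_angle_def exp_chord_log exp_eq_polar norm_exp_eq_Re)

lemma sin_chord_angle_diff:
  assumes "a < b" "b < a + L" "a' < b'" "b' < a' + L"
    and "Im ((\<gamma> b' - \<gamma> a') * cnj (\<gamma> b - \<gamma> a)) \<ge> 0"
  shows "sin (chord_angle a' b' - chord_angle a b) \<ge> 0"
proof -
  have "Im (exp (chord_log (a', b')) * cnj (exp (chord_log (a, b)))) \<ge> 0"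
    unfolding exp_chord_log[OF assms(1,2)] exp_chord_log[OF assms(3,4)] by (rule assms(5))
  then show ?thesis unfolding Im_exp_mult_cnj by (simp add: chord_angle_def zero_le_mult_iff)
qed

text \<open>Orientation of triangles says that a chord turns to the left, by at most half a turn,
  when its end point moves forward; continuity turns this statement about sines into one about real
  angles.\<close>

lemma chord_angle_mono_right:
  assumes "a < b" "b \<le> b'" "b' < a + L"
  shows "chord_angle a b \<le> chord_angle a b'" "chord_angle a b' \<le> chord_angle a b + pi"
proof -
  have c: "continuous_on {b..b'} (chord_angle a)"
    by (rule continuous_on_subset[OF continuous_chord_angle_right]) (use assms in auto)
  have s: "sin (chord_angle a t - chord_angle a b) \<ge> 0" if "b \<le> t" "t \<le> b'" for t
  proof (rule sin_chord_angle_diff)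
    show "Im ((\<gamma> t - \<gamma> a) * cnj (\<gamma> b - \<gamma> a)) \<ge> 0"
      using Im_triangle_nonneg[of a b t] that assms
      by (cases "b = t") (auto simp: complex_mult_cnj simp del: complex_cnj_diff)
  qed (use that assms in auto)
  show "chord_angle a b \<le> chord_angle a b'" "chord_angle a b' \<le> chord_angle a b + pi"
    using sin_nonneg_imp_angle_range[OF assms(2) c s] by auto
qed

lemma chord_angle_mono_left:
  assumes "a \<le> a'" "a' < b" "b < a + L"
  shows "chord_angle a b \<le> chord_angle a' b" "chord_angle a' b \<le> chord_angle a b + pi"
proof -
  have c: "continuous_on {a..a'} (\<lambda>t. chord_angle t b)"
    by (rule continuous_on_subset[OF continuous_chord_angle_left]) (use assms in auto)
  have s: "sin (chord_angle t b - chord_angle a b) \<ge> 0" if "a \<le> t" "t \<le> a'" for t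
  proof (rule sin_chord_angle_diff)
    have "Im ((\<gamma> b - \<gamma> t) * cnj (\<gamma> b - \<gamma> a)) = Im ((\<gamma> b - \<gamma> a) * cnj (\<gamma> t - \<gamma> a))"
      by (simp add: algebra_simps)
    then show "Im ((\<gamma> b - \<gamma> t) * cnj (\<gamma> b - \<gamma> a)) \<ge> 0"
      using Im_triangle_nonneg[of a t b] that assms by (cases "a = t") auto
  qed (use that assms in auto)
  show "chord_angle a b \<le> chord_angle a' b" "chord_angle a' b \<le> chord_angle a b + pi"
    using sin_nonneg_imp_angle_range[OF assms(1) c s] by auto
qed

text \<open>The second chord is the first one reversed, so the angles differ by an odd multiple of
  pi. Moving the chord from \<open>(a, b)\<close> through \<open>(a, c)\<close> and
  \<open>(b, c)\<close> to \<open>(b, a + L)\<close>, with \<open>c\<close> slightly beyond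
  \<open>b\<close>, raises the angle by less than 3 pi and never lowers it, which leaves only
  pi.\<close>

lemma chord_angle_reverse:
  assumes "a < b" "b < a + L" shows "chord_angle b (a + L) = chord_angle a b + pi"
proof -
  have "exp (chord_log (b, a + L)) = - exp (chord_log (a, b))"
    using assms by (simp add: exp_chord_log periodic_\<gamma>)
  also have "\<dots> = exp (chord_log (a, b) + \<i> * of_real pi)" by (simp add: exp_add)
  finally obtain n :: int where "chord_log (b, a + L) = chord_log (a, b) + \<i> * of_real pi + of_real (of_int (2 * n) * pi) * \<i>"
    unfolding exp_eq by blast
  then have n: "chord_angle b (a + L) = chord_angle a b + pi + 2 * of_int n * pi" by (simp add: chord_angle_def)
  have "isCont (chord_angle a) b"
    using continuous_chord_angle_right[of a] assms by (simp add: continuous_on_eq_continuous_at)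
  then have "(chord_angle a \<longlongrightarrow> chord_angle a b) (at_right b)"
    by (simp add: isCont_def filterlim_at_split)
  then have "\<forall>\<^sub>F c in at_right b. chord_angle a c < chord_angle a b + 1"
    by (rule order_tendstoD) simp
  moreover have "\<forall>\<^sub>F c in at_right b. c \<in> {b<..<a+L}" by (rule eventually_at_right_real) (use assms in auto)
  ultimately have "\<forall>\<^sub>F c in at_right b. chord_angle a c < chord_angle a b + 1 \<and> c \<in> {b<..<a+L}"
    by (rule eventually_conj)
  then obtain c where c: "chord_angle a c < chord_angle a b + 1" "b < c" "c < a + L"
    by (auto dest: eventually_happens)
  have 1: "chord_angle a b \<le> chord_angle a c" using assms c by (intro chord_angle_mono_right) auto
  have 2: "chord_angle a c \<le> chord_angle b c" "chord_angle b c \<le> chord_angle a c + pi"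
    using assms c by (auto intro: chord_angle_mono_left)
  have 3: "chord_angle b c \<le> chord_angle b (a + L)" "chord_angle b (a + L) \<le> chord_angle b c + pi"
    using assms c by (auto intro: chord_angle_mono_right)
  have eq: "(1 + 2 * of_int n) * pi = pi + 2 * of_int n * pi" by (simp add: distrib_right)
  have "0 \<le> (1 + 2 * of_int n) * pi" "(1 + 2 * of_int n) * pi < 3 * pi"
    unfolding eq using n 1 2 3 c pi_gt3 by linarith+
  then have "0 \<le> 1 + 2 * (of_int n :: real)" "1 + 2 * (of_int n :: real) < 3"
    using pi_gt_zero by (auto simp: zero_le_mult_iff)
  then have "n = 0" by linarith
  then show ?thesis using n by simp
qed

text \<open>By monotonicity these are limits of chord angles, that is, the one-sided tangent angles
  on a single branch along the whole line. In the form of infimum and supremum they compare directly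
  with every chord.\<close>

definition out_dir :: "real \<Rightarrow> real" where "out_dir t = Inf (chord_angle t ` {t<..<t+L})"
definition in_dir :: "real \<Rightarrow> real" where "in_dir t = Sup ((\<lambda>s. chord_angle s t) ` {t-L<..<t})"

text \<open>The chord over half a period serves as reference; the half-turn bounds limit how far the
  other angles can lie on the wrong side of it.\<close>

lemma chord_angle_bounds:
  "\<exists>m. \<forall>s\<in>{t<..<t+L}. m \<le> chord_angle t s" "\<exists>m. \<forall>s\<in>{t-L<..<t}. chord_angle s t \<le> m"
proof -
  have "chord_angle t (t + L / 2) - pi \<le> chord_angle t s" if s: "s \<in> {t<..<t+L}" for s
  proof (cases "s \<le> t + L / 2")
    case True
    then show ?thesis using chord_angle_mono_right(2)[of t s "t + L / 2"] s L_pos by auto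
  next
    case False
    then have "chord_angle t (t + L / 2) \<le> chord_angle t s"
      using s L_pos by (intro chord_angle_mono_right) auto
    then show ?thesis using pi_gt_zero by linarith
  qed
  then show "\<exists>m. \<forall>s\<in>{t<..<t+L}. m \<le> chord_angle t s" by blast
  have "chord_angle s t \<le> chord_angle (t - L / 2) t + pi" if s: "s \<in> {t-L<..<t}" for s
  proof (cases "s \<ge> t - L / 2")
    case True
    then show ?thesis using chord_angle_mono_left(2)[of "t - L / 2" s t] s L_pos by auto
  next
    case False
    then have "chord_angle s t \<le> chord_angle (t - L / 2) t"
      using s L_pos by (intro chord_angle_mono_left) auto
    then show ?thesis using pi_gt_zero by linarith
  qed
  then show "\<exists>m. \<forall>s\<in>{t-L<..<t}. chord_angle s t \<le> m" by blast
qed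

lemma out_dir_le: "t < s \<Longrightarrow> s < t + L \<Longrightarrow> out_dir t \<le> chord_angle t s"
  unfolding out_dir_def using chord_angle_bounds(1)[of t]
  by (intro cInf_lower) (auto simp: bdd_below_def)

lemma in_dir_ge: "s < t \<Longrightarrow> t < s + L \<Longrightarrow> chord_angle s t \<le> in_dir t"
  unfolding in_dir_def using chord_angle_bounds(2)[of t]
  by (intro cSup_upper) (auto simp: bdd_above_def)

lemma out_dir_approx: assumes "e > 0" shows "\<exists>s\<in>{t<..<t+L}. chord_angle t s < out_dir t + e"
  using cInf_lessD[of "chord_angle t ` {t<..<t+L}" "out_dir t + e"] assms L_pos
  by (auto simp flip: out_dir_def)

lemma in_dir_approx: assumes "e > 0" shows "\<exists>s\<in>{t-L<..<t}. chord_angle s t > in_dir t - e"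
  using less_cSupD[of "(\<lambda>s. chord_angle s t) ` {t-L<..<t}" "in_dir t - e"] assms L_pos
  by (auto simp flip: in_dir_def)

lemma out_dir_tendsto: "(chord_angle t \<longlongrightarrow> out_dir t) (at_right t)"
proof (rule tendstoI)
  fix e :: real assume "e > 0"
  then obtain s where s: "t < s" "s < t + L" "chord_angle t s < out_dir t + e"
    using out_dir_approx[of e t] by auto
  have "\<forall>\<^sub>F x in at_right t. x \<in> {t<..<s}" by (rule eventually_at_right_real[OF s(1)])
  then show "\<forall>\<^sub>F x in at_right t. dist (chord_angle t x) (out_dir t) < e"
  proof eventually_elim
    case (elim x)
    then show ?case
      using chord_angle_mono_right(1)[of t x s] out_dir_le[of t x] s by (auto simp: dist_real_def)
  qed
qed

lemma in_dir_tendsto: "((\<lambda>s. chord_angle s t) \<longlongrightarrow> in_dir t) (at_left t)"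
proof (rule tendstoI)
  fix e :: real assume "e > 0"
  then obtain s where s: "t - L < s" "s < t" "chord_angle s t > in_dir t - e"
    using in_dir_approx[of e t] by auto
  have "\<forall>\<^sub>F x in at_left t. x \<in> {s<..<t}" by (rule eventually_at_left_real[OF s(2)])
  then show "\<forall>\<^sub>F x in at_left t. dist (chord_angle x t) (in_dir t) < e"
  proof eventually_elim
    case (elim x)
    then show ?case
      using chord_angle_mono_left(1)[of s x t] in_dir_ge[of x t] s by (auto simp: dist_real_def)
  qed
qed

lemma in_dir_le_out_dir: "in_dir t \<le> out_dir t"
  unfolding in_dir_def
proof (rule cSup_least)
  fix x assume "x \<in> (\<lambda>s. chord_angle s t) ` {t-L<..<t}"
  then obtain a where a: "t - L < a" "a < t" "x = chord_angle a t" by auto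
  show "x \<le> out_dir t"
    unfolding out_dir_def
  proof (rule cInf_greatest)
    fix y assume "y \<in> chord_angle t ` {t<..<t+L}"
    then obtain b where b: "t < b" "b < t + L" "y = chord_angle t b" by auto
    \<comment> \<open>The chord from \<open>a\<close> to \<open>b\<close> itself may span a full
      period or more, outside the domain of the angle function.\<close>
    define c where "c = min b ((t + a + L) / 2)"
    have c: "t < c" "c \<le> b" "c < a + L" using a b by (auto simp: c_def min_def)
    have "chord_angle a t \<le> chord_angle a c" using a c by (intro chord_angle_mono_right) auto
    also have "\<dots> \<le> chord_angle t c" using a c by (intro chord_angle_mono_left) auto
    also have "\<dots> \<le> chord_angle t b" using b c by (intro chord_angle_mono_right) auto
    finally show "x \<le> y" using a b by simp
  qed (use L_pos in auto)
qed (use L_pos in auto)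

text \<open>Within one period both sides are compared with the chord from \<open>s\<close> to
  \<open>t\<close>; longer distances are covered in steps of half a period.\<close>

lemma out_dir_le_in_dir: assumes "s < t" shows "out_dir s \<le> in_dir t"
proof -
  have near: "out_dir s \<le> in_dir t" if "s < t" "t < s + L" for s t
    using out_dir_le[of s t] in_dir_ge[of s t] that by simp
  have "out_dir s \<le> out_dir (s + real n * (L / 2))" for s n
  proof (induction n)
    case (Suc n)
    have "out_dir (s + real n * (L / 2)) \<le> in_dir (s + real n * (L / 2) + L / 2)"
      by (rule near) (use L_pos in auto)
    also have "\<dots> \<le> out_dir (s + real n * (L / 2) + L / 2)" by (rule in_dir_le_out_dir)
    also have "s + real n * (L / 2) + L / 2 = s + real (Suc n) * (L / 2)" by (simp add: field_simps)
    finally show ?case using Suc by simp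
  qed simp
  define n where "n = nat \<lfloor>(t - s) / (L / 2)\<rfloor>"
  define r where "r = s + real n * (L / 2)"
  have n: "real n \<le> (t - s) / (L / 2)" "(t - s) / (L / 2) < real n + 1"
    using assms L_pos unfolding n_def by (auto simp: le_nat_iff)
  then have r: "r \<le> t" "t < r + L / 2"
    using L_pos by (auto simp: r_def field_simps)
  show ?thesis
  proof (cases "r = t")
    case False
    have "out_dir s \<le> out_dir r" unfolding r_def by fact
    also have "\<dots> \<le> in_dir t" using near[of r t] r False L_pos by auto
    finally show ?thesis .
  next
    case True
    then have "n \<noteq> 0" using assms unfolding r_def by (intro notI) simp
    then obtain m where m: "n = Suc m" by (cases n) auto
    have "out_dir s \<le> out_dir (s + real m * (L / 2))" by fact
    also have "\<dots> \<le> in_dir t"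
      by (rule near) (use True L_pos in \<open>auto simp: r_def m algebra_simps\<close>)
    finally show ?thesis .
  qed
qed

lemma mono_out_dir: "mono out_dir"
proof (rule monoI)
  fix s t :: real assume "s \<le> t"
  then show "out_dir s \<le> out_dir t"
    using out_dir_le_in_dir[of s t] in_dir_le_out_dir[of t] by (cases "s = t") auto
qed

text \<open>Here the unit speed enters. In the direction \<open>\<alpha>\<close> every chord
  advances by at least \<open>cos e\<close> times its length; summed over inscribed polygons, the
  advance is at least \<open>cos e\<close> times the arclength \<open>y - x\<close>. A number of
  modulus at most 1 with real part at least \<open>cos e\<close> is within
  \<open>sqrt (2 - 2 * cos e)\<close> of 1.\<close>

lemma chord_approx:
  assumes "x < y" "0 \<le> e" "e < pi / 2"
    and ang: "\<And>a b. x \<le> a \<Longrightarrow> a < b \<Longrightarrow> b \<le> y \<Longrightarrow> b < a + L \<and> \<bar>chord_angle a b - \<alpha>\<bar> \<le> e"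
  shows "cmod ((\<gamma> y - \<gamma> x) /\<^sub>R (y - x) - cis \<alpha>) \<le> sqrt (2 - 2 * cos e)"
proof -
  have ce: "cos e > 0" using assms by (intro cos_gt_zero_pi) auto
  define p where "p w = Re (cis (-\<alpha>) * w)" for w
  have p_diff: "p (u - w) = p u - p w" for u w by (simp add: p_def algebra_simps)
  have chord: "cmod (\<gamma> b - \<gamma> a) * cos e \<le> p (\<gamma> b) - p (\<gamma> a)" if ab: "x \<le> a" "a \<le> b" "b \<le> y" for a b
  proof (cases "a = b")
    case False
    then have ab': "a < b" "b < a + L" "\<bar>chord_angle a b - \<alpha>\<bar> \<le> e" using ang[of a b] ab by auto
    have "p (\<gamma> b - \<gamma> a) = cmod (\<gamma> b - \<gamma> a) * cos (chord_angle a b - \<alpha>)"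
      unfolding p_def by (subst chord_polar[OF ab'(1,2)]) (simp add: cos_diff algebra_simps)
    moreover have "cos e \<le> cos (chord_angle a b - \<alpha>)"
      using cos_monotone_0_pi_le[of "\<bar>chord_angle a b - \<alpha>\<bar>" e] ab' assms by (simp add: cos_abs_real)
    ultimately show ?thesis by (simp add: mult_left_mono flip: p_diff)
  qed simp
  have "ennreal ((y - x) * cos e) \<le> ennreal (p (\<gamma> y) - p (\<gamma> x))"
  proof -
    have "curve_length \<gamma> x y \<le> ennreal ((p (\<gamma> y) - p (\<gamma> x)) / cos e)"
      unfolding curve_length_def
    proof (rule SUP_least, clarify)
      fix n and t :: "nat \<Rightarrow> real"
      assume t: "x = t 0" "y = t n" "mono_on {..n} t"
      have mono: "t i \<le> t j" if "i \<le> j" "j \<le> n" for i j using t(3) that by (auto simp: mono_on_def)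
      have "(\<Sum>i<n. ennreal (dist (\<gamma> (t i)) (\<gamma> (t (Suc i))))) =
          ennreal (\<Sum>i<n. dist (\<gamma> (t i)) (\<gamma> (t (Suc i))))" by (simp add: sum_ennreal)
      also have "\<dots> \<le> ennreal (\<Sum>i<n. (p (\<gamma> (t (Suc i))) - p (\<gamma> (t i))) / cos e)"
      proof (intro ennreal_leI sum_mono)
        fix i assume "i \<in> {..<n}"
        then have "cmod (\<gamma> (t (Suc i)) - \<gamma> (t i)) * cos e \<le> p (\<gamma> (t (Suc i))) - p (\<gamma> (t i))"
          unfolding t(1,2) by (intro chord) (auto intro: mono simp: t(1,2))
        then show "dist (\<gamma> (t i)) (\<gamma> (t (Suc i))) \<le> (p (\<gamma> (t (Suc i))) - p (\<gamma> (t i))) / cos e"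
          using ce by (simp add: dist_norm norm_minus_commute pos_le_divide_eq)
      qed
      also have "(\<Sum>i<n. (p (\<gamma> (t (Suc i))) - p (\<gamma> (t i))) / cos e) = (p (\<gamma> y) - p (\<gamma> x)) / cos e"
        unfolding t by (simp add: sum_lessThan_telescope[of "\<lambda>i. p (\<gamma> (t i))"] flip: sum_divide_distrib)
      finally show "(\<Sum>i<n. ennreal (dist (\<gamma> (t i)) (\<gamma> (t (Suc i))))) \<le> ennreal ((p (\<gamma> (t n)) - p (\<gamma> (t 0))) / cos e)"
        unfolding t .
    qed
    then have "ennreal (y - x) \<le> ennreal ((p (\<gamma> y) - p (\<gamma> x)) / cos e)" using length_\<gamma>[of x y] assms by simp
    moreover have "0 \<le> p (\<gamma> y) - p (\<gamma> x)"
      using chord[of x y] assms ce mult_nonneg_nonneg[OF norm_ge_zero[of "\<gamma> y - \<gamma> x"], of "cos e"] by linarith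
    ultimately have "y - x \<le> (p (\<gamma> y) - p (\<gamma> x)) / cos e" using ce by (subst (asm) ennreal_le_iff) auto
    then show ?thesis using ce by (simp add: pos_le_divide_eq ennreal_leI)
  qed
  then have len: "(y - x) * cos e \<le> p (\<gamma> y) - p (\<gamma> x)"
    using chord[of x y] assms ce mult_nonneg_nonneg[OF norm_ge_zero[of "\<gamma> y - \<gamma> x"], of "cos e"]
    by (subst (asm) ennreal_le_iff) linarith+
  define w where "w = (\<gamma> y - \<gamma> x) /\<^sub>R (y - x) * cis (-\<alpha>)"
  have w1: "cmod w \<le> 1"
    using dist_\<gamma>_le[of x y] assms by (simp add: w_def norm_mult divide_simps)
  have "w = inverse (y - x) *\<^sub>R (cis (-\<alpha>) * (\<gamma> y - \<gamma> x))" by (simp only: w_def mult_scaleR_left mult_scaleR_right mult.commute)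
  then have "Re w = inverse (y - x) * p (\<gamma> y - \<gamma> x)" by (simp only: p_def scaleR_complex.sel)
  then have "Re w = p (\<gamma> y - \<gamma> x) / (y - x)" by (simp only: divide_inverse mult.commute)
  then have w2: "Re w \<ge> cos e"
    using len assms by (simp add: p_diff pos_le_divide_eq mult.commute)
  have "(cmod (w - 1))\<^sup>2 = (cmod w)\<^sup>2 - 2 * Re w + 1"
    unfolding cmod_power2 by (simp add: power2_eq_square algebra_simps)
  also have "\<dots> \<le> 2 - 2 * cos e" using w1 w2 power_mono[OF w1, of 2] by simp
  finally have "cmod (w - 1) \<le> sqrt (2 - 2 * cos e)" using real_le_rsqrt by blast
  moreover have "w - 1 = ((\<gamma> y - \<gamma> x) /\<^sub>R (y - x) - cis \<alpha>) * cis (-\<alpha>)"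
    by (simp add: w_def left_diff_distrib cis_mult)
  ultimately show ?thesis by (simp add: norm_mult)
qed

lemma angle_error_small:
  assumes "\<epsilon> > 0" obtains e where "0 < e" "e < pi / 2" "sqrt (2 - 2 * cos e) < (\<epsilon>::real)"
proof -
  have "((\<lambda>e. sqrt (2 - 2 * cos e)) \<longlongrightarrow> sqrt (2 - 2 * cos 0)) (at_right (0::real))"
    by (intro tendsto_intros)
  then have "\<forall>\<^sub>F e in at_right 0. sqrt (2 - 2 * cos e) < \<epsilon>"
    using assms by (intro order_tendstoD(2)) auto
  moreover have "\<forall>\<^sub>F e in at_right (0::real). e \<in> {0<..<pi/2}" by (rule eventually_at_right_real) simp
  ultimately have "\<forall>\<^sub>F e in at_right (0::real). sqrt (2 - 2 * cos e) < \<epsilon> \<and> e \<in> {0<..<pi/2}"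
    by (rule eventually_conj)
  then obtain e where "sqrt (2 - 2 * cos e) < \<epsilon> \<and> e \<in> {0<..<pi/2}"
    by (auto dest: eventually_happens)
  then show ?thesis using that by auto
qed

text \<open>By monotonicity all chords inside a short arc after \<open>t\<close> have angles between
  \<open>out_dir t\<close> and one chord angle close to it, so that \<open>chord_approx\<close>
  applies to the whole arc.\<close>

lemma right_derivative_\<gamma>: "(\<gamma> has_vector_derivative cis (out_dir t)) (at_right t)"
  unfolding has_vector_derivative_iff_slope
proof (rule tendstoI)
  fix \<epsilon> :: real assume "\<epsilon> > 0"
  then obtain e where e: "0 < e" "e < pi / 2" "sqrt (2 - 2 * cos e) < \<epsilon>" by (rule angle_error_small)
  obtain s1 where s1: "t < s1" "s1 < t + L" "chord_angle t s1 < out_dir t + e"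
    using out_dir_approx[OF e(1), of t] by auto
  have "isCont (\<lambda>s. chord_angle s s1) t"
    using continuous_chord_angle_left[of s1] s1 by (simp add: continuous_on_eq_continuous_at)
  then have "((\<lambda>s. chord_angle s s1) \<longlongrightarrow> chord_angle t s1) (at_right t)"
    by (simp add: isCont_def filterlim_at_split)
  then have "\<forall>\<^sub>F s in at_right t. chord_angle s s1 < out_dir t + e"
    using s1 by (intro order_tendstoD(2)) auto
  moreover have "\<forall>\<^sub>F s in at_right t. s \<in> {t<..<s1}" by (rule eventually_at_right_real[OF s1(1)])
  ultimately show "\<forall>\<^sub>F s in at_right t. dist ((\<gamma> s - \<gamma> t) /\<^sub>R (s - t)) (cis (out_dir t)) < \<epsilon>"
  proof eventually_elim
    case (elim s)
    have "cmod ((\<gamma> s - \<gamma> t) /\<^sub>R (s - t) - cis (out_dir t)) \<le> sqrt (2 - 2 * cos e)"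
    proof (rule chord_approx)
      fix a b assume ab: "t \<le> a" "a < b" "b \<le> s"
      have "out_dir t \<le> chord_angle t b" using ab elim s1 by (intro out_dir_le) auto
      also have "\<dots> \<le> chord_angle a b" using ab elim s1 by (intro chord_angle_mono_left) auto
      finally have 1: "out_dir t \<le> chord_angle a b" .
      have "chord_angle a b \<le> chord_angle a s1" using ab elim s1 by (intro chord_angle_mono_right) auto
      also have "\<dots> \<le> chord_angle s s1" using ab elim s1 by (intro chord_angle_mono_left) auto
      finally show "b < a + L \<and> \<bar>chord_angle a b - out_dir t\<bar> \<le> e" using 1 ab elim s1 by auto
    qed (use elim e in auto)
    then show ?case using e by (simp add: dist_norm)
  qed
qed

lemma left_derivative_\<gamma>: "(\<gamma> has_vector_derivative cis (in_dir t)) (at_left t)"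
  unfolding has_vector_derivative_iff_slope
proof (rule tendstoI)
  fix \<epsilon> :: real assume "\<epsilon> > 0"
  then obtain e where e: "0 < e" "e < pi / 2" "sqrt (2 - 2 * cos e) < \<epsilon>" by (rule angle_error_small)
  obtain s1 where s1: "t - L < s1" "s1 < t" "chord_angle s1 t > in_dir t - e"
    using in_dir_approx[OF e(1), of t] by auto
  have "isCont (\<lambda>s. chord_angle s1 s) t"
    using continuous_chord_angle_right[of s1] s1 by (simp add: continuous_on_eq_continuous_at)
  then have "((\<lambda>s. chord_angle s1 s) \<longlongrightarrow> chord_angle s1 t) (at_left t)"
    by (simp add: isCont_def filterlim_at_split)
  then have "\<forall>\<^sub>F s in at_left t. chord_angle s1 s > in_dir t - e"
    using s1 by (intro order_tendstoD(1)) auto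
  moreover have "\<forall>\<^sub>F s in at_left t. s \<in> {s1<..<t}" by (rule eventually_at_left_real[OF s1(2)])
  ultimately show "\<forall>\<^sub>F s in at_left t. dist ((\<gamma> s - \<gamma> t) /\<^sub>R (s - t)) (cis (in_dir t)) < \<epsilon>"
  proof eventually_elim
    case (elim s)
    have "cmod ((\<gamma> t - \<gamma> s) /\<^sub>R (t - s) - cis (in_dir t)) \<le> sqrt (2 - 2 * cos e)"
    proof (rule chord_approx)
      fix a b assume ab: "s \<le> a" "a < b" "b \<le> t"
      have "chord_angle a b \<le> chord_angle a t" using ab elim s1 by (intro chord_angle_mono_right) auto
      also have "\<dots> \<le> in_dir t" using ab elim s1 by (intro in_dir_ge) auto
      finally have 1: "chord_angle a b \<le> in_dir t" .
      have "chord_angle s1 s \<le> chord_angle s1 b" using ab elim s1 by (intro chord_angle_mono_right) auto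
      also have "\<dots> \<le> chord_angle a b" using ab elim s1 by (intro chord_angle_mono_left) auto
      finally show "b < a + L \<and> \<bar>chord_angle a b - in_dir t\<bar> \<le> e" using 1 ab elim s1 by auto
    qed (use elim e in auto)
    moreover have "(\<gamma> t - \<gamma> s) /\<^sub>R (t - s) = (\<gamma> s - \<gamma> t) /\<^sub>R (s - t)"
      using scaleR_minus_left[of "inverse (s - t)" "\<gamma> t - \<gamma> s"] elim
      by (metis inverse_minus_eq minus_diff_eq scaleR_minus_left scaleR_minus_right)
    ultimately show ?case using e by (simp add: dist_norm)
  qed
qed

end

section \<open>The double layer kernel\<close>

context convex_curve begin

text \<open>A compact convex set is the convex hull of its frontier (Krein-Milman), so a supporting
  half-plane has to be checked only on the curve.\<close>

lemma frontier_subset_imp_subset: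
  assumes "convex H" "\<And>t. \<gamma> t \<in> H" shows "\<Omega> \<subseteq> H"
proof -
  have "\<Omega> = convex hull (frontier \<Omega>)" by (rule Krein_Milman_frontier[OF convex_\<Omega> compact_\<Omega>])
  also have "\<dots> \<subseteq> H" by (rule hull_minimal) (use assms in \<open>auto simp flip: range_\<gamma>\<close>)
  finally show ?thesis .
qed

lemma chord_angle_wrap: "t < s \<Longrightarrow> s < t + L \<Longrightarrow> chord_angle t s = chord_angle (s - L) t + pi"
  using chord_angle_reverse[of "s - L" t] by simp

text \<open>Reversed, the chord from \<open>t\<close> to \<open>s\<close> is a chord that arrives at
  \<open>t\<close> from the parameter \<open>s - L\<close>.\<close>

lemma chord_angle_le_in_dir: "t < s \<Longrightarrow> s < t + L \<Longrightarrow> chord_angle t s \<le> in_dir t + pi"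
  using in_dir_ge[of "s - L" t] chord_angle_wrap[of t s] by simp

text \<open>Otherwise all chords from \<open>\<gamma> t\<close> would have the same angle, squeezed
  between \<open>out_dir t\<close> and \<open>in_dir t + pi\<close>, and the body would lie on a
  line, against its non-empty interior.\<close>

lemma out_dir_less: "out_dir t < in_dir t + pi"
proof (rule ccontr)
  assume neg: "\<not> out_dir t < in_dir t + pi"
  define p where "p w = Im (cis (- out_dir t) * (w - \<gamma> t))" for w
  have "p (\<gamma> s) = 0" if s: "t < s" "s < t + L" for s
  proof -
    have "chord_angle t s = out_dir t" using out_dir_le[OF s] chord_angle_le_in_dir[OF s] neg by simp
    then have "\<gamma> s - \<gamma> t = of_real (cmod (\<gamma> s - \<gamma> t)) * cis (out_dir t)" using chord_polar[OF s] by simp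
    then have "p (\<gamma> s) = Im (cis (- out_dir t) * (of_real (cmod (\<gamma> s - \<gamma> t)) * cis (out_dir t)))"
      unfolding p_def by (rule arg_cong)
    then show ?thesis by simp
  qed
  moreover have "\<exists>s. t \<le> s \<and> s < t + L \<and> \<gamma> s = \<gamma> u" for u
  proof (intro exI conjI)
    define k where "k = \<lfloor>(u - t) / L\<rfloor>"
    show "t \<le> u + of_int (- k) * L" "u + of_int (- k) * L < t + L"
      using floor_divide_lower[OF L_pos, of "u - t"] floor_divide_upper[OF L_pos, of "u - t"]
      by (auto simp: k_def algebra_simps)
  qed (rule periodic_\<gamma>_int)
  moreover have "p (\<gamma> t) = 0" by (simp add: p_def)
  ultimately have "p (\<gamma> u) = 0" for u using order_le_less by metis
  moreover have "convex {w. p w = 0}"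
    unfolding convex_def
  proof clarify
    fix x y and u v :: real assume *: "p x = 0" "p y = 0" "u + v = 1"
    have "p (u *\<^sub>R x + v *\<^sub>R y) = Im (cis (- out_dir t) * (u *\<^sub>R (x - \<gamma> t) + v *\<^sub>R (y - \<gamma> t) + (u + v - 1) *\<^sub>R \<gamma> t))"
      unfolding p_def by (rule arg_cong) (simp add: algebra_simps)
    also have "\<dots> = u * p x + v * p y" using *(3) by (simp add: p_def algebra_simps)
    finally show "p (u *\<^sub>R x + v *\<^sub>R y) = 0" using * by simp
  qed
  ultimately have sub: "\<Omega> \<subseteq> {w. p w = 0}" by (intro frontier_subset_imp_subset) auto
  obtain z where "z \<in> interior \<Omega>" using interior_\<Omega> by auto
  then obtain e where e: "e > 0" "ball z e \<subseteq> \<Omega>" by (meson mem_interior)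
  \<comment> \<open>A second point of the ball, displaced from \<open>z\<close> perpendicularly to
    that line.\<close>
  define y where "y = z + of_real (e / 2) * (\<i> * cis (out_dir t))"
  have "z \<in> ball z e" "y \<in> ball z e" using e by (auto simp: y_def dist_norm norm_mult)
  then have "p z = 0" "p y = 0" using e(2) sub by blast+
  moreover have "p y = p z + Im (cis (- out_dir t) * (of_real (e / 2) * (\<i> * cis (out_dir t))))"
    by (simp add: p_def y_def algebra_simps)
  moreover have "cis (- out_dir t) * (of_real (e / 2) * (\<i> * cis (out_dir t))) = of_real (e / 2) * \<i>"
  proof -
    have "cis (- out_dir t) * (of_real (e / 2) * (\<i> * cis (out_dir t))) = of_real (e / 2) * \<i> * (cis (- out_dir t) * cis (out_dir t))"
      by (simp only: mult_ac)
    then show ?thesis by (simp add: cis_mult)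
  qed
  ultimately have "0 = 0 + Im (of_real (e / 2) * \<i>)" by (simp only:)
  then show False using e by simp
qed

section \<open>Calculus along the curve with right derivatives\<close>

definition vel :: "real \<Rightarrow> complex" where "vel t = cis (out_dir t)"

lemma norm_vel [simp]: "cmod (vel t) = 1" by (simp add: vel_def)

lemma right_derivative_vel: "(\<gamma> has_vector_derivative vel t) (at_right t)"
  unfolding vel_def by (rule right_derivative_\<gamma>)

text \<open>All chords that start at \<open>\<gamma> t\<close> have angles between
  \<open>out_dir t\<close> and \<open>out_dir t + pi\<close>, to the left of the tangent; the hull
  argument passes from the curve to the body.\<close>

lemma Im_vel_cnj_nonneg: assumes "z \<in> \<Omega>" shows "Im (vel t * cnj (\<gamma> t - z)) \<ge> 0"
proof -
  have "Im (vel t * cnj (\<gamma> t - \<gamma> u)) \<ge> 0" for u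
  proof -
    define k where "k = \<lfloor>(u - t) / L\<rfloor>"
    define s where "s = u + of_int (- k) * L"
    have s: "t \<le> s" "s < t + L" "\<gamma> s = \<gamma> u"
      using floor_divide_lower[OF L_pos, of "u - t"] floor_divide_upper[OF L_pos, of "u - t"] periodic_\<gamma>_int[of u "-k"]
      by (auto simp: k_def s_def algebra_simps)
    show ?thesis
    proof (cases "s = t")
      case False
      then have st: "t < s" "s < t + L" using s by auto
      define r where "r = cmod (\<gamma> s - \<gamma> t)"
      have "\<gamma> s - \<gamma> t = of_real r * cis (chord_angle t s)" unfolding r_def by (rule chord_polar[OF st])
      then have "\<gamma> t - \<gamma> u = - (of_real r * cis (chord_angle t s))"
        using minus_diff_eq[of "\<gamma> u" "\<gamma> t"] s(3) by simp
      then have "Im (vel t * cnj (\<gamma> t - \<gamma> u)) = r * sin (chord_angle t s - out_dir t)"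
        by (simp only: vel_def sin_diff) (simp add: algebra_simps)
      moreover have "sin (chord_angle t s - out_dir t) \<ge> 0"
        using out_dir_le[OF st] chord_angle_le_in_dir[OF st] in_dir_le_out_dir[of t]
        by (intro sin_ge_zero) auto
      ultimately show ?thesis by (simp add: r_def)
    qed (use s in simp)
  qed
  moreover have "convex {z. Im (vel t * cnj (\<gamma> t - z)) \<ge> 0}"
  proof -
    have "{z. Im (vel t * cnj (\<gamma> t - z)) \<ge> 0} = {z. inner (Complex (- Im (vel t)) (Re (vel t))) z \<ge> inner (Complex (- Im (vel t)) (Re (vel t))) (\<gamma> t)}"
      by (auto simp: inner_complex_def algebra_simps)
    then show ?thesis by (simp only: convex_halfspace_ge)
  qed
  ultimately have "\<Omega> \<subseteq> {z. Im (vel t * cnj (\<gamma> t - z)) \<ge> 0}" by (intro frontier_subset_imp_subset) auto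
  then show ?thesis using assms by auto
qed

lemma borel_measurable_\<gamma> [measurable]: "\<gamma> \<in> borel_measurable borel"
  by (rule borel_measurable_continuous_onI) (rule continuous_\<gamma>)

lemma borel_measurable_vel [measurable]: "vel \<in> borel_measurable borel"
proof -
  have [measurable]: "out_dir \<in> borel_measurable borel" by (rule borel_measurable_mono[OF mono_out_dir])
  have "cis \<in> borel_measurable borel" by (rule borel_measurable_continuous_onI) (intro continuous_intros)
  then show ?thesis unfolding vel_def[abs_def] by measurable
qed

abbreviation par :: "real measure" where "par \<equiv> restrict_space lborel {0..<L}"

lemma finite_measure_par: "finite_measure par"
  using L_pos by (intro finite_measureI) (simp add: emeasure_restrict_space)

lemma measure_par: "measure par (space par) = L"
  using L_pos by (simp add: measure_restrict_space)

lemma measurable_par: "f \<in> borel_measurable borel \<Longrightarrow> f \<in> borel_measurable par"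
  by (simp add: measurable_restrict_space1)

lemma integrable_par_bounded:
  fixes f :: "real \<Rightarrow> 'b::{banach, second_countable_topology}"
  assumes "f \<in> borel_measurable par" "\<And>t. 0 \<le> t \<Longrightarrow> t < L \<Longrightarrow> norm (f t) \<le> B"
  shows "integrable par f"
  by (rule finite_measure.integrable_const_bound[OF finite_measure_par, of _ B])
    (use assms in \<open>auto intro!: AE_I2\<close>)

lemma norm_integral_par_le:
  fixes f :: "real \<Rightarrow> 'b::{banach, second_countable_topology}"
  assumes "f \<in> borel_measurable par" "\<And>t. 0 \<le> t \<Longrightarrow> t < L \<Longrightarrow> norm (f t) \<le> B"
  shows "norm (LINT t|par. f t) \<le> B * L"
proof -
  have "norm (LINT t|par. f t) \<le> (LINT t|par. norm (f t))" by (rule integral_norm_bound)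
  also have "\<dots> \<le> (LINT t|par. B)"
    using assms L_pos by (intro integral_mono integrable_par_bounded[where B = B] finite_measure.integrable_const[OF finite_measure_par]) auto
  also have "\<dots> = B * L" using measure_par by simp
  finally show ?thesis .
qed

lemma integral_par_FTC:
  assumes "continuous_on {0..L} F"
    and "\<And>t. 0 \<le> t \<Longrightarrow> t < L \<Longrightarrow> (F has_vector_derivative f t) (at_right t)"
    and "\<And>t. 0 \<le> t \<Longrightarrow> t < L \<Longrightarrow> cmod (f t) \<le> B" "f \<in> borel_measurable par"
  shows "(LINT t|par. f t) = F L - F 0"
proof -
  have "(LINT t|par. f t) = (LINT t:{0..<L}|lborel. f t)"
    unfolding set_lebesgue_integral_def by (rule integral_restrict_space) simp
  also have "\<dots> = F L - F 0"
    using L_pos assms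
    by (intro set_integral_right_derivative[where C = B]) (auto simp: set_borel_measurable_def borel_measurable_restrict_space_iff)
  finally show ?thesis .
qed

lemma integral_par_deriv:
  assumes h: "h \<in> borel_measurable borel" "\<And>t. cmod (h (\<gamma> t)) \<le> B"
    and H: "\<And>t. (H has_field_derivative h (\<gamma> t)) (at (\<gamma> t))"
  shows "(LINT t|par. h (\<gamma> t) * vel t) = 0"
proof -
  have "(LINT t|par. h (\<gamma> t) * vel t) = H (\<gamma> L) - H (\<gamma> 0)"
  proof (rule integral_par_FTC[where F = "\<lambda>t. H (\<gamma> t)" and B = B])
    have "isCont H (\<gamma> t)" for t using H[of t] by (rule DERIV_isCont)
    then show "continuous_on {0..L} (\<lambda>t. H (\<gamma> t))"
      by (intro continuous_on_compose2[OF _ continuous_\<gamma>, of "range \<gamma>"] continuous_at_imp_continuous_on) auto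
    show "((\<lambda>t. H (\<gamma> t)) has_vector_derivative h (\<gamma> t) * vel t) (at_right t)" for t
      using field_vector_diff_chain_within[OF right_derivative_vel, of H "h (\<gamma> t)"] H[of t]
      by (auto simp: o_def mult.commute intro: has_field_derivative_at_within)
    show "(\<lambda>t. h (\<gamma> t) * vel t) \<in> borel_measurable par"
      by (intro measurable_par borel_measurable_times borel_measurable_vel measurable_compose[OF borel_measurable_\<gamma> h(1)])
  qed (use h in \<open>auto simp: norm_mult\<close>)
  then show ?thesis using periodic_\<gamma>[of 0] by simp
qed

lemma dist_frontier_bound:
  assumes "z \<in> interior \<Omega>" obtains d where "d > 0" "\<And>t. cmod (\<gamma> t - z) \<ge> d"
proof -
  obtain d where d: "d > 0" "ball z d \<subseteq> interior \<Omega>" using assms open_contains_ball[of "interior \<Omega>"] by auto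
  have "cmod (\<gamma> t - z) \<ge> d" for t
    using d(2) \<gamma>_not_interior[of t] by (force simp: dist_norm norm_minus_commute subset_iff not_less)
  then show ?thesis using that d by blast
qed

text \<open>The logarithm along the curve is a primitive of the kernel in the sense of right
  derivatives, and it gains one full turn over a period.\<close>

lemma integral_cauchy_kernel:
  assumes z: "z \<in> interior \<Omega>" shows "(LINT t|par. vel t / (\<gamma> t - z)) = 2 * of_real pi * \<i>"
proof -
  obtain q where qc: "continuous_on UNIV q" and q: "\<And>t. \<gamma> t = z + exp (q t)"
    and qL: "\<And>t. q (t + L) = q t + 2 * of_real pi * \<i>"
    using log_around_interior_point[OF z] by blast
  obtain d where d: "d > 0" "\<And>t. cmod (\<gamma> t - z) \<ge> d" using dist_frontier_bound[OF z] by blast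
  have "(LINT t|par. vel t / (\<gamma> t - z)) = q L - q 0"
  proof (rule integral_par_FTC[where B = "1 / d"])
    fix t
    have "(\<lambda>t. exp (q t)) = (\<lambda>t. \<gamma> t - z)" by (simp add: q)
    then have "((\<lambda>t. exp (q t)) has_vector_derivative vel t) (at_right t)"
      using has_vector_derivative_diff[OF right_derivative_vel has_vector_derivative_const[of z], of t] by simp
    moreover have "(q \<longlongrightarrow> q t) (at_right t)"
      using qc by (metis continuous_on_def UNIV_I tendsto_within_subset subset_UNIV)
    ultimately show "(q has_vector_derivative vel t / (\<gamma> t - z)) (at_right t)"
      using has_vector_derivative_log_right[of q t "vel t"] by (simp add: q)
    show "cmod (vel t / (\<gamma> t - z)) \<le> 1 / d"
      using d(1) d(2)[of t] by (simp add: norm_divide frac_le)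
  qed (auto intro!: measurable_par continuous_on_subset[OF qc])
  then show ?thesis using qL[of 0] by simp
qed

text \<open>The rate at which the direction from \<open>z\<close> to the moving boundary point
  turns. Divided by pi this is the density of the Neumann-Poincare measure, but it makes sense for
  interior \<open>z\<close> as well.\<close>

definition dl_kernel :: "complex \<Rightarrow> real \<Rightarrow> real" where "dl_kernel z t = Im (vel t / (\<gamma> t - z))"

lemma borel_measurable_dl_kernel [measurable]: "dl_kernel z \<in> borel_measurable borel"
  unfolding dl_kernel_def[abs_def] by measurable

lemma dl_kernel_nonneg: assumes "z \<in> \<Omega>" shows "dl_kernel z t \<ge> 0"
proof -
  have "vel t / (\<gamma> t - z) = vel t * cnj (\<gamma> t - z) / of_real ((cmod (\<gamma> t - z))\<^sup>2)"
    by (metis complex_div_cnj of_real_power)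
  then show ?thesis using Im_vel_cnj_nonneg[OF assms, of t] unfolding dl_kernel_def by (simp add: Im_divide_of_real)
qed

lemma integral_dl_kernel_interior:
  assumes z: "z \<in> interior \<Omega>"
  shows "integrable par (dl_kernel z)" "(LINT t|par. dl_kernel z t) = 2 * pi"
proof -
  obtain d where d: "d > 0" "\<And>t. cmod (\<gamma> t - z) \<ge> d" using dist_frontier_bound[OF z] by blast
  have i: "integrable par (\<lambda>t. vel t / (\<gamma> t - z))"
    using d by (intro integrable_par_bounded[where B = "1 / d"] measurable_par)
      (simp_all add: norm_divide frac_le)
  show "integrable par (dl_kernel z)" unfolding dl_kernel_def[abs_def] using i by (rule integrable_Im)
  show "(LINT t|par. dl_kernel z t) = 2 * pi"
    unfolding dl_kernel_def using integral_Im[OF i] integral_cauchy_kernel[OF z] by simp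
qed

text \<open>Away from the boundary point \<open>\<gamma> t0\<close> the function
  \<open>chord_log\<close> is a primitive of the complex kernel. The nonnegative integral allows
  these arcs to be exhausted later without knowing integrability in advance.\<close>

lemma set_integral_dl_kernel:
  assumes ab: "t0 < a" "a \<le> b" "b < t0 + L"
  shows "(\<integral>\<^sup>+t. ennreal (dl_kernel (\<gamma> t0) t) * indicator {a..<b} t \<partial>lborel) = ennreal (chord_angle t0 b - chord_angle t0 a)"
proof -
  have "continuous_on {a..b} (\<lambda>t. inverse (cmod (\<gamma> t - \<gamma> t0)))"
  proof (intro continuous_intros continuous_\<gamma> ballI)
    fix t assume "t \<in> {a..b}"
    then show "cmod (\<gamma> t - \<gamma> t0) \<noteq> 0" using \<gamma>_neq[of t0 t] ab by simp
  qed
  then have "bounded ((\<lambda>t. inverse (cmod (\<gamma> t - \<gamma> t0))) ` {a..b})"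
    by (intro compact_imp_bounded compact_continuous_image) auto
  then obtain B where B: "\<And>t. a \<le> t \<Longrightarrow> t \<le> b \<Longrightarrow> inverse (cmod (\<gamma> t - \<gamma> t0)) \<le> B"
    unfolding bounded_iff by (metis (no_types, lifting) abs_ge_self atLeastAtMost_iff imageI order_trans real_norm_def)
  have bound: "cmod (vel t / (\<gamma> t - \<gamma> t0)) \<le> B" if "a \<le> t" "t < b" for t
    using B[of t] that by (simp add: norm_divide) (simp add: divide_inverse)
  have "(LINT t:{a..<b}|lborel. vel t / (\<gamma> t - \<gamma> t0)) = chord_log (t0, b) - chord_log (t0, a)"
  proof (rule set_integral_right_derivative[where C = B])
    show "continuous_on {a..b} (\<lambda>t. chord_log (t0, t))"
      by (rule continuous_on_subset[OF continuous_chord_log_right]) (use ab in auto)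
    fix t assume t: "a \<le> t" "t < b"
    have eq: "exp (chord_log (t0, s)) = \<gamma> s - \<gamma> t0" if "s \<in> {t0<..<t0+L}" for s
      using that by (intro exp_chord_log) auto
    have "isCont (\<lambda>s. chord_log (t0, s)) t"
      using continuous_chord_log_right[of t0] t ab by (simp add: continuous_on_eq_continuous_at)
    then have lim: "((\<lambda>s. chord_log (t0, s)) \<longlongrightarrow> chord_log (t0, t)) (at_right t)"
      by (simp add: isCont_def filterlim_at_split)
    have "((\<lambda>s. \<gamma> s - \<gamma> t0) has_vector_derivative vel t) (at_right t)"
      using has_vector_derivative_diff[OF right_derivative_vel has_vector_derivative_const[of "\<gamma> t0"], of t] by simp
    then have "((\<lambda>s. exp (chord_log (t0, s))) has_vector_derivative vel t) (at_right t)"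
      unfolding has_vector_derivative_iff_slope
    proof (rule Lim_transform_eventually)
      have "\<forall>\<^sub>F s in at_right t. s \<in> {t<..<t0+L}" by (rule eventually_at_right_real) (use t ab in auto)
      then show "\<forall>\<^sub>F s in at_right t. (\<gamma> s - \<gamma> t0 - (\<gamma> t - \<gamma> t0)) /\<^sub>R (s - t) =
          (exp (chord_log (t0, s)) - exp (chord_log (t0, t))) /\<^sub>R (s - t)"
        by eventually_elim (use t ab eq in auto)
    qed
    from has_vector_derivative_log_right[OF lim this]
    show "((\<lambda>s. chord_log (t0, s)) has_vector_derivative vel t / (\<gamma> t - \<gamma> t0)) (at_right t)"
      using eq[of t] t ab by simp
    show "cmod (vel t / (\<gamma> t - \<gamma> t0)) \<le> B" using bound t by simp
  qed (use ab in \<open>auto simp: set_borel_measurable_def\<close>)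
  moreover have i: "set_integrable lborel {a..<b} (\<lambda>t. vel t / (\<gamma> t - \<gamma> t0))"
    unfolding set_integrable_def
  proof (rule Bochner_Integration.integrable_bound[where f = "\<lambda>t. B * indicator {a..<b} t"])
    show "integrable lborel (\<lambda>t. B * indicator {a..<b} t)"
      using ab by (intro integrable_mult_right integrable_real_indicator) auto
    show "AE x in lborel. cmod (indicator {a..<b} x *\<^sub>R (vel x / (\<gamma> x - \<gamma> t0))) \<le> norm (B * indicator {a..<b} x)"
      using bound by (intro AE_I2) (auto simp: indicator_def intro: order_trans[OF _ abs_ge_self])
  qed simp
  ultimately have I: "(LINT t|lborel. Im (indicator {a..<b} t *\<^sub>R (vel t / (\<gamma> t - \<gamma> t0)))) = chord_angle t0 b - chord_angle t0 a"
    using integral_Im[of lborel "\<lambda>t. indicator {a..<b} t *\<^sub>R (vel t / (\<gamma> t - \<gamma> t0))"]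
    by (simp add: set_integrable_def set_lebesgue_integral_def chord_angle_def)
  have J: "integrable lborel (\<lambda>t. Im (indicator {a..<b} t *\<^sub>R (vel t / (\<gamma> t - \<gamma> t0))))"
    using i unfolding set_integrable_def by (rule integrable_Im)
  have eq: "Im (indicator {a..<b} t *\<^sub>R (vel t / (\<gamma> t - \<gamma> t0))) = dl_kernel (\<gamma> t0) t * indicator {a..<b} t" for t
    unfolding dl_kernel_def by (simp only: scaleR_complex.sel mult.commute)
  have "(\<integral>\<^sup>+t. ennreal (dl_kernel (\<gamma> t0) t) * indicator {a..<b} t \<partial>lborel) =
      (\<integral>\<^sup>+t. ennreal (dl_kernel (\<gamma> t0) t * indicator {a..<b} t) \<partial>lborel)"
    by (rule nn_integral_cong) (auto simp: indicator_def)
  also have "\<dots> = ennreal (chord_angle t0 b - chord_angle t0 a)"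
    using I J unfolding eq by (subst nn_integral_eq_integral) (auto simp: dl_kernel_nonneg[OF \<gamma>_mem])
  finally show ?thesis .
qed

end

section \<open>Angles modulo 2 pi, and measures with an additional atom\<close>

lemma cis_eq_imp_eq: assumes "cis a = cis b" "\<bar>a - b\<bar> < 2 * pi" shows "a = b"
proof -
  have "exp (\<i> * of_real a) = exp (\<i> * of_real b)" using assms by (simp add: cis_conv_exp)
  then obtain n :: int where "\<i> * of_real a = \<i> * of_real b + (of_int (2 * n) * pi) * \<i>"
    unfolding exp_eq by blast
  then have "Im (\<i> * of_real a) = Im (\<i> * of_real b + (of_int (2 * n) * pi) * \<i>)" by (rule arg_cong)
  then have n: "a - b = 2 * pi * of_int n" by simp
  with assms(2) have "2 * pi * \<bar>of_int n\<bar> < 2 * pi * 1" by (simp add: abs_mult)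
  then have "\<bar>of_int n :: real\<bar> < 1" by (subst (asm) mult_less_cancel_left_pos) auto
  then have "n = 0" by linarith
  then show ?thesis using n by simp
qed

text \<open>The Neumann-Poincare measure is given by a set function, an atom plus a density, so its
  integral has to be built up from indicators.\<close>

lemma nn_integral_add_point:
  assumes sets: "sets N = sets D" and x: "x \<in> space D"
    and N: "\<And>A. A \<in> sets D \<Longrightarrow> emeasure N A = c * indicator A x + emeasure D A"
    and "g \<in> borel_measurable D"
  shows "(\<integral>\<^sup>+y. g y \<partial>N) = c * g x + (\<integral>\<^sup>+y. g y \<partial>D)"
  using assms(4)
proof (induction rule: borel_measurable_induct)
  case (cong f g)
  have "integral\<^sup>N N f = integral\<^sup>N N g" "integral\<^sup>N D f = integral\<^sup>N D g"
    by (rule nn_integral_cong; use cong sets_eq_imp_space_eq[OF sets] in auto)+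
  then show ?case using cong x by simp
next
  case (set A)
  then show ?case by (simp add: N sets)
next
  case (mult u v)
  then have "u \<in> borel_measurable N" by (simp add: measurable_cong_sets[OF sets refl])
  with mult show ?case by (simp add: nn_integral_cmult distrib_left mult.left_commute)
next
  case (add u v)
  then have "u \<in> borel_measurable N" "v \<in> borel_measurable N" by (simp_all add: measurable_cong_sets[OF sets refl])
  with add show ?case by (simp add: nn_integral_add distrib_left add_ac)
next
  case (seq U)
  then have [measurable]: "U i \<in> borel_measurable N" for i by (simp add: measurable_cong_sets[OF sets refl])
  have inc: "incseq (\<lambda>i. c * U i x)" "incseq (\<lambda>i. \<integral>\<^sup>+y. U i y \<partial>D)"
    using seq by (auto simp: incseq_def le_fun_def intro!: mult_left_mono nn_integral_mono)
  have "(\<integral>\<^sup>+y. (SUP i. U i) y \<partial>N) = (SUP i. \<integral>\<^sup>+y. U i y \<partial>N)"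
    unfolding SUP_apply by (rule nn_integral_monotone_convergence_SUP) (use seq in auto)
  also have "\<dots> = (SUP i. c * U i x + (\<integral>\<^sup>+y. U i y \<partial>D))"
    by (rule SUP_cong[OF refl]) (rule seq)
  also have "\<dots> = (SUP i. c * U i x) + (SUP i. \<integral>\<^sup>+y. U i y \<partial>D)"
    by (rule ennreal_SUP_add[OF inc])
  also have "(SUP i. \<integral>\<^sup>+y. U i y \<partial>D) = (\<integral>\<^sup>+y. (SUP i. U i) y \<partial>D)"
    unfolding SUP_apply by (rule nn_integral_monotone_convergence_SUP[symmetric]) (use seq in auto)
  also have "(SUP i. c * U i x) = c * (SUP i. U i) x"
    unfolding SUP_apply by (rule SUP_mult_left_ennreal[symmetric])
  finally show ?case .
qed

lemma integral_add_point:
  fixes f :: "'a \<Rightarrow> complex"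
  assumes sets: "sets N = sets D" and x: "x \<in> space D" and c: "c \<ge> 0"
    and N: "\<And>A. A \<in> sets D \<Longrightarrow> emeasure N A = ennreal c * indicator A x + emeasure D A"
    and f: "integrable D f"
  shows "(LINT y|N. f y) = of_real c * f x + (LINT y|D. f y)" "integrable N f"
proof -
  have real: "integrable N h \<and> (LINT y|N. h y) = c * h x + (LINT y|D. h y)"
    if h: "integrable D h" for h :: "'a \<Rightarrow> real"
  proof -
    have m: "h \<in> borel_measurable D" "h \<in> borel_measurable N"
      using h by (auto simp: measurable_cong_sets[OF sets refl])
    have eq: "(\<integral>\<^sup>+y. ennreal (u y) \<partial>N) = ennreal c * ennreal (u x) + (\<integral>\<^sup>+y. ennreal (u y) \<partial>D)"
      if "u \<in> borel_measurable D" for u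
      by (rule nn_integral_add_point[OF sets x N]) (use that in auto)
    have fin: "(\<integral>\<^sup>+y. ennreal (h y) \<partial>D) < \<infinity>" "(\<integral>\<^sup>+y. ennreal (- h y) \<partial>D) < \<infinity>"
      using h by (auto simp: real_integrable_def less_top)
    have iN: "integrable N h" unfolding real_integrable_def
      using m fin eq[OF m(1)] eq[OF borel_measurable_uminus[OF m(1)]] by (simp add: ennreal_mult_eq_top_iff less_top[symmetric])
    have e: "enn2real (ennreal c * ennreal u + v) = c * max 0 u + enn2real v" if "v < \<infinity>" for u v
      using that c by (subst enn2real_plus) (auto simp: ennreal_mult_less_top enn2real_mult enn2real_ennreal max_def ennreal_neg)
    have "c * max 0 (h x) - c * max 0 (- h x) = c * h x" by (simp add: max_def)
    then have "(LINT y|N. h y) = c * h x + (LINT y|D. h y)"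
      unfolding real_lebesgue_integral_def[OF h] real_lebesgue_integral_def[OF iN]
        eq[OF m(1)] eq[OF borel_measurable_uminus[OF m(1)]] e[OF fin(1)] e[OF fin(2)] by linarith
    with iN show ?thesis ..
  qed
  have r: "integrable D (\<lambda>y. Re (f y))" "integrable D (\<lambda>y. Im (f y))" using f by (auto intro: integrable_Re integrable_Im)
  show i: "integrable N f"
  proof -
    have "integrable N (\<lambda>y. of_real (Re (f y)) + \<i> * of_real (Im (f y)))"
      using real[OF r(1)] real[OF r(2)] by (intro Bochner_Integration.integrable_add integrable_mult_right integrable_of_real) auto
    then show ?thesis by (simp flip: complex_eq)
  qed
  show "(LINT y|N. f y) = of_real c * f x + (LINT y|D. f y)"
    using real[OF r(1)] real[OF r(2)] integral_Re[OF f] integral_Im[OF f] integral_Re[OF i] integral_Im[OF i]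
    by (simp add: complex_eq_iff)
qed

section \<open>Total mass of the kernel seen from a boundary point\<close>

context convex_curve begin

lemma shift_\<gamma>: assumes "\<gamma> s = \<gamma> t" shows "\<gamma> (s + x) = \<gamma> (t + x)"
proof -
  obtain k :: int where "s = t + of_int k * L" using \<gamma>_eq_imp[OF assms] by auto
  then have "\<gamma> (s + x) = \<gamma> ((t + x) + of_int k * L)" by (simp add: algebra_simps)
  then show ?thesis by (simp add: periodic_\<gamma>_int)
qed

text \<open>The direction functions gain 2 pi in each period, so at parameters of the same point
  only their unit vectors and their difference agree. The differences agree modulo 2 pi, and both
  lie between 0 and pi.\<close>

lemma dirs_eq:
  assumes "\<gamma> s = \<gamma> t"
  shows "cis (out_dir s) = cis (out_dir t)" "cis (in_dir s) = cis (in_dir t)"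
    "out_dir s - in_dir s = out_dir t - in_dir t"
proof -
  have eq: "(\<lambda>x. \<gamma> (x + (s - t))) = \<gamma>"
  proof
    fix x
    have "x + (s - t) = s + (x - t)" "t + (x - t) = x" by simp_all
    then show "\<gamma> (x + (s - t)) = \<gamma> x" using shift_\<gamma>[OF assms, of "x - t"] by (simp only:)
  qed
  have d: "(\<gamma> has_vector_derivative d) (at t within S)" if "(\<gamma> has_vector_derivative d) (at s within (+) (s - t) ` S)" for S d
  proof -
    have "((\<gamma> \<circ> (\<lambda>x. x + (s - t))) has_vector_derivative 1 *\<^sub>R d) (at t within S)"
      by (rule vector_diff_chain_within) (use that in \<open>auto intro!: derivative_eq_intros simp: add.commute\<close>)
    then show ?thesis using eq by (simp add: o_def)
  qed
  have img: "(+) (s - t) ` {t<..} = {s<..}" "(+) (s - t) ` {..<t} = {..<s}"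
  proof -
    have "x \<in> (+) (s - t) ` {t<..}" if "s < x" for x
      using that by (intro image_eqI[of _ _ "x - s + t"]) auto
    then show "(+) (s - t) ` {t<..} = {s<..}" by auto
    have "x \<in> (+) (s - t) ` {..<t}" if "x < s" for x
      using that by (intro image_eqI[of _ _ "x - s + t"]) auto
    then show "(+) (s - t) ` {..<t} = {..<s}" by auto
  qed
  have "(\<gamma> has_vector_derivative cis (out_dir s)) (at_right t)"
    by (rule d) (simp only: img right_derivative_\<gamma>)
  then show o: "cis (out_dir s) = cis (out_dir t)"
    using right_derivative_\<gamma>[of t] by (metis vector_derivative_within trivial_limit_at_right_real)
  have "(\<gamma> has_vector_derivative cis (in_dir s)) (at_left t)"
    by (rule d) (simp only: img left_derivative_\<gamma>)
  then show i: "cis (in_dir s) = cis (in_dir t)"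
    using left_derivative_\<gamma>[of t] by (metis vector_derivative_within trivial_limit_at_left_real)
  have "cis (out_dir s - in_dir s) = cis (out_dir t - in_dir t)"
    using o i by (simp flip: cis_divide)
  then show "out_dir s - in_dir s = out_dir t - in_dir t"
  proof (rule cis_eq_imp_eq)
    show "\<bar>out_dir s - in_dir s - (out_dir t - in_dir t)\<bar> < 2 * pi"
      using in_dir_le_out_dir[of s] in_dir_le_out_dir[of t] out_dir_less[of s] out_dir_less[of t] pi_gt_zero
      by linarith
  qed
qed

lemma vel_eq: "\<gamma> s = \<gamma> t \<Longrightarrow> vel s = vel t" unfolding vel_def by (rule dirs_eq(1))

lemma dl_kernel_periodic: "dl_kernel z (L + t) = dl_kernel z t"
  using vel_eq[of "L + t" t] periodic_\<gamma>[of t] by (simp add: dl_kernel_def add.commute)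

text \<open>A corner is a jump of the monotone function \<open>out_dir\<close>, because its values
  before \<open>t\<close> stay below \<open>in_dir t\<close>.\<close>

lemma countable_corner_times: "countable {t. in_dir t < out_dir t}"
proof (rule countable_subset[OF _ mono_ctble_discont[OF mono_out_dir]], clarify)
  fix t assume t: "in_dir t < out_dir t" "isCont out_dir t"
  then have "(out_dir \<longlongrightarrow> out_dir t) (at_left t)" by (simp add: isCont_def filterlim_at_split)
  then have "\<forall>\<^sub>F s in at_left t. in_dir t < out_dir s" using t(1) by (rule order_tendstoD)
  moreover have "\<forall>\<^sub>F s in at_left t. out_dir s \<le> in_dir t"
    by (auto simp: eventually_at_filter intro!: always_eventually out_dir_le_in_dir)
  ultimately have "\<forall>\<^sub>F s in at_left t. False" by eventually_elim auto
  then show False by simp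
qed

lemma nn_integral_periodic:
  assumes [measurable]: "f \<in> borel_measurable borel" and per: "\<And>t. f (L + t) = (f t :: ennreal)"
    and s: "0 \<le> s" "s < L"
  shows "(\<integral>\<^sup>+t. f t * indicator {s..<s+L} t \<partial>lborel) = (\<integral>\<^sup>+t. f t \<partial>par)"
proof -
  have "(\<integral>\<^sup>+t. f t * indicator {s..<s+L} t \<partial>lborel) =
      (\<integral>\<^sup>+t. f t * indicator {s..<L} t + f t * indicator {L..<s+L} t \<partial>lborel)"
    by (rule nn_integral_cong) (use s in \<open>auto simp: indicator_def\<close>)
  also have "\<dots> = (\<integral>\<^sup>+t. f t * indicator {s..<L} t \<partial>lborel) + (\<integral>\<^sup>+t. f t * indicator {L..<s+L} t \<partial>lborel)"
    by (rule nn_integral_add) auto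
  also have "(\<integral>\<^sup>+t. f t * indicator {L..<s+L} t \<partial>lborel) = (\<integral>\<^sup>+t. f (L + 1 * t) * indicator {L..<s+L} (L + 1 * t) \<partial>lborel)"
    by (subst nn_integral_real_affine[of _ 1 L]) auto
  also have "\<dots> = (\<integral>\<^sup>+t. f t * indicator {0..<s} t \<partial>lborel)"
    by (rule nn_integral_cong) (auto simp: indicator_def per)
  also have "(\<integral>\<^sup>+t. f t * indicator {s..<L} t \<partial>lborel) + (\<integral>\<^sup>+t. f t * indicator {0..<s} t \<partial>lborel) =
      (\<integral>\<^sup>+t. f t * indicator {s..<L} t + f t * indicator {0..<s} t \<partial>lborel)"
    by (rule nn_integral_add[symmetric]) auto
  also have "\<dots> = (\<integral>\<^sup>+t. f t * indicator {0..<L} t \<partial>lborel)"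
    by (rule nn_integral_cong) (use s in \<open>auto simp: indicator_def\<close>)
  finally show ?thesis by (simp add: nn_integral_restrict_space)
qed

lemma time_representative: "\<exists>s. 0 \<le> s \<and> s < L \<and> \<gamma> s = \<gamma> t"
proof (intro exI conjI)
  show "0 \<le> t + of_int (- \<lfloor>t / L\<rfloor>) * L" "t + of_int (- \<lfloor>t / L\<rfloor>) * L < L"
    using floor_divide_lower[OF L_pos, of t] floor_divide_upper[OF L_pos, of t] by (auto simp: algebra_simps)
qed (rule periodic_\<gamma>_int)

text \<open>Seen from \<open>\<gamma> t0\<close> the curve turns from the outgoing tangent to the
  reversed incoming one, so the mass is the interior angle. At a corner it falls short of pi by the
  exterior angle, and the atom makes up for this.\<close>

lemma nn_integral_dl_kernel_boundary:
  "(\<integral>\<^sup>+t. ennreal (dl_kernel (\<gamma> t0) t) \<partial>par) = ennreal (pi - (out_dir t0 - in_dir t0))"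
proof -
  obtain s where s: "0 \<le> s" "s < L" "\<gamma> s = \<gamma> t0" using time_representative by blast
  define D where "D = density lborel (\<lambda>t. ennreal (dl_kernel (\<gamma> s) t))"
  define A where "A n = {s + L / (n + 3) ..< s + L - L / (n + 3)}" for n :: nat
  have [simp]: "sets D = sets lborel" by (simp add: D_def)
  have emD: "emeasure D B = (\<integral>\<^sup>+t. ennreal (dl_kernel (\<gamma> s) t) * indicator B t \<partial>lborel)" if "B \<in> sets borel" for B
    using that unfolding D_def by (subst emeasure_density) auto
  have small: "0 < L / (real n + 3)" "L / (real n + 3) \<le> L / 3" "2 * L / (real n + 3) \<le> L" for n
  proof -
    show "2 * L / (real n + 3) \<le> L" using L_pos by (simp add: pos_divide_le_eq algebra_simps add_pos_nonneg)
    show "0 < L / (real n + 3)" using L_pos by simp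
    show "L / (real n + 3) \<le> L / 3" by (rule divide_left_mono) (use L_pos in auto)
  qed
  have A: "emeasure D (A n) = ennreal (chord_angle s (s + L - L / (n + 3)) - chord_angle s (s + L / (n + 3)))" for n
    unfolding A_def using small[of n] by (subst emD, simp, subst set_integral_dl_kernel) auto
  have z: "(\<lambda>n. L / (real n + 3)) \<longlonglongrightarrow> 0" by real_asymp
  have f1: "filterlim (\<lambda>n. s + L / (real n + 3)) (at_right s) sequentially"
    unfolding filterlim_at using tendsto_add[OF tendsto_const[of s] z] small(1) by auto
  have f2: "filterlim (\<lambda>n. s - L / (real n + 3)) (at_left s) sequentially"
    unfolding filterlim_at using tendsto_diff[OF tendsto_const[of s] z] small(1) by auto
  have "(\<lambda>n. chord_angle (s - L / (real n + 3)) s + pi - chord_angle s (s + L / (real n + 3))) \<longlonglongrightarrow> in_dir s + pi - out_dir s"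
    by (intro tendsto_intros filterlim_compose[OF out_dir_tendsto f1] filterlim_compose[OF in_dir_tendsto f2])
  moreover have "chord_angle s (s + L - L / (real n + 3)) = chord_angle (s - L / (real n + 3)) s + pi" for n
    using chord_angle_wrap[of s "s + L - L / (real n + 3)"] small[of n] L_pos by (simp add: algebra_simps)
  ultimately have "(\<lambda>n. emeasure D (A n)) \<longlonglongrightarrow> ennreal (in_dir s + pi - out_dir s)"
    unfolding A by (intro tendsto_ennrealI) simp
  moreover have "(\<lambda>n. emeasure D (A n)) \<longlonglongrightarrow> emeasure D (\<Union>n. A n)"
  proof (rule Lim_emeasure_incseq)
    show "incseq A"
      unfolding incseq_def
    proof (intro allI impI)
      fix n m :: nat assume "n \<le> m"
      then have "L / (real m + 3) \<le> L / (real n + 3)" using L_pos by (intro divide_left_mono) auto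
      then show "A n \<subseteq> A m" unfolding A_def by (intro ivl_subset[THEN iffD2] disjI2 conjI) auto
    qed
  qed (auto simp: A_def)
  moreover have "(\<Union>n. A n) = {s<..<s+L}"
  proof (intro equalityI subsetI)
    fix t assume t: "t \<in> {s<..<s+L}"
    have "\<forall>\<^sub>F n in sequentially. L / (real n + 3) < min (t - s) (s + L - t)"
      using t by (intro order_tendstoD(2)[OF z]) auto
    then obtain n where "L / (real n + 3) < min (t - s) (s + L - t)"
      by (auto dest: eventually_happens)
    then show "t \<in> (\<Union>n. A n)" by (auto simp: A_def intro!: exI[of _ n])
  next
    fix t assume "t \<in> (\<Union>n. A n)"
    then obtain n where "t \<in> A n" by auto
    then show "t \<in> {s<..<s+L}" using small[of n] by (auto simp: A_def)
  qed
  ultimately have "emeasure D {s<..<s+L} = ennreal (in_dir s + pi - out_dir s)"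
    using LIMSEQ_unique by metis
  moreover have "emeasure D {s<..<s+L} = emeasure D {s..<s+L}"
    unfolding emD[of "{s<..<s+L}", simplified] emD[of "{s..<s+L}", simplified]
    by (rule nn_integral_cong_AE)
      (use AE_lborel_singleton[of s] in \<open>eventually_elim, auto simp: indicator_def\<close>)
  moreover have "emeasure D {s..<s+L} = (\<integral>\<^sup>+t. ennreal (dl_kernel (\<gamma> s) t) \<partial>par)"
    by (subst emD) (use s in \<open>auto intro!: nn_integral_periodic simp: dl_kernel_periodic\<close>)
  moreover have "in_dir s + pi - out_dir s = pi - (out_dir t0 - in_dir t0)" using dirs_eq(3)[OF s(3)] by simp
  ultimately show ?thesis using s(3) by simp
qed

lemma integral_dl_kernel_boundary:
  "integrable par (dl_kernel (\<gamma> t0))" "(LINT t|par. dl_kernel (\<gamma> t0) t) = pi - (out_dir t0 - in_dir t0)"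
proof -
  have m: "dl_kernel (\<gamma> t0) \<in> borel_measurable par" by (intro measurable_par borel_measurable_dl_kernel)
  have nn: "AE t in par. 0 \<le> dl_kernel (\<gamma> t0) t" by (intro AE_I2 dl_kernel_nonneg \<gamma>_mem)
  show i: "integrable par (dl_kernel (\<gamma> t0))"
    by (rule integrableI_nonneg[OF m nn]) (simp add: nn_integral_dl_kernel_boundary)
  show "(LINT t|par. dl_kernel (\<gamma> t0) t) = pi - (out_dir t0 - in_dir t0)"
    using integral_eq_nn_integral[OF m nn] nn_integral_dl_kernel_boundary[of t0] out_dir_less[of t0] by simp
qed

end

section \<open>The Neumann--Poincare operator on the boundary curve\<close>

locale boundary_param = convex_curve \<Omega> "perimeter \<Omega>" "boundary_curve \<Omega>" for \<Omega> :: "complex set"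
begin

abbreviation "L \<equiv> perimeter \<Omega>"
abbreviation "\<gamma> \<equiv> boundary_curve \<Omega>"

lemma frontier_time: "\<zeta> \<in> frontier \<Omega> \<Longrightarrow> \<exists>t. \<gamma> t = \<zeta>"
  unfolding range_\<gamma>[symmetric] by blast

lemma curve_boundary_time: "\<zeta> \<in> frontier \<Omega> \<Longrightarrow> \<gamma> (boundary_time \<Omega> \<zeta>) = \<zeta>"
  unfolding boundary_time_def by (rule someI_ex) (rule frontier_time)

lemma in_tangent_eq: "in_tangent \<Omega> \<zeta> = cis (in_dir (boundary_time \<Omega> \<zeta>))"
  unfolding in_tangent_def by (rule vector_derivative_within) (auto intro: left_derivative_\<gamma>)

lemma out_tangent_eq: "out_tangent \<Omega> \<zeta> = cis (out_dir (boundary_time \<Omega> \<zeta>))"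
  unfolding out_tangent_def by (rule vector_derivative_within) (auto intro: right_derivative_\<gamma>)

lemma cis_in_angle: "cis (in_angle \<Omega> \<zeta>) = cis (in_dir (boundary_time \<Omega> \<zeta>))"
proof -
  have "cis (in_angle \<Omega> \<zeta>) = sgn (cis (in_dir (boundary_time \<Omega> \<zeta>)))"
    unfolding in_angle_def in_tangent_eq by (rule cis_Arg) (rule cis_neq_zero)
  then show ?thesis by (simp add: sgn_eq)
qed

text \<open>\<open>in_angle\<close> comes from \<open>Arg\<close> and may lie on another branch than
  \<open>in_dir\<close>; the gap between the incoming and outgoing angles is the same on both.
  Uniqueness holds because two candidates differ by less than a full turn.\<close>

lemma out_angle_eq:
  "out_angle \<Omega> \<zeta> = in_angle \<Omega> \<zeta> + (out_dir (boundary_time \<Omega> \<zeta>) - in_dir (boundary_time \<Omega> \<zeta>))"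
proof -
  define t where "t = boundary_time \<Omega> \<zeta>"
  have c: "cis (in_angle \<Omega> \<zeta> + (out_dir t - in_dir t)) = cis (out_dir t)"
  proof -
    have "cis (in_angle \<Omega> \<zeta> + (out_dir t - in_dir t)) = cis (in_dir t) * cis (out_dir t - in_dir t)"
      unfolding t_def cis_in_angle[symmetric] by (simp add: cis_mult)
    then show ?thesis by (simp add: cis_mult)
  qed
  show ?thesis
    unfolding out_angle_def out_tangent_eq t_def[symmetric]
  proof (rule the_equality)
    show "in_angle \<Omega> \<zeta> \<le> in_angle \<Omega> \<zeta> + (out_dir t - in_dir t) \<and>
        in_angle \<Omega> \<zeta> + (out_dir t - in_dir t) < in_angle \<Omega> \<zeta> + pi \<and>
        cis (in_angle \<Omega> \<zeta> + (out_dir t - in_dir t)) = cis (out_dir t)"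
      using c in_dir_le_out_dir[of t] out_dir_less[of t] by simp
    fix \<beta> assume b: "in_angle \<Omega> \<zeta> \<le> \<beta> \<and> \<beta> < in_angle \<Omega> \<zeta> + pi \<and> cis \<beta> = cis (out_dir t)"
    show "\<beta> = in_angle \<Omega> \<zeta> + (out_dir t - in_dir t)"
    proof (rule cis_eq_imp_eq)
      show "cis \<beta> = cis (in_angle \<Omega> \<zeta> + (out_dir t - in_dir t))" using b c by simp
      show "\<bar>\<beta> - (in_angle \<Omega> \<zeta> + (out_dir t - in_dir t))\<bar> < 2 * pi"
        using b in_dir_le_out_dir[of t] out_dir_less[of t] by linarith
    qed
  qed
qed

lemma dir_gap_boundary_time:
  "out_dir (boundary_time \<Omega> (\<gamma> t)) - in_dir (boundary_time \<Omega> (\<gamma> t)) = out_dir t - in_dir t"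
  by (rule dirs_eq(3)) (rule curve_boundary_time[OF \<gamma>_frontier])

lemma is_corner_iff: "is_corner \<Omega> (\<gamma> t) \<longleftrightarrow> in_dir t < out_dir t"
  using dir_gap_boundary_time[of t] by (simp add: is_corner_def out_angle_eq)

lemma interior_angle_eq: "interior_angle \<Omega> (\<gamma> t) = pi - (out_dir t - in_dir t)"
  using dir_gap_boundary_time[of t] by (simp add: interior_angle_def out_angle_eq)

lemma outward_normal_eq: "outward_normal \<Omega> (\<gamma> t) = - \<i> * vel t"
proof -
  define b where "b = boundary_time \<Omega> (\<gamma> t)"
  have "cis (out_angle \<Omega> (\<gamma> t)) = cis (in_angle \<Omega> (\<gamma> t)) * cis (out_dir b - in_dir b)"
    by (simp add: out_angle_eq b_def cis_mult)
  also have "\<dots> = vel b" by (simp add: cis_in_angle b_def cis_mult vel_def)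
  also have "\<dots> = vel t" unfolding b_def by (rule vel_eq) (rule curve_boundary_time[OF \<gamma>_frontier])
  finally have "cis (out_angle \<Omega> (\<gamma> t)) = vel t" .
  moreover have "cis (out_angle \<Omega> (\<gamma> t) - pi / 2) = cis (out_angle \<Omega> (\<gamma> t)) * cis (- (pi / 2))"
    by (simp only: cis_mult add_uminus_conv_diff)
  moreover have "cis (- (pi / 2)) = - \<i>" by (simp add: complex_eq_iff)
  ultimately show ?thesis by (simp add: outward_normal_def)
qed

lemma np_density_eq:
  "np_density \<Omega> \<zeta> (\<gamma> t) = (if in_dir t < out_dir t then 0 else dl_kernel \<zeta> t / pi)"
proof -
  have "Re (outward_normal \<Omega> (\<gamma> t) / (\<gamma> t - \<zeta>)) = Im (vel t / (\<gamma> t - \<zeta>))"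
  proof -
    have "outward_normal \<Omega> (\<gamma> t) / (\<gamma> t - \<zeta>) = - \<i> * (vel t / (\<gamma> t - \<zeta>))"
      by (simp add: outward_normal_eq)
    moreover have "Re (- \<i> * w) = Im w" for w by simp
    ultimately show ?thesis by (simp only:)
  qed
  then show ?thesis by (auto simp: np_density_def is_corner_iff dl_kernel_def)
qed

section \<open>The Neumann-Poincare measure in terms of the parameter\<close>

lemma measurable_curve: "\<gamma> \<in> measurable par (boundary_borel \<Omega>)"
  by (intro measurable_restrict_space2 measurable_par borel_measurable_\<gamma>) (use \<gamma>_frontier in auto)

text \<open>The density is a function of the point, while all that is known about it is expressed by
  the parameter. The inverse of the curve transfers measurability: below \<open>L\<close> its
  sublevel sets are images of compact intervals, hence closed.\<close>

lemma borel_measurable_np_density: "np_density \<Omega> \<zeta> \<in> borel_measurable (boundary_borel \<Omega>)"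
proof -
  define \<tau> where "\<tau> = the_inv_into {0..<L} \<gamma>"
  have surj: "\<exists>s. 0 \<le> s \<and> s < L \<and> \<gamma> s = \<sigma>" if "\<sigma> \<in> frontier \<Omega>" for \<sigma>
  proof -
    obtain t where t: "\<gamma> t = \<sigma>" using frontier_time[OF \<open>\<sigma> \<in> frontier \<Omega>\<close>] by blast
    show ?thesis unfolding t[symmetric] by (rule time_representative)
  qed
  have \<tau>: "\<tau> (\<gamma> s) = s" if "0 \<le> s" "s < L" for s
    unfolding \<tau>_def using that by (intro the_inv_into_f_f inj_\<gamma>) auto
  have "\<tau> \<in> borel_measurable (boundary_borel \<Omega>)"
  proof (rule borel_measurableI_le)
    fix a
    have "compact (\<gamma> ` {0..a})" by (intro compact_continuous_image continuous_\<gamma>) auto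
    then have "\<gamma> ` {0..a} \<in> sets borel" by (intro borel_closed compact_imp_closed)
    moreover have "frontier \<Omega> \<in> sets borel" by (intro borel_closed frontier_closed)
    moreover have "{\<sigma> \<in> frontier \<Omega>. \<tau> \<sigma> \<le> a} = (if a < L then \<gamma> ` {0..a} else frontier \<Omega>)"
    proof (cases "a < L")
      case True
      show ?thesis
      proof (intro equalityI subsetI)
        fix \<sigma> assume "\<sigma> \<in> {\<sigma> \<in> frontier \<Omega>. \<tau> \<sigma> \<le> a}"
        then obtain s where "0 \<le> s" "s < L" "\<sigma> = \<gamma> s" "\<tau> \<sigma> \<le> a" using surj by blast
        then show "\<sigma> \<in> (if a < L then \<gamma> ` {0..a} else frontier \<Omega>)" using True \<tau> by auto
      next
        fix \<sigma> assume "\<sigma> \<in> (if a < L then \<gamma> ` {0..a} else frontier \<Omega>)"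
        then obtain s where "0 \<le> s" "s \<le> a" "\<sigma> = \<gamma> s" using True by auto
        then show "\<sigma> \<in> {\<sigma> \<in> frontier \<Omega>. \<tau> \<sigma> \<le> a}" using True \<tau>[of s] \<gamma>_frontier by auto
      qed
    next
      case False
      have "\<tau> \<sigma> \<le> a" if "\<sigma> \<in> frontier \<Omega>" for \<sigma>
        using surj[OF that] \<tau> False by fastforce
      then show ?thesis using False by auto
    qed
    ultimately show "{\<sigma> \<in> space (boundary_borel \<Omega>). \<tau> \<sigma> \<le> a} \<in> sets (boundary_borel \<Omega>)"
      using \<gamma>_frontier by (auto simp: sets_restrict_space_iff space_restrict_space)
  qed
  moreover have "(\<lambda>t. if in_dir t < out_dir t then 0 else dl_kernel \<zeta> t / pi) \<in> borel_measurable borel"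
  proof (rule measurable_If)
    have "{t. in_dir t < out_dir t} \<in> sets borel" by (rule sets.countable) (use countable_corner_times in auto)
    then show "{t \<in> space borel. in_dir t < out_dir t} \<in> sets borel" by simp
  qed auto
  ultimately have "(\<lambda>\<sigma>. if in_dir (\<tau> \<sigma>) < out_dir (\<tau> \<sigma>) then 0 else dl_kernel \<zeta> (\<tau> \<sigma>) / pi) \<in> borel_measurable (boundary_borel \<Omega>)"
    by (rule measurable_compose)
  then show ?thesis
  proof (rule measurable_cong[THEN iffD1, rotated])
    fix \<sigma> assume "\<sigma> \<in> space (boundary_borel \<Omega>)"
    then obtain s where "0 \<le> s" "s < L" "\<sigma> = \<gamma> s" using surj by (auto simp: space_restrict_space)
    then show "(if in_dir (\<tau> \<sigma>) < out_dir (\<tau> \<sigma>) then 0 else dl_kernel \<zeta> (\<tau> \<sigma>) / pi) = np_density \<Omega> \<zeta> \<sigma>"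
      using \<tau>[of s] by (simp add: np_density_eq)
  qed
qed

definition np_continuous_part :: "complex \<Rightarrow> complex measure"
  where "np_continuous_part \<zeta> = density (arclength_measure \<Omega>) (\<lambda>\<sigma>. ennreal (np_density \<Omega> \<zeta> \<sigma>))"

lemma sets_np_continuous_part: "sets (np_continuous_part \<zeta>) = sets (boundary_borel \<Omega>)"
  by (simp add: np_continuous_part_def arclength_measure_def)

lemma sets_np_measure: "sets (np_measure \<Omega> \<zeta>) = sets (boundary_borel \<Omega>)"
  unfolding np_measure_def
  using sets.space_closed[of "boundary_borel \<Omega>"] sets.sigma_sets_eq[of "boundary_borel \<Omega>"]
  by (simp add: space_restrict_space sets_measure_of)

text \<open>\<open>measure_of\<close> returns the given set function only if it is countably
  additive, and the zero measure by default; so additivity has to be checked.\<close>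

lemma emeasure_np_measure:
  assumes \<zeta>: "\<zeta> \<in> frontier \<Omega>" and A: "A \<in> sets (boundary_borel \<Omega>)"
  shows "emeasure (np_measure \<Omega> \<zeta>) A =
    ennreal (1 - interior_angle \<Omega> \<zeta> / pi) * indicator A \<zeta> + emeasure (np_continuous_part \<zeta>) A"
proof -
  have A': "A \<in> sets (np_measure \<Omega> \<zeta>)" using A sets_np_measure by simp
  have def': "np_measure \<Omega> \<zeta> = measure_of (frontier \<Omega>) (sets (boundary_borel \<Omega>))
      (\<lambda>A. ennreal (1 - interior_angle \<Omega> \<zeta> / pi) * indicator A \<zeta> + emeasure (np_continuous_part \<zeta>) A)"
    by (simp only: np_measure_def np_continuous_part_def)
  show ?thesis
  proof (rule emeasure_measure_of[OF def' _ _ _ A'])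
    show "sets (boundary_borel \<Omega>) \<subseteq> Pow (frontier \<Omega>)"
      using sets.space_closed[of "boundary_borel \<Omega>"] by (simp add: space_restrict_space)
    show "positive (sets (np_measure \<Omega> \<zeta>)) (\<lambda>A. ennreal (1 - interior_angle \<Omega> \<zeta> / pi) * indicator A \<zeta> + emeasure (np_continuous_part \<zeta>) A)"
      by (simp add: positive_def)
    show "countably_additive (sets (np_measure \<Omega> \<zeta>)) (\<lambda>A. ennreal (1 - interior_angle \<Omega> \<zeta> / pi) * indicator A \<zeta> + emeasure (np_continuous_part \<zeta>) A)"
    proof (rule countably_additiveI)
      fix B :: "nat \<Rightarrow> complex set"
      assume B: "range B \<subseteq> sets (np_measure \<Omega> \<zeta>)" "disjoint_family B"
      then have B1: "range B \<subseteq> sets (np_continuous_part \<zeta>)"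
        by (simp only: sets_np_continuous_part sets_np_measure)
      have "(\<Sum>i. ennreal (1 - interior_angle \<Omega> \<zeta> / pi) * indicator (B i) \<zeta> + emeasure (np_continuous_part \<zeta>) (B i)) =
          ennreal (1 - interior_angle \<Omega> \<zeta> / pi) * (\<Sum>i. indicator (B i) \<zeta>) + (\<Sum>i. emeasure (np_continuous_part \<zeta>) (B i))"
        by (simp add: suminf_add[symmetric] ennreal_suminf_cmult)
      also have "\<dots> = ennreal (1 - interior_angle \<Omega> \<zeta> / pi) * indicator (\<Union> (range B)) \<zeta> + emeasure (np_continuous_part \<zeta>) (\<Union> (range B))"
        using suminf_emeasure[OF B1 B(2)] suminf_indicator[OF B(2)] by simp
      finally show "(\<Sum>i. ennreal (1 - interior_angle \<Omega> \<zeta> / pi) * indicator (B i) \<zeta> + emeasure (np_continuous_part \<zeta>) (B i)) =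
          ennreal (1 - interior_angle \<Omega> \<zeta> / pi) * indicator (\<Union> (range B)) \<zeta> + emeasure (np_continuous_part \<zeta>) (\<Union> (range B))" .
    qed
  qed
qed

lemma continuous_frontier_bounded:
  fixes f :: "complex \<Rightarrow> complex"
  assumes "continuous_on (frontier \<Omega>) f"
  obtains B where "\<And>t. cmod (f (\<gamma> t)) \<le> B"
proof -
  have "compact (frontier \<Omega>)" by (rule compact_frontier[OF compact_\<Omega>])
  then have "bounded (f ` frontier \<Omega>)" using assms by (intro compact_imp_bounded compact_continuous_image)
  then show ?thesis using that \<gamma>_frontier by (auto simp: bounded_iff)
qed

lemma measurable_curve_compose:
  assumes "continuous_on (frontier \<Omega>) f" shows "(\<lambda>t. f (\<gamma> t)) \<in> borel_measurable borel"
  by (intro borel_measurable_continuous_onI continuous_on_compose2[OF assms continuous_\<gamma>]) (use \<gamma>_frontier in auto)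

text \<open>Corners occur at a null set of parameters, so the density, set to 0 there, may be
  replaced by the kernel. The atom carries the exterior angle divided by pi.\<close>

lemma np_operator_eq:
  assumes f: "continuous_on (frontier \<Omega>) f"
  shows "np_operator \<Omega> f (\<gamma> t0) = of_real ((out_dir t0 - in_dir t0) / pi) * f (\<gamma> t0) +
      (LINT t|par. of_real (dl_kernel (\<gamma> t0) t / pi) * f (\<gamma> t))"
proof -
  define \<zeta> where "\<zeta> = \<gamma> t0"
  have \<zeta>: "\<zeta> \<in> frontier \<Omega>" "\<zeta> \<in> \<Omega>" by (auto simp: \<zeta>_def \<gamma>_frontier \<gamma>_mem)
  obtain B where B: "\<And>t. cmod (f (\<gamma> t)) \<le> B" using continuous_frontier_bounded[OF f] by blast
  have fm: "f \<in> borel_measurable (boundary_borel \<Omega>)"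
    by (rule borel_measurable_continuous_on_restrict[OF f])
  have fm': "(\<lambda>t. f (\<gamma> t)) \<in> borel_measurable par"
    by (rule measurable_par[OF measurable_curve_compose[OF f]])
  have dm: "np_density \<Omega> \<zeta> \<in> borel_measurable (boundary_borel \<Omega>)" by (rule borel_measurable_np_density)
  have nn: "0 \<le> np_density \<Omega> \<zeta> \<sigma>" if "\<sigma> \<in> frontier \<Omega>" for \<sigma>
  proof -
    obtain t where "\<sigma> = \<gamma> t" using frontier_time[OF \<open>\<sigma> \<in> frontier \<Omega>\<close>] by blast
    then show ?thesis by (simp add: np_density_eq dl_kernel_nonneg[OF \<zeta>(2)])
  qed
  have [simp]: "space (arclength_measure \<Omega>) = frontier \<Omega>" "sets (arclength_measure \<Omega>) = sets (boundary_borel \<Omega>)"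
    by (auto simp: arclength_measure_def space_restrict_space)
  have m': "g \<in> borel_measurable (arclength_measure \<Omega>)" if "g \<in> borel_measurable (boundary_borel \<Omega>)" for g :: "complex \<Rightarrow> 'z::topological_space"
    using that by (simp add: measurable_cong_sets[of "arclength_measure \<Omega>" "boundary_borel \<Omega>"])
  have ae: "AE t in par. np_density \<Omega> \<zeta> (\<gamma> t) *\<^sub>R f (\<gamma> t) = of_real (dl_kernel \<zeta> t / pi) * f (\<gamma> t)"
  proof -
    have "AE t in lborel. t \<notin> {t. in_dir t < out_dir t}"
      using countable_imp_null_set_lborel[OF countable_corner_times] by (rule AE_not_in)
    then have "AE t in par. t \<notin> {t. in_dir t < out_dir t}"
      by (subst AE_restrict_space_iff) (auto elim: eventually_mono)
    then show ?thesis by eventually_elim (simp add: np_density_eq scaleR_conv_of_real)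
  qed
  have i0: "integrable par (\<lambda>t. of_real (dl_kernel \<zeta> t / pi) * f (\<gamma> t))"
  proof (rule Bochner_Integration.integrable_bound)
    show "integrable par (\<lambda>t. B * (dl_kernel \<zeta> t / pi))"
      unfolding \<zeta>_def by (intro integrable_mult_right integrable_divide integral_dl_kernel_boundary(1))
    show "(\<lambda>t. of_real (dl_kernel \<zeta> t / pi) * f (\<gamma> t)) \<in> borel_measurable par"
    proof (rule borel_measurable_times[OF measurable_par fm'])
      show "(\<lambda>t. complex_of_real (dl_kernel \<zeta> t / pi)) \<in> borel_measurable borel" by measurable
    qed
    show "AE t in par. cmod (of_real (dl_kernel \<zeta> t / pi) * f (\<gamma> t)) \<le> norm (B * (dl_kernel \<zeta> t / pi))"
    proof (rule AE_I2)
      fix t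
      have "cmod (of_real (dl_kernel \<zeta> t / pi) * f (\<gamma> t)) = (dl_kernel \<zeta> t / pi) * cmod (f (\<gamma> t))"
        using dl_kernel_nonneg[OF \<zeta>(2), of t] by (simp only: norm_mult norm_of_real) simp
      also have "\<dots> \<le> (dl_kernel \<zeta> t / pi) * B" using B[of t] dl_kernel_nonneg[OF \<zeta>(2), of t] by (intro mult_left_mono) auto
      also have "\<dots> \<le> norm (B * (dl_kernel \<zeta> t / pi))" unfolding real_norm_def mult.commute[of B] by (rule abs_ge_self)
      finally show "cmod (of_real (dl_kernel \<zeta> t / pi) * f (\<gamma> t)) \<le> norm (B * (dl_kernel \<zeta> t / pi))" .
    qed
  qed
  have m2: "(\<lambda>t. np_density \<Omega> \<zeta> (\<gamma> t) *\<^sub>R f (\<gamma> t)) \<in> borel_measurable par"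
    by (intro borel_measurable_scaleR fm' measurable_compose[OF measurable_curve dm])
  have m3: "(\<lambda>\<sigma>. np_density \<Omega> \<zeta> \<sigma> *\<^sub>R f \<sigma>) \<in> borel_measurable (boundary_borel \<Omega>)"
    by (intro borel_measurable_scaleR fm dm)
  have i1: "integrable par (\<lambda>t. np_density \<Omega> \<zeta> (\<gamma> t) *\<^sub>R f (\<gamma> t))"
    using i0 by (rule integrable_cong_AE_imp[OF _ m2]) (use ae in \<open>auto elim: eventually_mono\<close>)
  have i2: "integrable (arclength_measure \<Omega>) (\<lambda>\<sigma>. np_density \<Omega> \<zeta> \<sigma> *\<^sub>R f \<sigma>)"
    unfolding arclength_measure_def by (subst integrable_distr_eq[OF measurable_curve m3]) (rule i1)
  have i3: "integrable (np_continuous_part \<zeta>) f"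
    unfolding np_continuous_part_def
    by (subst integrable_density) (use i2 nn in \<open>auto intro!: m' fm dm AE_I2\<close>)
  have "(LINT y|np_continuous_part \<zeta>. f y) = (LINT \<sigma>|arclength_measure \<Omega>. np_density \<Omega> \<zeta> \<sigma> *\<^sub>R f \<sigma>)"
    unfolding np_continuous_part_def
    by (subst integral_density) (use nn in \<open>auto intro!: m' fm dm AE_I2\<close>)
  also have "\<dots> = (LINT t|par. np_density \<Omega> \<zeta> (\<gamma> t) *\<^sub>R f (\<gamma> t))"
    unfolding arclength_measure_def by (rule integral_distr[OF measurable_curve m3])
  also have "\<dots> = (LINT t|par. of_real (dl_kernel \<zeta> t / pi) * f (\<gamma> t))"
    using ae by (intro integral_cong_AE m2 borel_measurable_integrable[OF i0])
  finally have eq: "(LINT y|np_continuous_part \<zeta>. f y) = (LINT t|par. of_real (dl_kernel \<zeta> t / pi) * f (\<gamma> t))" .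
  have c: "1 - interior_angle \<Omega> \<zeta> / pi = (out_dir t0 - in_dir t0) / pi"
    by (simp add: \<zeta>_def interior_angle_eq diff_divide_distrib)
  have "(LINT y|np_measure \<Omega> \<zeta>. f y) = of_real (1 - interior_angle \<Omega> \<zeta> / pi) * f \<zeta> + (LINT y|np_continuous_part \<zeta>. f y)"
  proof (rule integral_add_point(1)[OF _ _ _ _ i3])
    show "sets (np_measure \<Omega> \<zeta>) = sets (np_continuous_part \<zeta>)" by (simp add: sets_np_measure sets_np_continuous_part)
    show "\<zeta> \<in> space (np_continuous_part \<zeta>)" by (simp add: np_continuous_part_def \<zeta>)
    show "0 \<le> 1 - interior_angle \<Omega> \<zeta> / pi" unfolding c using in_dir_le_out_dir[of t0] by simp
  qed (use emeasure_np_measure[OF \<zeta>(1)] in \<open>simp add: sets_np_continuous_part\<close>)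
  then show ?thesis unfolding np_operator_def eq c by (simp add: \<zeta>_def)
qed

end

section \<open>Existence of the arclength parametrization\<close>

definition polygon_chain :: "real \<Rightarrow> real \<Rightarrow> nat \<times> (nat \<Rightarrow> real) \<Rightarrow> bool"
  where "polygon_chain a b = (\<lambda>(n, t). t 0 = a \<and> t n = b \<and> mono_on {..n} t)"

definition polygon_length :: "(real \<Rightarrow> complex) \<Rightarrow> nat \<times> (nat \<Rightarrow> real) \<Rightarrow> ennreal"
  where "polygon_length \<gamma> = (\<lambda>(n, t). \<Sum>i<n. ennreal (dist (\<gamma> (t i)) (\<gamma> (t (Suc i)))))"

lemma curve_length_alt: "curve_length \<gamma> a b = (SUP c \<in> Collect (polygon_chain a b). polygon_length \<gamma> c)"
  unfolding curve_length_def polygon_length_def polygon_chain_def by (rule SUP_cong) auto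

lemma polygon_length_le: "polygon_chain a b c \<Longrightarrow> polygon_length \<gamma> c \<le> curve_length \<gamma> a b"
  unfolding curve_length_alt by (rule SUP_upper) auto

lemma curve_length_least:
  "(\<And>n t. polygon_chain a b (n, t) \<Longrightarrow> polygon_length \<gamma> (n, t) \<le> x) \<Longrightarrow> curve_length \<gamma> a b \<le> x"
  unfolding curve_length_alt by (rule SUP_least) auto

lemma curve_length_lipschitz:
  assumes lip: "\<And>s t. s \<le> t \<Longrightarrow> dist (\<gamma> s) (\<gamma> t) \<le> C * (t - s)"
  shows "curve_length \<gamma> a b \<le> ennreal (C * (b - a))"
proof (rule curve_length_least)
  fix n t assume "polygon_chain a b (n, t)"
  then have t: "t 0 = a" "t n = b" "mono_on {..n} t" by (auto simp: polygon_chain_def)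
  have "polygon_length \<gamma> (n, t) = ennreal (\<Sum>i<n. dist (\<gamma> (t i)) (\<gamma> (t (Suc i))))"
    by (simp add: polygon_length_def sum_ennreal)
  also have "\<dots> \<le> ennreal (\<Sum>i<n. C * (t (Suc i) - t i))"
    by (intro ennreal_leI sum_mono lip) (use t(3) in \<open>auto simp: mono_on_def\<close>)
  also have "(\<Sum>i<n. C * (t (Suc i) - t i)) = C * (b - a)"
    using t by (simp add: sum_lessThan_telescope flip: sum_distrib_left)
  finally show "polygon_length \<gamma> (n, t) \<le> ennreal (C * (b - a))" .
qed

text \<open>In one direction a chain is split at \<open>b\<close> by truncating it from above and
  from below; in the other, two chains are concatenated.\<close>

lemma curve_length_add:
  assumes "a \<le> b" "b \<le> c" shows "curve_length \<gamma> a c = curve_length \<gamma> a b + curve_length \<gamma> b c"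
proof (rule antisym)
  show "curve_length \<gamma> a c \<le> curve_length \<gamma> a b + curve_length \<gamma> b c"
  proof (rule curve_length_least)
    fix n t assume "polygon_chain a c (n, t)"
    then have t: "t 0 = a" "t n = c" "mono_on {..n} t" by (auto simp: polygon_chain_def)
    define s r where "s i = min (t i) b" and "r i = max (t i) b" for i
    have step: "dist (\<gamma> (t i)) (\<gamma> (t (Suc i))) \<le> dist (\<gamma> (s i)) (\<gamma> (s (Suc i))) + dist (\<gamma> (r i)) (\<gamma> (r (Suc i)))"
      if "i < n" for i
    proof -
      have "t i \<le> t (Suc i)" using t(3) that by (auto simp: mono_on_def)
      then consider "t (Suc i) \<le> b" | "b \<le> t i" | "t i \<le> b" "b \<le> t (Suc i)" by linarith
      then show ?thesis
        by cases (use \<open>t i \<le> t (Suc i)\<close> dist_triangle[of "\<gamma> (t i)" "\<gamma> (t (Suc i))" "\<gamma> b"]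
          in \<open>auto simp: s_def r_def min_def max_def\<close>)
    qed
    have "polygon_length \<gamma> (n, t) \<le> polygon_length \<gamma> (n, s) + polygon_length \<gamma> (n, r)"
    proof -
      have "polygon_length \<gamma> (n, t) \<le> (\<Sum>i<n. ennreal (dist (\<gamma> (s i)) (\<gamma> (s (Suc i)))) + ennreal (dist (\<gamma> (r i)) (\<gamma> (r (Suc i)))))"
        unfolding polygon_length_def prod.case
      proof (rule sum_mono)
        fix i assume "i \<in> {..<n}"
        then have "ennreal (dist (\<gamma> (t i)) (\<gamma> (t (Suc i)))) \<le> ennreal (dist (\<gamma> (s i)) (\<gamma> (s (Suc i))) + dist (\<gamma> (r i)) (\<gamma> (r (Suc i))))"
          using step by (intro ennreal_leI) simp
        then show "ennreal (dist (\<gamma> (t i)) (\<gamma> (t (Suc i)))) \<le> ennreal (dist (\<gamma> (s i)) (\<gamma> (s (Suc i)))) + ennreal (dist (\<gamma> (r i)) (\<gamma> (r (Suc i))))"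
          by simp
      qed
      then show ?thesis by (simp only: polygon_length_def prod.case sum.distrib)
    qed
    also have "\<dots> \<le> curve_length \<gamma> a b + curve_length \<gamma> b c"
    proof (intro add_mono polygon_length_le)
      show "polygon_chain a b (n, s)" "polygon_chain b c (n, r)"
      proof -
        have "mono_on {..n} s" "mono_on {..n} r"
          unfolding s_def r_def using t(3) by (auto simp only: mono_on_def intro!: min.mono max.mono order_refl)
        then show "polygon_chain a b (n, s)" "polygon_chain b c (n, r)"
          using t assms by (auto simp: polygon_chain_def s_def r_def)
      qed
    qed
    finally show "polygon_length \<gamma> (n, t) \<le> curve_length \<gamma> a b + curve_length \<gamma> b c" .
  qed
  have "polygon_chain a b (1, \<lambda>i. if i = 0 then a else b)" "polygon_chain b c (1, \<lambda>i. if i = 0 then b else c)"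
    using assms by (auto simp: polygon_chain_def mono_on_def)
  then have ne: "Collect (polygon_chain a b) \<noteq> {}" "Collect (polygon_chain b c) \<noteq> {}" by blast+
  show "curve_length \<gamma> a b + curve_length \<gamma> b c \<le> curve_length \<gamma> a c"
    unfolding curve_length_alt[of \<gamma> a b] curve_length_alt[of \<gamma> b c]
      ennreal_SUP_add_left[OF ne(1), symmetric] ennreal_SUP_add_right[OF ne(2)]
  proof (rule SUP_least, rule SUP_least, clarsimp)
    fix n s m r assume s: "polygon_chain a b (n, s)" and r: "polygon_chain b c (m, r)"
    define t where "t i = (if i \<le> n then s i else r (i - n))" for i
    have sb: "s i \<le> b" if "i \<le> n" for i using s that by (auto simp: polygon_chain_def mono_on_def)
    have rb: "b \<le> r i" if "i \<le> m" for i using r that by (force simp: polygon_chain_def mono_on_def)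
    have tn: "t (n + i) = r i" for i using s r by (auto simp: t_def polygon_chain_def)
    have chain: "polygon_chain a c (n + m, t)"
    proof -
      have "t i \<le> t j" if "i \<le> j" "j \<le> n + m" for i j
      proof -
        consider "j \<le> n" | "i \<le> n" "\<not> j \<le> n" | "\<not> i \<le> n" by linarith
        then show ?thesis
        proof cases
          case 1 then show ?thesis using s that by (auto simp: t_def polygon_chain_def mono_on_def)
        next
          case 2
          then have "s i \<le> b" "b \<le> r (j - n)" using that by (auto intro: sb rb)
          then show ?thesis using 2 by (simp add: t_def)
        next
          case 3
          have "r (i - n) \<le> r (j - n)"
            by (rule mono_onD[of "{..m}"]) (use r that in \<open>auto simp: polygon_chain_def\<close>)
          then show ?thesis using 3 that by (simp add: t_def)
        qed
      qed
      moreover have "t 0 = a" using s by (simp add: t_def polygon_chain_def)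
      moreover have "t (n + m) = c" using tn[of m] r by (simp add: polygon_chain_def)
      ultimately show ?thesis by (auto simp: polygon_chain_def mono_on_def)
    qed
    have "{..<n + m} = {..<n} \<union> {n..<n + m}" "{..<n} \<inter> {n..<n + m} = {}" by auto
    then have "polygon_length \<gamma> (n + m, t) = (\<Sum>i<n. ennreal (dist (\<gamma> (t i)) (\<gamma> (t (Suc i))))) +
        (\<Sum>i=n..<n+m. ennreal (dist (\<gamma> (t i)) (\<gamma> (t (Suc i)))))"
      unfolding polygon_length_def prod.case by (simp only: sum.union_disjoint finite_lessThan finite_atLeastLessThan)
    also have "(\<Sum>i<n. ennreal (dist (\<gamma> (t i)) (\<gamma> (t (Suc i))))) = polygon_length \<gamma> (n, s)"
      by (simp add: polygon_length_def t_def)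
    also have "(\<Sum>i=n..<n+m. ennreal (dist (\<gamma> (t i)) (\<gamma> (t (Suc i))))) =
        (\<Sum>i=0..<m. ennreal (dist (\<gamma> (t (i + n))) (\<gamma> (t (Suc (i + n))))))"
      using sum.shift_bounds_nat_ivl[of "\<lambda>i. ennreal (dist (\<gamma> (t i)) (\<gamma> (t (Suc i))))" 0 n m] by (simp add: add.commute)
    also have "\<dots> = polygon_length \<gamma> (m, r)"
    proof -
      have "t (i + n) = r i" "t (Suc (i + n)) = r (Suc i)" for i
        using tn[of i] tn[of "Suc i"] by (simp_all add: add.commute)
      then show ?thesis by (simp only: polygon_length_def prod.case atLeast0LessThan)
    qed
    finally show "polygon_length \<gamma> (n, s) + polygon_length \<gamma> (m, r) \<le> curve_length \<gamma> a c"
      using polygon_length_le[OF chain, of \<gamma>] by simp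
  qed
qed

lemma curve_length_comp_le:
  assumes "mono h" shows "curve_length (\<lambda>t. \<gamma> (h t)) a b \<le> curve_length \<gamma> (h a) (h b)"
proof (rule curve_length_least)
  fix n t assume "polygon_chain a b (n, t)"
  then have "polygon_chain (h a) (h b) (n, \<lambda>i. h (t i))"
    using assms by (auto simp: polygon_chain_def mono_on_def mono_def)
  from polygon_length_le[OF this, of \<gamma>] show "polygon_length (\<lambda>t. \<gamma> (h t)) (n, t) \<le> curve_length \<gamma> (h a) (h b)"
    by (simp add: polygon_length_def)
qed

lemma curve_length_comp:
  assumes "mono h" "mono k" "\<And>t. k (h t) = t" "\<And>t. h (k t) = t"
  shows "curve_length (\<lambda>t. \<gamma> (h t)) a b = curve_length \<gamma> (h a) (h b)"
proof (rule antisym)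
  show "curve_length \<gamma> (h a) (h b) \<le> curve_length (\<lambda>t. \<gamma> (h t)) a b"
    using curve_length_comp_le[OF assms(2), of "\<lambda>t. \<gamma> (h t)" "h a" "h b"] by (simp add: assms)
qed (rule curve_length_comp_le[OF assms(1)])

lemma norm_cis_diff_le: "cmod (cis a - cis b) \<le> \<bar>a - b\<bar>"
proof -
  have *: "cmod (cis b - cis a) \<le> b - a" if "a \<le> b" for a b
  proof -
    have "cmod (cis b - cis a) \<le> 1 * (b - a)"
    proof (rule norm_diff_le_of_right_derivative[OF that])
      have d: "(cis has_vector_derivative \<i> * cis t) (at t within S)" for t S
        unfolding has_vector_derivative_complex_iff by (auto intro!: derivative_eq_intros)
      show "continuous_on {a..b} cis" by (intro continuous_intros)
      show "(cis has_vector_derivative \<i> * cis t) (at_right t)" for t by (rule d)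
    qed (simp add: norm_mult)
    then show ?thesis by simp
  qed
  show ?thesis
    using *[of a b] *[of b a] by (cases "a \<le> b") (auto simp: norm_minus_commute)
qed

section \<open>Polar parametrization of a convex body\<close>

locale convex_body =
  fixes \<Omega> :: "complex set"
  assumes compact_\<Omega>: "compact \<Omega>" and convex_\<Omega>: "convex \<Omega>" and interior_\<Omega>: "interior \<Omega> \<noteq> {}"
begin

definition center :: complex where "center = (SOME z. z \<in> interior \<Omega>)"

lemma center: "center \<in> interior \<Omega>"
  unfolding center_def using interior_\<Omega> by (simp add: some_in_eq)

text \<open>The reciprocal of the Minkowski gauge of the body about \<open>center\<close>. The two
  equivalences express that a ray runs in the interior up to its last point in the body.\<close>

definition radius :: "complex \<Rightarrow> real"
  where "radius u = (THE d. 0 < d \<and> (\<forall>e\<ge>0. center + e *\<^sub>R u \<in> \<Omega> \<longleftrightarrow> e \<le> d) \<and>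
    (\<forall>e\<ge>0. center + e *\<^sub>R u \<in> interior \<Omega> \<longleftrightarrow> e < d))"

lemma radius:
  assumes "u \<noteq> 0"
  shows "0 < radius u" "\<And>e. 0 \<le> e \<Longrightarrow> center + e *\<^sub>R u \<in> \<Omega> \<longleftrightarrow> e \<le> radius u"
    "\<And>e. 0 \<le> e \<Longrightarrow> center + e *\<^sub>R u \<in> interior \<Omega> \<longleftrightarrow> e < radius u"
proof -
  have closed: "closed \<Omega>" using compact_\<Omega> by (rule compact_imp_closed)
  obtain d where d: "0 < d" "center + d *\<^sub>R u \<in> frontier \<Omega>"
      "\<And>e. 0 \<le> e \<Longrightarrow> e < d \<Longrightarrow> center + e *\<^sub>R u \<in> interior \<Omega>"
    using ray_to_frontier[OF compact_imp_bounded[OF compact_\<Omega>] center assms] by metis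
  have dn: "center + d *\<^sub>R u \<notin> interior \<Omega>" "center + d *\<^sub>R u \<in> \<Omega>"
    using d(2) closed frontier_subset_closed by (auto simp: frontier_def)
  have out: "center + e *\<^sub>R u \<notin> \<Omega>" if "e > d" for e
  proof
    assume e: "center + e *\<^sub>R u \<in> \<Omega>"
    have "center + e *\<^sub>R u - (1 - d / e) *\<^sub>R (center + e *\<^sub>R u - center) \<in> interior \<Omega>"
      using d(1) that by (intro mem_interior_convex_shrink convex_\<Omega> center e) (auto simp: field_simps)
    moreover have "center + e *\<^sub>R u - (1 - d / e) *\<^sub>R (center + e *\<^sub>R u - center) = center + d *\<^sub>R u"
      using d(1) that by (simp add: algebra_simps)
    ultimately show False using dn by (simp only:)
  qed
  have P: "0 < d \<and> (\<forall>e\<ge>0. center + e *\<^sub>R u \<in> \<Omega> \<longleftrightarrow> e \<le> d) \<and>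
    (\<forall>e\<ge>0. center + e *\<^sub>R u \<in> interior \<Omega> \<longleftrightarrow> e < d)"
  proof (intro conjI allI impI iffI)
    fix e :: real assume e: "e \<ge> 0"
    show "e \<le> d" if "center + e *\<^sub>R u \<in> \<Omega>" using out[of e] that by force
    show "center + e *\<^sub>R u \<in> \<Omega>" if "e \<le> d"
      using d(3)[OF e] dn(2) that interior_subset[of \<Omega>] by (cases "e = d") auto
    show "e < d" if "center + e *\<^sub>R u \<in> interior \<Omega>"
      using out[of e] dn(1) that interior_subset[of \<Omega>] by (cases "e = d") force+
  qed (use d in auto)
  have "radius u = d"
    unfolding radius_def
  proof (rule the_equality[where P = "\<lambda>d. 0 < d \<and> (\<forall>e\<ge>0. center + e *\<^sub>R u \<in> \<Omega> \<longleftrightarrow> e \<le> d) \<and>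
    (\<forall>e\<ge>0. center + e *\<^sub>R u \<in> interior \<Omega> \<longleftrightarrow> e < d)", OF P])
    fix d' assume P': "0 < d' \<and> (\<forall>e\<ge>0. center + e *\<^sub>R u \<in> \<Omega> \<longleftrightarrow> e \<le> d') \<and>
      (\<forall>e\<ge>0. center + e *\<^sub>R u \<in> interior \<Omega> \<longleftrightarrow> e < d')"
    have "d \<le> d'" using P P' by (meson less_imp_le order_refl)
    moreover have "d' \<le> d" using P P' by (meson less_imp_le order_refl)
    ultimately show "d' = d" by simp
  qed
  then show "0 < radius u" "\<And>e. 0 \<le> e \<Longrightarrow> center + e *\<^sub>R u \<in> \<Omega> \<longleftrightarrow> e \<le> radius u"
    "\<And>e. 0 \<le> e \<Longrightarrow> center + e *\<^sub>R u \<in> interior \<Omega> \<longleftrightarrow> e < radius u" using P by auto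
qed

text \<open>Subadditivity of the gauge: the convex combination of the two boundary points with
  weights proportional to the reciprocal radii lies in the direction \<open>u + v\<close>.\<close>

lemma inverse_radius_subadditive:
  assumes "u \<noteq> 0" "v \<noteq> 0" "u + v \<noteq> 0"
  shows "1 / radius (u + v) \<le> 1 / radius u + 1 / radius v"
proof -
  define a b where "a = 1 / radius u" and "b = 1 / radius v"
  have ab: "a > 0" "b > 0" using radius(1) assms by (auto simp: a_def b_def)
  have mem: "center + radius u *\<^sub>R u \<in> \<Omega>" "center + radius v *\<^sub>R v \<in> \<Omega>"
    using radius(1,2) assms by (auto simp: less_imp_le)
  have "(a / (a + b)) *\<^sub>R (center + radius u *\<^sub>R u) + (b / (a + b)) *\<^sub>R (center + radius v *\<^sub>R v) \<in> \<Omega>"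
    by (rule convexD[OF convex_\<Omega> mem]) (use ab in \<open>auto simp flip: add_divide_distrib\<close>)
  also have "(a / (a + b)) *\<^sub>R (center + radius u *\<^sub>R u) + (b / (a + b)) *\<^sub>R (center + radius v *\<^sub>R v) =
      (a / (a + b) + b / (a + b)) *\<^sub>R center + (1 / (a + b)) *\<^sub>R ((a * radius u) *\<^sub>R u + (b * radius v) *\<^sub>R v)"
    by (simp add: algebra_simps)
  also have "a / (a + b) + b / (a + b) = 1" using ab by (simp flip: add_divide_distrib)
  also have "a * radius u = 1" using radius(1)[OF assms(1)] by (simp add: a_def)
  also have "b * radius v = 1" using radius(1)[OF assms(2)] by (simp add: b_def)
  finally have "1 / (a + b) \<le> radius (u + v)"
    using radius(2)[OF assms(3), of "1 / (a + b)"] ab by (simp add: less_imp_le)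
  then show ?thesis
    using ab radius(1)[OF assms(3)] by (simp add: a_def b_def field_simps)
qed

text \<open>If a ball of radius \<open>\<delta>\<close> fits into the body, the gauge of
  \<open>w\<close> is at most \<open>cmod w / \<delta>\<close>, so it is Lipschitz by subadditivity.
  Its reciprocal is bounded by \<open>R\<close>, which turns the constant into
  \<open>R\<^sup>2 / \<delta>\<close>.\<close>

lemma radius_lipschitz:
  obtains C where "C \<ge> 0"
    "\<And>u v. cmod u = 1 \<Longrightarrow> cmod v = 1 \<Longrightarrow> \<bar>radius u - radius v\<bar> \<le> C * cmod (u - v)"
    "\<And>u. cmod u = 1 \<Longrightarrow> radius u \<le> C"
proof -
  obtain \<delta> where \<delta>: "\<delta> > 0" "cball center \<delta> \<subseteq> \<Omega>" using center mem_interior_cball[of center \<Omega>] by auto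
  obtain R where R: "\<And>z. z \<in> \<Omega> \<Longrightarrow> cmod (z - center) \<le> R"
    using bounded_any_center[of \<Omega> center] compact_imp_bounded[OF compact_\<Omega>]
    by (auto simp: dist_norm norm_minus_commute)
  have up: "radius u \<le> R" if "cmod u = 1" for u
  proof -
    have u: "u \<noteq> 0" using that by auto
    have "center + radius u *\<^sub>R u \<in> \<Omega>" using radius(1,2)[OF u] by (simp add: less_imp_le)
    from R[OF this] show ?thesis using that radius(1)[OF u] by simp
  qed
  have R0: "R \<ge> 0" using up[of 1] radius(1)[of 1] by simp
  have low: "1 / radius w \<le> cmod w / \<delta>" if w: "w \<noteq> 0" for w
  proof -
    have "center + (\<delta> / cmod w) *\<^sub>R w \<in> \<Omega>" using \<delta> w by (auto simp: subset_iff dist_norm)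
    then have "\<delta> / cmod w \<le> radius w" using radius(2)[OF w, of "\<delta> / cmod w"] \<delta> by simp
    then show ?thesis using \<delta> w radius(1)[OF w] by (simp add: field_simps)
  qed
  have diff: "1 / radius u - 1 / radius v \<le> cmod (u - v) / \<delta>" if "u \<noteq> 0" "v \<noteq> 0" for u v
  proof (cases "u = v")
    case False
    then show ?thesis
      using inverse_radius_subadditive[of "u - v" v] low[of "u - v"] that by simp
  qed (use \<delta> in simp)
  have "\<bar>radius u - radius v\<bar> \<le> R\<^sup>2 / \<delta> * cmod (u - v)" if "cmod u = 1" "cmod v = 1" for u v
  proof -
    have nz: "u \<noteq> 0" "v \<noteq> 0" using that by auto
    note pos = radius(1)[OF nz(1)] radius(1)[OF nz(2)]
    have "\<bar>1 / radius u - 1 / radius v\<bar> \<le> cmod (u - v) / \<delta>"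
      using diff[OF nz] diff[OF nz(2,1)] by (simp add: abs_le_iff norm_minus_commute)
    then have "radius u * radius v * \<bar>1 / radius u - 1 / radius v\<bar> \<le> R * R * (cmod (u - v) / \<delta>)"
      using up[OF that(1)] up[OF that(2)] pos R0 by (intro mult_mono) auto
    moreover have "radius u * radius v * \<bar>1 / radius u - 1 / radius v\<bar> = \<bar>radius u - radius v\<bar>"
    proof -
      have "radius u * radius v * \<bar>1 / radius u - 1 / radius v\<bar> = \<bar>radius u * radius v * (1 / radius u - 1 / radius v)\<bar>"
        using pos by (simp add: abs_mult)
      also have "radius u * radius v * (1 / radius u - 1 / radius v) = radius v - radius u"
        using pos by (simp add: field_simps)
      finally show ?thesis by simp
    qed
    ultimately show ?thesis by (simp add: power2_eq_square)
  qed
  note lip = this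
  have d: "\<bar>radius u - radius v\<bar> \<le> max (R\<^sup>2 / \<delta>) R * cmod (u - v)" if uv: "cmod u = 1" "cmod v = 1" for u v
  proof -
    have "\<bar>radius u - radius v\<bar> \<le> R\<^sup>2 / \<delta> * cmod (u - v)" by (rule lip[OF uv])
    also have "\<dots> \<le> max (R\<^sup>2 / \<delta>) R * cmod (u - v)" by (rule mult_right_mono) auto
    finally show ?thesis .
  qed
  show ?thesis
  proof (rule that)
    show "\<bar>radius u - radius v\<bar> \<le> max (R\<^sup>2 / \<delta>) R * cmod (u - v)" if "cmod u = 1" "cmod v = 1" for u v
      using that by (rule d)
    show "0 \<le> max (R\<^sup>2 / \<delta>) R" using R0 by simp
    show "radius u \<le> max (R\<^sup>2 / \<delta>) R" if "cmod u = 1" for u using up[OF that] by simp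
  qed
qed

definition radial :: "real \<Rightarrow> complex" where "radial \<theta> = center + radius (cis \<theta>) *\<^sub>R cis \<theta>"

lemma radial_lipschitz: obtains C where "\<And>s t. dist (radial s) (radial t) \<le> C * \<bar>s - t\<bar>"
proof -
  obtain C where C: "C \<ge> 0" "\<And>u v. cmod u = 1 \<Longrightarrow> cmod v = 1 \<Longrightarrow> \<bar>radius u - radius v\<bar> \<le> C * cmod (u - v)"
    "\<And>u. cmod u = 1 \<Longrightarrow> radius u \<le> C"
    using radius_lipschitz by metis
  have "dist (radial s) (radial t) \<le> (2 * C) * \<bar>s - t\<bar>" for s t
  proof -
    have "radial s - radial t = (radius (cis s) - radius (cis t)) *\<^sub>R cis s + radius (cis t) *\<^sub>R (cis s - cis t)"
      by (simp add: radial_def algebra_simps)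
    then have "dist (radial s) (radial t) \<le> \<bar>radius (cis s) - radius (cis t)\<bar> + \<bar>radius (cis t)\<bar> * cmod (cis s - cis t)"
      unfolding dist_norm by (auto intro!: order_trans[OF norm_triangle_ineq])
    also have "\<dots> \<le> C * cmod (cis s - cis t) + C * cmod (cis s - cis t)"
      using C(2)[of "cis s" "cis t"] C(3)[of "cis t"] radius(1)[of "cis t"] by (intro add_mono mult_right_mono) auto
    also have "\<dots> = (2 * C) * cmod (cis s - cis t)" by simp
    also have "\<dots> \<le> (2 * C) * \<bar>s - t\<bar>" by (intro mult_left_mono norm_cis_diff_le) (use C in simp)
    finally show ?thesis .
  qed
  then show ?thesis using that by blast
qed

lemma radial_eq_imp: assumes "radial s = radial t" shows "cis s = cis t"
proof -
  have eq: "radius (cis s) *\<^sub>R cis s = radius (cis t) *\<^sub>R cis t" using assms by (simp add: radial_def)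
  then have "cmod (radius (cis s) *\<^sub>R cis s) = cmod (radius (cis t) *\<^sub>R cis t)" by (rule arg_cong)
  then have "radius (cis s) = radius (cis t)" using radius(1)[of "cis s"] radius(1)[of "cis t"] by simp
  then show ?thesis using eq radius(1)[of "cis t"] by simp
qed

lemma range_radial: "range radial = frontier \<Omega>"
proof (intro equalityI subsetI)
  fix x assume "x \<in> range radial"
  then obtain t where t: "x = center + radius (cis t) *\<^sub>R cis t" by (auto simp: radial_def)
  have r: "0 \<le> radius (cis t)" using radius(1)[of "cis t"] by simp
  have "x \<in> \<Omega>" "x \<notin> interior \<Omega>"
    unfolding t using radius(2)[of "cis t" "radius (cis t)"] radius(3)[of "cis t" "radius (cis t)"] r by auto
  then show "x \<in> frontier \<Omega>"
    using compact_\<Omega> by (simp add: frontier_def compact_imp_closed)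
next
  fix x assume "x \<in> frontier \<Omega>"
  then have x: "x \<in> \<Omega>" "x \<notin> interior \<Omega>"
    using compact_\<Omega> by (simp_all add: frontier_def compact_imp_closed)
  then have ne: "x - center \<noteq> 0" using center by auto
  define u where "u = cis (Arg (x - center))"
  have xu: "x = center + cmod (x - center) *\<^sub>R u"
    using ne by (simp add: u_def cis_Arg sgn_div_norm)
  have u: "u \<noteq> 0" by (simp add: u_def)
  have "cmod (x - center) = radius u"
    using radius(2)[OF u, of "cmod (x - center)"] radius(3)[OF u, of "cmod (x - center)"] x xu by auto
  then have "x = radial (Arg (x - center))" using xu by (simp add: radial_def u_def)
  then show "x \<in> range radial" by blast
qed

text \<open>The polar parametrization is Lipschitz, so its length function \<open>S\<close> is
  finite and continuous; it is strictly increasing since short arcs are not constant. Composing with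
  the inverse of \<open>S\<close> gives unit speed, and the winding number is read off from an
  explicit logarithm.\<close>

lemma arclength_parametrization_exists: "\<exists>L \<gamma>. arclength_parametrization \<Omega> L \<gamma>"
proof -
  obtain C where lip: "\<And>s t. dist (radial s) (radial t) \<le> C * \<bar>s - t\<bar>" using radial_lipschitz by blast
  have per: "radial (t + 2 * pi) = radial t" for t by (simp add: radial_def cis.ctr)
  have cont: "continuous_on UNIV radial"
  proof (rule lipschitz_on_continuous_on)
    show "(max C 0)-lipschitz_on UNIV radial"
      by (rule lipschitz_onI)
        (auto simp: dist_real_def intro: order_trans[OF lip mult_right_mono])
  qed
  define l where "l a b = enn2real (curve_length radial a b)" for a b
  have len: "curve_length radial a b = ennreal (l a b)" if "a \<le> b" for a b
  proof -
    have "curve_length radial a b \<le> ennreal (C * (b - a))"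
    proof (rule curve_length_lipschitz)
      fix s t :: real assume "s \<le> t"
      then show "dist (radial s) (radial t) \<le> C * (t - s)" using lip[of s t] by simp
    qed
    then have "curve_length radial a b < \<infinity>" using le_less_trans by fastforce
    then show ?thesis by (simp add: l_def less_top[symmetric])
  qed
  have l0: "0 \<le> l a b" for a b by (simp add: l_def)
  have ladd: "l a c = l a b + l b c" if "a \<le> b" "b \<le> c" for a b c
  proof -
    have "ennreal (l a c) = ennreal (l a b) + ennreal (l b c)"
      using curve_length_add[OF that, of radial] len that by simp
    then show ?thesis using l0 by (simp flip: ennreal_plus)
  qed
  have lge: "dist (radial a) (radial b) \<le> l a b" if "a \<le> b" for a b
    using curve_length_ge_dist[OF that, of radial] len[OF that] l0 by simp
  have lpos: "0 < l a b" if "a < b" for a b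
  proof -
    \<comment> \<open>At most 1 ahead of \<open>a\<close>, less than a full turn, so that equal
      points would force equal angles.\<close>
    define c where "c = min b (a + 1)"
    have c: "a < c" "c \<le> b" "c \<le> a + 1" using that by (auto simp: c_def)
    have "radial a \<noteq> radial c"
    proof
      assume "radial a = radial c"
      then have "a = c" using radial_eq_imp[of a c] c pi_gt3 by (intro cis_eq_imp_eq) auto
      then show False using c by simp
    qed
    then have "0 < l a c" using lge[of a c] c by (metis less_imp_le less_le_trans zero_less_dist_iff)
    then show ?thesis using ladd[of a c b] l0[of c b] c by simp
  qed
  have lper: "l (a + 2 * pi) (b + 2 * pi) = l a b" for a b
    using curve_length_comp[of "\<lambda>t. t + 2 * pi" "\<lambda>t. t - 2 * pi" radial a b]
    by (simp add: l_def per mono_def)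
  \<comment> \<open>Length with sign from angle 0, so that lengths of arcs become differences of one
    function on the whole line.\<close>
  define S where "S t = (if 0 \<le> t then l 0 t else - l t 0)" for t
  have Sdiff: "S b - S a = l a b" if "a \<le> b" for a b
    using that ladd[of 0 a b] ladd[of a 0 b] ladd[of a b 0] by (auto simp: S_def)
  have l_self: "l a a = 0" for a using ladd[of a a a] by simp
  have Smono: "strict_mono S"
    by (rule strict_monoI) (use Sdiff lpos in \<open>metis diff_gt_0_iff_gt less_imp_le\<close>)
  define L where "L = l 0 (2 * pi)"
  have Lpos: "L > 0" unfolding L_def by (rule lpos) simp
  \<comment> \<open>The length of one turn is independent of its starting point: first for starts
    within the first turn, then by shifting through whole turns.\<close>
  have Sper: "S (t + 2 * pi) = S t + L" for t
  proof -
    have sym: "l s (s + 2 * pi) = L" if "0 \<le> s" "s \<le> 2 * pi" for s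
    proof -
      have "l s (s + 2 * pi) = l s (2 * pi) + l (0 + 2 * pi) (s + 2 * pi)"
        using ladd[of s "2 * pi" "s + 2 * pi"] that by simp
      also have "\<dots> = L" unfolding lper L_def using ladd[of 0 s "2 * pi"] that by simp
      finally show ?thesis .
    qed
    have shift: "l (s + 2 * pi) (s + 2 * pi + 2 * pi) = l s (s + 2 * pi)" for s by (rule lper)
    have nat: "l (s + real n * (2 * pi)) (s + real n * (2 * pi) + 2 * pi) = l s (s + 2 * pi)" for n s
    proof (induction n)
      case (Suc n)
      have eq: "s + real (Suc n) * (2 * pi) = (s + real n * (2 * pi)) + 2 * pi" by (simp add: algebra_simps)
      show ?case unfolding eq shift by (rule Suc)
    qed simp
    define k where "k = \<lfloor>t / (2 * pi)\<rfloor>"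
    define r where "r = t - of_int k * (2 * pi)"
    have r: "0 \<le> r" "r \<le> 2 * pi"
      using floor_divide_lower[of "2 * pi" t] floor_divide_upper[of "2 * pi" t]
      by (auto simp: r_def k_def algebra_simps)
    have "l t (t + 2 * pi) = l r (r + 2 * pi)"
    proof (cases "k \<ge> 0")
      case True
      then have "t = r + real (nat k) * (2 * pi)" by (simp add: r_def)
      then show ?thesis using nat[of r "nat k"] by simp
    next
      case False
      then have "r = t + real (nat (-k)) * (2 * pi)" by (simp add: r_def)
      then show ?thesis using nat[of t "nat (-k)"] by simp
    qed
    then show ?thesis using sym[OF r] Sdiff[of t "t + 2 * pi"] by simp
  qed
  have Scont: "continuous_on UNIV S"
  proof (rule lipschitz_on_continuous_on)
    have b: "l a b \<le> max C 0 * (b - a)" if "a \<le> b" for a b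
    proof -
      have "curve_length radial a b \<le> ennreal (max C 0 * (b - a))"
      proof (rule curve_length_lipschitz)
        fix s t :: real assume "s \<le> t"
        have "dist (radial s) (radial t) \<le> C * \<bar>s - t\<bar>" by (rule lip)
        also have "\<dots> \<le> max C 0 * \<bar>s - t\<bar>" by (rule mult_right_mono) auto
        finally show "dist (radial s) (radial t) \<le> max C 0 * (t - s)" using \<open>s \<le> t\<close> by simp
      qed
      then show ?thesis unfolding len[OF that] using that by (subst (asm) ennreal_le_iff) auto
    qed
    show "(max C 0)-lipschitz_on UNIV S"
    proof (rule lipschitz_onI)
      fix x y
      show "dist (S x) (S y) \<le> max C 0 * dist x y"
      proof (cases "x \<le> y")
        case True
        then show ?thesis using Sdiff[OF True] b[OF True] l0[of x y] by (simp add: dist_real_def)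
      next
        case False
        then have "y \<le> x" by simp
        then show ?thesis using Sdiff[of y x] b[of y x] l0[of y x] by (simp add: dist_real_def)
      qed
    qed simp
  qed
  have Snat: "S (t + real n * (2 * pi)) = S t + real n * L" for n t
  proof (induction n)
    case (Suc n)
    have eq: "t + real (Suc n) * (2 * pi) = (t + real n * (2 * pi)) + 2 * pi" by (simp add: algebra_simps)
    show ?case unfolding eq Sper Suc.IH by (simp add: algebra_simps)
  qed simp
  have surj: "\<exists>t. S t = x" for x
  proof -
    obtain n where n: "real n * L > \<bar>x\<bar>" using reals_Archimedean3[OF Lpos] by blast
    have S0: "S 0 = 0" by (simp add: S_def l_self)
    have 1: "S (real n * (2 * pi)) = real n * L" using Snat[of 0 n] S0 by simp
    have 2: "S (- (real n * (2 * pi))) = - (real n * L)" using Snat[of "- (real n * (2 * pi))" n] S0 by simp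
    have "\<exists>t. - (real n * (2 * pi)) \<le> t \<and> t \<le> real n * (2 * pi) \<and> S t = x"
    proof (rule IVT')
      show "- (real n * (2 * pi)) \<le> real n * (2 * pi)" by simp
    qed (use 1 2 n in \<open>auto intro: continuous_on_subset[OF Scont]\<close>)
    then show ?thesis by blast
  qed
  define K where "K = inv S"
  have SK: "S (K x) = x" for x unfolding K_def by (rule f_inv_into_f) (use surj in \<open>metis rangeI\<close>)
  have KS: "K (S t) = t" for t unfolding K_def by (rule inv_f_f) (rule strict_mono_imp_inj_on[OF Smono])
  have Kmono: "strict_mono K"
    by (rule strict_monoI) (metis SK Smono strict_mono_less)
  have Kcont: "continuous_on UNIV K"
  proof (rule continuous_onI_mono)
    have "range K = UNIV" using KS by (metis surjI)
    then show "open (range K)" by simp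
    show "K x \<le> K y" if "x \<le> y" for x y using Kmono that by (simp add: strict_mono_less_eq)
  qed
  have Kper: "K (x + L) = K x + 2 * pi" for x
    by (metis KS SK Sper)
  define \<gamma> where "\<gamma> t = radial (K t)" for t
  have \<gamma>cont: "continuous_on A \<gamma>" for A
    unfolding \<gamma>_def by (rule continuous_on_compose2[OF cont continuous_on_subset[OF Kcont]]) auto
  have \<gamma>per: "\<gamma> (t + L) = \<gamma> t" for t by (simp add: \<gamma>_def Kper per)
  have "arclength_parametrization \<Omega> L \<gamma>"
    unfolding arclength_parametrization_def
  proof (intro conjI allI impI ballI)
    show "range \<gamma> = frontier \<Omega>"
    proof -
      have "radial t \<in> range \<gamma>" for t by (rule image_eqI[of _ _ "S t"]) (auto simp: \<gamma>_def KS)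
      then show ?thesis unfolding range_radial[symmetric] by (auto simp: \<gamma>_def)
    qed
    show "inj_on \<gamma> {0..<L}"
    proof (rule inj_onI)
      fix x y assume xy: "x \<in> {0..<L}" "y \<in> {0..<L}" "\<gamma> x = \<gamma> y"
      have b: "K 0 \<le> K z \<and> K z < K 0 + 2 * pi" if "z \<in> {0..<L}" for z
        using that Kper[of 0] Kmono by (metis add_0 atLeastLessThan_iff strict_mono_less strict_mono_less_eq)
      have "K x = K y"
      proof (rule cis_eq_imp_eq)
        show "cis (K x) = cis (K y)" by (rule radial_eq_imp) (use xy(3) in \<open>simp add: \<gamma>_def\<close>)
        show "\<bar>K x - K y\<bar> < 2 * pi" using b[OF xy(1)] b[OF xy(2)] by linarith
      qed
      then show "x = y" by (metis SK)
    qed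
    show "curve_length \<gamma> a b = ennreal (b - a)" if "a \<le> b" for a b
    proof -
      have "curve_length \<gamma> a b = curve_length radial (K a) (K b)"
        unfolding \<gamma>_def[abs_def]
        by (rule curve_length_comp[of K S]) (auto simp: KS SK strict_mono_mono Kmono Smono)
      also have "\<dots> = ennreal (l (K a) (K b))"
        using that Kmono by (intro len) (simp add: strict_mono_less_eq)
      also have "l (K a) (K b) = b - a"
        using Sdiff[of "K a" "K b"] that Kmono by (simp add: strict_mono_less_eq SK)
      finally show ?thesis .
    qed
    fix z assume z: "z \<in> interior \<Omega>"
    let ?p = "\<lambda>u. \<gamma> (L * u)"
    have path: "path ?p" unfolding path_def by (intro continuous_on_compose2[OF \<gamma>cont[of UNIV]] continuous_intros) auto
    have img: "path_image ?p \<subseteq> frontier \<Omega>" unfolding path_image_def range_radial[symmetric] by (auto simp: \<gamma>_def)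
    have loop: "pathfinish ?p = pathstart ?p" using \<gamma>per[of 0] by (simp add: pathfinish_def pathstart_def)
    have disj: "interior \<Omega> \<inter> path_image ?p = {}" using img by (auto simp: frontier_def)
    have "winding_number ?p z = winding_number ?p center"
      by (rule winding_number_eq[OF path loop z center _ disj])
        (simp add: convex_connected convex_interior convex_\<Omega>)
    also have "\<dots> = 1"
    proof -
      have nz: "center \<notin> path_image ?p" using disj center by auto
      obtain r where "path r" and r: "pathfinish r - pathstart r = 2 * of_real pi * \<i> * winding_number ?p center"
        and re: "\<And>t. t \<in> {0..1} \<Longrightarrow> ?p t = center + exp (r t)"
        using winding_number_as_continuous_log[OF path nz] by blast
      \<comment> \<open>An explicit logarithm with the polar angle as imaginary part; it differs by
        a constant from the one whose increment is the winding number.\<close>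
      define q where "q u = of_real (ln (radius (cis (K (L * u))))) + \<i> * of_real (K (L * u))" for u
      have qe: "?p u = center + exp (q u)" for u
        using radius(1)[of "cis (K (L * u))"]
        by (simp add: q_def \<gamma>_def radial_def exp_add exp_of_real scaleR_conv_of_real flip: cis_conv_exp)
      have rad: "radius (cis (K (L * u))) = cmod (?p u - center)" for u
        using radius(1)[of "cis (K (L * u))"] by (simp add: \<gamma>_def radial_def)
      have ne: "cmod (?p u - center) \<noteq> 0" for u
        using radius(1)[of "cis (K (L * u))"] unfolding rad[symmetric] by simp
      have "continuous_on {0..1} q"
        unfolding q_def rad using ne
        by (intro continuous_intros continuous_on_compose2[OF \<gamma>cont[of UNIV]] continuous_on_compose2[OF Kcont]) auto
      then have "(\<lambda>u. q u - r u) constant_on {0..1}"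
        using \<open>path r\<close> qe re
        by (intro exp_eq_1_imp_constant_on continuous_intros) (auto simp: path_def exp_diff)
      then obtain d where "\<And>u. u \<in> {0..1} \<Longrightarrow> q u - r u = d" unfolding constant_on_def by blast
      from this[of 0] this[of 1] have "q 1 - q 0 = r 1 - r 0" by (simp add: algebra_simps)
      moreover have "q 1 - q 0 = 2 * of_real pi * \<i>"
        using Kper[of 0] \<gamma>per[of 0] unfolding q_def rad by (simp add: algebra_simps)
      ultimately have "2 * of_real pi * \<i> * winding_number ?p center = 2 * of_real pi * \<i>"
        using r by (simp only: pathfinish_def pathstart_def)
      then show ?thesis by simp
    qed
    finally show "winding_number ?p z = 1" .
  qed (use Lpos \<gamma>cont \<gamma>per in auto)
  then show ?thesis by blast
qed

end

lemma (in convex_body) convex_curve_boundary: "convex_curve \<Omega> (perimeter \<Omega>) (boundary_curve \<Omega>)"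
proof
  have "\<exists>\<gamma>. arclength_parametrization \<Omega> (perimeter \<Omega>) \<gamma>"
    unfolding perimeter_def by (rule someI_ex) (rule arclength_parametrization_exists)
  then show "arclength_parametrization \<Omega> (perimeter \<Omega>) (boundary_curve \<Omega>)"
    unfolding boundary_curve_def by (rule someI_ex)
qed (rule compact_\<Omega> convex_\<Omega> interior_\<Omega>)+

section \<open>Polynomials of an operator\<close>

lemma scaleC_one [simp]: "1 *\<^sub>C (x :: 'a::complex_hilbert_space) = x"
  using scaleC_of_real[of 1 x] by simp

lemma scaleC_zero_left [simp]: "0 *\<^sub>C (x :: 'a::complex_hilbert_space) = 0"
  using scaleC_of_real[of 0 x] by simp

lemma scaleC_minus_left: "(- c) *\<^sub>C (x :: 'a::complex_hilbert_space) = - (c *\<^sub>C x)"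
  using scaleC_add_left[of c "-c" x] by (simp add: eq_neg_iff_add_eq_0 add.commute)

lemma scaleC_zero_right [simp]: "c *\<^sub>C (0 :: 'a::complex_hilbert_space) = 0"
  using bounded_linear_scaleC[of c] by (rule linear_simps(3))

lemma scaleC_diff_right: "c *\<^sub>C ((x :: 'a::complex_hilbert_space) - y) = c *\<^sub>C x - c *\<^sub>C y"
  using bounded_linear_scaleC[of c] by (rule linear_simps(2))

lemma scaleC_diff_left: "(c - d) *\<^sub>C (x :: 'a::complex_hilbert_space) = c *\<^sub>C x - d *\<^sub>C x"
  using scaleC_add_left[of c "-d" x] by (simp add: scaleC_minus_left)

lemma scaleC_sum_right: "c *\<^sub>C (\<Sum>i\<in>A. f i) = (\<Sum>i\<in>A. c *\<^sub>C (f i :: 'a::complex_hilbert_space))"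
  by (induction A rule: infinite_finite_induct) (auto simp: scaleC_add_right)

lemma cinner_add_right: "cinner x (y + z) = cinner x y + cinner x (z :: 'a::complex_hilbert_space)"
  by (metis cinner_add_left cinner_commute complex_cnj_add)

lemma cinner_scaleC_right: "cinner x (c *\<^sub>C y) = cnj c * cinner x (y :: 'a::complex_hilbert_space)"
  by (metis cinner_commute cinner_scaleC_left complex_cnj_mult)

lemma cinner_zero_left [simp]: "cinner 0 (x :: 'a::complex_hilbert_space) = 0"
  using cinner_add_left[of 0 0 x] by simp

lemma cinner_zero_right [simp]: "cinner (x :: 'a::complex_hilbert_space) 0 = 0"
  using cinner_add_right[of x 0 0] by simp

lemma cinner_minus_left: "cinner (- x) y = - cinner x (y :: 'a::complex_hilbert_space)"
  using cinner_add_left[of x "-x" y] by (simp add: eq_neg_iff_add_eq_0 add.commute)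

lemma cinner_minus_right: "cinner x (- y) = - cinner x (y :: 'a::complex_hilbert_space)"
  using cinner_add_right[of x y "-y"] by (simp add: eq_neg_iff_add_eq_0 add.commute)

lemma cinner_diff_left: "cinner (x - y) z = cinner x z - cinner y (z :: 'a::complex_hilbert_space)"
  using cinner_add_left[of x "-y" z] by (simp add: cinner_minus_left)

lemma cinner_diff_right: "cinner x (y - z) = cinner x y - cinner x (z :: 'a::complex_hilbert_space)"
  using cinner_add_right[of x y "-z"] by (simp add: cinner_minus_right)

lemma cinner_scaleR_left: "cinner (r *\<^sub>R x) y = of_real r * cinner x (y :: 'a::complex_hilbert_space)"
  by (metis cinner_scaleC_left scaleC_of_real)

lemma cinner_sum_left: "cinner (\<Sum>i\<in>A. f i) y = (\<Sum>i\<in>A. cinner (f i) (y :: 'a::complex_hilbert_space))"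
  by (induction A rule: infinite_finite_induct) (auto simp: cinner_add_left)

text \<open>The device that turns a modulus into a real part; at zero any rotation will do.\<close>

lemma unimodular_rotation: obtains c where "cmod c = 1" "c * z = of_real (cmod z)"
proof (cases "z = 0")
  case False
  show ?thesis
    by (rule that[of "cnj z / of_real (cmod z)"])
      (use False in \<open>simp_all add: norm_divide complex_norm_square[symmetric] power2_eq_square mult.commute[of "cnj z"]\<close>)
qed (use that[of 1] in simp)

lemma cmod_cinner_le: "cmod (cinner x y) \<le> norm x * norm (y :: 'a::complex_hilbert_space)"
proof -
  obtain c where c: "cmod c = 1" "c * cinner x y = of_real (cmod (cinner x y))" by (rule unimodular_rotation)
  have "cmod (cinner x y) = Re (c * cinner x y)" using c by simp
  also have "\<dots> = inner (c *\<^sub>C x) y" by (simp add: Re_cinner[symmetric] cinner_scaleC_left)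
  also have "\<dots> \<le> norm (c *\<^sub>C x) * norm y" by (rule norm_cauchy_schwarz)
  finally show ?thesis using c by (simp add: norm_scaleC)
qed

lemma bounded_linear_cinner_left: "bounded_linear (\<lambda>x. cinner x (y :: 'a::complex_hilbert_space))"
  by (rule bounded_linear_intro[where K = "norm y"])
    (auto simp: cinner_add_left cinner_scaleR_left scaleR_conv_of_real cmod_cinner_le)

lemma cinner_self_norm: "Re (cinner x x) = (norm (x :: 'a::complex_hilbert_space))\<^sup>2"
  by (simp add: cinner_self)

lemma norm_le_of_cinner:
  assumes "B \<ge> 0" "\<And>y. cmod (cinner (x :: 'a::complex_hilbert_space) y) \<le> B * norm y" shows "norm x \<le> B"
proof (cases "x = 0")
  case False
  have "(norm x)\<^sup>2 \<le> B * norm x" using assms(2)[of x] by (simp add: cinner_self norm_power)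
  then show ?thesis using False by (simp add: power2_eq_square)
qed (use assms in simp)

text \<open>The type of bounded linear maps knows real scalars only, so complex homogeneity is a
  separate property.\<close>

definition clinear_op :: "('a::complex_hilbert_space \<Rightarrow>\<^sub>L 'a) \<Rightarrow> bool"
  where "clinear_op T \<longleftrightarrow> (\<forall>c x. T (c *\<^sub>C x) = c *\<^sub>C T x)"

section \<open>Algebra of polynomials of an operator\<close>

lemma poly_op_eq_sum: "degree p \<le> n \<Longrightarrow> poly_op p T x = (\<Sum>i\<le>n. coeff p i *\<^sub>C (blinfun_apply T ^^ i) x)"
  unfolding poly_op.rep_eq
  by (rule sum.mono_neutral_left) (auto simp: coeff_eq_0)

lemma poly_op_0 [simp]: "poly_op 0 T = 0"
  by (rule blinfun_eqI) (simp add: poly_op.rep_eq)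

lemma poly_op_add: "poly_op (p + q) T = poly_op p T + poly_op q T"
proof (rule blinfun_eqI)
  fix x
  have "degree p \<le> max (degree p) (degree q)" "degree q \<le> max (degree p) (degree q)"
    "degree (p + q) \<le> max (degree p) (degree q)" by (auto intro: degree_add_le)
  then show "poly_op (p + q) T x = (poly_op p T + poly_op q T) x"
    by (simp add: poly_op_eq_sum[of _ "max (degree p) (degree q)"] blinfun.add_left scaleC_add_left sum.distrib)
qed

lemma poly_op_smult: "poly_op (smult c p) T x = c *\<^sub>C poly_op p T x"
  by (simp add: poly_op_eq_sum[OF degree_smult_le] poly_op.rep_eq scaleC_scaleC scaleC_sum_right)

lemma poly_op_pCons: "poly_op (pCons a p) T x = a *\<^sub>C x + poly_op p T (T x)"
proof -
  have "poly_op (pCons a p) T x = (\<Sum>i\<le>Suc (degree p). coeff (pCons a p) i *\<^sub>C (blinfun_apply T ^^ i) x)"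
    by (rule poly_op_eq_sum) (simp add: degree_pCons_le)
  also have "\<dots> = a *\<^sub>C x + (\<Sum>i\<le>degree p. coeff p i *\<^sub>C (blinfun_apply T ^^ i) (T x))"
    by (simp add: sum.atMost_Suc_shift funpow_swap1 del: sum.atMost_Suc)
  finally show ?thesis by (simp add: poly_op.rep_eq)
qed

lemma poly_op_1 [simp]: "poly_op 1 T x = x"
  by (simp add: one_pCons poly_op_pCons)

lemma poly_op_diff: "poly_op (p - q) T = poly_op p T - poly_op q T"
  using poly_op_add[of "p - q" q T] by (simp add: algebra_simps)

lemma poly_op_sum: "poly_op (\<Sum>i\<in>A. p i) T = (\<Sum>i\<in>A. poly_op (p i) T)"
  by (induction A rule: infinite_finite_induct) (auto simp: poly_op_add)

lemma norm_poly_op_smult: "norm (poly_op (smult c p) T) = cmod c * norm (poly_op p T)"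
proof (rule antisym)
  have *: "norm (poly_op (smult c p) T) \<le> cmod c * norm (poly_op p T)" for c p
  proof (rule norm_blinfun_bound)
    fix x
    have "norm (poly_op p T x) \<le> norm (poly_op p T) * norm x" by (rule norm_blinfun)
    then show "norm (poly_op (smult c p) T x) \<le> cmod c * norm (poly_op p T) * norm x"
      by (simp add: poly_op_smult norm_scaleC mult_left_mono mult.assoc)
  qed simp
  show "norm (poly_op (smult c p) T) \<le> cmod c * norm (poly_op p T)" by (rule *)
  show "cmod c * norm (poly_op p T) \<le> norm (poly_op (smult c p) T)"
  proof (cases "c = 0")
    case False
    then show ?thesis using *[of "1 / c" "smult c p"] by (simp add: norm_divide field_simps)
  qed simp
qed

lemma poly_op_commute:
  assumes "clinear_op T" shows "poly_op p T (T x) = T (poly_op p T x)"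
  using assms
  by (induction p arbitrary: x) (auto simp: poly_op_pCons blinfun.add_right clinear_op_def)

lemma clinear_poly_op: assumes "clinear_op T" shows "poly_op p T (c *\<^sub>C x) = c *\<^sub>C poly_op p T x"
  using assms
  by (induction p arbitrary: x) (auto simp: poly_op_pCons scaleC_add_right clinear_op_def scaleC_scaleC mult.commute)

lemma poly_op_mult:
  assumes "clinear_op T" shows "poly_op (p * q) T x = poly_op p T (poly_op q T x)"
proof (induction p arbitrary: x)
  case (pCons a p)
  have "poly_op (pCons a p * q) T x = a *\<^sub>C poly_op q T x + poly_op (p * q) T (T x)"
    by (simp add: poly_op_add blinfun.add_left poly_op_smult poly_op_pCons)
  then show ?case by (simp add: pCons.IH poly_op_pCons poly_op_commute[OF assms])
qed simp

text \<open>Contractions of \<open>T\<close> towards a point and shifts of \<open>T\<close> by a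
  scalar are all of this form.\<close>

lift_definition affine_op :: "complex \<Rightarrow> complex \<Rightarrow> ('a::complex_hilbert_space \<Rightarrow>\<^sub>L 'a) \<Rightarrow> 'a \<Rightarrow>\<^sub>L 'a"
  is "\<lambda>c r T x. c *\<^sub>C x + r *\<^sub>C T x"
proof (rule bounded_linear_add)
  fix c r and T :: "'a \<Rightarrow> 'a" assume "bounded_linear T"
  then show "bounded_linear (\<lambda>x. r *\<^sub>C T x)" by (rule bounded_linear_compose[OF bounded_linear_scaleC])
qed (rule bounded_linear_scaleC)

lemma clinear_affine_op: "clinear_op T \<Longrightarrow> clinear_op (affine_op c r T)"
  by (simp add: clinear_op_def affine_op.rep_eq scaleC_add_right scaleC_scaleC mult.commute)

lemma affine_op_0_1 [simp]: "affine_op 0 1 T = T"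
  by (rule blinfun_eqI) (simp add: affine_op.rep_eq)

lemma poly_op_pcompose:
  assumes "clinear_op T" shows "poly_op (pcompose p [:c, r:]) T x = poly_op p (affine_op c r T) x"
proof (induction p arbitrary: x)
  case (pCons a p)
  have "poly_op (pcompose (pCons a p) [:c, r:]) T x =
      a *\<^sub>C x + poly_op [:c, r:] T (poly_op (pcompose p [:c, r:]) T x)"
    by (simp add: pcompose_pCons poly_op_add blinfun.add_left poly_op_mult[OF assms] poly_op_pCons del: mult_pCons_left)
  also have "poly_op [:c, r:] T (poly_op (pcompose p [:c, r:]) T x) = affine_op c r T (poly_op p (affine_op c r T) x)"
    using assms by (simp add: pCons.IH poly_op_pCons affine_op.rep_eq)
  finally show ?case
    by (simp add: poly_op_pCons poly_op_commute[OF clinear_affine_op[OF assms]])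
qed simp

text \<open>One polynomial has to serve the scalar function and the operator at once. This stands in
  for a functional calculus of functions such as \<open>1 / (\<sigma> - z)\<close>.\<close>

definition poly_approximable ::
  "('a::complex_hilbert_space \<Rightarrow>\<^sub>L 'a) \<Rightarrow> complex set \<Rightarrow> (complex \<Rightarrow> complex) \<Rightarrow> ('a \<Rightarrow>\<^sub>L 'a) \<Rightarrow> bool"
  where "poly_approximable T \<Omega> \<phi> A \<longleftrightarrow>
    (\<forall>\<epsilon>>0. \<exists>p. (\<forall>z\<in>\<Omega>. cmod (poly p z - \<phi> z) \<le> \<epsilon>) \<and> norm (poly_op p T - A) \<le> \<epsilon>)"

definition is_resolvent :: "('a::complex_hilbert_space \<Rightarrow>\<^sub>L 'a) \<Rightarrow> complex \<Rightarrow> ('a \<Rightarrow>\<^sub>L 'a) \<Rightarrow> bool"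
  where "is_resolvent T \<sigma> R \<longleftrightarrow> (\<forall>x. \<sigma> *\<^sub>C R x - T (R x) = x) \<and> (\<forall>x. R (\<sigma> *\<^sub>C x - T x) = x)"

text \<open>Coercivity of \<open>\<sigma> - T\<close> at the vector \<open>R x\<close>, set against
  the Cauchy-Schwarz inequality.\<close>

lemma norm_resolvent_le:
  assumes R: "is_resolvent T \<sigma> R" and d: "d > 0" "cmod n = 1"
    and coercive: "\<And>x. Re (cnj n * cinner (\<sigma> *\<^sub>C x - T x) x) \<ge> d * (norm x)\<^sup>2"
  shows "norm (R x) \<le> norm x / d" "norm R \<le> 1 / d"
proof -
  show *: "norm (R x) \<le> norm x / d" for x
  proof (cases "R x = 0")
    case False
    have "d * (norm (R x))\<^sup>2 \<le> Re (cnj n * cinner x (R x))"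
      using coercive[of "R x"] R by (simp add: is_resolvent_def)
    also have "\<dots> \<le> cmod (cnj n * cinner x (R x))" by (rule complex_Re_le_cmod)
    also have "\<dots> \<le> norm x * norm (R x)" using cmod_cinner_le[of x "R x"] d by (simp add: norm_mult)
    finally have "(d * norm (R x)) * norm (R x) \<le> norm x * norm (R x)" by (simp add: power2_eq_square)
    then show ?thesis using False d by (simp add: field_simps)
  qed (use d in simp)
  show "norm R \<le> 1 / d" by (rule norm_blinfun_bound) (use * d in auto)
qed

text \<open>The Neumann series in a large disc that contains \<open>\<Omega>\<close> and the numerical range, but not \<open>\<sigma>\<close>.\<close>

lemma resolvent_poly_approximable:
  assumes T: "clinear_op T" and n: "cmod n = 1" and d: "d > 0" and bdd: "bounded \<Omega>"
    and op: "\<And>x. Re (cnj n * cinner (\<sigma> *\<^sub>C x - T x) x) \<ge> d * (norm x)\<^sup>2"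
    and set: "\<And>z. z \<in> \<Omega> \<Longrightarrow> Re (cnj n * (\<sigma> - z)) \<ge> d"
  obtains R where "is_resolvent T \<sigma> R" "poly_approximable T \<Omega> (\<lambda>z. 1 / (\<sigma> - z)) R"
proof -
  obtain b where b: "\<And>z. z \<in> \<Omega> \<Longrightarrow> cmod z \<le> b" using bdd by (auto simp: bounded_iff)
  define M where "M = cmod \<sigma> + norm T + \<bar>b\<bar> + d"
  have M: "M > 0" "d \<le> M" using d by (auto simp: M_def add_nonneg_pos)
  have Mop: "norm (\<sigma> *\<^sub>C x - T x) \<le> M * norm x" for x
  proof -
    have "norm (\<sigma> *\<^sub>C x - T x) \<le> cmod \<sigma> * norm x + norm T * norm x"
      using norm_triangle_ineq4[of "\<sigma> *\<^sub>C x" "T x"] norm_blinfun[of T x] by (simp add: norm_scaleC)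
    also have "\<dots> \<le> M * norm x" using d by (simp add: M_def algebra_simps)
    finally show ?thesis .
  qed
  have Mset: "cmod (\<sigma> - z) \<le> M" if "z \<in> \<Omega>" for z
    using norm_triangle_ineq4[of \<sigma> z] b[OF that] d norm_ge_zero[of T] abs_ge_self[of b] unfolding M_def by linarith
  \<comment> \<open>The radius for which \<open>\<rho>\<^sup>2 - 2 * \<rho> * d + M\<^sup>2\<close>
    becomes \<open>\<rho>\<^sup>2 - \<rho> * d\<close>, less than the squared radius. The centre
    \<open>c\<close> lies at distance \<open>\<rho>\<close> from \<open>\<sigma>\<close>, so
    \<open>\<sigma>\<close> is on the circle itself.\<close>
  define \<rho> where "\<rho> = M\<^sup>2 / d"
  have \<rho>: "\<rho> > 0" "\<rho> * d = M\<^sup>2" using M d by (auto simp: \<rho>_def)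
  have "d * d \<le> M * M" using M d by (intro mult_mono) auto
  then have d\<rho>: "d \<le> \<rho>" using d by (simp add: \<rho>_def power2_eq_square field_simps)
  define q where "q = sqrt (1 - d / \<rho>)"
  have q: "0 \<le> q" "q < 1" "q\<^sup>2 = 1 - d / \<rho>" using d \<rho> d\<rho> by (auto simp: q_def)
  have \<rho>q: "(\<rho> * q)\<^sup>2 = \<rho>\<^sup>2 - 2 * \<rho> * d + M\<^sup>2"
  proof -
    have "\<rho>\<^sup>2 * (1 - d / \<rho>) = \<rho>\<^sup>2 - \<rho> * d" using \<rho>(1) by (simp add: field_simps power2_eq_square)
    then show ?thesis using \<rho>(2) q(3) by (simp add: power_mult_distrib)
  qed
  have n0: "n \<noteq> 0" using n by auto
  define c where "c = \<sigma> - of_real \<rho> * n"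
  \<comment> \<open>Normalized so that \<open>1 - u\<close> is \<open>\<sigma> - z\<close> divided
    by \<open>of_real \<rho> * n\<close>; the Neumann series becomes a geometric series in
    \<open>u\<close>.\<close>
  define u where "u = smult (1 / (of_real \<rho> * n)) [:- c, 1:]"
  have un: "of_real \<rho> * n \<noteq> 0" "cmod (of_real \<rho> * n) = \<rho>" using \<rho> n0 n by (auto simp: norm_mult)
  have uset: "cmod (poly u z) \<le> q" if z: "z \<in> \<Omega>" for z
  proof -
    have "(cmod (z - c))\<^sup>2 = (cmod (of_real \<rho> * n - (\<sigma> - z)))\<^sup>2" by (simp add: c_def algebra_simps)
    also have "\<dots> = \<rho>\<^sup>2 * (cmod n)\<^sup>2 - 2 * \<rho> * Re (cnj n * (\<sigma> - z)) + (cmod (\<sigma> - z))\<^sup>2"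
      unfolding cmod_power2 by (simp add: power2_eq_square algebra_simps)
    also have "\<dots> \<le> (\<rho> * q)\<^sup>2"
    proof -
      have "\<rho> * d \<le> \<rho> * Re (cnj n * (\<sigma> - z))" using set[OF z] \<rho> by (intro mult_left_mono) auto
      moreover have "(cmod (\<sigma> - z))\<^sup>2 \<le> M\<^sup>2" using Mset[OF z] by (intro power_mono) auto
      ultimately show ?thesis unfolding \<rho>q n mult.assoc power_one mult_1_right by linarith
    qed
    finally have "cmod (z - c) \<le> \<rho> * q" by (rule power2_le_imp_le) (use \<rho> q in simp)
    then show ?thesis using un \<rho> by (simp add: u_def norm_mult norm_divide field_simps)
  qed
  have uapply: "poly_op u T x = (1 / (of_real \<rho> * n)) *\<^sub>C (T x - c *\<^sub>C x)" for x
    by (simp add: u_def poly_op_smult poly_op_pCons scaleC_minus_left scaleC_diff_right scaleC_scaleC)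
  have uop: "norm (poly_op u T x) \<le> q * norm x" for x
  proof -
    have "T x - c *\<^sub>C x = (of_real \<rho> * n) *\<^sub>C x - (\<sigma> *\<^sub>C x - T x)" by (simp add: c_def scaleC_diff_left)
    then have "(norm (T x - c *\<^sub>C x))\<^sup>2 = Re (cinner ((of_real \<rho> * n) *\<^sub>C x - (\<sigma> *\<^sub>C x - T x)) ((of_real \<rho> * n) *\<^sub>C x - (\<sigma> *\<^sub>C x - T x)))"
      by (simp only: cinner_self_norm)
    also have "\<dots> = \<rho>\<^sup>2 * (norm x)\<^sup>2 - 2 * \<rho> * Re (cnj n * cinner (\<sigma> *\<^sub>C x - T x) x) + (norm (\<sigma> *\<^sub>C x - T x))\<^sup>2"
    proof -
      define y where "y = \<sigma> *\<^sub>C x - T x"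
      have "cinner x y = cnj (cinner y x)" by (rule cinner_commute)
      then have "cinner ((of_real \<rho> * n) *\<^sub>C x - y) ((of_real \<rho> * n) *\<^sub>C x - y) =
         of_real (\<rho>\<^sup>2) * (n * cnj n) * of_real ((norm x)\<^sup>2)
          - (of_real \<rho> * (cnj n * cinner y x) + cnj (of_real \<rho> * (cnj n * cinner y x))) + of_real ((norm y)\<^sup>2)"
        by (simp add: cinner_diff_left cinner_diff_right cinner_scaleC_left cinner_scaleC_right cinner_self[of x] cinner_self[of y] algebra_simps power2_eq_square)
      also have "n * cnj n = 1" using complex_norm_square[of n] n by simp
      finally show ?thesis by (simp add: y_def[symmetric] del: of_real_power)
    qed
    also have "\<dots> \<le> \<rho>\<^sup>2 * (norm x)\<^sup>2 - 2 * \<rho> * (d * (norm x)\<^sup>2) + (M * norm x)\<^sup>2"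
      using op[of x] power_mono[OF Mop[of x], of 2] \<rho> by (intro add_mono diff_mono mult_left_mono) auto
    also have "\<dots> = (\<rho> * q * norm x)\<^sup>2"
      unfolding power_mult_distrib[of "\<rho> * q"] \<rho>q by (simp add: power_mult_distrib algebra_simps)
    finally have "norm (T x - c *\<^sub>C x) \<le> \<rho> * q * norm x" by (rule power2_le_imp_le) (use \<rho> q in simp)
    then show ?thesis using un \<rho> by (simp add: uapply norm_scaleC norm_divide field_simps)
  qed
  have upow: "norm (poly_op (u ^ k) T) \<le> q ^ k" for k
  proof (rule norm_blinfun_bound)
    show "norm (poly_op (u ^ k) T x) \<le> q ^ k * norm x" for x
    proof (induction k)
      case (Suc k)
      have "norm (poly_op (u ^ Suc k) T x) \<le> q * norm (poly_op (u ^ k) T x)"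
        using uop by (simp add: poly_op_mult[OF T])
      also have "\<dots> \<le> q * (q ^ k * norm x)" by (intro mult_left_mono Suc q)
      finally show ?case by (simp add: mult.assoc)
    qed simp
  qed (use q in simp)
  define w where "w = 1 / (of_real \<rho> * n)"
  have wn: "cmod w = 1 / \<rho>" "w \<noteq> 0" using un by (auto simp: w_def norm_divide)
  define p where "p N = (\<Sum>k<N. smult w (u ^ k))" for N
  have "summable (\<lambda>k. poly_op (smult w (u ^ k)) T)"
  proof (rule summable_comparison_test'[of "\<lambda>k. (1 / \<rho>) * q ^ k" 0])
    show "summable (\<lambda>k. (1 / \<rho>) * q ^ k)" using q by (intro summable_mult summable_geometric) auto
    show "norm (poly_op (smult w (u ^ k)) T) \<le> (1 / \<rho>) * q ^ k" for k
      unfolding norm_poly_op_smult wn by (rule mult_left_mono[OF upow]) (use \<rho> in simp)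
  qed
  then obtain R where R: "(\<lambda>N. poly_op (p N) T) \<longlonglongrightarrow> R"
    unfolding p_def poly_op_sum summable_def sums_def by blast
  have poly_p: "[:\<sigma>, -1:] * p N = 1 - u ^ N" for N
  proof -
    have eq: "smult w [:\<sigma>, -1:] = 1 - u"
      using un by (simp add: w_def u_def c_def one_pCons field_simps)
    have "[:\<sigma>, -1:] * p N = smult w [:\<sigma>, -1:] * (\<Sum>k<N. u ^ k)"
      by (simp only: p_def sum_distrib_left mult_smult_right mult_smult_left)
    also have "\<dots> = 1 - u ^ N" unfolding eq by (rule one_diff_power_eq[symmetric])
    finally show ?thesis .
  qed
  have shift: "poly_op [:\<sigma>, -1:] T x = \<sigma> *\<^sub>C x - T x" for x
    by (simp add: poly_op_pCons scaleC_minus_left)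
  have lim: "(\<lambda>N. poly_op (p N) T x) \<longlonglongrightarrow> R x" for x by (rule blinfun.tendsto[OF R tendsto_const])
  have qlim: "(\<lambda>N. q ^ N) \<longlonglongrightarrow> 0" using q by (intro LIMSEQ_power_zero) auto
  have ulim: "(\<lambda>N. poly_op (1 - u ^ N) T x) \<longlonglongrightarrow> x" for x
  proof -
    have "(\<lambda>N. poly_op (u ^ N) T x) \<longlonglongrightarrow> 0"
    proof (rule Lim_null_comparison)
      show "\<forall>\<^sub>F N in sequentially. norm (poly_op (u ^ N) T x) \<le> q ^ N * norm x"
      proof (intro always_eventually allI)
        fix N
        have "norm (poly_op (u ^ N) T x) \<le> norm (poly_op (u ^ N) T) * norm x" by (rule norm_blinfun)
        also have "\<dots> \<le> q ^ N * norm x" by (rule mult_right_mono[OF upow]) simp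
        finally show "norm (poly_op (u ^ N) T x) \<le> q ^ N * norm x" .
      qed
      show "(\<lambda>N. q ^ N * norm x) \<longlonglongrightarrow> 0" using tendsto_mult_right[OF qlim] by simp
    qed
    from tendsto_diff[OF tendsto_const[of x] this]
    show ?thesis by (simp add: poly_op_diff blinfun.diff_left)
  qed
  have "is_resolvent T \<sigma> R"
    unfolding is_resolvent_def
  proof (intro conjI allI)
    fix x
    have "(\<lambda>N. \<sigma> *\<^sub>C poly_op (p N) T x - T (poly_op (p N) T x)) \<longlonglongrightarrow> \<sigma> *\<^sub>C R x - T (R x)"
      by (rule tendsto_diff[OF bounded_linear.tendsto[OF bounded_linear_scaleC lim[of x]] blinfun.tendsto[OF tendsto_const lim[of x]]])
    moreover have "\<sigma> *\<^sub>C poly_op (p N) T x - T (poly_op (p N) T x) = poly_op (1 - u ^ N) T x" for N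
    proof -
      have "\<sigma> *\<^sub>C poly_op (p N) T x - T (poly_op (p N) T x) = poly_op ([:\<sigma>, -1:] * p N) T x"
        unfolding poly_op_mult[OF T] by (rule shift[symmetric])
      then show ?thesis by (simp only: poly_p)
    qed
    ultimately have "(\<lambda>N. poly_op (1 - u ^ N) T x) \<longlonglongrightarrow> \<sigma> *\<^sub>C R x - T (R x)" by (simp only:)
    then show "\<sigma> *\<^sub>C R x - T (R x) = x" by (rule LIMSEQ_unique[OF _ ulim])
    have "(\<lambda>N. poly_op (p N) T (\<sigma> *\<^sub>C x - T x)) \<longlonglongrightarrow> R (\<sigma> *\<^sub>C x - T x)" by (rule lim)
    moreover have "poly_op (p N) T (\<sigma> *\<^sub>C x - T x) = poly_op (1 - u ^ N) T x" for N
    proof -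
      have "poly_op (p N) T (\<sigma> *\<^sub>C x - T x) = poly_op (p N * [:\<sigma>, -1:]) T x"
        unfolding poly_op_mult[OF T] shift ..
      then show ?thesis by (simp only: mult.commute[of "p N"] poly_p)
    qed
    ultimately have "(\<lambda>N. poly_op (1 - u ^ N) T x) \<longlonglongrightarrow> R (\<sigma> *\<^sub>C x - T x)" by (simp only:)
    then show "R (\<sigma> *\<^sub>C x - T x) = x" by (rule LIMSEQ_unique[OF _ ulim])
  qed
  moreover have "poly_approximable T \<Omega> (\<lambda>z. 1 / (\<sigma> - z)) R"
    unfolding poly_approximable_def
  proof (intro allI impI)
    fix \<epsilon> :: real assume e: "\<epsilon> > 0"
    have "\<forall>\<^sub>F N in sequentially. q ^ N < \<epsilon> * d" using e d by (intro order_tendstoD(2)[OF qlim]) auto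
    moreover have "\<forall>\<^sub>F N in sequentially. dist (poly_op (p N) T) R < \<epsilon>" using R e by (rule tendstoD)
    ultimately have "\<forall>\<^sub>F N in sequentially. q ^ N < \<epsilon> * d \<and> dist (poly_op (p N) T) R < \<epsilon>" by (rule eventually_conj)
    then obtain N where N: "q ^ N < \<epsilon> * d" "dist (poly_op (p N) T) R < \<epsilon>"
      using eventually_happens'[OF sequentially_bot] by blast
    have "cmod (poly (p N) z - 1 / (\<sigma> - z)) \<le> \<epsilon>" if z: "z \<in> \<Omega>" for z
    proof -
      have dz: "d \<le> cmod (\<sigma> - z)"
        using order_trans[OF set[OF z] complex_Re_le_cmod] n by (simp add: norm_mult)
      then have nz: "\<sigma> - z \<noteq> 0" using d by auto
      have "poly ([:\<sigma>, -1:] * p N) z = poly (1 - u ^ N) z" unfolding poly_p ..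
      moreover have "poly ([:\<sigma>, -1:] * p N) z = poly (p N) z * (\<sigma> - z)"
        unfolding poly_mult by (simp add: mult.commute)
      moreover have "poly (1 - u ^ N) z = 1 - poly u z ^ N" by simp
      ultimately have "poly (p N) z * (\<sigma> - z) = 1 - poly u z ^ N" by (simp only:)
      then have "poly (p N) z = (1 - poly u z ^ N) / (\<sigma> - z)" using nz by (metis nonzero_mult_div_cancel_right)
      then have "poly (p N) z - 1 / (\<sigma> - z) = - (poly u z ^ N) / (\<sigma> - z)"
        by (simp add: diff_divide_distrib)
      then have "cmod (poly (p N) z - 1 / (\<sigma> - z)) = cmod (poly u z) ^ N / cmod (\<sigma> - z)"
        by (simp add: norm_divide norm_power)
      also have "\<dots> \<le> q ^ N / d" using uset[OF z] dz d q by (intro frac_le power_mono) auto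
      also have "\<dots> \<le> \<epsilon>" using N(1) d by (simp add: field_simps)
      finally show ?thesis .
    qed
    then show "\<exists>p. (\<forall>z\<in>\<Omega>. cmod (poly p z - 1 / (\<sigma> - z)) \<le> \<epsilon>) \<and> norm (poly_op p T - R) \<le> \<epsilon>"
      using N(2) by (intro exI[of _ "p N"]) (auto simp: dist_norm)
  qed
  ultimately show ?thesis using that by blast
qed

section \<open>The Cauchy integral of an operator over an expanded boundary\<close>

lemma cinner_scaleR_right: "cinner x (r *\<^sub>R y) = of_real r * cinner x (y :: 'a::complex_hilbert_space)"
  by (metis cinner_scaleC_right complex_cnj_complex_of_real scaleC_of_real)

lemma poly_has_primitive:
  fixes p :: "complex poly" shows "\<exists>H. \<forall>z. (H has_field_derivative poly p z) (at z)"
proof -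
  have "poly p holomorphic_on UNIV" by (intro holomorphic_intros)
  then obtain H where "\<And>z. z \<in> UNIV \<Longrightarrow> (H has_field_derivative poly p z) (at z)"
    using holomorphic_convex_primitive'[of UNIV "poly p"] by auto
  then show ?thesis by blast
qed

lemma is_resolvent_clinear:
  assumes "clinear_op T" "is_resolvent T \<sigma> R" shows "R (c *\<^sub>C x) = c *\<^sub>C R x"
proof -
  have "c *\<^sub>C x = c *\<^sub>C (\<sigma> *\<^sub>C R x - T (R x))" using assms(2) by (simp add: is_resolvent_def)
  also have "\<dots> = \<sigma> *\<^sub>C (c *\<^sub>C R x) - T (c *\<^sub>C R x)"
    using assms(1) by (simp add: clinear_op_def scaleC_diff_right scaleC_scaleC mult.commute)
  finally show ?thesis using assms(2) by (simp add: is_resolvent_def)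
qed

locale operator_in_convex = boundary_param \<Omega> for \<Omega> :: "complex set" +
  fixes T :: "'a::complex_hilbert_space \<Rightarrow>\<^sub>L 'a" and z0 :: complex and s :: real
  assumes T: "clinear_op T" and range_T: "\<And>x. norm x = 1 \<Longrightarrow> cinner (T x) x \<in> \<Omega>"
    and z0: "z0 \<in> interior \<Omega>" and s: "s > 1"
begin

text \<open>The boundary expanded about \<open>z0\<close>; it stays at a positive distance from the numerical range.\<close>

definition outer :: "real \<Rightarrow> complex" where "outer t = z0 + of_real s * (\<gamma> t - z0)"

definition gap :: real where "gap = (SOME d. d > 0 \<and> (\<forall>t. \<forall>z\<in>\<Omega>. Im (vel t * cnj (outer t - z)) \<ge> d))"

text \<open>The supporting line at a boundary point is at distance at least \<open>\<delta>\<close>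
  from \<open>z0\<close>, and the expansion moves it outward by \<open>s - 1\<close> times that
  distance.\<close>

lemma gap: "gap > 0" "z \<in> \<Omega> \<Longrightarrow> Im (vel t * cnj (outer t - z)) \<ge> gap"
proof -
  obtain \<delta> where \<delta>: "\<delta> > 0" "cball z0 \<delta> \<subseteq> \<Omega>" using z0 mem_interior_cball[of z0 \<Omega>] by auto
  have 1: "Im (vel t * cnj (\<gamma> t - z0)) \<ge> \<delta>" for t
  proof -
    \<comment> \<open>The point of the ball that lies furthest in the direction of the outward
      normal.\<close>
    have "z0 - of_real \<delta> * (\<i> * vel t) \<in> \<Omega>" using \<delta> by (auto simp: subset_iff dist_norm norm_mult)
    from Im_vel_cnj_nonneg[OF this, of t]
    have "Im (vel t * cnj (\<gamma> t - z0)) + Im (of_real \<delta> * (vel t * cnj (vel t) * (- \<i>))) \<ge> 0"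
      by (simp add: algebra_simps)
    moreover have "vel t * cnj (vel t) = 1" by (simp add: complex_norm_square[symmetric])
    ultimately show ?thesis by simp
  qed
  have "Im (vel t * cnj (outer t - z)) \<ge> (s - 1) * \<delta>" if z: "z \<in> \<Omega>" for t z
  proof -
    have "outer t - z = of_real (s - 1) * (\<gamma> t - z0) + (\<gamma> t - z)" by (simp add: outer_def algebra_simps)
    then have "vel t * cnj (outer t - z) = of_real (s - 1) * (vel t * cnj (\<gamma> t - z0)) + vel t * cnj (\<gamma> t - z)"
      by (simp only: complex_cnj_add complex_cnj_mult complex_cnj_complex_of_real distrib_left mult.left_commute)
    then have "Im (vel t * cnj (outer t - z)) = (s - 1) * Im (vel t * cnj (\<gamma> t - z0)) + Im (vel t * cnj (\<gamma> t - z))"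
      by (simp only: plus_complex.sel Im_complex_of_real times_complex.sel Re_complex_of_real mult_zero_left diff_zero add_0_left add_0_right)
    moreover have "(s - 1) * \<delta> \<le> (s - 1) * Im (vel t * cnj (\<gamma> t - z0))" using 1[of t] s by (intro mult_left_mono) auto
    ultimately show ?thesis using Im_vel_cnj_nonneg[OF z, of t] by simp
  qed
  moreover have "(s - 1) * \<delta> > 0" using s \<delta> by simp
  ultimately have "\<exists>d. d > 0 \<and> (\<forall>t. \<forall>z\<in>\<Omega>. Im (vel t * cnj (outer t - z)) \<ge> d)" by blast
  from someI_ex[OF this, folded gap_def]
  show "gap > 0" "z \<in> \<Omega> \<Longrightarrow> Im (vel t * cnj (outer t - z)) \<ge> gap" by auto
qed

lemma norm_outer_diff_ge: assumes "z \<in> \<Omega>" shows "cmod (outer t - z) \<ge> gap"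
proof -
  have "gap \<le> cmod (vel t * cnj (outer t - z))"
    using gap(2)[OF assms, of t] abs_Im_le_cmod[of "vel t * cnj (outer t - z)"] by linarith
  then show ?thesis by (simp add: norm_mult del: complex_cnj_diff)
qed

lemma outer_neq: "z \<in> \<Omega> \<Longrightarrow> outer t - z \<noteq> 0"
  using norm_outer_diff_ge[of z t] gap(1) by auto

lemma outer_lipschitz: "cmod (outer a - outer b) \<le> s * \<bar>a - b\<bar>"
proof -
  have "cmod (outer a - outer b) = s * cmod (\<gamma> a - \<gamma> b)"
  proof -
    have "outer a - outer b = of_real s * (\<gamma> a - \<gamma> b)" by (simp add: outer_def algebra_simps)
    then show ?thesis using s by (simp add: norm_mult)
  qed
  also have "\<dots> \<le> s * \<bar>a - b\<bar>"
    using s dist_\<gamma>_le[of a b] dist_\<gamma>_le[of b a]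
    by (intro mult_left_mono) (auto simp: norm_minus_commute abs_if)
  finally show ?thesis .
qed

lemma continuous_outer: "continuous_on A outer"
  unfolding outer_def by (intro continuous_intros continuous_\<gamma>)

lemma outer_periodic: "outer L = outer 0"
  using periodic_\<gamma>[of 0] by (simp add: outer_def)

lemma right_derivative_outer: "(outer has_vector_derivative of_real s * vel t) (at_right t)"
  unfolding outer_def[abs_def] using right_derivative_vel[of t]
  by (auto intro!: derivative_eq_intros)

text \<open>A homotopy from the scalar \<open>z0\<close> at \<open>u = 0\<close> to \<open>T\<close>
  at \<open>u = 1\<close>; by convexity the numerical ranges stay in \<open>\<Omega>\<close>. It
  reduces the integral of the resolvent to the scalar Cauchy integral.\<close>

definition scaled :: "real \<Rightarrow> 'a \<Rightarrow>\<^sub>L 'a"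
  where "scaled u = affine_op (of_real (1 - u) * z0) (of_real u) T"

definition shift :: "'a \<Rightarrow>\<^sub>L 'a" where "shift = affine_op (- z0) 1 T"

lemma scaled_apply: "scaled u x = z0 *\<^sub>C x + of_real u *\<^sub>C shift x"
  by (simp add: scaled_def shift_def affine_op.rep_eq scaleC_add_right scaleC_scaleC
      scaleC_add_left scaleC_diff_left scaleC_minus_left scaleC_diff_right left_diff_distrib)

lemma clinear_scaled: "clinear_op (scaled u)" and clinear_shift: "clinear_op shift"
  unfolding scaled_def shift_def by (rule clinear_affine_op[OF T])+

lemma scaled_1 [simp]: "scaled 1 = T" by (simp add: scaled_def)

lemma cinner_T_mem: "norm x = 1 \<Longrightarrow> 0 \<le> u \<Longrightarrow> u \<le> 1 \<Longrightarrow> cinner (scaled u x) x \<in> \<Omega>"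
proof -
  assume x: "norm x = 1" "0 \<le> u" "u \<le> 1"
  have "(1 - u) *\<^sub>R z0 + u *\<^sub>R cinner (T x) x \<in> \<Omega>"
    using x z0 interior_subset[of \<Omega>] by (intro convexD[OF convex_\<Omega>] range_T) auto
  then show ?thesis
    using x by (simp add: scaled_def affine_op.rep_eq cinner_add_left cinner_scaleC_left cinner_self scaleR_conv_of_real)
qed

text \<open>On unit vectors this is the distance between the numerical range and the expanded
  tangent, and homogeneity does the rest; \<open>- \<i> * vel t\<close> is the outward
  normal.\<close>

lemma coercive:
  assumes "0 \<le> u" "u \<le> 1"
  shows "gap * (norm x)\<^sup>2 \<le> Re (cnj (- \<i> * vel t) * cinner (outer t *\<^sub>C x - scaled u x) x)"
proof (cases "x = 0")
  case False
  define y where "y = (1 / norm x) *\<^sub>R x"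
  have y: "norm y = 1" "x = norm x *\<^sub>R y" using False by (auto simp: y_def)
  have yy: "cinner (outer t *\<^sub>C y - scaled u y) y = outer t - cinner (scaled u y) y"
    using y(1) by (simp add: cinner_diff_left cinner_scaleC_left cinner_self)
  have "scaled u x = norm x *\<^sub>R scaled u y" by (subst y(2)) (simp add: blinfun.scaleR_right)
  moreover have "outer t *\<^sub>C x = norm x *\<^sub>R (outer t *\<^sub>C y)"
    by (subst y(2)) (simp only: scaleC_of_real[symmetric] scaleC_scaleC mult.commute)
  ultimately have xx: "outer t *\<^sub>C x - scaled u x = norm x *\<^sub>R (outer t *\<^sub>C y - scaled u y)"
    by (simp add: scaleR_diff_right)
  have "cinner (outer t *\<^sub>C x - scaled u x) x = of_real ((norm x)\<^sup>2) * cinner (outer t *\<^sub>C y - scaled u y) y"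
  proof -
    have "cinner (outer t *\<^sub>C x - scaled u x) x = cinner (norm x *\<^sub>R (outer t *\<^sub>C y - scaled u y)) x" by (simp only: xx)
    also have "\<dots> = cinner (norm x *\<^sub>R (outer t *\<^sub>C y - scaled u y)) (norm x *\<^sub>R y)" by (rule arg_cong[OF y(2)])
    finally show ?thesis by (simp only: cinner_scaleR_left cinner_scaleR_right power2_eq_square of_real_mult mult.assoc)
  qed
  moreover have "Re (cnj (- \<i> * vel t) * (of_real ((norm x)\<^sup>2) * w)) = (norm x)\<^sup>2 * Im (vel t * cnj w)" for w
    by (simp add: algebra_simps)
  ultimately have "Re (cnj (- \<i> * vel t) * cinner (outer t *\<^sub>C x - scaled u x) x) =
      (norm x)\<^sup>2 * Im (vel t * cnj (outer t - cinner (scaled u y) y))"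
    unfolding yy by (simp only:)
  moreover have "(norm x)\<^sup>2 * gap \<le> (norm x)\<^sup>2 * Im (vel t * cnj (outer t - cinner (scaled u y) y))"
    by (intro mult_left_mono gap(2) cinner_T_mem y assms) simp
  ultimately show ?thesis by (simp add: mult.commute)
qed simp

section \<open>The resolvent along the expanded curve\<close>

definition resolv :: "real \<Rightarrow> real \<Rightarrow> 'a \<Rightarrow>\<^sub>L 'a"
  where "resolv u t = (SOME R. is_resolvent (scaled u) (outer t) R \<and>
    poly_approximable (scaled u) \<Omega> (\<lambda>z. 1 / (outer t - z)) R)"

lemma resolv:
  assumes "0 \<le> u" "u \<le> 1"
  shows "is_resolvent (scaled u) (outer t) (resolv u t)"
    "poly_approximable (scaled u) \<Omega> (\<lambda>z. 1 / (outer t - z)) (resolv u t)"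
proof -
  have 1: "cmod (- \<i> * vel t) = 1" by (simp add: norm_mult)
  have 2: "gap \<le> Re (cnj (- \<i> * vel t) * (outer t - z))" if "z \<in> \<Omega>" for z
    using gap(2)[OF that, of t] by (simp add: algebra_simps)
  have "\<exists>R. is_resolvent (scaled u) (outer t) R \<and> poly_approximable (scaled u) \<Omega> (\<lambda>z. 1 / (outer t - z)) R"
    by (rule resolvent_poly_approximable[OF clinear_scaled 1 gap(1) compact_imp_bounded[OF compact_\<Omega>] coercive[OF assms] 2]) blast+
  from someI_ex[OF this, folded resolv_def]
  show "is_resolvent (scaled u) (outer t) (resolv u t)"
    "poly_approximable (scaled u) \<Omega> (\<lambda>z. 1 / (outer t - z)) (resolv u t)" by auto
qed

lemma resolv_right: "0 \<le> u \<Longrightarrow> u \<le> 1 \<Longrightarrow> outer t *\<^sub>C resolv u t x - scaled u (resolv u t x) = x"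
  and resolv_left: "0 \<le> u \<Longrightarrow> u \<le> 1 \<Longrightarrow> resolv u t (outer t *\<^sub>C x - scaled u x) = x"
  using resolv(1) by (auto simp: is_resolvent_def)

lemma norm_resolv_le: assumes "0 \<le> u" "u \<le> 1" shows "norm (resolv u t x) \<le> norm x / gap"
  by (rule norm_resolvent_le(1)[OF resolv(1)[OF assms] gap(1) _ coercive[OF assms]]) (simp add: norm_mult)

lemma resolv_clinear: "0 \<le> u \<Longrightarrow> u \<le> 1 \<Longrightarrow> resolv u t (c *\<^sub>C x) = c *\<^sub>C resolv u t x"
  by (rule is_resolvent_clinear[OF clinear_scaled resolv(1)])

text \<open>The two resolvent identities, in the spectral parameter here and in the operator in
  \<open>resolv_diff_u\<close>, supply the Lipschitz bounds and derivatives used below.\<close>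

lemma resolv_diff_t:
  assumes "0 \<le> u" "u \<le> 1"
  shows "resolv u a x - resolv u b x = (outer b - outer a) *\<^sub>C resolv u a (resolv u b x)"
proof -
  define y where "y = resolv u b x"
  have "outer a *\<^sub>C y - scaled u y = x + (outer a - outer b) *\<^sub>C y"
    using resolv_right[OF assms, of b x] by (simp add: y_def scaleC_diff_left algebra_simps)
  then have "resolv u a (x + (outer a - outer b) *\<^sub>C y) = y" using resolv_left[OF assms, of a y] by simp
  then have "resolv u a x + (outer a - outer b) *\<^sub>C resolv u a y = y"
    by (simp add: blinfun.add_right resolv_clinear[OF assms])
  then show ?thesis by (simp add: y_def scaleC_diff_left algebra_simps)
qed

lemma resolv_diff_u:
  assumes "0 \<le> u" "u \<le> 1" "0 \<le> u'" "u' \<le> 1"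
  shows "resolv u' t x - resolv u t x = of_real (u' - u) *\<^sub>C resolv u' t (shift (resolv u t x))"
proof -
  define y where "y = resolv u t x"
  have "outer t *\<^sub>C y - scaled u' y = x - of_real (u' - u) *\<^sub>C shift y"
    using resolv_right[OF assms(1,2), of t x] by (simp add: y_def scaled_apply scaleC_diff_left algebra_simps)
  then have "resolv u' t (x - of_real (u' - u) *\<^sub>C shift y) = y" using resolv_left[OF assms(3,4), of t y] by simp
  then have "resolv u' t x - of_real (u' - u) *\<^sub>C resolv u' t (shift y) = y"
    by (simp only: blinfun.diff_right resolv_clinear[OF assms(3,4)])
  then show ?thesis by (simp add: y_def algebra_simps)
qed

lemma resolv_shift_commute:
  assumes "0 \<le> u" "u \<le> 1" shows "resolv u t (shift x) = shift (resolv u t x)"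
proof -
  define y where "y = resolv u t x"
  have "shift x = shift (outer t *\<^sub>C y - scaled u y)" using resolv_right[OF assms, of t x] by (simp add: y_def)
  also have "\<dots> = outer t *\<^sub>C shift y - scaled u (shift y)"
    using clinear_shift by (simp add: scaled_apply clinear_op_def blinfun.diff_right blinfun.add_right)
  finally show ?thesis using resolv_left[OF assms, of t "shift y"] by (simp add: y_def)
qed

lemma resolv_dist:
  assumes "0 \<le> u" "u \<le> 1"
  shows "norm (resolv u a x - resolv u b x) \<le> s / gap\<^sup>2 * norm x * \<bar>a - b\<bar>"
proof -
  have "norm (resolv u a x - resolv u b x) = cmod (outer a - outer b) * norm (resolv u a (resolv u b x))"
    by (simp add: resolv_diff_t[OF assms] norm_scaleC norm_minus_commute)
  also have "\<dots> \<le> (s * \<bar>a - b\<bar>) * (norm x / gap / gap)"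
    using s norm_resolv_le[OF assms, of a "resolv u b x"] norm_resolv_le[OF assms, of b x] gap(1)
    by (intro mult_mono outer_lipschitz order_trans[OF norm_resolv_le[OF assms] divide_right_mono]) auto
  finally show ?thesis by (simp add: power2_eq_square mult_ac)
qed

lemma continuous_resolv: assumes "0 \<le> u" "u \<le> 1" shows "continuous_on A (\<lambda>t. resolv u t x)"
proof (rule continuous_on_subset)
  show "continuous_on UNIV (\<lambda>t. resolv u t x)"
  proof (rule lipschitz_on_continuous_on)
    show "(s / gap\<^sup>2 * norm x)-lipschitz_on UNIV (\<lambda>t. resolv u t x)"
      using s gap(1) resolv_dist[OF assms] by (intro lipschitz_onI) (auto simp: dist_norm)
  qed
qed simp

lemma continuous_cinner_resolv: "0 \<le> u \<Longrightarrow> u \<le> 1 \<Longrightarrow> continuous_on A (\<lambda>t. cinner (resolv u t x) y)"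
  by (rule bounded_linear.continuous_on[OF bounded_linear_cinner_left continuous_resolv])

lemma cmod_cinner_resolv_le:
  assumes "0 \<le> u" "u \<le> 1" shows "cmod (cinner (resolv u t x) y) \<le> norm x * norm y / gap"
  using order_trans[OF cmod_cinner_le mult_right_mono[OF norm_resolv_le[OF assms, of t x] norm_ge_zero[of y]]] by simp

text \<open>The Cauchy measure of the expanded curve, as a density in the parameter of the original
  boundary.\<close>

definition weight :: "real \<Rightarrow> complex" where "weight t = of_real s * vel t / (2 * of_real pi * \<i>)"

lemma norm_weight: "cmod (weight t) = s / (2 * pi)"
  using s by (simp add: weight_def norm_divide norm_mult)

lemma borel_measurable_weight [measurable]: "weight \<in> borel_measurable borel"
  unfolding weight_def[abs_def] by (intro borel_measurable_divide borel_measurable_times borel_measurable_const borel_measurable_vel)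

lemma weighted_integrable:
  assumes F: "F \<in> borel_measurable borel" "\<And>t. cmod (F t) \<le> B" and G: "continuous_on UNIV G" "\<And>t. cmod (G t) \<le> C"
  shows "integrable par (\<lambda>t. F t * weight t * G t)"
proof (rule integrable_par_bounded[where B = "B * (s / (2 * pi)) * C"])
  show "(\<lambda>t. F t * weight t * G t) \<in> borel_measurable par"
    by (intro measurable_par borel_measurable_times F borel_measurable_weight borel_measurable_continuous_onI G)
  show "norm (F t * weight t * G t) \<le> B * (s / (2 * pi)) * C" for t
    unfolding norm_mult norm_weight
    using F(2)[of t] G(2)[of t] s order_trans[OF norm_ge_zero F(2)[of t]] by (intro mult_mono) auto
qed

lemma continuous_cinner_resolv2:
  assumes u: "0 \<le> u" "u \<le> 1"
  shows "continuous_on UNIV (\<lambda>t. cinner (resolv u t (resolv u t x)) y)"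
proof (rule bounded_linear.continuous_on[OF bounded_linear_cinner_left])
    have "norm (resolv u a (resolv u a x) - resolv u b (resolv u b x)) \<le> (2 * (s / gap ^ 3 * norm x)) * \<bar>a - b\<bar>" for a b
    proof -
      have "resolv u a (resolv u a x) - resolv u b (resolv u b x) =
        (resolv u a (resolv u a x) - resolv u b (resolv u a x)) + resolv u b (resolv u a x - resolv u b x)"
        by (simp add: blinfun.diff_right)
      then have "norm (resolv u a (resolv u a x) - resolv u b (resolv u b x)) \<le>
        norm (resolv u a (resolv u a x) - resolv u b (resolv u a x)) + norm (resolv u b (resolv u a x - resolv u b x))"
        by (metis norm_triangle_ineq)
      also have "\<dots> \<le> s / gap\<^sup>2 * (norm x / gap) * \<bar>a - b\<bar> + (s / gap\<^sup>2 * norm x * \<bar>a - b\<bar>) / gap"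
      proof (rule add_mono)
        have "s / gap\<^sup>2 * norm (resolv u a x) * \<bar>a - b\<bar> \<le> s / gap\<^sup>2 * (norm x / gap) * \<bar>a - b\<bar>"
          using norm_resolv_le[OF u, of a x] s by (intro mult_right_mono mult_left_mono) auto
        then show "norm (resolv u a (resolv u a x) - resolv u b (resolv u a x)) \<le> s / gap\<^sup>2 * (norm x / gap) * \<bar>a - b\<bar>"
          using resolv_dist[OF u, of a "resolv u a x" b] by linarith
        show "norm (resolv u b (resolv u a x - resolv u b x)) \<le> (s / gap\<^sup>2 * norm x * \<bar>a - b\<bar>) / gap"
          using norm_resolv_le[OF u, of b "resolv u a x - resolv u b x"] divide_right_mono[OF resolv_dist[OF u, of a x b], of gap] gap(1)
          by linarith
      qed
      also have "\<dots> = (2 * (s / gap ^ 3 * norm x)) * \<bar>a - b\<bar>"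
        by (simp add: power2_eq_square power3_eq_cube)
      finally show ?thesis .
    qed
    then show "continuous_on UNIV (\<lambda>t. resolv u t (resolv u t x))"
      using s gap(1)
      by (intro lipschitz_on_continuous_on[of "2 * (s / gap ^ 3 * norm x)"] lipschitz_onI) (auto simp: dist_norm)
qed

text \<open>The integrand is the derivative of the resolvent along the curve.\<close>

lemma integral_resolv_square:
  assumes u: "0 \<le> u" "u \<le> 1"
  shows "(LINT t|par. weight t * cinner (resolv u t (resolv u t x)) y) = 0"
proof -
  have "(LINT t|par. - (of_real s * vel t * cinner (resolv u t (resolv u t x)) y)) =
      cinner (resolv u L x) y - cinner (resolv u 0 x) y"
  proof (rule integral_par_FTC[where B = "s * (norm x * norm y / gap / gap)"])
    show "continuous_on {0..L} (\<lambda>t. cinner (resolv u t x) y)" by (rule continuous_cinner_resolv[OF u])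
    show "(\<lambda>t. - (of_real s * vel t * cinner (resolv u t (resolv u t x)) y)) \<in> borel_measurable par"
      by (intro measurable_par borel_measurable_uminus borel_measurable_times borel_measurable_const borel_measurable_vel
          borel_measurable_continuous_onI continuous_cinner_resolv2 u)
    fix t
    show "cmod (- (of_real s * vel t * cinner (resolv u t (resolv u t x)) y)) \<le> s * (norm x * norm y / gap / gap)"
    proof -
      have "cmod (cinner (resolv u t (resolv u t x)) y) \<le> norm (resolv u t x) * norm y / gap"
        by (rule cmod_cinner_resolv_le[OF u])
      also have "\<dots> \<le> (norm x / gap) * norm y / gap"
        using norm_resolv_le[OF u, of t x] gap(1) by (intro divide_right_mono mult_right_mono) auto
      finally have "s * cmod (cinner (resolv u t (resolv u t x)) y) \<le> s * (norm x / gap * norm y / gap)"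
        using s by (intro mult_left_mono) auto
      then show ?thesis using s by (simp add: norm_mult)
    qed
    show "((\<lambda>t. cinner (resolv u t x) y) has_vector_derivative - (of_real s * vel t * cinner (resolv u t (resolv u t x)) y)) (at_right t)"
      unfolding has_vector_derivative_iff_slope
    proof (rule Lim_transform_eventually)
      have "((\<lambda>b. (outer b - outer t) /\<^sub>R (b - t)) \<longlongrightarrow> of_real s * vel t) (at_right t)"
        using right_derivative_outer[of t] by (simp add: has_vector_derivative_iff_slope)
      moreover have "((\<lambda>b. cinner (resolv u b (resolv u t x)) y) \<longlongrightarrow> cinner (resolv u t (resolv u t x)) y) (at_right t)"
        using continuous_cinner_resolv[OF u, of UNIV "resolv u t x" y]
        by (metis UNIV_I continuous_on_def subset_UNIV tendsto_within_subset)
      ultimately show "((\<lambda>b. - ((outer b - outer t) /\<^sub>R (b - t) * cinner (resolv u b (resolv u t x)) y)) \<longlongrightarrow>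
          - (of_real s * vel t * cinner (resolv u t (resolv u t x)) y)) (at_right t)"
        by (intro tendsto_minus tendsto_mult)
      have "(cinner (resolv u b x) y - cinner (resolv u t x) y) /\<^sub>R (b - t) =
          - ((outer b - outer t) /\<^sub>R (b - t) * cinner (resolv u b (resolv u t x)) y)" for b
        by (simp add: cinner_diff_left[symmetric] resolv_diff_t[OF u] cinner_scaleC_left algebra_simps)
      then show "\<forall>\<^sub>F b in at_right t. - ((outer b - outer t) /\<^sub>R (b - t) * cinner (resolv u b (resolv u t x)) y) =
          (cinner (resolv u b x) y - cinner (resolv u t x) y) /\<^sub>R (b - t)"
        by simp
    qed
  qed
  moreover have "resolv u L = resolv u 0" by (simp add: resolv_def outer_periodic)
  ultimately have "(LINT t|par. - (of_real s * vel t * cinner (resolv u t (resolv u t x)) y)) = 0" by simp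
  moreover have "weight t * w = (- 1 / (2 * of_real pi * \<i>)) * (- (of_real s * vel t * w))" for t w
    by (simp add: weight_def)
  ultimately show ?thesis by (simp only: integral_mult_right_zero mult_zero_right)
qed

end

section \<open>Cauchy integral representation of polynomials of the operator\<close>

context operator_in_convex begin

text \<open>The resolvent identity, used twice, splits the increment into a part linear in
  \<open>u' - u\<close> and a quadratic remainder. The linear part is the integral of a squared
  resolvent, which vanishes over the closed curve.\<close>

lemma integral_resolv_step:
  assumes u: "0 \<le> u" "u \<le> 1" "0 \<le> u'" "u' \<le> 1"
  shows "cmod ((LINT t|par. weight t * cinner (resolv u' t x) y) - (LINT t|par. weight t * cinner (resolv u t x) y))
    \<le> (s / (2 * pi) * ((norm shift)\<^sup>2 * norm x * norm y / gap ^ 3) * L) * \<bar>u' - u\<bar>\<^sup>2"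
proof -
  define Q where "Q t = resolv u' t (shift (resolv u t (shift (resolv u t x))))" for t
  have int: "integrable par (\<lambda>t. weight t * cinner (resolv v t w) y)" if "0 \<le> v" "v \<le> 1" for v w
    using weighted_integrable[of "\<lambda>_. 1" 1 "\<lambda>t. cinner (resolv v t w) y" "norm w * norm y / gap"]
      continuous_cinner_resolv[OF that] cmod_cinner_resolv_le[OF that] by simp
  have exp: "cinner (resolv u' t x) y = cinner (resolv u t x) y + of_real (u' - u) * cinner (resolv u t (resolv u t (shift x))) y
      + of_real ((u' - u)\<^sup>2) * cinner (Q t) y" for t
  proof -
    have "resolv u' t x = resolv u t x + of_real (u' - u) *\<^sub>C resolv u' t (shift (resolv u t x))"
      using resolv_diff_u[OF u, of t x] by (simp add: algebra_simps)
    also have "resolv u' t (shift (resolv u t x)) =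
        resolv u t (shift (resolv u t x)) + of_real (u' - u) *\<^sub>C Q t"
      using resolv_diff_u[OF u, of t "shift (resolv u t x)"] by (simp add: Q_def algebra_simps)
    also have "resolv u t (shift (resolv u t x)) = resolv u t (resolv u t (shift x))"
      by (simp only: resolv_shift_commute[OF u(1,2)])
    finally show ?thesis
      by (simp add: cinner_add_left cinner_scaleC_left scaleC_add_right scaleC_scaleC power2_eq_square algebra_simps)
  qed
  have sq: "integrable par (\<lambda>t. weight t * cinner (resolv u t (resolv u t (shift x))) y)"
  proof (rule integrable_par_bounded[where B = "s / (2 * pi) * (norm (shift x) / gap * norm y / gap)"])
    show "(\<lambda>t. weight t * cinner (resolv u t (resolv u t (shift x))) y) \<in> borel_measurable par"
      by (intro measurable_par borel_measurable_times borel_measurable_weight borel_measurable_continuous_onI continuous_cinner_resolv2 u)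
    show "cmod (weight t * cinner (resolv u t (resolv u t (shift x))) y) \<le> s / (2 * pi) * (norm (shift x) / gap * norm y / gap)" for t
      unfolding norm_mult norm_weight
      using norm_resolv_le[OF u(1,2), of t "shift x"] gap(1) s
      by (intro mult_left_mono order_trans[OF cmod_cinner_resolv_le[OF u(1,2)]] divide_right_mono mult_right_mono) auto
  qed
  have Qint: "integrable par (\<lambda>t. weight t * (of_real ((u' - u)\<^sup>2) * cinner (Q t) y))"
  proof -
    have eq: "weight t * (of_real ((u' - u)\<^sup>2) * cinner (Q t) y) =
        weight t * cinner (resolv u' t x) y - weight t * cinner (resolv u t x) y
          - of_real (u' - u) * (weight t * cinner (resolv u t (resolv u t (shift x))) y)" for t
      unfolding exp by (simp add: algebra_simps)
    show ?thesis unfolding eq by (intro Bochner_Integration.integrable_diff integrable_mult_right int sq u)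
  qed
  have "(LINT t|par. weight t * cinner (resolv u' t x) y) =
      (LINT t|par. weight t * cinner (resolv u t x) y + of_real (u' - u) * (weight t * cinner (resolv u t (resolv u t (shift x))) y)
        + weight t * (of_real ((u' - u)\<^sup>2) * cinner (Q t) y))"
    unfolding exp by (simp add: algebra_simps)
  also have "\<dots> = (LINT t|par. weight t * cinner (resolv u t x) y) +
      of_real (u' - u) * (LINT t|par. weight t * cinner (resolv u t (resolv u t (shift x))) y) +
      (LINT t|par. weight t * (of_real ((u' - u)\<^sup>2) * cinner (Q t) y))"
    using Bochner_Integration.integral_add[OF Bochner_Integration.integrable_add[OF int[OF u(1,2), of x] integrable_mult_right[OF sq, of "of_real (u' - u)"]] Qint]
      Bochner_Integration.integral_add[OF int[OF u(1,2), of x] integrable_mult_right[OF sq, of "of_real (u' - u)"]]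
    by (simp only: integral_mult_right_zero)
  finally have "(LINT t|par. weight t * cinner (resolv u' t x) y) - (LINT t|par. weight t * cinner (resolv u t x) y) =
      (LINT t|par. weight t * (of_real ((u' - u)\<^sup>2) * cinner (Q t) y))"
    by (simp add: integral_resolv_square[OF u(1,2)])
  also have "cmod \<dots> \<le> (s / (2 * pi) * ((u' - u)\<^sup>2 * ((norm shift)\<^sup>2 * norm x * norm y / gap ^ 3))) * L"
  proof (rule norm_integral_par_le)
    show "(\<lambda>t. weight t * (of_real ((u' - u)\<^sup>2) * cinner (Q t) y)) \<in> borel_measurable par"
      using Qint by (rule borel_measurable_integrable)
    fix t
    have b: "norm (resolv v t (shift w)) \<le> norm shift * norm w / gap" if "0 \<le> v" "v \<le> 1" for v w
      using order_trans[OF norm_resolv_le[OF that] divide_right_mono[OF norm_blinfun]] gap(1) by simp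
    have "norm (Q t) \<le> norm shift * (norm shift * (norm x / gap) / gap) / gap"
      unfolding Q_def using norm_resolv_le[OF u(1,2), of t x] gap(1)
      by (intro order_trans[OF b[OF u(3,4)]] order_trans[OF b[OF u(1,2)]] divide_right_mono mult_left_mono) auto
    also have "\<dots> = (norm shift)\<^sup>2 * norm x / gap ^ 3" by (simp add: power2_eq_square power3_eq_cube)
    finally have "cmod (cinner (Q t) y) \<le> (norm shift)\<^sup>2 * norm x / gap ^ 3 * norm y"
      by (intro order_trans[OF cmod_cinner_le] mult_right_mono) auto
    then show "cmod (weight t * (of_real ((u' - u)\<^sup>2) * cinner (Q t) y)) \<le>
        s / (2 * pi) * ((u' - u)\<^sup>2 * ((norm shift)\<^sup>2 * norm x * norm y / gap ^ 3))"
      unfolding norm_mult norm_weight norm_of_real using s by (intro mult_left_mono mult_mono) auto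
  qed
  finally show ?thesis by (simp add: mult_ac)
qed

text \<open>Quadratic increments mean derivative zero in the homotopy parameter, so the integral is
  the same for \<open>T\<close> as for the scalar operator \<open>z0\<close>, where it is the
  ordinary Cauchy integral.\<close>

lemma integral_resolv: "(LINT t|par. weight t * cinner (resolv 1 t x) y) = cinner x y"
proof -
  define E where "E u = (LINT t|par. weight t * cinner (resolv u t x) y)" for u
  define C where "C = s / (2 * pi) * ((norm shift)\<^sup>2 * norm x * norm y / gap ^ 3) * L"
  have C: "C \<ge> 0" using s gap(1) L_pos by (simp add: C_def)
  have step: "cmod (E v - E u) \<le> C * \<bar>v - u\<bar>\<^sup>2" if "0 \<le> u" "u \<le> 1" "0 \<le> v" "v \<le> 1" for u v
    using integral_resolv_step[OF that] by (simp add: E_def C_def)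
  have "cmod (E 1 - E 0) \<le> 0 * (1 - 0)"
  proof (rule norm_diff_le_of_right_derivative[where f = "\<lambda>_. 0"])
    show "continuous_on {0..1} E"
    proof (rule lipschitz_on_continuous_on)
      show "C-lipschitz_on {0..1} E"
      proof (rule lipschitz_onI[OF _ C])
        fix u v :: real assume uv: "u \<in> {0..1}" "v \<in> {0..1}"
        have "\<bar>u - v\<bar>\<^sup>2 \<le> \<bar>u - v\<bar>"
          using mult_left_mono[of "\<bar>u - v\<bar>" 1 "\<bar>u - v\<bar>"] uv by (auto simp: power2_eq_square)
        then show "dist (E u) (E v) \<le> C * dist u v"
          using step[of v u] uv C by (auto simp: dist_norm dist_real_def intro: order_trans mult_left_mono)
      qed
    qed
    fix u :: real assume u: "0 \<le> u" "u < 1"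
    show "(E has_vector_derivative 0) (at_right u)"
      unfolding has_vector_derivative_iff_slope
    proof (rule Lim_null_comparison)
      have "\<forall>\<^sub>F v in at_right u. v \<in> {u<..<1}" by (rule eventually_at_right_real) (use u in auto)
      then show "\<forall>\<^sub>F v in at_right u. norm ((E v - E u) /\<^sub>R (v - u)) \<le> C * (v - u)"
      proof eventually_elim
        case (elim v)
        then have "cmod (E v - E u) \<le> C * (v - u)\<^sup>2" using step[of u v] u by simp
        then show ?case using elim by (simp add: divide_simps power2_eq_square)
      qed
      have "((\<lambda>v. C * (v - u)) \<longlongrightarrow> C * (u - u)) (at_right u)" by (intro tendsto_intros)
      then show "((\<lambda>v. C * (v - u)) \<longlongrightarrow> 0) (at_right u)" by simp
    qed
  qed auto
  then have "E 1 = E 0" by simp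
  also have "E 0 = cinner x y"
  proof -
    have r: "resolv 0 t x = (1 / (outer t - z0)) *\<^sub>C x" for t
    proof -
      have nz: "outer t - z0 \<noteq> 0" using outer_neq[of z0 t] z0 interior_subset[of \<Omega>] by auto
      have "(outer t - z0) *\<^sub>C resolv 0 t x = x"
        using resolv_right[of 0 t x] by (simp add: scaled_apply scaleC_diff_left)
      then have "(1 / (outer t - z0)) *\<^sub>C ((outer t - z0) *\<^sub>C resolv 0 t x) = (1 / (outer t - z0)) *\<^sub>C x" by simp
      then show ?thesis using nz by (simp add: scaleC_scaleC)
    qed
    have "weight t * cinner (resolv 0 t x) y = (cinner x y / (2 * of_real pi * \<i>)) * (vel t / (\<gamma> t - z0))" for t
    proof -
      have "outer t - z0 = of_real s * (\<gamma> t - z0)" by (simp add: outer_def)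
      then show ?thesis unfolding r using s by (simp add: cinner_scaleC_left weight_def mult_ac)
    qed
    then have "E 0 = (cinner x y / (2 * of_real pi * \<i>)) * (LINT t|par. vel t / (\<gamma> t - z0))"
      unfolding E_def by (simp only: integral_mult_right_zero)
    then show ?thesis by (simp add: integral_cauchy_kernel[OF z0])
  qed
  finally show ?thesis by (simp add: E_def)
qed

abbreviation res :: "real \<Rightarrow> 'a \<Rightarrow>\<^sub>L 'a" where "res \<equiv> resolv 1"

lemma integrable_weight_res:
  assumes "F \<in> borel_measurable borel" "\<And>t. cmod (F t) \<le> B"
  shows "integrable par (\<lambda>t. F t * weight t * cinner (res t x) y)"
  by (rule weighted_integrable[OF assms, where C = "norm x * norm y / gap"])
    (auto intro: continuous_cinner_resolv cmod_cinner_resolv_le)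

lemma continuous_periodic_bounded:
  fixes F :: "real \<Rightarrow> complex"
  assumes "continuous_on UNIV F" "\<And>a b. \<gamma> a = \<gamma> b \<Longrightarrow> F a = F b"
  obtains B where "\<And>t. cmod (F t) \<le> B"
proof -
  have "bounded (F ` {0..L})"
    by (intro compact_imp_bounded compact_continuous_image continuous_on_subset[OF assms(1)]) auto
  then obtain B where "\<forall>y\<in>F ` {0..L}. cmod y \<le> B" unfolding bounded_iff by blast
  then have B: "\<And>t. t \<in> {0..L} \<Longrightarrow> cmod (F t) \<le> B" by blast
  have "cmod (F t) \<le> B" for t
  proof -
    obtain r where "0 \<le> r" "r < L" "\<gamma> r = \<gamma> t" using time_representative by blast
    then show ?thesis using B[of r] assms(2)[of r t] by simp
  qed
  then show ?thesis using that by blast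
qed

lemma poly_outer_bounded: obtains B where "\<And>t. cmod (poly p (outer t)) \<le> B"
proof (rule continuous_periodic_bounded[of "\<lambda>t. poly p (outer t)"])
  show "continuous_on UNIV (\<lambda>t. poly p (outer t))" by (intro continuous_intros continuous_outer)
  show "poly p (outer a) = poly p (outer b)" if "\<gamma> a = \<gamma> b" for a b using that by (simp add: outer_def)
qed (rule that)

lemma borel_measurable_poly_outer: "(\<lambda>t. poly p (outer t)) \<in> borel_measurable borel"
  by (intro borel_measurable_continuous_onI continuous_intros continuous_outer)

lemma integral_weight_poly: "(LINT t|par. poly p (outer t) * weight t) = 0"
proof -
  define q where "q = pcompose p [:z0 - of_real s * z0, of_real s:]"
  have q: "poly q w = poly p (z0 + of_real s * (w - z0))" for w
    by (simp add: q_def poly_pcompose algebra_simps)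
  obtain H where H: "\<And>z. (H has_field_derivative poly q z) (at z)" using poly_has_primitive by blast
  obtain B where B: "\<And>t. cmod (poly p (outer t)) \<le> B" using poly_outer_bounded by blast
  have "(LINT t|par. poly q (\<gamma> t) * vel t) = 0"
  proof (rule integral_par_deriv[where H = H and B = B])
    show "poly q \<in> borel_measurable borel" by (intro borel_measurable_continuous_onI continuous_intros)
    show "cmod (poly q (\<gamma> t)) \<le> B" for t using B[of t] by (simp add: q outer_def)
  qed (rule H)
  moreover have "poly p (outer t) * weight t = (of_real s / (2 * of_real pi * \<i>)) * (poly q (\<gamma> t) * vel t)" for t
    by (simp add: q outer_def weight_def)
  ultimately show ?thesis by (simp only: integral_mult_right_zero mult_zero_right)
qed

text \<open>Induction over the coefficients: multiplying the resolvent at \<open>\<sigma>\<close> by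
  \<open>\<sigma>\<close> yields the identity plus the resolvent times \<open>T\<close>. The part
  without a resolvent integrates to zero because polynomials have primitives.\<close>

lemma integral_poly_res: "(LINT t|par. poly p (outer t) * weight t * cinner (res t x) y) = cinner (poly_op p T x) y"
proof (induction p arbitrary: x)
  case (pCons a p)
  obtain B where B: "\<And>t. cmod (poly p (outer t)) \<le> B" using poly_outer_bounded by blast
  have i1: "integrable par (\<lambda>t. weight t * cinner (res t x) y)"
    using integrable_weight_res[of "\<lambda>_. 1" 1 x y] by simp
  have i2: "integrable par (\<lambda>t. poly p (outer t) * weight t * cinner (res t (T x)) y)"
    by (rule integrable_weight_res[OF borel_measurable_poly_outer B])
  have i3: "integrable par (\<lambda>t. poly p (outer t) * weight t)"
    using weighted_integrable[OF borel_measurable_poly_outer B, of "\<lambda>_. 1" 1] by simp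
  have "outer t * cinner (res t x) y = cinner x y + cinner (res t (T x)) y" for t
  proof -
    have "res t (outer t *\<^sub>C x - T x) = x" using resolv_left[of 1 t x] by simp
    then have "outer t *\<^sub>C res t x = x + res t (T x)"
      by (simp add: blinfun.diff_right resolv_clinear algebra_simps)
    then show ?thesis by (metis cinner_add_left cinner_scaleC_left)
  qed
  then have "poly (pCons a p) (outer t) * weight t * cinner (res t x) y =
      a * (weight t * cinner (res t x) y) + cinner x y * (poly p (outer t) * weight t)
        + poly p (outer t) * weight t * cinner (res t (T x)) y" for t
    by (simp add: distrib_right mult.assoc mult.left_commute[of "outer t"]) (simp add: algebra_simps)
  then have "(LINT t|par. poly (pCons a p) (outer t) * weight t * cinner (res t x) y) =
      (LINT t|par. a * (weight t * cinner (res t x) y) + cinner x y * (poly p (outer t) * weight t)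
        + poly p (outer t) * weight t * cinner (res t (T x)) y)" by simp
  also have "\<dots> = (LINT t|par. a * (weight t * cinner (res t x) y)) + (LINT t|par. cinner x y * (poly p (outer t) * weight t))
        + (LINT t|par. poly p (outer t) * weight t * cinner (res t (T x)) y)"
    using i1 i2 i3 by (simp add: Bochner_Integration.integral_add)
  also have "\<dots> = a * cinner x y + cinner (poly_op p T (T x)) y"
    by (simp add: integral_resolv integral_weight_poly pCons.IH)
  finally show ?case by (simp add: poly_op_pCons cinner_add_left cinner_scaleC_left)
qed simp

end

lemma borel_measurable_cnj: "f \<in> borel_measurable M \<Longrightarrow> (\<lambda>x. cnj (f x)) \<in> borel_measurable M"
  by (rule measurable_compose[of f M borel]) (auto intro!: borel_measurable_continuous_onI continuous_intros)

section \<open>The positive form along the expanded curve, and the dual polynomial\<close>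

context operator_in_convex begin

text \<open>With \<open>r\<close> the resolvent applied to \<open>x\<close>, the vector
  \<open>x\<close> is \<open>\<sigma> - T\<close> applied to \<open>r\<close>, and coercivity in the
  normal direction at \<open>r\<close> is exactly this sign.\<close>

lemma Re_weight_res_nonneg: "0 \<le> Re (weight t * cinner (res t x) x)"
proof -
  define r where "r = res t x"
  have x: "outer t *\<^sub>C r - scaled 1 r = x" unfolding r_def by (rule resolv_right) auto
  have "0 \<le> gap * (norm r)\<^sup>2" using gap(1) by simp
  also have "\<dots> \<le> Re (cnj (- \<i> * vel t) * cinner x r)"
    using coercive[of 1 r t] unfolding x by simp
  also have "cinner x r = cnj (cinner r x)" by (rule cinner_commute)
  also have "Re (cnj (- \<i> * vel t) * cnj (cinner r x)) = Re (- \<i> * vel t * cinner r x)"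
    unfolding complex_cnj_mult[symmetric] by (rule cnj.sel)
  finally have "0 \<le> (s / (2 * pi)) * Re (- \<i> * vel t * cinner r x)"
    using s by (intro mult_nonneg_nonneg) auto
  also have "\<dots> = Re (of_real (s / (2 * pi)) * (- \<i> * vel t * cinner r x))"
    by (simp only: times_complex.sel Re_complex_of_real Im_complex_of_real mult_zero_left diff_zero)
  also have "of_real (s / (2 * pi)) * (- \<i> * vel t * cinner r x) = weight t * cinner r x"
    by (simp add: weight_def field_simps)
  finally show ?thesis by (simp add: r_def)
qed

text \<open>The form of the weighted resolvent plus its adjoint: a positive operator-valued density
  whose integral is twice the identity.\<close>

definition pair_form :: "real \<Rightarrow> 'a \<Rightarrow> 'a \<Rightarrow> complex"
  where "pair_form t x y = weight t * cinner (res t x) y + cnj (weight t) * cinner x (res t y)"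

text \<open>Positivity at \<open>c *\<^sub>C x - y\<close>, where the phase \<open>c\<close> makes
  the mixed term real.\<close>

lemma cmod_pair_form_le:
  "cmod (pair_form t x y) \<le> Re (weight t * cinner (res t x) x) + Re (weight t * cinner (res t y) y)"
proof -
  obtain c where c: "cmod c = 1" "c * pair_form t x y = of_real (cmod (pair_form t x y))" by (rule unimodular_rotation)
  have cc: "c * cnj c = 1" using complex_norm_square[of c] c by simp
  have R: "res t (c *\<^sub>C x - y) = c *\<^sub>C res t x - res t y" by (simp add: blinfun.diff_right resolv_clinear)
  have "0 \<le> Re (weight t * cinner (res t (c *\<^sub>C x - y)) (c *\<^sub>C x - y))" by (rule Re_weight_res_nonneg)
  also have "weight t * cinner (res t (c *\<^sub>C x - y)) (c *\<^sub>C x - y) =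
      (c * cnj c) * (weight t * cinner (res t x) x) + weight t * cinner (res t y) y
        - c * (weight t * cinner (res t x) y) - weight t * cnj c * cinner (res t y) x"
    unfolding R by (simp add: cinner_diff_left cinner_diff_right cinner_scaleC_left cinner_scaleC_right algebra_simps)
  also have "cinner (res t y) x = cnj (cinner x (res t y))" by (rule cinner_commute)
  also have "weight t * cnj c * cnj (cinner x (res t y)) = cnj (c * (cnj (weight t) * cinner x (res t y)))" by simp
  finally have "0 \<le> Re (weight t * cinner (res t x) x) + Re (weight t * cinner (res t y) y)
      - Re (c * (weight t * cinner (res t x) y)) - Re (c * (cnj (weight t) * cinner x (res t y)))"
    unfolding cc by (simp only: mult_1_left plus_complex.sel minus_complex.sel cnj.sel)
  moreover have "Re (c * (weight t * cinner (res t x) y)) + Re (c * (cnj (weight t) * cinner x (res t y))) = Re (c * pair_form t x y)"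
    unfolding pair_form_def by (simp only: distrib_left plus_complex.sel)
  ultimately show ?thesis unfolding c(2) by simp
qed

lemma integrable_weight_res': "integrable par (\<lambda>t. weight t * cinner (res t x) y)"
  using integrable_weight_res[of "\<lambda>_. 1" 1 x y] by simp

lemma pair_form_eq: "pair_form t x y = weight t * cinner (res t x) y + cnj (weight t * cinner (res t y) x)"
  unfolding pair_form_def using cinner_commute[of x "res t y"] by simp

lemma integrable_pair_form:
  assumes F: "F \<in> borel_measurable borel" "\<And>t. cmod (F t) \<le> M"
  shows "integrable par (\<lambda>t. F t * (weight t * cinner (res t x) y))"
    "integrable par (\<lambda>t. F t * cnj (weight t * cinner (res t y) x))"
proof -
  show 1: "integrable par (\<lambda>t. F t * (weight t * cinner (res t x) y))"
    using integrable_weight_res[OF F, of x y] by (simp add: mult.assoc)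
  have "integrable par (\<lambda>t. cnj (F t) * (weight t * cinner (res t y) x))"
    using integrable_weight_res[of "\<lambda>t. cnj (F t)" M y x] F by (simp add: mult.assoc borel_measurable_cnj)
  then have "integrable par (\<lambda>t. cnj (cnj (F t) * (weight t * cinner (res t y) x)))" by (rule integrable_cnj)
  then show "integrable par (\<lambda>t. F t * cnj (weight t * cinner (res t y) x))" by simp
qed

text \<open>The form is bounded pointwise by its diagonal, whose integral gives the squared norms.
  For unit vectors and \<open>M = 1\<close> this produces the constant 2 of the pairing.\<close>

lemma integral_pair_form_le:
  assumes F: "F \<in> borel_measurable borel" "\<And>t. cmod (F t) \<le> M"
  shows "cmod ((LINT t|par. F t * weight t * cinner (res t x) y) + cnj (LINT t|par. cnj (F t) * weight t * cinner (res t y) x))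
    \<le> M * ((norm x)\<^sup>2 + (norm y)\<^sup>2)"
proof -
  have M: "M \<ge> 0" using order_trans[OF norm_ge_zero F(2)[of 0]] .
  have "cnj (LINT t|par. cnj (F t) * weight t * cinner (res t y) x) = (LINT t|par. F t * cnj (weight t * cinner (res t y) x))"
    by (subst Bochner_Integration.integral_cnj[symmetric]) (simp add: mult.assoc)
  then have "(LINT t|par. F t * weight t * cinner (res t x) y) + cnj (LINT t|par. cnj (F t) * weight t * cinner (res t y) x) =
      (LINT t|par. F t * (weight t * cinner (res t x) y)) + (LINT t|par. F t * cnj (weight t * cinner (res t y) x))"
    by (simp add: mult.assoc)
  also have "\<dots> = (LINT t|par. F t * pair_form t x y)"
    unfolding pair_form_eq distrib_left
    by (rule Bochner_Integration.integral_add[OF integrable_pair_form[OF F], symmetric])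
  also have "cmod \<dots> \<le> (LINT t|par. M * (Re (weight t * cinner (res t x) x) + Re (weight t * cinner (res t y) y)))"
  proof (rule Bochner_Integration.integral_norm_bound_integral)
    show "integrable par (\<lambda>t. F t * pair_form t x y)"
      unfolding pair_form_eq distrib_left by (rule Bochner_Integration.integrable_add[OF integrable_pair_form[OF F]])
    show "integrable par (\<lambda>t. M * (Re (weight t * cinner (res t x) x) + Re (weight t * cinner (res t y) y)))"
      by (intro integrable_mult_right Bochner_Integration.integrable_add integrable_Re integrable_weight_res')
    show "cmod (F t * pair_form t x y) \<le> M * (Re (weight t * cinner (res t x) x) + Re (weight t * cinner (res t y) y))" for t
      unfolding norm_mult by (intro mult_mono F(2) cmod_pair_form_le M norm_ge_zero)
  qed
  also have "\<dots> = M * ((LINT t|par. Re (weight t * cinner (res t x) x)) + (LINT t|par. Re (weight t * cinner (res t y) y)))"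
    by (simp only: integral_mult_right_zero Bochner_Integration.integral_add[OF integrable_Re[OF integrable_weight_res'] integrable_Re[OF integrable_weight_res']])
  also have "\<dots> = M * (Re (cinner x x) + Re (cinner y y))"
    by (simp only: integral_Re[OF integrable_weight_res'] integral_resolv)
  finally show ?thesis by (simp only: cinner_self_norm)
qed

text \<open>The cell integrals of \<open>h\<close> do not involve \<open>k\<close>, so the same
  coefficients serve the scalar kernel and the resolvent.\<close>

lemma integral_step_approx:
  fixes h k :: "real \<Rightarrow> complex"
  assumes h: "h \<in> borel_measurable borel" "\<And>t. cmod (h t) \<le> H"
    and k: "\<And>a b. cmod (k a - k b) \<le> D * \<bar>a - b\<bar>" and N: "N > 0"
  shows "cmod ((LINT t|par. h t * k t) - (\<Sum>i<N. (LINT t|par. h t * of_bool (nat \<lfloor>t * real N / L\<rfloor> = i)) * k (real i * L / real N)))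
    \<le> H * (D * (L / N)) * L"
proof -
  define I where "I i t = (of_bool (nat \<lfloor>t * real N / L\<rfloor> = i) :: complex)" for i :: nat and t :: real
  have H: "H \<ge> 0" using order_trans[OF norm_ge_zero h(2)[of 0]] .
  have D: "D \<ge> 0" using order_trans[OF norm_ge_zero k[of 1 0]] by simp
  have Im: "I i \<in> borel_measurable borel" for i
    unfolding I_def[abs_def] of_bool_def by measurable
  have Ib: "cmod (I i t) \<le> 1" for i t by (simp add: I_def)
  have kc: "continuous_on UNIV k"
    by (rule lipschitz_on_continuous_on[of D], rule lipschitz_onI) (use k D in \<open>auto simp: dist_norm\<close>)
  have km: "k \<in> borel_measurable borel" using kc by (rule borel_measurable_continuous_onI)
  have "bounded (k ` {0..L})"
    by (intro compact_imp_bounded compact_continuous_image continuous_on_subset[OF kc]) auto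
  then obtain B where B: "\<forall>y\<in>k ` {0..L}. cmod y \<le> B" unfolding bounded_iff by blast
  have hk: "integrable par (\<lambda>t. h t * k t)"
    by (rule integrable_par_bounded[where B = "H * B"])
      (use B h H in \<open>auto simp: norm_mult intro!: measurable_par borel_measurable_times km mult_mono\<close>)
  have hI: "integrable par (\<lambda>t. h t * I i t)" for i
  proof (rule integrable_par_bounded[where B = "H * 1"])
    show "(\<lambda>t. h t * I i t) \<in> borel_measurable par" by (intro measurable_par borel_measurable_times h Im)
    show "cmod (h t * I i t) \<le> H * 1" for t
      unfolding norm_mult by (rule mult_mono[OF h(2) Ib H norm_ge_zero])
  qed
  have "(\<Sum>i<N. (LINT t|par. h t * I i t) * k (real i * L / real N)) = (LINT t|par. (\<Sum>i<N. h t * I i t * k (real i * L / real N)))"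
    using hI by (subst Bochner_Integration.integral_sum) (auto intro!: integrable_mult_left)
  then have "(LINT t|par. h t * k t) - (\<Sum>i<N. (LINT t|par. h t * I i t) * k (real i * L / real N)) =
      (LINT t|par. h t * k t - (\<Sum>i<N. h t * I i t * k (real i * L / real N)))"
    using hI hk by (subst Bochner_Integration.integral_diff) (auto intro!: integrable_mult_left Bochner_Integration.integrable_sum)
  also have "cmod \<dots> \<le> (H * (D * (L / N))) * L"
  proof (rule norm_integral_par_le)
    show "(\<lambda>t. h t * k t - (\<Sum>i<N. h t * I i t * k (real i * L / real N))) \<in> borel_measurable par"
      by (rule borel_measurable_diff[OF borel_measurable_integrable[OF hk] borel_measurable_sum
          [OF borel_measurable_times[OF borel_measurable_integrable[OF hI] borel_measurable_const]]])
    fix t assume t: "0 \<le> t" "t < L"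
    define j where "j = nat \<lfloor>t * real N / L\<rfloor>"
    have x: "0 \<le> t * real N / L" "t * real N / L < N" using t N L_pos by (auto simp: divide_simps)
    have j: "real j \<le> t * real N / L" "t * real N / L < real j + 1"
      using x(1) unfolding j_def by (auto simp: of_nat_nat)
    then have jN: "j < N" using x(2) by (simp add: of_nat_less_iff[symmetric, where 'a = real] del: of_nat_less_iff)
    have "(\<Sum>i<N. h t * I i t * k (real i * L / real N)) = (\<Sum>i<N. if i = j then h t * k (real i * L / real N) else 0)"
      by (rule sum.cong) (auto simp: I_def j_def)
    also have "\<dots> = h t * k (real j * L / real N)" using jN by (simp add: sum.delta)
    finally have "cmod (h t * k t - (\<Sum>i<N. h t * I i t * k (real i * L / real N))) = cmod (h t) * cmod (k t - k (real j * L / real N))"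
      by (simp add: norm_mult[symmetric] right_diff_distrib)
    also have "\<dots> \<le> H * (D * (L / N))"
    proof (intro mult_mono h(2) H norm_ge_zero order_trans[OF k] mult_left_mono D)
      have "real j * L / N \<le> t" "t < (real j + 1) * L / N"
        using j N L_pos by (auto simp: field_simps)
      then show "\<bar>t - real j * L / N\<bar> \<le> L / N" by (simp add: add_divide_distrib distrib_right)
    qed (use D in auto)
    finally show "norm (h t * k t - (\<Sum>i<N. h t * I i t * k (real i * L / real N))) \<le> H * (D * (L / N))" .
  qed
  finally show ?thesis by (simp add: I_def)
qed

text \<open>Riemann sums, with the same polynomials on the scalar and on the operator side.\<close>

lemma cauchy_transform_approximable:
  assumes h: "h \<in> borel_measurable borel" "\<And>t. cmod (h t) \<le> H" and \<epsilon>: "\<epsilon> > 0"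
  obtains q where "\<And>z. z \<in> \<Omega> \<Longrightarrow> cmod (poly q z - (LINT t|par. h t * (1 / (outer t - z)))) \<le> \<epsilon>"
    "\<And>x y. cmod (cinner (poly_op q T x) y - (LINT t|par. h t * cinner (res t x) y)) \<le> \<epsilon> * (norm x * norm y)"
proof -
  have H: "H \<ge> 0" using order_trans[OF norm_ge_zero h(2)[of 0]] .
  define D where "D = s / gap\<^sup>2"
  have D: "D > 0" using s gap(1) by (simp add: D_def)
  \<comment> \<open>The Riemann error takes half of \<open>\<epsilon>\<close>, the polynomial
    approximations at the \<open>N\<close> nodes take the other half.\<close>
  obtain N :: nat where N: "2 * (H * D * L * L) / \<epsilon> < N" using reals_Archimedean2 by blast
  have N0: "N > 0"
  proof (rule ccontr)
    assume "\<not> N > 0"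
    then have "2 * (H * D * L * L) / \<epsilon> < 0" using N by simp
    then show False using H D L_pos \<epsilon> by (simp add: divide_less_0_iff mult_less_0_iff)
  qed
  have err: "H * (D * (L / N)) * L \<le> \<epsilon> / 2" using N N0 \<epsilon> by (simp add: field_simps)
  \<comment> \<open>The summand 1 keeps the denominator positive even if \<open>H\<close> is
    0.\<close>
  define e where "e = \<epsilon> / (2 * (N * (H * L) + 1))"
  have e: "e > 0" "N * (H * L) * e \<le> \<epsilon> / 2"
  proof -
    have p: "N * (H * L) \<ge> 0" using H L_pos by simp
    then show "e > 0" using \<epsilon> by (simp add: e_def add_nonneg_pos)
    have "N * (H * L) * e \<le> (N * (H * L) + 1) * e" using \<open>e > 0\<close> by (simp add: distrib_right)
    also have "\<dots> = \<epsilon> / 2"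
    proof -
      have "X * (\<epsilon> / (2 * X)) = \<epsilon> / 2" if "X \<noteq> 0" for X using that by simp
      then show ?thesis unfolding e_def using p by (metis add_nonneg_pos less_irrefl zero_less_one)
    qed
    finally show "N * (H * L) * e \<le> \<epsilon> / 2" .
  qed
  define c where "c i = (LINT t|par. h t * of_bool (nat \<lfloor>t * real N / L\<rfloor> = i))" for i :: nat
  define \<tau> where "\<tau> i = real i * L / real N" for i :: nat
  have cb: "cmod (c i) \<le> H * L" for i
    unfolding c_def
    by (rule norm_integral_par_le)
      (use h H in \<open>auto simp: norm_mult of_bool_def intro!: measurable_par borel_measurable_times\<close>)
  have "\<exists>p. (\<forall>z\<in>\<Omega>. cmod (poly p z - 1 / (outer (\<tau> i) - z)) \<le> e) \<and> norm (poly_op p T - res (\<tau> i)) \<le> e" for i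
    using resolv(2)[of 1 "\<tau> i"] e(1) unfolding poly_approximable_def by auto
  then obtain p where p: "\<And>i z. z \<in> \<Omega> \<Longrightarrow> cmod (poly (p i) z - 1 / (outer (\<tau> i) - z)) \<le> e"
      "\<And>i. norm (poly_op (p i) T - res (\<tau> i)) \<le> e" by metis
  define q where "q = (\<Sum>i<N. smult (c i) (p i))"
  have sum_err: "cmod ((\<Sum>i<N. c i * a i) - (\<Sum>i<N. c i * b i)) \<le> \<epsilon> / 2 * m"
    if "\<And>i. cmod (a i - b i) \<le> e * m" "m \<ge> 0" for a b :: "nat \<Rightarrow> complex" and m
  proof -
    have "cmod ((\<Sum>i<N. c i * a i) - (\<Sum>i<N. c i * b i)) \<le> (\<Sum>i<N. (H * L) * (e * m))"
      unfolding sum_subtractf[symmetric] right_diff_distrib[symmetric]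
      using cb that H L_pos by (intro sum_norm_le) (auto simp: norm_mult intro!: mult_mono)
    also have "\<dots> = (N * (H * L) * e) * m" by simp
    also have "\<dots> \<le> \<epsilon> / 2 * m" using e(2) that(2) by (rule mult_right_mono)
    finally show ?thesis .
  qed
  show ?thesis
  proof (rule that)
    fix z assume z: "z \<in> \<Omega>"
    have lip: "cmod (1 / (outer a - z) - 1 / (outer b - z)) \<le> D * \<bar>a - b\<bar>" for a b
    proof -
      have "1 / (outer a - z) - 1 / (outer b - z) = (outer b - outer a) / ((outer a - z) * (outer b - z))"
        using outer_neq[OF z] by (simp add: field_simps)
      then have "cmod (1 / (outer a - z) - 1 / (outer b - z)) = cmod (outer a - outer b) / (cmod (outer a - z) * cmod (outer b - z))"
        by (simp add: norm_divide norm_mult norm_minus_commute)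
      also have "\<dots> \<le> (s * \<bar>a - b\<bar>) / (gap * gap)"
        using norm_outer_diff_ge[OF z] gap(1) s by (intro frac_le mult_mono outer_lipschitz) auto
      finally show ?thesis by (simp add: D_def power2_eq_square)
    qed
    have "cmod ((LINT t|par. h t * (1 / (outer t - z))) - (\<Sum>i<N. c i * (1 / (outer (\<tau> i) - z)))) \<le> \<epsilon> / 2"
      using order_trans[OF integral_step_approx[OF h lip N0] err] by (simp add: c_def \<tau>_def)
    moreover have "cmod ((\<Sum>i<N. c i * poly (p i) z) - (\<Sum>i<N. c i * (1 / (outer (\<tau> i) - z)))) \<le> \<epsilon> / 2 * 1"
      using p(1)[OF z] by (intro sum_err) auto
    moreover have "poly q z = (\<Sum>i<N. c i * poly (p i) z)" by (simp add: q_def poly_sum)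
    ultimately show "cmod (poly q z - (LINT t|par. h t * (1 / (outer t - z)))) \<le> \<epsilon>"
      using norm_diff_triangle_ineq by (smt (verit, best) field_sum_of_halves mult.right_neutral norm_minus_commute norm_triangle_ineq4 diff_add_cancel norm_diff_triangle_le)
  next
    fix x y
    have lip: "cmod (cinner (res a x) y - cinner (res b x) y) \<le> (D * (norm x * norm y)) * \<bar>a - b\<bar>" for a b
      using order_trans[OF cmod_cinner_le mult_right_mono[OF resolv_dist[of 1 a x b] norm_ge_zero[of y]]]
      by (simp add: cinner_diff_left[symmetric] D_def mult_ac)
    have "cmod ((LINT t|par. h t * cinner (res t x) y) - (\<Sum>i<N. c i * cinner (res (\<tau> i) x) y)) \<le>
        H * (D * (norm x * norm y) * (L / N)) * L"
      unfolding c_def \<tau>_def by (rule integral_step_approx[OF h lip N0])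
    also have "\<dots> = (norm x * norm y) * (H * (D * (L / N)) * L)" by (simp add: mult_ac)
    also have "\<dots> \<le> (norm x * norm y) * (\<epsilon> / 2)" using err by (rule mult_left_mono) simp
    finally have "cmod ((LINT t|par. h t * cinner (res t x) y) - (\<Sum>i<N. c i * cinner (res (\<tau> i) x) y)) \<le> (norm x * norm y) * (\<epsilon> / 2)" .
    moreover have "cmod ((\<Sum>i<N. c i * cinner (poly_op (p i) T x) y) - (\<Sum>i<N. c i * cinner (res (\<tau> i) x) y)) \<le> \<epsilon> / 2 * (norm x * norm y)"
    proof (rule sum_err)
      fix i
      have "cmod (cinner (poly_op (p i) T x) y - cinner (res (\<tau> i) x) y) \<le> norm ((poly_op (p i) T - res (\<tau> i)) x) * norm y"
        unfolding cinner_diff_left[symmetric] blinfun.diff_left[symmetric] by (rule cmod_cinner_le)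
      also have "\<dots> \<le> (e * norm x) * norm y"
        by (intro mult_right_mono order_trans[OF norm_blinfun] p(2)) auto
      finally show "cmod (cinner (poly_op (p i) T x) y - cinner (res (\<tau> i) x) y) \<le> e * (norm x * norm y)" by (simp add: mult.assoc)
    qed simp
    moreover have "cinner (poly_op q T x) y = (\<Sum>i<N. c i * cinner (poly_op (p i) T x) y)"
      by (simp add: q_def poly_op_sum blinfun.sum_left poly_op_smult cinner_sum_left cinner_scaleC_left)
    ultimately show "cmod (cinner (poly_op q T x) y - (LINT t|par. h t * cinner (res t x) y)) \<le> \<epsilon> * (norm x * norm y)"
      using norm_triangle_ineq4[of "cinner (poly_op q T x) y - (\<Sum>i<N. c i * cinner (res (\<tau> i) x) y)" "(LINT t|par. h t * cinner (res t x) y) - (\<Sum>i<N. c i * cinner (res (\<tau> i) x) y)"]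
      by (simp add: algebra_simps)
  qed
qed

text \<open>Its values on the expanded curve are those of \<open>p\<close> on the boundary, so they
  are bounded by the supremum of \<open>p\<close> over \<open>\<Omega>\<close>.\<close>

definition dilate :: "complex poly \<Rightarrow> complex poly"
  where "dilate p = pcompose p [:z0 - z0 / of_real s, 1 / of_real s:]"

lemma poly_dilate: "poly (dilate p) z = poly p (z0 + (z - z0) / of_real s)"
  by (simp add: dilate_def poly_pcompose diff_divide_distrib algebra_simps)

lemma poly_dilate_outer: "poly (dilate p) (outer t) = poly p (\<gamma> t)"
  using s by (simp add: poly_dilate outer_def)

lemma borel_measurable_poly_curve: "(\<lambda>t. poly p (\<gamma> t)) \<in> borel_measurable borel"
  by (intro borel_measurable_continuous_onI continuous_intros continuous_\<gamma>)

lemma integral_dilate_res: "(LINT t|par. poly p (\<gamma> t) * weight t * cinner (res t x) y) = cinner (poly_op (dilate p) T x) y"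
  using integral_poly_res[of "dilate p" x y] by (simp add: poly_dilate_outer)

text \<open>A crude estimate by the length of the curve and by \<open>gap\<close>. It degenerates as
  \<open>s\<close> tends to 1, but it makes the best constant for the contracted operator
  finite.\<close>

lemma poly_op_dilate_bound:
  obtains K where "\<And>p M. (\<And>z. z \<in> \<Omega> \<Longrightarrow> cmod (poly p z) \<le> M) \<Longrightarrow> norm (poly_op (dilate p) T) \<le> K * M"
proof (rule that)
  fix p M assume M: "\<And>z. z \<in> \<Omega> \<Longrightarrow> cmod (poly p z) \<le> M"
  have M0: "M \<ge> 0" using order_trans[OF norm_ge_zero M[OF \<gamma>_mem]] .
  show "norm (poly_op (dilate p) T) \<le> (s / (2 * pi) / gap * L) * M"
  proof (rule norm_blinfun_bound)
    show "0 \<le> (s / (2 * pi) / gap * L) * M" using M0 s gap(1) L_pos by simp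
    fix x
    show "norm (poly_op (dilate p) T x) \<le> (s / (2 * pi) / gap * L) * M * norm x"
    proof (rule norm_le_of_cinner)
      show "0 \<le> (s / (2 * pi) / gap * L) * M * norm x" using M0 s gap(1) L_pos by simp
      fix y
      have "cmod (LINT t|par. poly p (\<gamma> t) * weight t * cinner (res t x) y) \<le> (M * (s / (2 * pi)) * (norm x * norm y / gap)) * L"
      proof (rule norm_integral_par_le)
        show "(\<lambda>t. poly p (\<gamma> t) * weight t * cinner (res t x) y) \<in> borel_measurable par"
          by (rule borel_measurable_integrable[OF integrable_weight_res[OF borel_measurable_poly_curve M[OF \<gamma>_mem]]])
        show "norm (poly p (\<gamma> t) * weight t * cinner (res t x) y) \<le> M * (s / (2 * pi)) * (norm x * norm y / gap)" for t
          unfolding norm_mult norm_weight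
          using M[OF \<gamma>_mem, of t] cmod_cinner_resolv_le[of 1 t x y] M0 s by (intro mult_mono) auto
      qed
      then show "cmod (cinner (poly_op (dilate p) T x) y) \<le> (s / (2 * pi) / gap * L) * M * norm x * norm y"
        unfolding integral_dilate_res by (simp add: mult_ac)
    qed
  qed
qed

text \<open>The adjoint half of the positive form is supplied by a polynomial close to the Cauchy
  transform of the conjugate of \<open>p\<close>. Unit vectors come first: the bound by a sum of
  squared norms becomes one by a product only after normalization.\<close>

lemma dual_pair_estimate:
  assumes M: "\<And>z. z \<in> \<Omega> \<Longrightarrow> cmod (poly p z) \<le> 1" and \<epsilon>: "\<epsilon> > 0"
  obtains q where
    "\<And>z. z \<in> \<Omega> \<Longrightarrow> cmod (poly q z - (LINT t|par. cnj (poly p (\<gamma> t)) * weight t * (1 / (outer t - z)))) \<le> \<epsilon>"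
    "\<And>x y. cmod (cinner (poly_op (dilate p) T x) y + cinner x (poly_op q T y)) \<le> (2 + \<epsilon>) * (norm x * norm y)"
proof -
  have m: "(\<lambda>t. cnj (poly p (\<gamma> t)) * weight t) \<in> borel_measurable borel"
    using borel_measurable_poly_curve[of p] by (intro borel_measurable_times borel_measurable_weight borel_measurable_cnj)
  have b: "cmod (cnj (poly p (\<gamma> t)) * weight t) \<le> 1 * (s / (2 * pi))" for t
    unfolding norm_mult norm_weight complex_mod_cnj using M[OF \<gamma>_mem, of t] s by (intro mult_right_mono) auto
  obtain q where q1: "\<And>z. z \<in> \<Omega> \<Longrightarrow> cmod (poly q z - (LINT t|par. cnj (poly p (\<gamma> t)) * weight t * (1 / (outer t - z)))) \<le> \<epsilon>"
    and q2: "\<And>x y. cmod (cinner (poly_op q T x) y - (LINT t|par. cnj (poly p (\<gamma> t)) * weight t * cinner (res t x) y)) \<le> \<epsilon> * (norm x * norm y)"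
    using cauchy_transform_approximable[OF m b \<epsilon>] by blast
  have unit: "cmod (cinner (poly_op (dilate p) T x) y + cinner x (poly_op q T y)) \<le> 2 + \<epsilon>"
    if x: "norm x = 1" "norm y = 1" for x y
  proof -
    define I where "I = (LINT t|par. cnj (poly p (\<gamma> t)) * weight t * cinner (res t y) x)"
    have "cmod (cinner (poly_op (dilate p) T x) y + cnj I) \<le> 2"
      using integral_pair_form_le[OF borel_measurable_poly_curve[of p] M[OF \<gamma>_mem], where x = x and y = y] x
      by (simp add: integral_dilate_res I_def)
    moreover have "cmod (cinner x (poly_op q T y) - cnj I) \<le> \<epsilon>"
    proof -
      have "cinner x (poly_op q T y) - cnj I = cnj (cinner (poly_op q T y) x - I)"
        using cinner_commute[of x "poly_op q T y"] by simp
      then have "cmod (cinner x (poly_op q T y) - cnj I) = cmod (cinner (poly_op q T y) x - I)"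
        by (simp only: complex_mod_cnj)
      then show ?thesis using q2[of y x] x by (simp add: I_def)
    qed
    moreover have "cinner (poly_op (dilate p) T x) y + cinner x (poly_op q T y) =
        (cinner (poly_op (dilate p) T x) y + cnj I) + (cinner x (poly_op q T y) - cnj I)" by simp
    ultimately show ?thesis by (metis add_mono norm_triangle_le)
  qed
  have "cmod (cinner (poly_op (dilate p) T x) y + cinner x (poly_op q T y)) \<le> (2 + \<epsilon>) * (norm x * norm y)" for x y
  proof (cases "x = 0 \<or> y = 0")
    case False
    define u v where "u = (1 / norm x) *\<^sub>R x" and "v = (1 / norm y) *\<^sub>R y"
    have uv: "norm u = 1" "norm v = 1" "x = norm x *\<^sub>R u" "y = norm y *\<^sub>R v" using False by (auto simp: u_def v_def)
    have "cinner (poly_op (dilate p) T (a *\<^sub>R u)) (b *\<^sub>R v) + cinner (a *\<^sub>R u) (poly_op q T (b *\<^sub>R v)) =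
        of_real (a * b) * (cinner (poly_op (dilate p) T u) v + cinner u (poly_op q T v))" for a b
      by (simp add: blinfun.scaleR_right cinner_scaleR_left cinner_scaleR_right algebra_simps)
    from this[of "norm x" "norm y"]
    have "cinner (poly_op (dilate p) T x) y + cinner x (poly_op q T y) =
        of_real (norm x * norm y) * (cinner (poly_op (dilate p) T u) v + cinner u (poly_op q T v))"
      unfolding uv(3)[symmetric] uv(4)[symmetric] .
    then have "cmod (cinner (poly_op (dilate p) T x) y + cinner x (poly_op q T y)) =
        (norm x * norm y) * cmod (cinner (poly_op (dilate p) T u) v + cinner u (poly_op q T v))"
      by (simp only: norm_mult norm_of_real) simp
    also have "\<dots> \<le> (norm x * norm y) * (2 + \<epsilon>)" by (intro mult_left_mono unit uv) simp
    finally show ?thesis by (simp add: mult.commute)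
  qed (use \<epsilon> in auto)
  then show ?thesis using that q1 by blast
qed

end

section \<open>The conjugate Cauchy transform\<close>

context boundary_param begin

lemma shrink_mem_interior:
  assumes "z0 \<in> interior \<Omega>" "w \<in> \<Omega>" "s > 1" shows "z0 + (w - z0) / of_real s \<in> interior \<Omega>"
proof -
  have "w - (1 - 1 / s) *\<^sub>R (w - z0) \<in> interior \<Omega>"
    by (rule mem_interior_convex_shrink[OF convex_\<Omega> assms(1,2)]) (use assms(3) in auto)
  moreover have "w - (1 - 1 / s) *\<^sub>R (w - z0) = z0 + (w - z0) / of_real s"
    by (simp add: scaleR_conv_of_real algebra_simps)
  ultimately show ?thesis by simp
qed

lemma shrink_mem: assumes "z0 \<in> interior \<Omega>" "w \<in> \<Omega>" "s \<ge> 1" shows "z0 + (w - z0) / of_real s \<in> \<Omega>"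
proof (cases "s = 1")
  case True
  then show ?thesis using assms(2) by simp
next
  case False
  then have "z0 + (w - z0) / of_real s \<in> interior \<Omega>" using assms by (intro shrink_mem_interior) auto
  then show ?thesis by (rule subsetD[OF interior_subset])
qed

text \<open>Contraction of the argument towards \<open>z0\<close> makes a function that is only
  continuous up to the boundary holomorphic beyond it; uniform continuity keeps the change small on
  all of \<open>\<Omega>\<close>.\<close>

lemma dilation_uniform:
  assumes f: "continuous_on \<Omega> f" and z0: "z0 \<in> interior \<Omega>" and e: "\<epsilon> > (0::real)"
  obtains s0 where "s0 > 1"
    "\<And>s w. 1 \<le> s \<Longrightarrow> s < s0 \<Longrightarrow> w \<in> \<Omega> \<Longrightarrow> cmod (f (z0 + (w - z0) / of_real s) - f w) < \<epsilon>"
proof -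
  have "uniformly_continuous_on \<Omega> f" using f compact_\<Omega> by (rule compact_uniformly_continuous)
  then obtain d where d: "d > 0" "\<And>x y. x \<in> \<Omega> \<Longrightarrow> y \<in> \<Omega> \<Longrightarrow> dist x y < d \<Longrightarrow> dist (f x) (f y) < \<epsilon>"
    unfolding uniformly_continuous_on_def using e by metis
  obtain b where b: "\<And>w. w \<in> \<Omega> \<Longrightarrow> cmod (w - z0) \<le> b"
    using compact_imp_bounded[OF compact_\<Omega>, unfolded bounded_any_center[of \<Omega> z0] dist_norm norm_minus_commute[of z0]] by blast
  have b0: "b \<ge> 0" using order_trans[OF norm_ge_zero b[OF \<gamma>_mem]] .
  show ?thesis
  proof (rule that)
    show "1 < 1 + d / (b + 1)" using d(1) b0 by simp
    fix s w assume s: "1 \<le> s" "s < 1 + d / (b + 1)" and w: "w \<in> \<Omega>"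
    have m: "z0 + (w - z0) / of_real s \<in> \<Omega>" by (rule shrink_mem[OF z0 w s(1)])
    have "z0 + (w - z0) / of_real s - w = of_real (1 / s - 1) * (w - z0)"
      by (simp add: algebra_simps)
    then have "cmod (z0 + (w - z0) / of_real s - w) = \<bar>1 / s - 1\<bar> * cmod (w - z0)" by (simp only: norm_mult norm_of_real)
    also have "\<dots> \<le> (s - 1) * b"
    proof (intro mult_mono b w)
      have "(s - 1) / s \<le> (s - 1) / 1" using s(1) by (intro divide_left_mono) auto
      moreover have "(s - 1) / s = 1 - 1 / s" "1 / s \<le> 1" using s(1) by (simp_all add: diff_divide_distrib)
      ultimately have "1 - 1 / s \<le> s - 1" "1 / s \<le> 1" by (simp_all only: div_by_1)
      then show "\<bar>1 / s - 1\<bar> \<le> s - 1" using s(1) by (intro abs_leI) linarith+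
    qed (use s in auto)
    also have "\<dots> \<le> (s - 1) * (b + 1)" using s by (intro mult_left_mono) auto
    also have "\<dots> < d" using s b0 by (simp add: field_simps)
    finally show "cmod (f (z0 + (w - z0) / of_real s) - f w) < \<epsilon>" using d(2)[OF m w] by (simp add: dist_norm)
  qed
qed

section \<open>Cauchy's formula up to the boundary\<close>

lemma integrable_curve_cauchy:
  assumes f: "continuous_on (frontier \<Omega>) f" and z: "z \<in> interior \<Omega>"
  shows "integrable par (\<lambda>t. f (\<gamma> t) * (vel t / (\<gamma> t - z)))"
proof -
  obtain B where B: "\<And>t. cmod (f (\<gamma> t)) \<le> B" using continuous_frontier_bounded[OF f] by blast
  obtain d where d: "d > 0" "\<And>t. cmod (\<gamma> t - z) \<ge> d" using dist_frontier_bound[OF z] by blast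
  show ?thesis
  proof (rule integrable_par_bounded[where B = "B * (1 / d)"])
    show "(\<lambda>t. f (\<gamma> t) * (vel t / (\<gamma> t - z))) \<in> borel_measurable par"
      by (intro measurable_par borel_measurable_times measurable_curve_compose[OF f] borel_measurable_divide
          borel_measurable_diff borel_measurable_const borel_measurable_vel borel_measurable_\<gamma>)
    show "norm (f (\<gamma> t) * (vel t / (\<gamma> t - z))) \<le> B * (1 / d)" for t
      unfolding norm_mult norm_divide norm_vel
      using d(1) d(2)[of t] order_trans[OF norm_ge_zero B[of t]] by (intro mult_mono B frac_le) auto
  qed
qed

text \<open>After subtraction of \<open>f z\<close> the kernel turns into a holomorphic difference
  quotient, which has a primitive on the convex neighbourhood.\<close>

lemma cauchy_formula_neighbourhood:
  assumes U: "open U" "convex U" "\<Omega> \<subseteq> U" and f: "f holomorphic_on U" and z: "z \<in> interior \<Omega>"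
  shows "(LINT t|par. f (\<gamma> t) * (vel t / (\<gamma> t - z))) = 2 * of_real pi * \<i> * f z"
proof -
  define h where "h w = (if w = z then deriv f z else (f w - f z) / (w - z))" for w
  have zU: "z \<in> interior U" using z U interior_mono[of \<Omega> U] by auto
  have hU: "h holomorphic_on U" unfolding h_def by (rule pole_lemma[OF f zU])
  obtain H where H: "\<And>w. w \<in> U \<Longrightarrow> (H has_field_derivative h w) (at w within U)"
    using holomorphic_convex_primitive'[OF U(2,1) hU] by blast
  have fr: "frontier \<Omega> \<subseteq> U" by (rule order_trans[OF frontier_subset_closed[OF compact_imp_closed[OF compact_\<Omega>]] U(3)])
  \<comment> \<open>Set to 0 off the frontier: a Borel function on the whole plane with the same
    values on the curve.\<close>
  define h' where "h' w = indicator (frontier \<Omega>) w *\<^sub>R h w" for w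
  have h'm: "h' \<in> borel_measurable borel"
    unfolding h'_def
    by (intro borel_measurable_continuous_on_indicator borel_closed frontier_closed
        continuous_on_subset[OF holomorphic_on_imp_continuous_on[OF hU] fr])
  have h'\<gamma>: "h' (\<gamma> t) = h (\<gamma> t)" for t using \<gamma>_frontier[of t] by (simp add: h'_def)
  obtain B where B: "\<And>t. cmod (h (\<gamma> t)) \<le> B"
    using continuous_frontier_bounded[OF continuous_on_subset[OF holomorphic_on_imp_continuous_on[OF hU] fr]] by blast
  have "(LINT t|par. h' (\<gamma> t) * vel t) = 0"
  proof (rule integral_par_deriv[OF h'm, where B = B and H = H])
    show "cmod (h' (\<gamma> t)) \<le> B" for t using B[of t] by (simp add: h'\<gamma>)
    show "(H has_field_derivative h' (\<gamma> t)) (at (\<gamma> t))" for t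
      unfolding h'\<gamma> using H[OF subsetD[OF fr \<gamma>_frontier]] by (simp only: at_within_open[OF subsetD[OF fr \<gamma>_frontier] U(1)])
  qed
  moreover have "h' (\<gamma> t) * vel t = f (\<gamma> t) * (vel t / (\<gamma> t - z)) - f z * (vel t / (\<gamma> t - z))" for t
    using z \<gamma>_not_interior[of t] by (auto simp: h'\<gamma> h_def diff_divide_distrib algebra_simps)
  ultimately have 0: "(LINT t|par. f (\<gamma> t) * (vel t / (\<gamma> t - z)) - f z * (vel t / (\<gamma> t - z))) = 0" by simp
  have i1: "integrable par (\<lambda>t. f (\<gamma> t) * (vel t / (\<gamma> t - z)))"
    by (rule integrable_curve_cauchy[OF continuous_on_subset[OF holomorphic_on_imp_continuous_on[OF f] fr] z])
  have i2: "integrable par (\<lambda>t. f z * (vel t / (\<gamma> t - z)))"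
    by (rule integrable_curve_cauchy[OF continuous_on_const z])
  have "(LINT t|par. f (\<gamma> t) * (vel t / (\<gamma> t - z))) = f z * (LINT t|par. vel t / (\<gamma> t - z))"
    using 0 by (simp only: Bochner_Integration.integral_diff[OF i1 i2] integral_mult_right_zero right_minus_eq)
  then show ?thesis by (simp add: integral_cauchy_kernel[OF z] mult.commute)
qed

text \<open>The dilations of \<open>f\<close> about \<open>z\<close> are holomorphic near
  \<open>\<Omega>\<close>, leave the value at \<open>z\<close> unchanged and converge uniformly to
  \<open>f\<close>.\<close>

lemma cauchy_formula:
  assumes f: "f \<in> analytic_algebra \<Omega>" and z: "z \<in> interior \<Omega>"
  shows "(LINT t|par. f (\<gamma> t) * (vel t / (\<gamma> t - z))) = 2 * of_real pi * \<i> * f z"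
proof -
  have fc: "continuous_on \<Omega> f" and fh: "f holomorphic_on interior \<Omega>"
    using f by (auto simp: analytic_algebra_def analytic_on_open)
  have fr: "frontier \<Omega> \<subseteq> \<Omega>" using compact_\<Omega> by (simp add: compact_imp_closed frontier_subset_closed)
  define g where "g s w = f (z + (w - z) / of_real s)" for s :: real and w
  have eq: "(LINT t|par. g s (\<gamma> t) * (vel t / (\<gamma> t - z))) = 2 * of_real pi * \<i> * f z" if s: "s > 1" for s
  proof -
    define U where "U = (\<lambda>w. z + (w - z) / of_real s) -` interior \<Omega>"
    have "open U" unfolding U_def
      by (rule continuous_open_vimage[OF open_interior]) (use s in \<open>auto intro!: continuous_intros\<close>)
    moreover have "convex U"
    proof (rule convexI)
      fix x y u v assume *: "x \<in> U" "y \<in> U" "0 \<le> u" "0 \<le> v" "u + v = (1::real)"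
      have "u *\<^sub>R (z + (x - z) / of_real s) + v *\<^sub>R (z + (y - z) / of_real s) \<in> interior \<Omega>"
        using * by (intro convexD[OF convex_interior[OF convex_\<Omega>]]) (auto simp: U_def)
      also have "u *\<^sub>R (z + (x - z) / of_real s) + v *\<^sub>R (z + (y - z) / of_real s) =
          of_real (u + v) * z + ((u *\<^sub>R x + v *\<^sub>R y) - of_real (u + v) * z) / of_real s"
        by (simp add: scaleR_conv_of_real algebra_simps add_divide_distrib diff_divide_distrib)
      finally show "u *\<^sub>R x + v *\<^sub>R y \<in> U" using *(5) by (simp add: U_def)
    qed
    moreover have "\<Omega> \<subseteq> U" using shrink_mem_interior[OF z _ s] by (auto simp: U_def)
    moreover have "g s holomorphic_on U"
      unfolding g_def[abs_def]
      by (rule holomorphic_on_compose_gen[OF _ fh, unfolded o_def]) (use s in \<open>auto simp: U_def intro!: holomorphic_intros\<close>)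
    ultimately have "(LINT t|par. g s (\<gamma> t) * (vel t / (\<gamma> t - z))) = 2 * of_real pi * \<i> * g s z"
      by (rule cauchy_formula_neighbourhood[OF _ _ _ _ z])
    then show ?thesis by (simp add: g_def)
  qed
  obtain d where d: "d > 0" "\<And>t. cmod (\<gamma> t - z) \<ge> d" using dist_frontier_bound[OF z] by blast
  have i1: "integrable par (\<lambda>t. f (\<gamma> t) * (vel t / (\<gamma> t - z)))"
    by (rule integrable_curve_cauchy[OF continuous_on_subset[OF fc fr] z])
  have "cmod ((LINT t|par. f (\<gamma> t) * (vel t / (\<gamma> t - z))) - 2 * of_real pi * \<i> * f z) \<le> 0 + e" if e: "e > 0" for e
  proof -
    define e' where "e' = e * d / L"
    have "e' > 0" using e d L_pos by (simp add: e'_def)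
    then obtain s0 where s0: "s0 > 1" "\<And>s w. 1 \<le> s \<Longrightarrow> s < s0 \<Longrightarrow> w \<in> \<Omega> \<Longrightarrow> cmod (f (z + (w - z) / of_real s) - f w) < e'"
      using dilation_uniform[OF fc z] by blast
    define s where "s = (1 + s0) / 2"
    have s: "1 < s" "s < s0" using s0(1) by (auto simp: s_def)
    have gc: "continuous_on (frontier \<Omega>) (g s)"
      unfolding g_def
      by (rule continuous_on_compose2[OF fc]) (use s(1) subsetD[OF fr] in \<open>auto intro!: continuous_intros shrink_mem[OF z]\<close>)
    have i2: "integrable par (\<lambda>t. g s (\<gamma> t) * (vel t / (\<gamma> t - z)))" by (rule integrable_curve_cauchy[OF gc z])
    have "(LINT t|par. f (\<gamma> t) * (vel t / (\<gamma> t - z))) - 2 * of_real pi * \<i> * f z =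
        (LINT t|par. f (\<gamma> t) * (vel t / (\<gamma> t - z)) - g s (\<gamma> t) * (vel t / (\<gamma> t - z)))"
      using Bochner_Integration.integral_diff[OF i1 i2] eq[OF s(1)] by simp
    also have "cmod \<dots> \<le> (e' * (1 / d)) * L"
    proof (rule norm_integral_par_le)
      show "(\<lambda>t. f (\<gamma> t) * (vel t / (\<gamma> t - z)) - g s (\<gamma> t) * (vel t / (\<gamma> t - z))) \<in> borel_measurable par"
        by (rule borel_measurable_diff[OF borel_measurable_integrable[OF i1] borel_measurable_integrable[OF i2]])
      fix t
      have "cmod (f (\<gamma> t) - g s (\<gamma> t)) \<le> e'"
        using s0(2)[of s "\<gamma> t"] s \<gamma>_mem[of t] by (simp add: g_def norm_minus_commute less_imp_le)
      then show "norm (f (\<gamma> t) * (vel t / (\<gamma> t - z)) - g s (\<gamma> t) * (vel t / (\<gamma> t - z))) \<le> e' * (1 / d)"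
        unfolding left_diff_distrib[symmetric] norm_mult norm_divide norm_vel
        using d(1) d(2)[of t] \<open>e' > 0\<close> by (intro mult_mono frac_le) auto
    qed
    also have "\<dots> = e" using d L_pos by (simp add: e'_def)
    finally show ?thesis by simp
  qed
  then have "cmod ((LINT t|par. f (\<gamma> t) * (vel t / (\<gamma> t - z))) - 2 * of_real pi * \<i> * f z) \<le> 0"
    by (rule field_le_epsilon)
  then show ?thesis by simp
qed

lemma continuous_frontier: "f \<in> analytic_algebra \<Omega> \<Longrightarrow> continuous_on (frontier \<Omega>) f"
  unfolding analytic_algebra_def
  using compact_\<Omega> by (auto intro: continuous_on_subset dest: compact_imp_closed frontier_subset_closed)

lemma integrable_dl_curve:
  fixes f :: "complex \<Rightarrow> complex"
  assumes f: "continuous_on (frontier \<Omega>) f" and k: "integrable par (dl_kernel z)"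
  shows "integrable par (\<lambda>t. f (\<gamma> t) * of_real (dl_kernel z t))"
proof -
  obtain B where B: "\<And>t. cmod (f (\<gamma> t)) \<le> B" using continuous_frontier_bounded[OF f] by blast
  have B0: "B \<ge> 0" using order_trans[OF norm_ge_zero B[of 0]] .
  show ?thesis
  proof (rule Bochner_Integration.integrable_bound[OF integrable_mult_right[OF k, of B]])
    show "(\<lambda>t. f (\<gamma> t) * of_real (dl_kernel z t)) \<in> borel_measurable par"
      by (rule borel_measurable_times[OF measurable_par[OF measurable_curve_compose[OF f]] borel_measurable_integrable[OF integrable_of_real[OF k]]])
    show "AE t in par. norm (f (\<gamma> t) * of_real (dl_kernel z t)) \<le> norm (B * dl_kernel z t)"
      using B B0 by (intro AE_I2) (auto simp: norm_mult abs_mult intro!: mult_right_mono)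
  qed
qed

text \<open>With \<open>X = \<gamma>' / (\<gamma> - z)\<close>, the sum of \<open>X / (2\<pi>\<i>)\<close> and its conjugate is \<open>Im X / \<pi>\<close>.\<close>

lemma conjugate_cauchy_transform:
  assumes f: "f \<in> analytic_algebra \<Omega>" and z: "z \<in> interior \<Omega>"
  shows "(LINT t|par. cnj (f (\<gamma> t)) * (vel t / (\<gamma> t - z) / (2 * of_real pi * \<i>))) =
    cnj ((LINT t|par. f (\<gamma> t) * of_real (dl_kernel z t)) / of_real pi - f z)"
proof -
  define X where "X t = vel t / (\<gamma> t - z)" for t
  note fc = continuous_frontier[OF f]
  have i1: "integrable par (\<lambda>t. f (\<gamma> t) * of_real (dl_kernel z t))"
    by (rule integrable_dl_curve[OF fc integral_dl_kernel_interior(1)[OF z]])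
  have i2: "integrable par (\<lambda>t. f (\<gamma> t) * X t)" unfolding X_def by (rule integrable_curve_cauchy[OF fc z])
  have id: "cnj (x / (2 * of_real pi * \<i>)) = of_real (Im x) / of_real pi - x / (2 * of_real pi * \<i>)" for x
    by (simp add: complex_eq_iff Re_divide Im_divide power2_eq_square)
  have "cnj (LINT t|par. cnj (f (\<gamma> t)) * (X t / (2 * of_real pi * \<i>))) =
      (LINT t|par. f (\<gamma> t) * cnj (X t / (2 * of_real pi * \<i>)))"
    by (subst Bochner_Integration.integral_cnj[symmetric]) simp
  also have "\<dots> = (LINT t|par. f (\<gamma> t) * of_real (dl_kernel z t) / of_real pi - f (\<gamma> t) * X t / (2 * of_real pi * \<i>))"
    unfolding id by (simp add: dl_kernel_def X_def right_diff_distrib)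
  also have "\<dots> = (LINT t|par. f (\<gamma> t) * of_real (dl_kernel z t)) / of_real pi - (LINT t|par. f (\<gamma> t) * X t) / (2 * of_real pi * \<i>)"
    using i1 i2 by (simp add: Bochner_Integration.integral_diff)
  also have "(LINT t|par. f (\<gamma> t) * X t) = 2 * of_real pi * \<i> * f z" unfolding X_def by (rule cauchy_formula[OF f z])
  finally have "cnj (LINT t|par. cnj (f (\<gamma> t)) * (X t / (2 * of_real pi * \<i>))) =
    (LINT t|par. f (\<gamma> t) * of_real (dl_kernel z t)) / of_real pi - f z" by simp
  from arg_cong[OF this, of cnj] show ?thesis unfolding complex_cnj_cnj X_def .
qed

section \<open>The jump relation\<close>

lemma np_operator_alt:
  assumes f: "continuous_on (frontier \<Omega>) f"
  shows "np_operator \<Omega> f (\<gamma> t0) = of_real ((out_dir t0 - in_dir t0) / pi) * f (\<gamma> t0) +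
      (LINT t|par. f (\<gamma> t) * of_real (dl_kernel (\<gamma> t0) t)) / of_real pi"
  unfolding np_operator_eq[OF f] by (simp add: mult.commute)

text \<open>The kernel has mass 2 pi from inside, but pi, atom included, on the boundary.
  Subtracting the constant \<open>f \<zeta>\<close> therefore leaves an integral of
  \<open>f - f \<zeta>\<close> against a difference of kernels. Near \<open>\<zeta>\<close> it is
  small by continuity and a joint mass of at most 3 pi, elsewhere because the two kernels are close.
  The bound is uniform in the boundary point.\<close>

lemma boundary_limit:
  assumes f: "f \<in> analytic_algebra \<Omega>" and e: "\<epsilon> > (0::real)"
  obtains \<eta> where "\<eta> > 0"
    "\<And>z t0. z \<in> interior \<Omega> \<Longrightarrow> cmod (z - \<gamma> t0) < \<eta> \<Longrightarrow>
      cmod ((LINT t|par. f (\<gamma> t) * of_real (dl_kernel z t)) / of_real pi - f z - np_operator \<Omega> f (\<gamma> t0)) \<le> \<epsilon>"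
proof -
  have fO: "continuous_on \<Omega> f" using f by (simp add: analytic_algebra_def)
  note fc = continuous_frontier[OF f]
  obtain B where B: "\<And>t. cmod (f (\<gamma> t)) \<le> B" using continuous_frontier_bounded[OF fc] by blast
  have B0: "B \<ge> 0" using order_trans[OF norm_ge_zero B[of 0]] .
  \<comment> \<open>Three of these from the joint mass 3 pi, divided by pi, and one from
    \<open>f \<zeta> - f z\<close> make up half of \<open>\<epsilon>\<close>.\<close>
  define e1 where "e1 = \<epsilon> / 8"
  have e1: "e1 > 0" using e by (simp add: e1_def)
  have "uniformly_continuous_on \<Omega> f" using fO compact_\<Omega> by (rule compact_uniformly_continuous)
  then obtain d where d: "d > 0" "\<And>x y. x \<in> \<Omega> \<Longrightarrow> y \<in> \<Omega> \<Longrightarrow> dist x y < d \<Longrightarrow> dist (f x) (f y) < e1"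
    unfolding uniformly_continuous_on_def using e1 by metis
  \<comment> \<open>The first entry keeps \<open>z\<close> at distance \<open>d / 2\<close> from the
    far part of the curve, the second limits the contribution of that part to the other half of
    \<open>\<epsilon>\<close>.\<close>
  define \<eta> where "\<eta> = min (d / 2) (\<epsilon> * d\<^sup>2 / (8 * (B * L + 1)))"
  have BL: "B * L + 1 > 0" using B0 L_pos by (simp add: add_nonneg_pos)
  have \<eta>: "\<eta> > 0" "\<eta> \<le> d / 2" "4 * B * L * \<eta> / d\<^sup>2 \<le> \<epsilon> / 2"
  proof -
    show "\<eta> > 0" using d e BL by (simp add: \<eta>_def)
    show "\<eta> \<le> d / 2" unfolding \<eta>_def by (rule min.cobounded1)
    have "4 * B * L * \<eta> \<le> 4 * (B * L + 1) * \<eta>" using \<open>\<eta> > 0\<close> by (simp add: algebra_simps)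
    also have "\<dots> \<le> 4 * (B * L + 1) * (\<epsilon> * d\<^sup>2 / (8 * (B * L + 1)))"
      using BL by (intro mult_left_mono) (auto simp: \<eta>_def)
    also have "\<dots> = \<epsilon> / 2 * d\<^sup>2" using BL by (simp add: field_simps)
    finally show "4 * B * L * \<eta> / d\<^sup>2 \<le> \<epsilon> / 2" using d(1) by (simp add: divide_le_eq)
  qed
  show ?thesis
  proof (rule that[OF \<eta>(1)])
    fix z t0 assume z: "z \<in> interior \<Omega>" and near: "cmod (z - \<gamma> t0) < \<eta>"
    define \<zeta> where "\<zeta> = \<gamma> t0"
    have \<zeta>: "\<zeta> \<in> \<Omega>" and zO: "z \<in> \<Omega>" using \<gamma>_mem z interior_subset by (auto simp: \<zeta>_def)
    define \<theta> where "\<theta> = out_dir t0 - in_dir t0"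
    note kz = integral_dl_kernel_interior[OF z]
    have k\<zeta>: "integrable par (dl_kernel \<zeta>)" "(LINT t|par. dl_kernel \<zeta> t) = pi - \<theta>"
      unfolding \<zeta>_def \<theta>_def by (rule integral_dl_kernel_boundary)+
    have fz: "cmod (f \<zeta> - f z) \<le> e1"
      using d(2)[OF \<zeta> zO] near \<eta>(2) d(1) by (simp add: \<zeta>_def dist_norm norm_minus_commute less_imp_le)
    have gk: "integrable par (\<lambda>t. (f (\<gamma> t) - f \<zeta>) * of_real (dl_kernel w t))" if "integrable par (dl_kernel w)" for w
      by (rule integrable_dl_curve[OF continuous_on_diff[OF fc continuous_on_const] that])
    have split: "(LINT t|par. (f (\<gamma> t) - f \<zeta>) * of_real (dl_kernel w t)) =
        (LINT t|par. f (\<gamma> t) * of_real (dl_kernel w t)) - f \<zeta> * of_real (LINT t|par. dl_kernel w t)"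
      if w: "integrable par (dl_kernel w)" for w
    proof -
      have "(LINT t|par. (f (\<gamma> t) - f \<zeta>) * of_real (dl_kernel w t)) =
          (LINT t|par. f (\<gamma> t) * of_real (dl_kernel w t) - f \<zeta> * of_real (dl_kernel w t))"
        by (simp add: left_diff_distrib)
      also have "\<dots> = (LINT t|par. f (\<gamma> t) * of_real (dl_kernel w t)) - (LINT t|par. f \<zeta> * of_real (dl_kernel w t))"
        by (rule Bochner_Integration.integral_diff[OF integrable_dl_curve[OF fc w] integrable_mult_right[OF integrable_of_real[OF w]]])
      finally show ?thesis by (simp add: integral_of_real)
    qed
    have "(LINT t|par. f (\<gamma> t) * of_real (dl_kernel z t)) / of_real pi - f z - np_operator \<Omega> f (\<gamma> t0) =
      ((LINT t|par. (f (\<gamma> t) - f \<zeta>) * of_real (dl_kernel z t)) - (LINT t|par. (f (\<gamma> t) - f \<zeta>) * of_real (dl_kernel \<zeta> t))) / of_real pi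
        + (f \<zeta> - f z)"
      unfolding split[OF kz(1)] split[OF k\<zeta>(1)] kz(2) k\<zeta>(2) np_operator_alt[OF fc]
      by (simp add: \<zeta>_def[symmetric] \<theta>_def[symmetric] field_simps)
    also have "cmod \<dots> \<le> (e1 * (2 * pi + pi) + 4 * B * \<eta> / d\<^sup>2 * L) / pi + e1"
    proof (rule order_trans[OF norm_triangle_ineq add_mono[OF _ fz]])
      have "cmod ((LINT t|par. (f (\<gamma> t) - f \<zeta>) * of_real (dl_kernel z t)) - (LINT t|par. (f (\<gamma> t) - f \<zeta>) * of_real (dl_kernel \<zeta> t)))
          = cmod (LINT t|par. (f (\<gamma> t) - f \<zeta>) * of_real (dl_kernel z t) - (f (\<gamma> t) - f \<zeta>) * of_real (dl_kernel \<zeta> t))"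
        by (simp add: Bochner_Integration.integral_diff gk kz k\<zeta>)
      also have "\<dots> \<le> (LINT t|par. e1 * (dl_kernel z t + dl_kernel \<zeta> t) + 4 * B * \<eta> / d\<^sup>2)"
      proof (rule Bochner_Integration.integral_norm_bound_integral)
        show "integrable par (\<lambda>t. (f (\<gamma> t) - f \<zeta>) * of_real (dl_kernel z t) - (f (\<gamma> t) - f \<zeta>) * of_real (dl_kernel \<zeta> t))"
          by (intro Bochner_Integration.integrable_diff gk kz k\<zeta>)
        show "integrable par (\<lambda>t. e1 * (dl_kernel z t + dl_kernel \<zeta> t) + 4 * B * \<eta> / d\<^sup>2)"
          by (intro Bochner_Integration.integrable_add integrable_mult_right kz k\<zeta> finite_measure.integrable_const[OF finite_measure_par])
        fix t
        have k0: "dl_kernel z t \<ge> 0" "dl_kernel \<zeta> t \<ge> 0" using dl_kernel_nonneg zO \<zeta> by auto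
        have "cmod (f (\<gamma> t) - f \<zeta>) * \<bar>dl_kernel z t - dl_kernel \<zeta> t\<bar> \<le> e1 * (dl_kernel z t + dl_kernel \<zeta> t) + 4 * B * \<eta> / d\<^sup>2"
        proof (cases "cmod (\<gamma> t - \<zeta>) < d")
          case True
          then have "cmod (f (\<gamma> t) - f \<zeta>) \<le> e1" using d(2)[OF \<gamma>_mem \<zeta>, of t] by (simp add: dist_norm less_imp_le)
          then have "cmod (f (\<gamma> t) - f \<zeta>) * \<bar>dl_kernel z t - dl_kernel \<zeta> t\<bar> \<le> e1 * (dl_kernel z t + dl_kernel \<zeta> t)"
            using k0 e1 by (intro mult_mono) auto
          then show ?thesis using B0 \<eta>(1) by (simp add: add_increasing2)
        next
          case False
          have far: "cmod (\<gamma> t - \<zeta>) \<ge> d" "cmod (\<gamma> t - z) \<ge> d / 2"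
            using False near \<eta>(2) norm_triangle_ineq[of "\<gamma> t - z" "z - \<zeta>"] by (auto simp: \<zeta>_def)
          then have nz: "\<gamma> t - \<zeta> \<noteq> 0" "\<gamma> t - z \<noteq> 0" using d(1) by auto
          have "vel t / (\<gamma> t - z) - vel t / (\<gamma> t - \<zeta>) = vel t * (z - \<zeta>) / ((\<gamma> t - z) * (\<gamma> t - \<zeta>))"
            using nz by (simp add: field_simps)
          then have "cmod (vel t / (\<gamma> t - z) - vel t / (\<gamma> t - \<zeta>)) = cmod (z - \<zeta>) / (cmod (\<gamma> t - z) * cmod (\<gamma> t - \<zeta>))"
            by (simp add: norm_mult norm_divide)
          also have "\<dots> \<le> \<eta> / (d / 2 * d)"
            using near far d(1) \<eta>(1) by (intro frac_le mult_mono mult_pos_pos) (auto simp: \<zeta>_def)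
          finally have "\<bar>dl_kernel z t - dl_kernel \<zeta> t\<bar> \<le> 2 * \<eta> / d\<^sup>2"
            using abs_Im_le_cmod[of "vel t / (\<gamma> t - z) - vel t / (\<gamma> t - \<zeta>)"]
            by (simp add: dl_kernel_def power2_eq_square mult.commute[of \<eta> 2])
          moreover have "cmod (f (\<gamma> t) - f \<zeta>) \<le> 2 * B"
            using norm_triangle_ineq4[of "f (\<gamma> t)" "f \<zeta>"] B[of t] B[of t0] by (simp add: \<zeta>_def)
          ultimately have "cmod (f (\<gamma> t) - f \<zeta>) * \<bar>dl_kernel z t - dl_kernel \<zeta> t\<bar> \<le> 2 * B * (2 * \<eta> / d\<^sup>2)"
            using B0 by (intro mult_mono) auto
          then show ?thesis using k0 e1 by (simp add: add_increasing)
        qed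
        then show "norm ((f (\<gamma> t) - f \<zeta>) * of_real (dl_kernel z t) - (f (\<gamma> t) - f \<zeta>) * of_real (dl_kernel \<zeta> t)) \<le>
            e1 * (dl_kernel z t + dl_kernel \<zeta> t) + 4 * B * \<eta> / d\<^sup>2"
          unfolding right_diff_distrib[symmetric] of_real_diff[symmetric] norm_mult norm_of_real .
      qed
      also have "\<dots> = e1 * (2 * pi + (pi - \<theta>)) + 4 * B * \<eta> / d\<^sup>2 * L"
        using measure_par
        by (simp add: Bochner_Integration.integral_add kz k\<zeta> finite_measure.integrable_const[OF finite_measure_par])
      also have "\<dots> \<le> e1 * (2 * pi + pi) + 4 * B * \<eta> / d\<^sup>2 * L"
        using e1 in_dir_le_out_dir[of t0] by (simp add: \<theta>_def)
      finally show "cmod (((LINT t|par. (f (\<gamma> t) - f \<zeta>) * of_real (dl_kernel z t)) - (LINT t|par. (f (\<gamma> t) - f \<zeta>) * of_real (dl_kernel \<zeta> t))) / of_real pi)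
          \<le> (e1 * (2 * pi + pi) + 4 * B * \<eta> / d\<^sup>2 * L) / pi"
        by (simp add: norm_divide divide_right_mono)
    qed
    also have "\<dots> \<le> \<epsilon>"
    proof -
      have "4 * B * \<eta> / d\<^sup>2 * L / pi \<le> 4 * B * \<eta> / d\<^sup>2 * L / 1"
        using B0 \<eta>(1) L_pos pi_gt3 by (intro divide_left_mono) auto
      also have "\<dots> \<le> \<epsilon> / 2" using \<eta>(3) by (simp add: mult_ac)
      finally have "4 * B * \<eta> / d\<^sup>2 * L / pi \<le> \<epsilon> / 2" .
      moreover have "e1 * (2 * pi + pi) / pi = 3 * e1" by simp
      ultimately show ?thesis unfolding add_divide_distrib using e1 by (simp add: e1_def)
    qed
    finally show "cmod ((LINT t|par. f (\<gamma> t) * of_real (dl_kernel z t)) / of_real pi - f z - np_operator \<Omega> f (\<gamma> t0)) \<le> \<epsilon>" .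
  qed
qed

text \<open>The value is an average of \<open>f\<close>: the atom \<open>\<theta> / pi\<close> and
  the kernel mass \<open>(pi - \<theta>) / pi\<close> add up to 1.\<close>

lemma np_operator_diff_le:
  assumes f: "continuous_on (frontier \<Omega>) f" and M: "\<And>t. cmod (f (\<gamma> t) - c) \<le> M"
  shows "cmod (np_operator \<Omega> f (\<gamma> t0) - c) \<le> M"
proof -
  define \<theta> where "\<theta> = out_dir t0 - in_dir t0"
  have \<theta>: "\<theta> \<ge> 0" using in_dir_le_out_dir[of t0] by (simp add: \<theta>_def)
  have k: "integrable par (dl_kernel (\<gamma> t0))" "(LINT t|par. dl_kernel (\<gamma> t0) t) = pi - \<theta>"
    unfolding \<theta>_def by (rule integral_dl_kernel_boundary)+
  have i: "integrable par (\<lambda>t. (f (\<gamma> t) - c) * of_real (dl_kernel (\<gamma> t0) t))"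
    by (rule integrable_dl_curve[OF continuous_on_diff[OF f continuous_on_const] k(1)])
  have "(LINT t|par. (f (\<gamma> t) - c) * of_real (dl_kernel (\<gamma> t0) t)) =
      (LINT t|par. f (\<gamma> t) * of_real (dl_kernel (\<gamma> t0) t)) - c * of_real (pi - \<theta>)"
  proof -
    have "(LINT t|par. (f (\<gamma> t) - c) * of_real (dl_kernel (\<gamma> t0) t)) =
        (LINT t|par. f (\<gamma> t) * of_real (dl_kernel (\<gamma> t0) t) - c * of_real (dl_kernel (\<gamma> t0) t))"
      by (simp add: left_diff_distrib)
    also have "\<dots> = (LINT t|par. f (\<gamma> t) * of_real (dl_kernel (\<gamma> t0) t)) - (LINT t|par. c * of_real (dl_kernel (\<gamma> t0) t))"
      by (rule Bochner_Integration.integral_diff[OF integrable_dl_curve[OF f k(1)] integrable_mult_right[OF integrable_of_real[OF k(1)]]])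
    finally show ?thesis by (simp add: integral_of_real k(2))
  qed
  note eq = this
  have gen: "of_real (\<theta> / pi) * a + J / of_real pi - c = of_real (\<theta> / pi) * (a - c) + (J - c * of_real (pi - \<theta>)) / of_real pi" for a J
    by (simp add: field_simps)
  have "np_operator \<Omega> f (\<gamma> t0) - c = of_real (\<theta> / pi) * (f (\<gamma> t0) - c) +
      (LINT t|par. (f (\<gamma> t) - c) * of_real (dl_kernel (\<gamma> t0) t)) / of_real pi"
    unfolding np_operator_alt[OF f] eq \<theta>_def[symmetric] by (rule gen)
  also have "cmod \<dots> \<le> (\<theta> / pi) * M + M * (pi - \<theta>) / pi"
  proof (rule order_trans[OF norm_triangle_ineq add_mono])
    show "cmod (of_real (\<theta> / pi) * (f (\<gamma> t0) - c)) \<le> (\<theta> / pi) * M"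
      unfolding norm_mult norm_of_real using \<theta> M[of t0] by (intro mult_mono) auto
    have "cmod (LINT t|par. (f (\<gamma> t) - c) * of_real (dl_kernel (\<gamma> t0) t)) \<le> (LINT t|par. M * dl_kernel (\<gamma> t0) t)"
      using M order_trans[OF norm_ge_zero M] dl_kernel_nonneg[OF \<gamma>_mem]
      by (intro Bochner_Integration.integral_norm_bound_integral i integrable_mult_right k(1)) (auto simp: norm_mult intro!: mult_mono)
    then show "cmod ((LINT t|par. (f (\<gamma> t) - c) * of_real (dl_kernel (\<gamma> t0) t)) / of_real pi) \<le> M * (pi - \<theta>) / pi"
      by (simp add: k(2) norm_divide divide_right_mono)
  qed
  also have "\<dots> = M" by (simp add: field_simps)
  finally show ?thesis .
qed

section \<open>Quotient norms and the configuration constant\<close>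

lemma sup_bdd:
  fixes f :: "complex \<Rightarrow> complex"
  assumes "continuous_on (frontier \<Omega>) f" shows "bdd_above ((\<lambda>\<zeta>. cmod (f \<zeta> - c)) ` frontier \<Omega>)"
  by (intro bounded_imp_bdd_above compact_imp_bounded compact_continuous_image continuous_intros assms compact_frontier compact_\<Omega>)

lemma np_sup_bdd:
  fixes f :: "complex \<Rightarrow> complex"
  assumes f: "continuous_on (frontier \<Omega>) f" shows "bdd_above ((\<lambda>\<zeta>. cmod (np_operator \<Omega> f \<zeta> - c)) ` frontier \<Omega>)"
proof -
  have "cmod (f (\<gamma> t) - c) \<le> (SUP \<zeta>\<in>frontier \<Omega>. cmod (f \<zeta> - c))" for t
    by (rule cSUP_upper[OF \<gamma>_frontier sup_bdd[OF f]])
  from np_operator_diff_le[OF f this] show ?thesis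
    unfolding range_\<gamma>[symmetric] by (intro bdd_aboveI) auto
qed

lemma frontier_nonempty: "frontier \<Omega> \<noteq> {}" using \<gamma>_frontier by blast

lemma quot_norm_props:
  assumes "\<And>c. bdd_above ((\<lambda>\<zeta>. cmod (g \<zeta> - c)) ` frontier \<Omega>)"
  shows "0 \<le> quot_norm \<Omega> g" "quot_norm \<Omega> g \<le> (SUP \<zeta>\<in>frontier \<Omega>. cmod (g \<zeta> - c))"
proof -
  have nn: "0 \<le> (SUP \<zeta>\<in>frontier \<Omega>. cmod (g \<zeta> - c))" for c
    using cSUP_upper[OF \<gamma>_frontier assms, of 0 c] norm_ge_zero order_trans by blast
  then show "0 \<le> quot_norm \<Omega> g" unfolding quot_norm_def by (intro cINF_greatest) auto
  show "quot_norm \<Omega> g \<le> (SUP \<zeta>\<in>frontier \<Omega>. cmod (g \<zeta> - c))"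
    unfolding quot_norm_def using nn by (intro cINF_lower bdd_belowI[of _ 0]) auto
qed

lemma quot_norm_np_le: assumes f: "continuous_on (frontier \<Omega>) f" shows "quot_norm \<Omega> (np_operator \<Omega> f) \<le> quot_norm \<Omega> f"
  unfolding quot_norm_def[of _ f]
proof (rule cINF_greatest)
  fix c
  have "cmod (f (\<gamma> t) - c) \<le> (SUP \<zeta>\<in>frontier \<Omega>. cmod (f \<zeta> - c))" for t
    by (rule cSUP_upper[OF \<gamma>_frontier sup_bdd[OF f]])
  from np_operator_diff_le[OF f this]
  have "(SUP \<zeta>\<in>frontier \<Omega>. cmod (np_operator \<Omega> f \<zeta> - c)) \<le> (SUP \<zeta>\<in>frontier \<Omega>. cmod (f \<zeta> - c))"
    by (intro cSUP_least frontier_nonempty) (auto simp flip: range_\<gamma>)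
  then show "quot_norm \<Omega> (np_operator \<Omega> f) \<le> (SUP \<zeta>\<in>frontier \<Omega>. cmod (f \<zeta> - c))"
    using quot_norm_props(2)[OF np_sup_bdd[OF f], of c] by linarith
qed simp

text \<open>Averaging does not increase the quotient norm, so the supremum in the constant is over a
  bounded family and dominates its members. The \<open>\<epsilon>\<close> pays for approaching the
  infimum over \<open>c\<close>.\<close>

lemma analytic_config_const_approx:
  assumes f: "f \<in> analytic_algebra \<Omega>" and f1: "\<And>t. cmod (f (\<gamma> t)) \<le> 1" and e: "\<epsilon> > 0"
  shows "0 \<le> analytic_config_const \<Omega>"
    "\<exists>c. \<forall>t. cmod (np_operator \<Omega> f (\<gamma> t) - c) \<le> analytic_config_const \<Omega> + \<epsilon>"
proof -
  note fc = continuous_frontier[OF f]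
  have "(SUP \<zeta>\<in>frontier \<Omega>. cmod (f \<zeta> - 0)) \<le> 1"
    by (intro cSUP_least frontier_nonempty) (use f1 in \<open>auto simp flip: range_\<gamma>\<close>)
  then have q1: "quot_norm \<Omega> f \<le> 1" using quot_norm_props(2)[OF sup_bdd[OF fc], of 0] by linarith
  have "bdd_above ((\<lambda>f. quot_norm \<Omega> (np_operator \<Omega> f)) ` {f \<in> analytic_algebra \<Omega>. quot_norm \<Omega> f \<le> 1})"
    by (intro bdd_aboveI[of _ 1]) (auto intro: order_trans[OF quot_norm_np_le[OF continuous_frontier]])
  then have le: "quot_norm \<Omega> (np_operator \<Omega> f) \<le> analytic_config_const \<Omega>"
    unfolding analytic_config_const_def using f q1 by (intro cSUP_upper) auto
  then show "0 \<le> analytic_config_const \<Omega>" using quot_norm_props(1)[OF np_sup_bdd[OF fc]] by linarith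
  have "quot_norm \<Omega> (np_operator \<Omega> f) < analytic_config_const \<Omega> + \<epsilon>" using le e by simp
  then obtain c where c: "(SUP \<zeta>\<in>frontier \<Omega>. cmod (np_operator \<Omega> f \<zeta> - c)) < analytic_config_const \<Omega> + \<epsilon>"
    unfolding quot_norm_def using cInf_lessD by blast
  have "cmod (np_operator \<Omega> f (\<gamma> t) - c) \<le> analytic_config_const \<Omega> + \<epsilon>" for t
    using cSUP_upper[OF \<gamma>_frontier np_sup_bdd[OF fc], of t c] c by linarith
  then show "\<exists>c. \<forall>t. cmod (np_operator \<Omega> f (\<gamma> t) - c) \<le> analytic_config_const \<Omega> + \<epsilon>" by blast
qed

end

section \<open>Extremal vectors\<close>

lemma norm_add_square: "(norm (x + y))\<^sup>2 = (norm x)\<^sup>2 + 2 * Re (cinner x y) + (norm (y :: 'a::complex_hilbert_space))\<^sup>2"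
  by (simp add: Re_cinner power2_norm_eq_inner inner_add_left inner_add_right inner_commute)

text \<open>The Cauchy--Schwarz inequality for the positive form \<open>K\<^sup>2\<langle>u, v\<rangle> - \<langle>Au, Av\<rangle>\<close>, at a vector
  where this form is nearly zero.\<close>

lemma near_maximal_vector:
  fixes A :: "'a::complex_hilbert_space \<Rightarrow>\<^sub>L 'a"
  assumes A: "\<And>c x. A (c *\<^sub>C x) = c *\<^sub>C A x" and K: "norm A \<le> K" "K > 0"
    and x: "norm x = 1" "K\<^sup>2 - \<eta>\<^sup>2 \<le> (norm (A x))\<^sup>2" and \<eta>: "\<eta> > 0"
  shows "cmod (of_real (K\<^sup>2) * cinner x y - cinner (A x) (A y)) \<le> \<eta> * K * norm y"
proof (cases "y = 0")
  case False
  define Q where "Q = of_real (K\<^sup>2) * cinner x y - cinner (A x) (A y)"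
  obtain c where c: "cmod c = 1" "c * Q = of_real (cmod Q)" by (rule unimodular_rotation)
  \<comment> \<open>Balances the defect \<open>\<eta>\<^sup>2\<close> of \<open>x\<close> against
    the second-order term \<open>K\<^sup>2 * (norm w)\<^sup>2\<close>, which becomes
    \<open>\<eta>\<^sup>2\<close> as well.\<close>
  define r where "r = \<eta> / (K * norm y)"
  have r: "r > 0" "r * (K * norm y) = \<eta>" using \<eta> K False by (simp_all add: r_def)
  \<comment> \<open>The phase turns the mixed term of the form into
    \<open>- (r * cmod Q)\<close>.\<close>
  define w where "w = (- (of_real r * cnj c)) *\<^sub>C y"
  have nw: "norm w = r * norm y" using r(1) c(1) by (simp add: w_def norm_scaleC norm_mult)
  have "norm (A (x + w)) \<le> K * norm (x + w)"
    by (rule order_trans[OF norm_blinfun mult_right_mono[OF K(1) norm_ge_zero]])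
  then have "(norm (A x + A w))\<^sup>2 \<le> (K * norm (x + w))\<^sup>2" by (simp add: blinfun.add_right power_mono)
  then have "(norm (A x))\<^sup>2 + 2 * Re (cinner (A x) (A w)) + (norm (A w))\<^sup>2 \<le>
      K\<^sup>2 * (1 + 2 * Re (cinner x w) + (norm w)\<^sup>2)"
    unfolding power_mult_distrib norm_add_square x(1) by simp
  moreover have "cinner (A x) (A w) = - (of_real r * c * cinner (A x) (A y))"
    "cinner x w = - (of_real r * c * cinner x y)"
    by (simp_all add: w_def A cinner_scaleC_right)
  moreover have "Re (of_real (K\<^sup>2) * (of_real r * c * cinner x y) - of_real r * c * cinner (A x) (A y)) = r * cmod Q"
  proof -
    have "of_real (K\<^sup>2) * (of_real r * c * cinner x y) - of_real r * c * cinner (A x) (A y) = of_real r * (c * Q)"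
      by (simp add: Q_def algebra_simps)
    then show ?thesis by (simp add: c(2))
  qed
  then have "K\<^sup>2 * Re (of_real r * c * cinner x y) - Re (of_real r * c * cinner (A x) (A y)) = r * cmod Q"
    by (simp only: minus_complex.sel Re_complex_of_real Im_complex_of_real times_complex.sel(1)[of "of_real (K\<^sup>2)"] mult_zero_left diff_zero)
  ultimately have "K\<^sup>2 * Re (cinner x w) - Re (cinner (A x) (A w)) = - (r * cmod Q)"
    and sq: "(norm (A x))\<^sup>2 + 2 * Re (cinner (A x) (A w)) + (norm (A w))\<^sup>2 \<le> K\<^sup>2 * (1 + 2 * Re (cinner x w) + (norm w)\<^sup>2)"
    by (simp_all only: uminus_complex.sel mult_minus_right)
  moreover have "K\<^sup>2 * (1 + 2 * Re (cinner x w) + (norm w)\<^sup>2) = K\<^sup>2 + 2 * (K\<^sup>2 * Re (cinner x w)) + K\<^sup>2 * (norm w)\<^sup>2"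
    by (simp add: algebra_simps)
  ultimately have "2 * (r * cmod Q) \<le> K\<^sup>2 - (norm (A x))\<^sup>2 + K\<^sup>2 * (norm w)\<^sup>2"
    using zero_le_power2[of "norm (A w)"] by linarith
  also have "K\<^sup>2 * (norm w)\<^sup>2 = \<eta>\<^sup>2" unfolding nw r(2)[symmetric] by (simp add: power_mult_distrib mult_ac)
  finally have "2 * (r * cmod Q) \<le> 2 * \<eta>\<^sup>2" using x(2) by linarith
  moreover have "\<eta>\<^sup>2 = r * (\<eta> * K * norm y)"
    unfolding power2_eq_square by (subst (2) r(2)[symmetric]) (simp add: mult_ac)
  ultimately have "r * cmod Q \<le> r * (\<eta> * K * norm y)" by linarith
  then show ?thesis using r(1) by (simp add: Q_def)
qed simp

text \<open>The expression is the Moebius image \<open>(p - w) / (1 - cnj w * p)\<close> expanded to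
  first order in \<open>w\<close>. The image has modulus at most 1, so the truncation costs only
  second order in \<open>w\<close>.\<close>

lemma norm_moebius_numerator_le:
  assumes "cmod p \<le> 1" "cmod w \<le> 1"
  shows "cmod (p - w + cnj w * p\<^sup>2) \<le> 1 + 2 * (cmod w)\<^sup>2"
proof -
  have "(cmod (p - w))\<^sup>2 \<le> (cmod (1 - cnj w * p))\<^sup>2"
  proof -
    have "(cmod (1 - cnj w * p))\<^sup>2 - (cmod (p - w))\<^sup>2 = (1 - (cmod w)\<^sup>2) * (1 - (cmod p)\<^sup>2)"
      unfolding cmod_power2 by (simp add: power2_eq_square algebra_simps)
    moreover have "(cmod w)\<^sup>2 \<le> 1" "(cmod p)\<^sup>2 \<le> 1" using assms by (simp_all add: power_le_one)
    then have "0 \<le> (1 - (cmod w)\<^sup>2) * (1 - (cmod p)\<^sup>2)" by (intro mult_nonneg_nonneg) auto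
    ultimately show ?thesis by linarith
  qed
  then have "cmod (p - w) \<le> cmod (1 - cnj w * p)" by (rule power2_le_imp_le) simp
  then have "cmod ((p - w) * (1 + cnj w * p)) \<le> cmod ((1 - cnj w * p) * (1 + cnj w * p))"
    unfolding norm_mult by (intro mult_right_mono) auto
  also have "(1 - cnj w * p) * (1 + cnj w * p) = 1 - (cnj w * p)\<^sup>2" by (simp add: power2_eq_square algebra_simps)
  also have "cmod \<dots> \<le> 1 + (cmod w)\<^sup>2 * (cmod p)\<^sup>2"
    by (rule order_trans[OF norm_triangle_ineq4]) (simp add: norm_power norm_mult power_mult_distrib)
  finally have 1: "cmod ((p - w) * (1 + cnj w * p)) \<le> 1 + (cmod w)\<^sup>2 * (cmod p)\<^sup>2" .
  have "p - w + cnj w * p\<^sup>2 = (p - w) * (1 + cnj w * p) + (w * cnj w) * p"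
    by (simp add: power2_eq_square algebra_simps)
  then have "cmod (p - w + cnj w * p\<^sup>2) \<le> cmod ((p - w) * (1 + cnj w * p)) + cmod ((w * cnj w) * p)"
    by (simp only: norm_triangle_ineq)
  also have "cmod ((w * cnj w) * p) = (cmod w)\<^sup>2 * cmod p" by (simp add: norm_mult power2_eq_square)
  finally have "cmod (p - w + cnj w * p\<^sup>2) \<le> 1 + (cmod w)\<^sup>2 * (cmod p)\<^sup>2 + (cmod w)\<^sup>2 * cmod p" using 1 by linarith
  moreover have "(cmod w)\<^sup>2 * (cmod p)\<^sup>2 \<le> (cmod w)\<^sup>2 * 1" "(cmod w)\<^sup>2 * cmod p \<le> (cmod w)\<^sup>2 * 1"
    using assms by (intro mult_left_mono; simp add: power_le_one)+
  ultimately show ?thesis by simp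
qed

section \<open>Orthogonality at near-extremal vectors\<close>

locale spectral_constant =
  fixes T :: "'a::complex_hilbert_space \<Rightarrow>\<^sub>L 'a" and \<Omega> :: "complex set" and K :: real
  assumes T: "clinear_op T" and K: "K > 1"
    and bound: "\<And>p. (\<And>z. z \<in> \<Omega> \<Longrightarrow> cmod (poly p z) \<le> 1) \<Longrightarrow> norm (poly_op p T) \<le> K"
begin

lemma bound_scaled:
  assumes m: "m > 0" and p: "\<And>z. z \<in> \<Omega> \<Longrightarrow> cmod (poly p z) \<le> m"
  shows "norm (poly_op p T x) \<le> K * m * norm x"
proof -
  have "norm (poly_op (smult (of_real (1 / m)) p) T) \<le> K"
    by (rule bound) (use m p in \<open>simp add: norm_mult norm_divide divide_le_eq_1\<close>)
  then have "norm (poly_op p T) \<le> K * m"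
    unfolding norm_poly_op_smult norm_of_real using m by (simp add: divide_le_eq mult.commute)
  then show ?thesis by (rule order_trans[OF norm_blinfun mult_right_mono[OF _ norm_ge_zero]])
qed

text \<open>Perturbing \<open>p\<close> in the Moebius direction cannot raise the squared norm at
  \<open>x\<close> by more than second order in \<open>\<eta>\<close>, while its first-order change
  is \<open>2 * (K\<^sup>2 - 1) * \<eta> * cmod e\<close>. The second-order terms add up to
  \<open>1 + 2 * K\<^sup>2 + 8 * K\<^sup>2\<close>, whence the constant.\<close>

lemma cinner_near_maximal:
  assumes p: "\<And>z. z \<in> \<Omega> \<Longrightarrow> cmod (poly p z) \<le> 1"
    and x: "norm x = 1" "K\<^sup>2 - \<eta>\<^sup>2 \<le> (norm (poly_op p T x))\<^sup>2" and \<eta>: "0 < \<eta>" "\<eta> \<le> 1"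
  shows "cmod (cinner (poly_op p T x) x) \<le> \<eta> * ((10 * K\<^sup>2 + 1) / (2 * (K\<^sup>2 - 1)))"
proof -
  define A where "A = poly_op p T"
  define e where "e = cinner (A x) x"
  obtain c where c: "cmod c = 1" "c * e = of_real (cmod e)" by (rule unimodular_rotation)
  \<comment> \<open>The size matches the defect of \<open>x\<close>, and the phase makes
    \<open>cnj w * e\<close> nonnegative.\<close>
  define w where "w = of_real \<eta> * cnj c"
  have w: "cmod w = \<eta>" "cnj w * e = of_real (\<eta> * cmod e)" using \<eta> c by (simp_all add: w_def norm_mult mult.assoc)
  have K1: "K\<^sup>2 > 1" using K by (simp add: one_less_power)
  have A: "norm A \<le> K" using bound[OF p] by (simp add: A_def)
  define p' where "p' = p - smult w 1 + smult (cnj w) (p * p)"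
  have "norm (poly_op p' T x) \<le> K * (1 + 2 * \<eta>\<^sup>2) * norm x"
  proof (rule bound_scaled)
    show "0 < 1 + 2 * \<eta>\<^sup>2" by (simp add: add_pos_nonneg)
    show "cmod (poly p' z) \<le> 1 + 2 * \<eta>\<^sup>2" if "z \<in> \<Omega>" for z
      using norm_moebius_numerator_le[of "poly p z" w] p[OF that] w(1) \<eta> by (simp add: p'_def power2_eq_square mult.assoc)
  qed
  then have "(norm (poly_op p' T x))\<^sup>2 \<le> (K * (1 + 2 * \<eta>\<^sup>2))\<^sup>2" using x(1) by (simp add: power_mono)
  moreover have "poly_op p' T x = A x + (cnj w *\<^sub>C A (A x) - w *\<^sub>C x)"
    by (simp add: p'_def poly_op_add poly_op_diff blinfun.add_left blinfun.diff_left poly_op_pCons poly_op_smult poly_op_mult[OF T] A_def)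
  ultimately have "(norm (A x))\<^sup>2 + 2 * Re (cinner (A x) (cnj w *\<^sub>C A (A x) - w *\<^sub>C x)) \<le> (K * (1 + 2 * \<eta>\<^sup>2))\<^sup>2"
    using zero_le_power2[of "norm (cnj w *\<^sub>C A (A x) - w *\<^sub>C x)"] by (simp only: norm_add_square)
  moreover have "cinner (A x) (cnj w *\<^sub>C A (A x) - w *\<^sub>C x) = w * cinner (A x) (A (A x)) - cnj w * e"
    by (simp add: cinner_diff_right cinner_scaleC_right e_def)
  moreover have "(K * (1 + 2 * \<eta>\<^sup>2))\<^sup>2 \<le> K\<^sup>2 + 8 * K\<^sup>2 * \<eta>\<^sup>2"
  proof -
    have "\<eta>\<^sup>2 * \<eta>\<^sup>2 \<le> \<eta>\<^sup>2 * 1" using \<eta> by (intro mult_left_mono) (auto simp: power_le_one)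
    then have "K\<^sup>2 * (\<eta>\<^sup>2 * \<eta>\<^sup>2) \<le> K\<^sup>2 * \<eta>\<^sup>2" by (intro mult_left_mono) auto
    moreover have "(K * (1 + 2 * \<eta>\<^sup>2))\<^sup>2 = K\<^sup>2 + 4 * (K\<^sup>2 * \<eta>\<^sup>2) + 4 * (K\<^sup>2 * (\<eta>\<^sup>2 * \<eta>\<^sup>2))"
      by (simp add: power2_eq_square algebra_simps)
    ultimately show ?thesis by linarith
  qed
  moreover have "Re (w * cinner (A x) (A (A x))) \<ge> K\<^sup>2 * (\<eta> * cmod e) - K\<^sup>2 * \<eta>\<^sup>2"
  proof -
    define R where "R = of_real (K\<^sup>2) * cinner x (A x) - cinner (A x) (A (A x))"
    have "cmod R \<le> \<eta> * K * norm (A x)"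
      unfolding R_def by (rule near_maximal_vector[OF _ A _ x(1) x(2)[folded A_def] \<eta>(1)])
        (use K in \<open>auto simp: A_def clinear_poly_op[OF T]\<close>)
    also have "\<dots> \<le> \<eta> * K * K"
      using order_trans[OF norm_blinfun[of A x]] A x(1) \<eta> K by (intro mult_left_mono) auto
    finally have "cmod (w * R) \<le> \<eta> * (\<eta> * K * K)" unfolding norm_mult w(1) using \<eta>(1) by (intro mult_left_mono) auto
    then have "Re (w * R) \<le> K\<^sup>2 * \<eta>\<^sup>2" using complex_Re_le_cmod[of "w * R"] by (simp add: power2_eq_square mult_ac)
    moreover have "w * cinner (A x) (A (A x)) = of_real (K\<^sup>2) * cnj (cnj w * e) - w * R"
      by (simp add: R_def e_def right_diff_distrib mult_ac cinner_commute[of x])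
    then have "Re (w * cinner (A x) (A (A x))) = K\<^sup>2 * (\<eta> * cmod e) - Re (w * R)" unfolding w(2) by simp
    ultimately show ?thesis by linarith
  qed
  ultimately have "(K\<^sup>2 - \<eta>\<^sup>2) + 2 * (K\<^sup>2 * (\<eta> * cmod e) - K\<^sup>2 * \<eta>\<^sup>2 - \<eta> * cmod e) \<le> K\<^sup>2 + 8 * K\<^sup>2 * \<eta>\<^sup>2"
    using x(2) w(2) by (simp add: A_def)
  then have "\<eta> * (2 * (K\<^sup>2 - 1) * cmod e) \<le> \<eta> * (\<eta> * (10 * K\<^sup>2 + 1))"
    by (simp add: algebra_simps power2_eq_square)
  then have "cmod e * (2 * (K\<^sup>2 - 1)) \<le> \<eta> * (10 * K\<^sup>2 + 1)" using \<eta>(1) by (simp add: mult.commute)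
  then show ?thesis using K1 by (simp add: e_def A_def pos_le_divide_eq)
qed

end

text \<open>At a vector on which \<open>p(T)\<close> nearly attains the best constant \<open>K\<close>, the pairing of \<open>p\<close> with
  its dual polynomial \<open>q\<close> can be computed through \<open>p q p = c p\<^sup>2 + p (q - c) p\<close>, where the first
  summand contributes almost nothing.\<close>

lemma norm_poly_op_le_of_dual:
  fixes T :: "'a::complex_hilbert_space \<Rightarrow>\<^sub>L 'a"
  assumes T: "clinear_op T" and a: "a \<ge> 0"
    and M: "\<And>p. (\<And>z. z \<in> \<Omega> \<Longrightarrow> cmod (poly p z) \<le> 1) \<Longrightarrow> norm (poly_op p T) \<le> M"
    and dual: "\<And>p \<epsilon>. (\<And>z. z \<in> \<Omega> \<Longrightarrow> cmod (poly p z) \<le> 1) \<Longrightarrow> \<epsilon> > 0 \<Longrightarrow>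
      \<exists>q c. (\<forall>z\<in>\<Omega>. cmod (poly q z - c) \<le> a + \<epsilon>) \<and>
        (\<forall>x y. cmod (cinner (poly_op p T x) y + cinner x (poly_op q T y)) \<le> (2 + \<epsilon>) * (norm x * norm y))"
    and p: "\<And>z. z \<in> \<Omega> \<Longrightarrow> cmod (poly p z) \<le> 1"
  shows "norm (poly_op p T) \<le> 1 + sqrt (1 + a)"
proof -
  define P where "P = {p. \<forall>z\<in>\<Omega>. cmod (poly p z) \<le> 1}"
  define K where "K = (SUP p\<in>P. norm (poly_op p T))"
  have bdd: "bdd_above ((\<lambda>p. norm (poly_op p T)) ` P)" using M by (intro bdd_aboveI[of _ M]) (auto simp: P_def)
  have P0: "P \<noteq> {}" by (auto simp: P_def intro!: exI[of _ 0])
  have ub: "norm (poly_op p T) \<le> K" if "\<And>z. z \<in> \<Omega> \<Longrightarrow> cmod (poly p z) \<le> 1" for p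
    unfolding K_def by (rule cSUP_upper[OF _ bdd]) (use that in \<open>simp add: P_def\<close>)
  have "K \<le> 1 + sqrt (1 + a)"
  \<comment> \<open>The orthogonality relation divides by \<open>K\<^sup>2 - 1\<close>, so it is
    available only in the second case.\<close>
  proof (cases "K \<le> 1")
    case True
    then show ?thesis using a by (simp add: add_increasing2)
  next
    case False
    interpret spectral_constant T \<Omega> K using T False ub by unfold_locales auto
    define C1 where "C1 = (10 * K\<^sup>2 + 1) / (2 * (K\<^sup>2 - 1))"
    define C2 where "C2 = 3 + K + K * (a + 1)"
    define C where "C = 5 + 2 * K + C2 * (C1 + 1)"
    have K1: "K\<^sup>2 > 1" using K by (simp add: one_less_power)
    have C1: "C1 \<ge> 0" unfolding C1_def using K1 by (intro divide_nonneg_nonneg) auto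
    have C2: "C2 \<ge> 0" using K a by (simp add: C2_def)
    have C: "C > 0" using K C1 C2 unfolding C_def by (intro add_pos_nonneg mult_nonneg_nonneg) auto
    have main: "K\<^sup>2 \<le> 2 * K + a + \<eta> * C" if \<eta>: "0 < \<eta>" "\<eta> < 1" for \<eta>
    proof -
      \<comment> \<open>Just below \<open>K\<close>, so that first the supremum and then the
        operator norm supply a vector that is extremal up to the defect
        \<open>\<eta>\<^sup>2\<close>.\<close>
      define r where "r = sqrt (K\<^sup>2 - \<eta>\<^sup>2)"
      have \<eta>2: "0 < \<eta>\<^sup>2" "\<eta>\<^sup>2 \<le> \<eta>" using \<eta> by (auto simp: power2_eq_square mult_left_le)
      have r0: "r \<ge> 0" "r\<^sup>2 = K\<^sup>2 - \<eta>\<^sup>2" using \<eta>2 \<eta>(2) K1 by (simp_all add: r_def)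
      have "r < K" unfolding r_def by (rule real_less_lsqrt) (use K \<eta>2 in auto)
      then obtain p where p: "p \<in> P" "r < norm (poly_op p T)"
        unfolding K_def using less_cSUP_iff[OF P0 bdd, of r] by blast
      then have p1: "\<And>z. z \<in> \<Omega> \<Longrightarrow> cmod (poly p z) \<le> 1" by (simp add: P_def)
      define A where "A = poly_op p T"
      have "\<exists>x. \<not> norm (A x) \<le> r * norm x"
      proof (rule ccontr)
        assume "\<not> ?thesis"
        then have "norm A \<le> r" by (intro norm_blinfun_bound r0(1)) blast
        then show False using p(2) by (simp add: A_def)
      qed
      then obtain x0 where x0: "r * norm x0 < norm (A x0)" by (auto simp: not_le)
      then have n0: "norm x0 > 0" by (cases "x0 = 0") auto
      define x where "x = (1 / norm x0) *\<^sub>R x0"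
      have x: "norm x = 1" using n0 by (simp add: x_def)
      have "r < norm (A x)" using x0 n0 by (simp add: x_def blinfun.scaleR_right less_divide_eq)
      then have "r\<^sup>2 \<le> (norm (A x))\<^sup>2" using r0(1) by (intro power_mono) auto
      then have Ax: "K\<^sup>2 - \<eta>\<^sup>2 \<le> (norm (A x))\<^sup>2" by (simp add: r0(2))
      have AK: "norm A \<le> K" using ub[OF p1] by (simp add: A_def)
      have nAx: "norm (A x) \<le> K" using norm_blinfun[of A x] AK x by simp
      have Ac: "\<And>c x. A (c *\<^sub>C x) = c *\<^sub>C A x" by (simp add: A_def clinear_poly_op[OF T])
      have near: "cmod (of_real (K\<^sup>2) * cinner x y - cinner (A x) (A y)) \<le> \<eta> * K * norm y" for y
        by (rule near_maximal_vector[OF Ac AK _ x Ax \<eta>(1)]) (use K in simp)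
      have E: "cmod (cinner (A x) x) \<le> \<eta> * C1"
        unfolding C1_def A_def by (rule cinner_near_maximal[OF p1 x Ax[unfolded A_def]]) (use \<eta> in auto)
      obtain q c where q: "\<And>z. z \<in> \<Omega> \<Longrightarrow> cmod (poly q z - c) \<le> a + \<eta>"
        and pq: "\<And>x y. cmod (cinner (A x) y + cinner x (poly_op q T y)) \<le> (2 + \<eta>) * (norm x * norm y)"
        using dual[OF p1 \<eta>(1)] unfolding A_def by blast
      define B where "B = poly_op q T"
      \<comment> \<open>The pairing itself bounds \<open>q(T)\<close>, although the size of
        \<open>c\<close>, and with it that of \<open>q\<close>, is not known yet; 3 stands for
        \<open>2 + \<eta>\<close>.\<close>
      have B: "norm B \<le> 3 + K"
      proof (rule norm_blinfun_bound)
        fix y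
        show "norm (B y) \<le> (3 + K) * norm y"
        proof (rule norm_le_of_cinner)
          fix u
          have "cmod (cinner u (B y)) \<le> cmod (cinner (A u) y + cinner u (B y)) + cmod (cinner (A u) y)"
            using norm_triangle_ineq4[of "cinner (A u) y + cinner u (B y)" "cinner (A u) y"] by simp
          also have "\<dots> \<le> 3 * (norm u * norm y) + K * norm u * norm y"
          proof (rule add_mono)
            have "cmod (cinner (A u) y + cinner u (B y)) \<le> (2 + \<eta>) * (norm u * norm y)" unfolding B_def by (rule pq)
            also have "\<dots> \<le> 3 * (norm u * norm y)" using \<eta> by (intro mult_right_mono) auto
            finally show "cmod (cinner (A u) y + cinner u (B y)) \<le> 3 * (norm u * norm y)" .
            show "cmod (cinner (A u) y) \<le> K * norm u * norm y"
              by (rule order_trans[OF cmod_cinner_le mult_right_mono[OF order_trans[OF norm_blinfun mult_right_mono[OF AK norm_ge_zero]] norm_ge_zero]])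
          qed
          finally show "cmod (cinner (B y) u) \<le> (3 + K) * norm y * norm u"
            by (subst cinner_commute) (simp add: algebra_simps)
        qed (use K in simp)
      qed (use K in simp)
      have qc: "norm (poly_op (q - smult c 1) T x) \<le> K * (a + \<eta>) * norm x"
        by (rule bound_scaled) (use a \<eta> q in auto)
      have c: "cmod c \<le> C2"
      proof -
        have "c *\<^sub>C x = B x - poly_op (q - smult c 1) T x"
          by (simp add: poly_op_diff blinfun.diff_left poly_op_pCons poly_op_smult B_def)
        then have "norm (c *\<^sub>C x) \<le> norm (B x) + norm (poly_op (q - smult c 1) T x)" by (simp only: norm_triangle_ineq4)
        also have "\<dots> \<le> (3 + K) + K * (a + 1)"
        proof (rule add_mono)
          show "norm (B x) \<le> 3 + K" using norm_blinfun[of B x] B x by simp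
          have "K * (a + \<eta>) \<le> K * (a + 1)" using \<eta> K by (intro mult_left_mono) auto
          then show "norm (poly_op (q - smult c 1) T x) \<le> K * (a + 1)" using qc unfolding x by linarith
        qed
        finally show ?thesis by (simp add: norm_scaleC x C2_def)
      qed
      \<comment> \<open>Estimated as a single polynomial: since \<open>p\<close> has modulus at most
        1 on \<open>\<Omega>\<close>, only one factor \<open>K\<close> appears instead of
        three.\<close>
      have rr: "norm (poly_op (p * (q - smult c 1) * p) T x) \<le> K * (a + \<eta>) * norm x"
      proof (rule bound_scaled)
        fix z assume z: "z \<in> \<Omega>"
        have "cmod (poly (p * (q - smult c 1) * p) z) \<le> 1 * (a + \<eta>) * 1"
          unfolding poly_mult norm_mult using p1[OF z] q[OF z] a \<eta> by (intro mult_mono) auto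
        then show "cmod (poly (p * (q - smult c 1) * p) z) \<le> a + \<eta>" by simp
      qed (use a \<eta> in auto)
      have ABA: "A (B (A x)) = c *\<^sub>C A (A x) + poly_op (p * (q - smult c 1) * p) T x"
        by (simp add: poly_op_mult[OF T] poly_op_diff blinfun.diff_left blinfun.diff_right poly_op_pCons poly_op_smult Ac[unfolded A_def] A_def B_def)
      \<comment> \<open>By near-maximality this is almost \<open>K\<^sup>2 * cinner x (A x)\<close>,
        which orthogonality makes small. So the unknown constant \<open>c\<close> contributes almost
        nothing.\<close>
      have AA: "cmod (cinner (A x) (A (A x))) \<le> K\<^sup>2 * (\<eta> * (C1 + 1))"
      proof -
        have "cmod (cinner (A x) (A (A x))) \<le> cmod (of_real (K\<^sup>2) * cinner x (A x)) + cmod (of_real (K\<^sup>2) * cinner x (A x) - cinner (A x) (A (A x)))"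
          using norm_triangle_ineq4[of "of_real (K\<^sup>2) * cinner x (A x)" "of_real (K\<^sup>2) * cinner x (A x) - cinner (A x) (A (A x))"] by simp
        also have "\<dots> \<le> K\<^sup>2 * (\<eta> * C1) + \<eta> * K * K"
        proof (rule add_mono)
          show "cmod (of_real (K\<^sup>2) * cinner x (A x)) \<le> K\<^sup>2 * (\<eta> * C1)"
            using E by (subst cinner_commute) (simp add: norm_mult norm_power mult_left_mono)
          show "cmod (of_real (K\<^sup>2) * cinner x (A x) - cinner (A x) (A (A x))) \<le> \<eta> * K * K"
            by (rule order_trans[OF near mult_left_mono[OF nAx]]) (use \<eta> K in auto)
        qed
        finally show ?thesis by (simp add: power2_eq_square algebra_simps)
      qed
      have "cmod (cinner (A x) (A (B (A x)))) \<le> C2 * (K\<^sup>2 * (\<eta> * (C1 + 1))) + K * (K * (a + \<eta>))"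
        unfolding ABA cinner_add_right cinner_scaleC_right
      proof (rule order_trans[OF norm_triangle_ineq add_mono])
        show "cmod (cnj c * cinner (A x) (A (A x))) \<le> C2 * (K\<^sup>2 * (\<eta> * (C1 + 1)))"
          unfolding norm_mult complex_mod_cnj using c AA C2 by (intro mult_mono) auto
        show "cmod (cinner (A x) (poly_op (p * (q - smult c 1) * p) T x)) \<le> K * (K * (a + \<eta>))"
          by (rule order_trans[OF cmod_cinner_le mult_mono]) (use nAx rr x K in auto)
      qed
      moreover have "cmod (of_real (K\<^sup>2) * cinner x (B (A x)) - cinner (A x) (A (B (A x)))) \<le> \<eta> * K * ((3 + K) * K)"
      proof (rule order_trans[OF near mult_left_mono])
        show "norm (B (A x)) \<le> (3 + K) * K"
          by (rule order_trans[OF norm_blinfun mult_mono[OF B nAx]]) (use K in auto)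
      qed (use \<eta> K in auto)
      ultimately have "cmod (of_real (K\<^sup>2) * cinner x (B (A x))) \<le>
          \<eta> * K * ((3 + K) * K) + (C2 * (K\<^sup>2 * (\<eta> * (C1 + 1))) + K * (K * (a + \<eta>)))"
        using norm_triangle_sub[of "of_real (K\<^sup>2) * cinner x (B (A x))" "cinner (A x) (A (B (A x)))"] by linarith
      also have "\<dots> = K\<^sup>2 * (a + \<eta> * (4 + K + C2 * (C1 + 1)))" by (simp add: power2_eq_square algebra_simps)
      finally have "K\<^sup>2 * cmod (cinner x (B (A x))) \<le> K\<^sup>2 * (a + \<eta> * (4 + K + C2 * (C1 + 1)))"
        by (simp add: norm_mult norm_power)
      \<comment> \<open>The two factors \<open>K\<close> of the main term, one from
        \<open>norm (A x)\<close> and one from \<open>rr\<close>, cancel here.\<close>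
      then have xBA: "cmod (cinner x (B (A x))) \<le> a + \<eta> * (4 + K + C2 * (C1 + 1))" using K by simp
      have "cmod (cinner (A x) (A x)) \<le> cmod (cinner (A x) (A x) + cinner x (B (A x))) + cmod (cinner x (B (A x)))"
        using norm_triangle_ineq4[of "cinner (A x) (A x) + cinner x (B (A x))" "cinner x (B (A x))"] by simp
      also have "cmod (cinner (A x) (A x)) = (norm (A x))\<^sup>2" by (simp add: cinner_self norm_power)
      also have "cmod (cinner (A x) (A x) + cinner x (B (A x))) \<le> (2 + \<eta>) * K"
        unfolding B_def by (rule order_trans[OF pq mult_left_mono]) (use x nAx \<eta> in auto)
      finally have "K\<^sup>2 - \<eta>\<^sup>2 \<le> (2 + \<eta>) * K + (a + \<eta> * (4 + K + C2 * (C1 + 1)))" using Ax xBA by linarith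
      then have "K\<^sup>2 \<le> \<eta> + ((2 + \<eta>) * K + (a + \<eta> * (4 + K + C2 * (C1 + 1))))" using \<eta>2 by linarith
      then show ?thesis by (simp add: C_def algebra_simps)
    qed
    have "K\<^sup>2 \<le> 2 * K + a"
    proof (rule ccontr)
      assume "\<not> K\<^sup>2 \<le> 2 * K + a"
      then have d: "K\<^sup>2 - (2 * K + a) > 0" by simp
      \<comment> \<open>Small enough for \<open>\<eta> * C\<close> to be at most half of the assumed
        excess.\<close>
      define \<eta> where "\<eta> = min (1 / 2) ((K\<^sup>2 - (2 * K + a)) / (2 * C))"
      have \<eta>: "0 < \<eta>" "\<eta> < 1" using d C by (auto simp: \<eta>_def)
      have "\<eta> \<le> (K\<^sup>2 - (2 * K + a)) / (2 * C)" unfolding \<eta>_def by (rule min.cobounded2)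
      then have "\<eta> * (2 * C) \<le> K\<^sup>2 - (2 * K + a)" using C by (simp add: pos_le_divide_eq)
      then show False using main[OF \<eta>] d by linarith
    qed
    then have "(K - 1)\<^sup>2 \<le> 1 + a" by (simp add: power2_eq_square algebra_simps)
    then have "K - 1 \<le> sqrt (1 + a)" by (rule real_le_rsqrt)
    then show ?thesis by simp
  qed
  then show ?thesis using ub[OF p] by linarith
qed

section \<open>Continuity in the operator, and convexity of the numerical range\<close>

lemma poly_op_pCons_compose: "poly_op (pCons a p) T = affine_op a 0 0 + (poly_op p T o\<^sub>L T)"
  by (rule blinfun_eqI) (simp add: poly_op_pCons blinfun.add_left affine_op.rep_eq)

lemma tendsto_poly_op:
  fixes S :: "'b \<Rightarrow> 'a::complex_hilbert_space \<Rightarrow>\<^sub>L 'a"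
  assumes "(S \<longlongrightarrow> T) F" shows "((\<lambda>s. poly_op p (S s)) \<longlongrightarrow> poly_op p T) F"
  by (induction p)
    (auto simp: poly_op_pCons_compose intro!: tendsto_add bounded_bilinear.tendsto[OF bounded_bilinear_blinfun_compose] assms)

lemma tendsto_affine_op:
  assumes c: "(c \<longlongrightarrow> 0) F" and r: "(r \<longlongrightarrow> 1) F"
  shows "((\<lambda>s. affine_op (c s) (of_real (r s)) T) \<longlongrightarrow> T) F"
proof -
  have "affine_op (c s) (of_real (r s)) T = affine_op (c s) 0 T + r s *\<^sub>R T" for s
    by (rule blinfun_eqI) (simp add: affine_op.rep_eq blinfun.add_left blinfun.scaleR_left scaleC_of_real)
  moreover have "((\<lambda>s. affine_op (c s) 0 T) \<longlongrightarrow> 0) F"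
  proof (rule Lim_null_comparison)
    have "norm (affine_op (c s) 0 T) \<le> cmod (c s)" for s
      by (rule norm_blinfun_bound) (auto simp: affine_op.rep_eq norm_scaleC)
    then show "\<forall>\<^sub>F s in F. norm (affine_op (c s) 0 T) \<le> cmod (c s)" by simp
    show "((\<lambda>s. cmod (c s)) \<longlongrightarrow> 0) F" using c by (rule tendsto_norm_zero)
  qed
  from tendsto_add[OF this tendsto_scaleR[OF r tendsto_const[of T]]]
  have "((\<lambda>s. affine_op (c s) 0 T + r s *\<^sub>R T) \<longlongrightarrow> T) F" by simp
  ultimately show ?thesis by simp
qed

text \<open>The Toeplitz--Hausdorff theorem. After an affine change the two given points are 0 and 1, and
  rotating one of the two vectors makes the form real on the segment between them.\<close>

lemma convex_numerical_range:
  fixes T :: "'a::complex_hilbert_space \<Rightarrow>\<^sub>L 'a"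
  assumes T: "clinear_op T" shows "convex (numerical_range T)"
proof (rule convexI)
  fix a b and u v :: real
  assume "a \<in> numerical_range T" "b \<in> numerical_range T" and uv: "0 \<le> u" "0 \<le> v" "u + v = 1"
  then obtain x y where x: "norm x = 1" "cinner (T x) x = a" and y: "norm y = 1" "cinner (T y) y = b"
    unfolding numerical_range_def by blast
  show "u *\<^sub>R a + v *\<^sub>R b \<in> numerical_range T"
  proof (cases "a = b")
    case True
    then have "u *\<^sub>R a + v *\<^sub>R b = a" using uv by (simp flip: scaleR_add_left)
    then show ?thesis using x by (auto simp: numerical_range_def)
  next
    case False
    have Tc: "T (c *\<^sub>C w) = c *\<^sub>C T w" for c w using T by (simp add: clinear_op_def)
    define \<beta> where "\<beta> w w' = (cinner (T w) w' - a * cinner w w') / (b - a)" for w w'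
    have \<beta>_add: "\<beta> (w1 + w2) w3 = \<beta> w1 w3 + \<beta> w2 w3" "\<beta> w3 (w1 + w2) = \<beta> w3 w1 + \<beta> w3 w2" for w1 w2 w3
      by (simp_all add: \<beta>_def cinner_add_left cinner_add_right blinfun.add_right add_divide_distrib diff_divide_distrib algebra_simps)
    have \<beta>_scale: "\<beta> (c *\<^sub>C w) w' = c * \<beta> w w'" "\<beta> w (c *\<^sub>C w') = cnj c * \<beta> w w'" for c w w'
      by (simp_all add: \<beta>_def Tc cinner_scaleC_left cinner_scaleC_right algebra_simps diff_divide_distrib)
    have \<beta>_x: "\<beta> x x = 0" and \<beta>_y: "\<beta> y y = 1" using x y False by (simp_all add: \<beta>_def cinner_self)
    obtain c where c: "cmod c = 1" "c * (\<beta> x y - cnj (\<beta> y x)) = of_real (cmod (\<beta> x y - cnj (\<beta> y x)))"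
      by (rule unimodular_rotation)
    define x' where "x' = c *\<^sub>C x"
    have "Im (\<beta> x' y + \<beta> y x') = Im (c * (\<beta> x y - cnj (\<beta> y x)))"
      by (simp add: x'_def \<beta>_scale algebra_simps)
    then have cross: "Im (\<beta> x' y + \<beta> y x') = 0" unfolding c(2) by simp
    have \<beta>_x': "\<beta> x' x' = 0" by (simp add: x'_def \<beta>_scale \<beta>_x)
    define w where "w r = of_real (1 - r) *\<^sub>C x' + of_real r *\<^sub>C y" for r :: real
    have \<beta>_w: "\<beta> (w r) (w r) = of_real (r * (1 - r)) * (\<beta> x' y + \<beta> y x') + of_real (r * r)" for r
      by (simp add: w_def \<beta>_add \<beta>_scale \<beta>_x' \<beta>_y algebra_simps)
    \<comment> \<open>A zero of the path would make the two vectors dependent, but the form is 0 on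
      one of them and 1 on the other.\<close>
    have w0: "w r \<noteq> 0" for r
    proof
      assume "w r = 0"
      then have eq: "of_real r *\<^sub>C y = - (of_real (1 - r) *\<^sub>C x')" by (simp add: w_def eq_neg_iff_add_eq_0 add.commute)
      have "of_real (r * r) * \<beta> y y = \<beta> (of_real r *\<^sub>C y) (of_real r *\<^sub>C y)" by (simp add: \<beta>_scale)
      also have "\<dots> = 0" unfolding eq scaleC_minus_left[symmetric] by (simp add: \<beta>_scale \<beta>_x')
      finally have "r = 0" by (simp add: \<beta>_y)
      then have "x' = 0" using \<open>w r = 0\<close> by (simp add: w_def)
      then show False using norm_scaleC[of c x] x(1) c(1) by (simp add: x'_def)
    qed
    define h where "h r = Re (\<beta> (w r) (w r)) / (norm (w r))\<^sup>2" for r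
    have cw: "continuous_on {0..1} w" unfolding w_def scaleC_of_real by (intro continuous_intros)
    have ch: "continuous_on {0..1} h"
      unfolding h_def \<beta>_w using w0 by (intro continuous_intros cw) auto
    have "h 0 = 0" "h 1 = 1" unfolding h_def \<beta>_w using y by (simp_all add: w_def)
    then obtain r where r: "h r = v" using IVT'[of h 0 v 1] ch uv by auto
    define z where "z = of_real (1 / norm (w r)) *\<^sub>C w r"
    have z: "norm z = 1" using w0[of r] by (simp add: z_def norm_scaleC norm_divide)
    have "Im (\<beta> (w r) (w r)) = 0" unfolding \<beta>_w using cross by simp
    then have "\<beta> (w r) (w r) = of_real (v * (norm (w r))\<^sup>2)"
      using r w0[of r] by (auto simp: h_def complex_eq_iff)
    then have "\<beta> z z = of_real v" using w0[of r] by (simp add: z_def \<beta>_scale power2_eq_square)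
    then have "cinner (T z) z = a + of_real v * (b - a)"
      using False z by (simp add: \<beta>_def cinner_self divide_eq_eq algebra_simps)
    also have "\<dots> = of_real (u + v) * a + of_real v * (b - a)" by (simp add: uv(3))
    also have "\<dots> = u *\<^sub>R a + v *\<^sub>R b" by (simp add: scaleR_conv_of_real algebra_simps)
    finally show ?thesis using z by (force simp: numerical_range_def)
  qed
qed

section \<open>The functional calculus\<close>

context boundary_param begin

lemma operator_in_convexI:
  assumes "clinear_op T" "numerical_range T \<subseteq> \<Omega>" "z0 \<in> interior \<Omega>" "s > 1"
  shows "operator_in_convex \<Omega> T z0 s"
proof unfold_locales
  show "cinner (T x) x \<in> \<Omega>" if "norm x = 1" for x
    using assms(2) that unfolding numerical_range_def by blast
qed (fact assms)+

text \<open>The expanded curve seen from \<open>z\<close> is a scaled copy of the boundary seen from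
  the contracted point, and the Cauchy kernel is invariant under scaling. Boundary points thereby
  become nearby interior points.\<close>

lemma cauchy_kernel_outer:
  assumes "operator_in_convex \<Omega> T z0 s"
  shows "operator_in_convex.weight \<Omega> s t * (1 / (operator_in_convex.outer \<Omega> z0 s t - z)) =
    vel t / (\<gamma> t - (z0 + (z - z0) / of_real s)) / (2 * of_real pi * \<i>)"
proof -
  interpret operator_in_convex \<Omega> T z0 s by fact
  have "outer t - z = of_real s * (\<gamma> t - (z0 + (z - z0) / of_real s))"
    using s by (simp add: outer_def field_simps)
  then show ?thesis using s by (simp add: weight_def)
qed

text \<open>At a boundary point the transform over the expanded curve is the transform over the
  boundary at a nearby interior point, where the jump relation applies; the maximum modulus
  principle carries the estimate inside. Closeness of \<open>s\<close> to 1 is needed twice: for the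
  jump relation, and for returning from the dilated polynomial to \<open>p\<close>.\<close>

lemma dual_polynomial:
  fixes T :: "'a::complex_hilbert_space \<Rightarrow>\<^sub>L 'a"
  assumes T: "clinear_op T" "numerical_range T \<subseteq> \<Omega>"
    and p: "\<And>z. z \<in> \<Omega> \<Longrightarrow> cmod (poly p z) \<le> 1" and \<epsilon>: "\<epsilon> > 0"
  shows "\<exists>q c. (\<forall>z\<in>\<Omega>. cmod (poly q z - c) \<le> analytic_config_const \<Omega> + \<epsilon>) \<and>
    (\<forall>x y. cmod (cinner (poly_op p T x) y + cinner x (poly_op q T y)) \<le> (2 + \<epsilon>) * (norm x * norm y))"
proof -
  define a where "a = analytic_config_const \<Omega>"
  \<comment> \<open>Three errors of this size arise on the boundary and two in the pairing.\<close>
  define e where "e = \<epsilon> / 4"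
  have e: "e > 0" using \<epsilon> by (simp add: e_def)
  obtain z0 where z0: "z0 \<in> interior \<Omega>" using interior_\<Omega> by blast
  have fA: "poly p \<in> analytic_algebra \<Omega>"
    by (auto simp: analytic_algebra_def analytic_on_open intro!: continuous_intros holomorphic_intros)
  obtain \<eta> where \<eta>: "\<eta> > 0" "\<And>z t0. z \<in> interior \<Omega> \<Longrightarrow> cmod (z - \<gamma> t0) < \<eta> \<Longrightarrow>
      cmod ((LINT t|par. poly p (\<gamma> t) * of_real (dl_kernel z t)) / of_real pi - poly p z - np_operator \<Omega> (poly p) (\<gamma> t0)) \<le> e"
    using boundary_limit[OF fA e] by blast
  obtain c0 where c0: "\<And>t. cmod (np_operator \<Omega> (poly p) (\<gamma> t) - c0) \<le> a + e"
    using analytic_config_const_approx(2)[OF fA p[OF \<gamma>_mem] e] unfolding a_def by blast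
  obtain s0 where s0: "s0 > 1" "\<And>s w. 1 \<le> s \<Longrightarrow> s < s0 \<Longrightarrow> w \<in> \<Omega> \<Longrightarrow> cmod (z0 + (w - z0) / of_real s - w) < \<eta>"
    using dilation_uniform[OF continuous_on_id z0 \<eta>(1)] by auto
  \<comment> \<open>Applying the dilated polynomial to \<open>T\<close> is the same as applying
    \<open>p\<close> to this contraction of \<open>T\<close>.\<close>
  define S where "S s = affine_op (z0 - z0 / of_real s) (of_real (1 / s)) T" for s :: real
  have "((\<lambda>s. poly_op p (S s)) \<longlongrightarrow> poly_op p T) (at_right 1)"
    unfolding S_def by (rule tendsto_poly_op[OF tendsto_affine_op]) (auto intro!: tendsto_eq_intros)
  then have "\<forall>\<^sub>F s in at_right 1. dist (poly_op p (S s)) (poly_op p T) < e" using e by (rule tendstoD)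
  then obtain s1 where s1: "s1 > 1" "\<And>s. 1 < s \<Longrightarrow> s < s1 \<Longrightarrow> dist (poly_op p (S s)) (poly_op p T) < e"
    unfolding eventually_at_right_field by blast
  define s where "s = (1 + min s0 s1) / 2"
  have s: "1 < s" "s < s0" "s < s1" using s0(1) s1(1) by (auto simp: s_def)
  interpret O: operator_in_convex \<Omega> T z0 s by (rule operator_in_convexI[OF T z0 s(1)])
  obtain q where q: "\<And>z. z \<in> \<Omega> \<Longrightarrow> cmod (poly q z - (LINT t|par. cnj (poly p (\<gamma> t)) * O.weight t * (1 / (O.outer t - z)))) \<le> e"
    and pq: "\<And>x y. cmod (cinner (poly_op (O.dilate p) T x) y + cinner x (poly_op q T y)) \<le> (2 + e) * (norm x * norm y)"
    using O.dual_pair_estimate[OF p e] by blast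
  have fr: "cmod (poly q (\<gamma> t0) - cnj c0) \<le> a + \<epsilon>" for t0
  proof -
    define z where "z = z0 + (\<gamma> t0 - z0) / of_real s"
    have z: "z \<in> interior \<Omega>" unfolding z_def by (rule shrink_mem_interior[OF z0 \<gamma>_mem s(1)])
    have near: "cmod (z - \<gamma> t0) < \<eta>" unfolding z_def by (rule s0(2)[OF less_imp_le[OF s(1)] s(2) \<gamma>_mem])
    define X where "X = (LINT t|par. poly p (\<gamma> t) * of_real (dl_kernel z t)) / of_real pi - poly p z"
    have k: "cnj (poly p (\<gamma> t)) * O.weight t * (1 / (O.outer t - \<gamma> t0)) =
        cnj (poly p (\<gamma> t)) * (vel t / (\<gamma> t - z) / (2 * of_real pi * \<i>))" for t
      unfolding mult.assoc[of "cnj (poly p (\<gamma> t))"] cauchy_kernel_outer[OF O.operator_in_convex_axioms] z_def ..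
    have "(LINT t|par. cnj (poly p (\<gamma> t)) * O.weight t * (1 / (O.outer t - \<gamma> t0))) = cnj X"
      unfolding k X_def by (rule conjugate_cauchy_transform[OF fA z])
    then have 1: "cmod (poly q (\<gamma> t0) - cnj X) \<le> e" using q[OF \<gamma>_mem, of t0] by simp
    have 2: "cmod (X - np_operator \<Omega> (poly p) (\<gamma> t0)) \<le> e" unfolding X_def by (rule \<eta>(2)[OF z near])
    have "cmod (X - c0) \<le> e + (a + e)"
      using norm_triangle_ineq[of "X - np_operator \<Omega> (poly p) (\<gamma> t0)" "np_operator \<Omega> (poly p) (\<gamma> t0) - c0"] 2 c0[of t0] by simp
    then have 3: "cmod (cnj X - cnj c0) \<le> e + (a + e)" by (simp flip: complex_cnj_diff)
    have "cmod (poly q (\<gamma> t0) - cnj c0) \<le> e + (e + (a + e))"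
      using norm_triangle_ineq[of "poly q (\<gamma> t0) - cnj X" "cnj X - cnj c0"] 1 3 by simp
    then show ?thesis using \<epsilon> by (simp add: e_def)
  qed
  have "cmod (poly q z - cnj c0) \<le> a + \<epsilon>" if "z \<in> \<Omega>" for z
  proof (rule maximum_modulus_frontier[of "\<lambda>z. poly q z - cnj c0" \<Omega>])
    show "cmod (poly q \<zeta> - cnj c0) \<le> a + \<epsilon>" if "\<zeta> \<in> frontier \<Omega>" for \<zeta>
      using frontier_time[OF that] fr by blast
    show "bounded \<Omega>" by (rule compact_imp_bounded[OF compact_\<Omega>])
  qed (use that in \<open>auto intro!: continuous_intros holomorphic_intros\<close>)
  moreover have "cmod (cinner (poly_op p T x) y + cinner x (poly_op q T y)) \<le> (2 + \<epsilon>) * (norm x * norm y)" for x y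
  proof -
    have eq: "poly_op (O.dilate p) T = poly_op p (S s)"
      by (rule blinfun_eqI) (simp add: O.dilate_def S_def poly_op_pcompose[OF T(1)])
    have "norm (poly_op p T - poly_op p (S s)) \<le> e" using s1(2)[OF s(1,3)] by (simp add: dist_norm norm_minus_commute)
    then have "norm ((poly_op p T - poly_op p (S s)) x) \<le> e * norm x"
      by (rule order_trans[OF norm_blinfun mult_right_mono[OF _ norm_ge_zero]])
    then have "cmod (cinner ((poly_op p T - poly_op p (S s)) x) y) \<le> e * norm x * norm y"
      by (rule order_trans[OF cmod_cinner_le mult_right_mono[OF _ norm_ge_zero]])
    moreover have E: "cinner (poly_op p T x) y + cinner x (poly_op q T y) =
        cinner ((poly_op p T - poly_op p (S s)) x) y + (cinner (poly_op (O.dilate p) T x) y + cinner x (poly_op q T y))"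
      unfolding eq by (simp add: blinfun.diff_left cinner_diff_left)
    ultimately have "cmod (cinner (poly_op p T x) y + cinner x (poly_op q T y)) \<le> e * norm x * norm y + (2 + e) * (norm x * norm y)"
      unfolding E using pq[of x y] norm_triangle_ineq[of "cinner ((poly_op p T - poly_op p (S s)) x) y" "cinner (poly_op (O.dilate p) T x) y + cinner x (poly_op q T y)"]
      by linarith
    also have "\<dots> = (2 + 2 * e) * (norm x * norm y)" by (simp add: algebra_simps)
    also have "\<dots> \<le> (2 + \<epsilon>) * (norm x * norm y)" using \<epsilon> by (intro mult_right_mono) (auto simp: e_def)
    finally show ?thesis .
  qed
  ultimately show ?thesis unfolding a_def by blast
qed

lemma analytic_config_const_nonneg: "0 \<le> analytic_config_const \<Omega>"
  by (rule analytic_config_const_approx(1)[of "\<lambda>_. 0" 1]) (auto simp: analytic_algebra_def)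

text \<open>The extremal argument needs some finite bound in advance. One is available for the
  contraction \<open>S s\<close>, whose numerical range still lies in \<open>\<Omega>\<close>; the
  resulting bound is independent of \<open>s\<close> and survives the limit.\<close>

lemma norm_poly_op_le_1:
  fixes T :: "'a::complex_hilbert_space \<Rightarrow>\<^sub>L 'a"
  assumes T: "clinear_op T" "numerical_range T \<subseteq> \<Omega>"
    and p: "\<And>z. z \<in> \<Omega> \<Longrightarrow> cmod (poly p z) \<le> 1"
  shows "norm (poly_op p T) \<le> 1 + sqrt (1 + analytic_config_const \<Omega>)"
proof -
  obtain z0 where z0: "z0 \<in> interior \<Omega>" using interior_\<Omega> by blast
  define S where "S s = affine_op (z0 - z0 / of_real s) (of_real (1 / s)) T" for s :: real
  have lim: "((\<lambda>s. poly_op p (S s)) \<longlongrightarrow> poly_op p T) (at_right 1)"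
    unfolding S_def by (rule tendsto_poly_op[OF tendsto_affine_op]) (auto intro!: tendsto_eq_intros)
  have "norm (poly_op p (S s)) \<le> 1 + sqrt (1 + analytic_config_const \<Omega>)" if s: "s > 1" for s
  proof -
    interpret O: operator_in_convex \<Omega> T z0 s by (rule operator_in_convexI[OF T z0 s])
    have eq: "poly_op (O.dilate p) T = poly_op p (S s)" for p
      by (rule blinfun_eqI) (simp add: O.dilate_def S_def poly_op_pcompose[OF T(1)])
    obtain M where M: "\<And>p B. (\<And>z. z \<in> \<Omega> \<Longrightarrow> cmod (poly p z) \<le> B) \<Longrightarrow> norm (poly_op p (S s)) \<le> M * B"
      using O.poly_op_dilate_bound unfolding eq by blast
    have SC: "clinear_op (S s)" unfolding S_def by (rule clinear_affine_op[OF T(1)])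
    have SR: "numerical_range (S s) \<subseteq> \<Omega>"
    proof
      fix w assume "w \<in> numerical_range (S s)"
      then obtain x where x: "norm x = 1" "w = cinner (S s x) x" unfolding numerical_range_def by blast
      have "w = z0 + (cinner (T x) x - z0) / of_real s"
        unfolding x(2) using x(1)
        by (simp add: S_def affine_op.rep_eq cinner_add_left cinner_scaleC_left cinner_self diff_divide_distrib)
      then show "w \<in> \<Omega>" using shrink_mem[OF z0 O.range_T[OF x(1)], of s] s by simp
    qed
    show ?thesis
      by (rule norm_poly_op_le_of_dual[OF SC analytic_config_const_nonneg M[of _ 1] dual_polynomial[OF SC SR] p])
  qed
  then have "\<forall>\<^sub>F s in at_right 1. norm (poly_op p (S s)) \<le> 1 + sqrt (1 + analytic_config_const \<Omega>)"
    unfolding eventually_at_right_field by (intro exI[of _ 2]) auto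
  then show ?thesis by (rule tendsto_upperbound[OF tendsto_norm[OF lim]]) simp
qed

lemma norm_poly_op_le:
  fixes T :: "'a::complex_hilbert_space \<Rightarrow>\<^sub>L 'a"
  assumes T: "clinear_op T" "numerical_range T \<subseteq> \<Omega>" and m: "m > 0"
    and p: "\<And>z. z \<in> \<Omega> \<Longrightarrow> cmod (poly p z) \<le> m"
  shows "norm (poly_op p T) \<le> (1 + sqrt (1 + analytic_config_const \<Omega>)) * m"
proof -
  have "norm (poly_op (smult (of_real (1 / m)) p) T) \<le> 1 + sqrt (1 + analytic_config_const \<Omega>)"
    by (rule norm_poly_op_le_1[OF T]) (use m p in \<open>simp add: norm_mult norm_divide divide_le_eq_1\<close>)
  then show ?thesis
    unfolding norm_poly_op_smult norm_of_real using m by (simp add: divide_le_eq mult.commute)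
qed

text \<open>Evaluated at the contracted argument, \<open>f\<close> is a Cauchy integral over the
  expanded curve, and such integrals are uniform limits of polynomials on
  \<open>\<Omega>\<close>.\<close>

lemma polynomial_approximation:
  fixes T :: "'a::complex_hilbert_space \<Rightarrow>\<^sub>L 'a"
  assumes T: "clinear_op T" "numerical_range T \<subseteq> \<Omega>"
    and f: "f \<in> analytic_algebra \<Omega>" and \<epsilon>: "\<epsilon> > 0"
  shows "\<exists>p. \<forall>z\<in>\<Omega>. cmod (poly p z - f z) \<le> \<epsilon>"
proof -
  obtain z0 where z0: "z0 \<in> interior \<Omega>" using interior_\<Omega> by blast
  define e where "e = \<epsilon> / 2"
  have e: "e > 0" using \<epsilon> by (simp add: e_def)
  have fc: "continuous_on \<Omega> f" using f by (simp add: analytic_algebra_def)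
  obtain s0 where s0: "s0 > 1" "\<And>s w. 1 \<le> s \<Longrightarrow> s < s0 \<Longrightarrow> w \<in> \<Omega> \<Longrightarrow> cmod (f (z0 + (w - z0) / of_real s) - f w) < e"
    using dilation_uniform[OF fc z0 e] by blast
  define s where "s = (1 + s0) / 2"
  have s: "1 < s" "s < s0" using s0(1) by (auto simp: s_def)
  interpret O: operator_in_convex \<Omega> T z0 s by (rule operator_in_convexI[OF T z0 s(1)])
  obtain B where B: "\<And>t. cmod (f (\<gamma> t)) \<le> B" using continuous_frontier_bounded[OF continuous_frontier[OF f]] by blast
  have hm: "(\<lambda>t. f (\<gamma> t) * O.weight t) \<in> borel_measurable borel"
    by (rule borel_measurable_times[OF measurable_curve_compose[OF continuous_frontier[OF f]] O.borel_measurable_weight])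
  have hb: "cmod (f (\<gamma> t) * O.weight t) \<le> B * (s / (2 * pi))" for t
    unfolding norm_mult O.norm_weight using s(1) by (intro mult_right_mono B) auto
  obtain q where q: "\<And>z. z \<in> \<Omega> \<Longrightarrow> cmod (poly q z - (LINT t|par. f (\<gamma> t) * O.weight t * (1 / (O.outer t - z)))) \<le> e"
    and "\<And>x y. cmod (cinner (poly_op q T x) y - (LINT t|par. f (\<gamma> t) * O.weight t * cinner (O.res t x) y)) \<le> e * (norm x * norm y)"
  proof (rule O.cauchy_transform_approximable[OF hm hb e])
  qed (rule that)
  have "cmod (poly q z - f z) \<le> \<epsilon>" if z: "z \<in> \<Omega>" for z
  proof -
    define w where "w = z0 + (z - z0) / of_real s"
    have w: "w \<in> interior \<Omega>" unfolding w_def by (rule shrink_mem_interior[OF z0 z s(1)])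
    have k: "f (\<gamma> t) * O.weight t * (1 / (O.outer t - z)) = f (\<gamma> t) * (vel t / (\<gamma> t - w)) / (2 * of_real pi * \<i>)" for t
      by (simp only: mult.assoc[of "f (\<gamma> t)"] cauchy_kernel_outer[OF O.operator_in_convex_axioms] w_def[symmetric])
        (simp only: times_divide_eq_right)
    have I: "(LINT t|par. f (\<gamma> t) * O.weight t * (1 / (O.outer t - z))) = f w"
      unfolding k integral_divide_zero cauchy_formula[OF f w] by simp
    have "cmod (poly q z - f w) \<le> e" using q[OF z] unfolding I .
    moreover have "cmod (f w - f z) \<le> e" unfolding w_def by (rule less_imp_le[OF s0(2)[OF less_imp_le[OF s(1)] s(2) z]])
    ultimately show ?thesis using norm_triangle_ineq[of "poly q z - f w" "f w - f z"] by (simp add: e_def)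
  qed
  then show ?thesis by blast
qed

text \<open>The polynomial bound, applied to differences, shows that approximating sequences give
  Cauchy sequences of operators with a common limit, so the definite description is meaningful;
  applied to the polynomials themselves, it passes to that limit.\<close>

lemma norm_fun_calc_le:
  fixes T :: "'a::complex_hilbert_space \<Rightarrow>\<^sub>L 'a"
  assumes T: "clinear_op T" and W: "closure (numerical_range T) = \<Omega>" and f: "f \<in> analytic_algebra \<Omega>"
  shows "norm (fun_calc f T) \<le> (1 + sqrt (1 + analytic_config_const \<Omega>)) * (SUP z\<in>\<Omega>. cmod (f z))"
proof -
  define C where "C = 1 + sqrt (1 + analytic_config_const \<Omega>)"
  have C: "C > 0" using analytic_config_const_nonneg by (simp add: C_def add_pos_nonneg)
  have TO: "numerical_range T \<subseteq> \<Omega>" using closure_subset[of "numerical_range T"] W by simp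
  note bound = norm_poly_op_le[OF T TO, folded C_def]
  define approx where "approx p A \<longleftrightarrow> uniform_limit \<Omega> (\<lambda>n. poly (p n)) f sequentially \<and> (\<lambda>n. poly_op (p n) T) \<longlonglongrightarrow> A"
    for p :: "nat \<Rightarrow> complex poly" and A
  have close: "\<forall>\<^sub>F n in sequentially. \<forall>z\<in>\<Omega>. cmod (poly (p n) z - f z) < \<epsilon>"
    if "uniform_limit \<Omega> (\<lambda>n. poly (p n)) f sequentially" "\<epsilon> > 0" for p \<epsilon>
    using uniform_limitD[OF that] by (simp add: dist_norm)
  have unique: "A = A'" if "approx p A" "approx p' A'" for p p' A A'
  proof -
    have "norm (A - A') \<le> 0 + \<epsilon>" if \<epsilon>: "\<epsilon> > 0" for \<epsilon>
    proof -
      define d where "d = \<epsilon> / C / 2"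
      have d: "d > 0" using \<epsilon> C by (simp add: d_def)
      have ev: "\<forall>\<^sub>F n in sequentially. norm (poly_op (p n) T - poly_op (p' n) T) \<le> \<epsilon>"
        using close[OF conjunct1[OF \<open>approx p A\<close>[unfolded approx_def]] d] close[OF conjunct1[OF \<open>approx p' A'\<close>[unfolded approx_def]] d]
      proof eventually_elim
        case (elim n)
        have "norm (poly_op (p n - p' n) T) \<le> C * (2 * d)"
        proof (rule bound)
          fix z assume z: "z \<in> \<Omega>"
          show "cmod (poly (p n - p' n) z) \<le> 2 * d"
            using norm_triangle_ineq4[of "poly (p n) z - f z" "poly (p' n) z - f z"] bspec[OF elim(1) z] bspec[OF elim(2) z] by simp
        qed (use d in simp)
        also have "C * (2 * d) = \<epsilon>" using C by (simp add: d_def)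
        finally show ?case by (simp add: poly_op_diff)
      qed
      have "(\<lambda>n. norm (poly_op (p n) T - poly_op (p' n) T)) \<longlonglongrightarrow> norm (A - A')"
        using \<open>approx p A\<close> \<open>approx p' A'\<close> unfolding approx_def by (intro tendsto_norm tendsto_diff) blast+
      from tendsto_upperbound[OF this ev sequentially_bot] show ?thesis by simp
    qed
    then have "norm (A - A') \<le> 0" by (rule field_le_epsilon)
    then show ?thesis by simp
  qed
  have "\<forall>n. \<exists>p. \<forall>z\<in>\<Omega>. cmod (poly p z - f z) \<le> inverse (real (Suc n))"
    by (intro allI polynomial_approximation[OF T TO f]) simp
  from choice[OF this] obtain p where "\<forall>n. \<forall>z\<in>\<Omega>. cmod (poly (p n) z - f z) \<le> inverse (real (Suc n))" ..
  note p = bspec[OF spec[OF this]]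
  have pu: "uniform_limit \<Omega> (\<lambda>n. poly (p n)) f sequentially"
  proof (rule uniform_limitI)
    fix e :: real assume "e > 0"
    then obtain N where "inverse (real (Suc N)) < e" using reals_Archimedean by blast
    have N: "inverse (real (Suc n)) < e" if "n \<ge> N" for n
    proof -
      have "inverse (real (Suc n)) \<le> inverse (real (Suc N))" using that by (intro le_imp_inverse_le) auto
      also note \<open>inverse (real (Suc N)) < e\<close>
      finally show ?thesis .
    qed
    show "\<forall>\<^sub>F n in sequentially. \<forall>z\<in>\<Omega>. dist (poly (p n) z) (f z) < e"
      using eventually_ge_at_top[of N] unfolding dist_norm
      by eventually_elim (rule ballI, rule le_less_trans[OF p N])
  qed
  have "Cauchy (\<lambda>n. poly_op (p n) T)"
  proof (rule CauchyI)
    fix e :: real assume e: "e > 0"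
    define d where "d = e / C / 4"
    have d: "d > 0" using e C by (simp add: d_def)
    obtain N where N: "\<And>n z. n \<ge> N \<Longrightarrow> z \<in> \<Omega> \<Longrightarrow> cmod (poly (p n) z - f z) < d"
      using close[OF pu d] unfolding eventually_sequentially by blast
    have "norm (poly_op (p m) T - poly_op (p n) T) < e" if "m \<ge> N" "n \<ge> N" for m n
    proof -
      have "norm (poly_op (p m - p n) T) \<le> C * (2 * d)"
      proof (rule bound)
        fix z assume z: "z \<in> \<Omega>"
        show "cmod (poly (p m - p n) z) \<le> 2 * d"
          using norm_triangle_ineq4[of "poly (p m) z - f z" "poly (p n) z - f z"] N[OF that(1) z] N[OF that(2) z] by simp
      qed (use d in simp)
      also have "C * (2 * d) < e" using C e by (simp add: d_def)
      finally show ?thesis by (simp add: poly_op_diff)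
    qed
    then show "\<exists>N. \<forall>m\<ge>N. \<forall>n\<ge>N. norm (poly_op (p m) T - poly_op (p n) T) < e" by blast
  qed
  from Cauchy_convergent[OF this] obtain A where "(\<lambda>n. poly_op (p n) T) \<longlonglongrightarrow> A"
    unfolding convergent_def by (rule exE)
  then have A: "approx p A" using pu by (simp add: approx_def)
  have "fun_calc f T = (THE A. \<exists>p. approx p A)" unfolding fun_calc_def W approx_def ..
  also have "\<dots> = A"
  proof (rule the_equality)
    show "\<exists>p. approx p A" by (intro exI[of _ p] A)
    fix A' assume "\<exists>p. approx p A'"
    then obtain p' where "approx p' A'" ..
    then show "A' = A" using A by (rule unique)
  qed
  finally have fA: "fun_calc f T = A" .
  have bdd: "bdd_above ((\<lambda>z. cmod (f z)) ` \<Omega>)"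
    using f by (intro bounded_imp_bdd_above compact_imp_bounded compact_continuous_image continuous_intros compact_\<Omega>)
      (simp add: analytic_algebra_def)
  define m where "m = (SUP z\<in>\<Omega>. cmod (f z))"
  have m: "cmod (f z) \<le> m" if "z \<in> \<Omega>" for z unfolding m_def by (rule cSUP_upper[OF that bdd])
  have m0: "m \<ge> 0" using order_trans[OF norm_ge_zero m[OF \<gamma>_mem]] .
  have "norm A \<le> C * m + \<epsilon>" if \<epsilon>: "\<epsilon> > 0" for \<epsilon>
  proof -
    \<comment> \<open>The supremum \<open>m\<close> may be 0, whereas the scaled polynomial bound
      asks for a positive number; \<open>m + d\<close> is one.\<close>
    define d where "d = \<epsilon> / C"
    have d: "d > 0" "C * (m + d) = C * m + \<epsilon>" using \<epsilon> C by (simp_all add: d_def distrib_left)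
    have ev: "\<forall>\<^sub>F n in sequentially. norm (poly_op (p n) T) \<le> C * (m + d)"
      using close[OF pu d(1)]
    proof eventually_elim
      case (elim n)
      show ?case
      proof (rule bound)
        fix z assume z: "z \<in> \<Omega>"
        show "cmod (poly (p n) z) \<le> m + d"
          using norm_triangle_ineq[of "poly (p n) z - f z" "f z"] bspec[OF elim z] m[OF z] unfolding diff_add_cancel by linarith
      qed (rule add_nonneg_pos[OF m0 d(1)])
    qed
    have "(\<lambda>n. poly_op (p n) T) \<longlonglongrightarrow> A" using A unfolding approx_def by (rule conjunct2)
    from tendsto_upperbound[OF tendsto_norm[OF this] ev sequentially_bot] show ?thesis by (simp only: d(2))
  qed
  then have "norm A \<le> C * m" by (rule field_le_epsilon)
  then show ?thesis by (simp only: fA C_def m_def)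
qed

end

lemma convex_body_numerical_range:
  fixes T :: "'a::complex_hilbert_space \<Rightarrow>\<^sub>L 'a"
  assumes "clinear_op T" "interior (closure (numerical_range T)) \<noteq> {}"
  shows "convex_body (closure (numerical_range T))"
proof
  have "cmod (cinner (T x) x) \<le> norm T" if "norm x = 1" for x
    using cmod_cinner_le[of "T x" x] norm_blinfun[of T x] that by simp
  then have "bounded (numerical_range T)" unfolding numerical_range_def by (intro boundedI[where B = "norm T"]) blast
  then show "compact (closure (numerical_range T))" by (simp add: compact_closure)
  show "convex (closure (numerical_range T))" by (rule convex_closure[OF convex_numerical_range[OF assms(1)]])
qed (fact assms(2))

theorem theorem28:
  fixes T :: "'a::complex_hilbert_space \<Rightarrow>\<^sub>L 'a"
    and W :: "complex set"
    and f :: "complex \<Rightarrow> complex"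
  assumes T_clinear: "\<And>c x. T (c *\<^sub>C x) = c *\<^sub>C T x"
    and W_def: "W = closure (numerical_range T)"
    and W_interior: "interior W \<noteq> {}"
    and f: "f \<in> analytic_algebra W"
  shows "norm (fun_calc f T) \<le>
           (1 + sqrt (1 + analytic_config_const W)) * (SUP z\<in>W. cmod (f z))"
proof -
  have T: "clinear_op T" using T_clinear by (simp add: clinear_op_def)
  have "convex_body W" using W_interior unfolding W_def by (rule convex_body_numerical_range[OF T])
  then have "boundary_param W" unfolding boundary_param_def by (rule convex_body.convex_curve_boundary)
  from boundary_param.norm_fun_calc_le[OF this T W_def[symmetric] f] show ?thesis .
qed

end
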